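(* Let $M^7=\mathrm{SO}(5)/\mathrm{SO}(3)_{irr}$ be the Berger space equipped with its homogeneous proper nearly parallel $\mathrm{G}_2$ structure. Then the induced Einstein metric is linearly unstable. Moreover, $M^7$ admits a $5$-dimensional space of divergence-free and trace-free Killing ($2$-)tensors.
   Context: The Berger space is $\mathrm{SO}(5)/\mathrm{SO}(3)_{irr}$, where $\mathrm{SO}(3)$ is embedded in $\mathrm{SO}(5)$ by its irreducible $5$-dimensional representation; equivalently $\mathrm{Sp}(2)/\mathrm{Sp}(1)_{irr}$ with $\mathrm{Sp}(1)$ embedded by its irreducible complex $4$-dimensional representation. Its isotropy representation is the irreducible $7$-dimensional representation of $\mathrm{SO}(3)$, which embeds $\mathrm{SO}(3)$ in $\mathrm{G}_2$ and thereby defines a homogeneous $\mathrm{G}_2$-structure $\varphi$ on $M^7$; it is proper nearly parallel, i.e. $d\varphi=\lambda\ast\varphi$ for a non-zero real $\lambda$ and the space of real Killing spinors is $1$-dimensional. The induced Einstein metric $g$ is a positive multiple of the invariant metric given by $-B$, where $B$ is the Killing form of $\mathfrak{sp}(2)$ restricted to the orthogonal complement $\mathfrak{m}$ of $\mathfrak{sp}(1)$. A symmetric $p$-tensor $h\in\Gamma(\mathrm{Sym}^p TM)$ is a Killing tensor if the complete symmetrization of $\nabla h$ vanishes, i.e. $(\nabla_X h)(X,\ldots,X)=0$ for all tangent vectors $X$ (with $\nabla$ the Levi-Civita connection); here $p=2$. A symmetric $2$-tensor $h$ is transverse traceless (TT) if $\mathrm{tr}_g h=0$ and $\delta_g h=0$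 (divergence-free). For an Einstein metric $g$ with $\mathrm{Ric}_g=E\,g$ on a compact manifold, $g$ is linearly unstable if there is a non-trivial TT symmetric $2$-tensor $h$ with $$\langle \nabla^*\nabla h-2\mathring{R}h,h\rangle_{L^2(M,g)}=\langle(\Delta_L-2E)h,h\rangle_{L^2(M,g)}<0,$$ where $\Delta_L$ is the positive Lichnerowicz Laplacian, $\mathring{R}h$ is the action of the curvature tensor on symmetric $2$-tensors, and $\nabla^*\nabla$ is the (positive) rough Laplacian. *)

theory Defs
  imports "HOL-Analysis.Analysis" "HOL-Library.Function_Algebras"
begin

section \<open>Smooth maps and atlases\<close>

text \<open>The two definitions below are meant for open \<^term>\<open>U\<close>.\<close>

primrec Ck_on :: "nat \<Rightarrow> ('a::euclidean_space \<Rightarrow> 'b::real_normed_vector) \<Rightarrow> 'a set \<Rightarrow> bool" where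
  "Ck_on 0 f U \<longleftrightarrow> continuous_on U f"
| "Ck_on (Suc k) f U \<longleftrightarrow>
     (\<forall>x\<in>U. f differentiable (at x)) \<and>
     (\<forall>v. Ck_on k (\<lambda>x. frechet_derivative f (at x) v) U)"

definition smooth_on :: "('a::euclidean_space \<Rightarrow> 'b::real_normed_vector) \<Rightarrow> 'a set \<Rightarrow> bool" where
  "smooth_on f U \<longleftrightarrow> (\<forall>k. Ck_on k f U)"

definition pd :: "'n \<Rightarrow> (real^'n \<Rightarrow> real) \<Rightarrow> real^'n \<Rightarrow> real" where
  "pd i f x = frechet_derivative f (at x) (axis i 1)"

text \<open>A chart \<open>(U, \<psi>)\<close> is a local parametrisation: \<open>U\<close> is an open set of coordinates and
  \<open>\<psi>\<close> maps \<open>U\<close> injectively into the manifold; an atlas is a set of charts.  Tensor fields are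
  given classically, by their components in every chart of the atlas, subject to the
  transformation law; \<open>h c x i j\<close> is the \<open>(i,j)\<close> component at the point with coordinates \<open>x\<close>
  in the chart \<open>c\<close>.  Components are required to be \<open>0\<close> outside the atlas and outside the
  coordinate domains, so that equality of component families is equality of tensor fields.\<close>

type_synonym ('p, 'n) chart = "(real^'n) set \<times> (real^'n \<Rightarrow> 'p)"
type_synonym ('p, 'n) scalar = "('p, 'n) chart \<Rightarrow> real^'n \<Rightarrow> real"
type_synonym ('p, 'n) tensor2 = "('p, 'n) chart \<Rightarrow> real^'n \<Rightarrow> 'n \<Rightarrow> 'n \<Rightarrow> real"
type_synonym ('p, 'n) tensor3 = "('p, 'n) chart \<Rightarrow> real^'n \<Rightarrow> 'n \<Rightarrow> 'n \<Rightarrow> 'n \<Rightarrow> real"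

definition manifold_points :: "('p, 'n::finite) chart set \<Rightarrow> 'p set" where
  "manifold_points A = (\<Union>c\<in>A. snd c ` fst c)"

text \<open>\<open>transition_jac c c' x a i\<close> is \<open>\<partial>y\<^sup>a/\<partial>x\<^sup>i\<close> for the coordinates \<open>y\<close> of \<open>c'\<close> and \<open>x\<close> of \<open>c\<close>.\<close>

definition transition_jac ::
  "('p, 'n) chart \<Rightarrow> ('p, 'n) chart \<Rightarrow> real^'n \<Rightarrow> 'n \<Rightarrow> 'n \<Rightarrow> real" where
  "transition_jac c c' x a i = pd i (\<lambda>y. the_inv_into (fst c') (snd c') (snd c y) $ a) x"

definition tensor2_field :: "('p, 'n::finite) chart set \<Rightarrow> ('p, 'n) tensor2 \<Rightarrow> bool" where
  "tensor2_field A h \<longleftrightarrow>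
     (\<forall>c\<in>A. \<forall>i j. smooth_on (\<lambda>x. h c x i j) (fst c)) \<and>
     (\<forall>c\<in>A. \<forall>c'\<in>A. \<forall>x\<in>fst c. \<forall>x'\<in>fst c'. snd c x = snd c' x' \<longrightarrow>
        (\<forall>i j. h c x i j = (\<Sum>a\<in>UNIV. \<Sum>b\<in>UNIV.
           h c' x' a b * transition_jac c c' x a i * transition_jac c c' x b j))) \<and>
     (\<forall>c x i j. c \<notin> A \<or> x \<notin> fst c \<longrightarrow> h c x i j = 0)"

definition tensor3_field :: "('p, 'n::finite) chart set \<Rightarrow> ('p, 'n) tensor3 \<Rightarrow> bool" where
  "tensor3_field A \<phi> \<longleftrightarrow>
     (\<forall>c\<in>A. \<forall>i j k. smooth_on (\<lambda>x. \<phi> c x i j k) (fst c)) \<and>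
     (\<forall>c\<in>A. \<forall>c'\<in>A. \<forall>x\<in>fst c. \<forall>x'\<in>fst c'. snd c x = snd c' x' \<longrightarrow>
        (\<forall>i j k. \<phi> c x i j k = (\<Sum>a\<in>UNIV. \<Sum>b\<in>UNIV. \<Sum>d\<in>UNIV.
           \<phi> c' x' a b d * transition_jac c c' x a i * transition_jac c c' x b j
             * transition_jac c c' x d k))) \<and>
     (\<forall>c x i j k. c \<notin> A \<or> x \<notin> fst c \<longrightarrow> \<phi> c x i j k = 0)"

definition symmetric_tensor2 :: "('p, 'n::finite) tensor2 \<Rightarrow> bool" where
  "symmetric_tensor2 h \<longleftrightarrow> (\<forall>c x i j. h c x i j = h c x j i)"

definition tensor_scale :: "real \<Rightarrow> ('p, 'n::finite) tensor2 \<Rightarrow> ('p, 'n) tensor2" where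
  "tensor_scale r h = (\<lambda>c x i j. r * h c x i j)"

global_interpretation tens: vector_space
  "tensor_scale :: real \<Rightarrow> ('p, 'n::finite) tensor2 \<Rightarrow> ('p, 'n) tensor2"
  by unfold_locales (auto simp: tensor_scale_def fun_eq_iff algebra_simps)

section \<open>Riemannian geometry in coordinates\<close>

text \<open>In this section \<open>g\<close>, \<open>h\<close> are the components, in one chart, of a metric and of a
  2-tensor.\<close>

definition metric_matrix :: "(real^'n \<Rightarrow> 'n \<Rightarrow> 'n \<Rightarrow> real) \<Rightarrow> real^'n \<Rightarrow> real^'n^'n" where
  "metric_matrix g x = (\<chi> i j. g x i j)"

definition ginv :: "(real^'n \<Rightarrow> 'n \<Rightarrow> 'n \<Rightarrow> real) \<Rightarrow> real^'n \<Rightarrow> 'n \<Rightarrow> 'n \<Rightarrow> real" where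
  "ginv g x i j = matrix_inv (metric_matrix g x) $ i $ j"

text \<open>\<open>christoffel g x k i j\<close> is \<open>\<Gamma>\<^sup>k\<^sub>i\<^sub>j\<close>, i.e. the Levi-Civita connection
  \<open>\<nabla>\<^sub>i \<partial>\<^sub>j = \<Sum>k. \<Gamma>\<^sup>k\<^sub>i\<^sub>j \<partial>\<^sub>k\<close>.\<close>

definition christoffel ::
  "(real^'n \<Rightarrow> 'n \<Rightarrow> 'n \<Rightarrow> real) \<Rightarrow> real^'n \<Rightarrow> 'n \<Rightarrow> 'n \<Rightarrow> 'n \<Rightarrow> real" where
  "christoffel g x k i j = (\<Sum>m\<in>UNIV. ginv g x k m *
     (pd i (\<lambda>y. g y m j) x + pd j (\<lambda>y. g y m i) x - pd m (\<lambda>y. g y i j) x)) / 2"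

text \<open>\<open>cov2 g h x k i j = (\<nabla>\<^sub>k h)\<^sub>i\<^sub>j\<close> and, for a 3-tensor \<open>T\<close>,
  \<open>cov3 g T x l k i j = (\<nabla>\<^sub>l T)\<^sub>k\<^sub>i\<^sub>j\<close>.\<close>

definition cov2 ::
  "(real^'n \<Rightarrow> 'n \<Rightarrow> 'n \<Rightarrow> real) \<Rightarrow> (real^'n \<Rightarrow> 'n \<Rightarrow> 'n \<Rightarrow> real) \<Rightarrow>
     real^'n \<Rightarrow> 'n \<Rightarrow> 'n \<Rightarrow> 'n \<Rightarrow> real" where
  "cov2 g h x k i j = pd k (\<lambda>y. h y i j) x
     - (\<Sum>m\<in>UNIV. christoffel g x m k i * h x m j + christoffel g x m k j * h x i m)"

definition cov3 ::
  "(real^'n \<Rightarrow> 'n \<Rightarrow> 'n \<Rightarrow> real) \<Rightarrow> (real^'n \<Rightarrow> 'n \<Rightarrow> 'n \<Rightarrow> 'n \<Rightarrow> real) \<Rightarrow>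
     real^'n \<Rightarrow> 'n \<Rightarrow> 'n \<Rightarrow> 'n \<Rightarrow> 'n \<Rightarrow> real" where
  "cov3 g T x l k i j = pd l (\<lambda>y. T y k i j) x
     - (\<Sum>m\<in>UNIV. christoffel g x m l k * T x m i j + christoffel g x m l i * T x k m j
          + christoffel g x m l j * T x k i m)"

definition rough_laplacian ::
  "(real^'n \<Rightarrow> 'n \<Rightarrow> 'n \<Rightarrow> real) \<Rightarrow> (real^'n \<Rightarrow> 'n \<Rightarrow> 'n \<Rightarrow> real) \<Rightarrow>
     real^'n \<Rightarrow> 'n \<Rightarrow> 'n \<Rightarrow> real" where
  "rough_laplacian g h x i j =
     - (\<Sum>l\<in>UNIV. \<Sum>k\<in>UNIV. ginv g x l k * cov3 g (cov2 g h) x l k i j)"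

text \<open>\<open>riemann g x l k i j\<close> is the \<open>\<partial>\<^sub>l\<close> component of \<open>R(\<partial>\<^sub>i,\<partial>\<^sub>j)\<partial>\<^sub>k\<close>, where
  \<open>R(X,Y) = [\<nabla>\<^sub>X,\<nabla>\<^sub>Y] - \<nabla>\<^bsub>[X,Y]\<^esub>\<close>.  The Ricci tensor is \<open>Ric(Y,Z) = tr (X \<mapsto> R(X,Y)Z)\<close> and
  the curvature acts on symmetric 2-tensors by \<open>(Y,Z) \<mapsto> \<Sum>i. h(R(e\<^sub>i,Y)Z, e\<^sub>i)\<close> for an
  orthonormal basis \<open>e\<^sub>i\<close>; it maps \<open>g\<close> to \<open>Ric\<close>.\<close>

definition riemann ::
  "(real^'n \<Rightarrow> 'n \<Rightarrow> 'n \<Rightarrow> real) \<Rightarrow> real^'n \<Rightarrow> 'n \<Rightarrow> 'n \<Rightarrow> 'n \<Rightarrow> 'n \<Rightarrow> real" where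
  "riemann g x l k i j =
     pd i (\<lambda>y. christoffel g y l j k) x - pd j (\<lambda>y. christoffel g y l i k) x
     + (\<Sum>m\<in>UNIV. christoffel g x l i m * christoffel g x m j k
                - christoffel g x l j m * christoffel g x m i k)"

definition ricci :: "(real^'n \<Rightarrow> 'n \<Rightarrow> 'n \<Rightarrow> real) \<Rightarrow> real^'n \<Rightarrow> 'n \<Rightarrow> 'n \<Rightarrow> real" where
  "ricci g x j k = (\<Sum>i\<in>UNIV. riemann g x i k i j)"

definition curvature_action ::
  "(real^'n \<Rightarrow> 'n \<Rightarrow> 'n \<Rightarrow> real) \<Rightarrow> (real^'n \<Rightarrow> 'n \<Rightarrow> 'n \<Rightarrow> real) \<Rightarrow>
     real^'n \<Rightarrow> 'n \<Rightarrow> 'n \<Rightarrow> real" where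
  "curvature_action g h x j k =
     (\<Sum>i\<in>UNIV. \<Sum>l\<in>UNIV. \<Sum>m\<in>UNIV. ginv g x i l * riemann g x m k i j * h x m l)"

definition trace2 ::
  "(real^'n \<Rightarrow> 'n \<Rightarrow> 'n \<Rightarrow> real) \<Rightarrow> (real^'n \<Rightarrow> 'n \<Rightarrow> 'n \<Rightarrow> real) \<Rightarrow> real^'n \<Rightarrow> real" where
  "trace2 g h x = (\<Sum>i\<in>UNIV. \<Sum>j\<in>UNIV. ginv g x i j * h x i j)"

definition divergence2 ::
  "(real^'n \<Rightarrow> 'n \<Rightarrow> 'n \<Rightarrow> real) \<Rightarrow> (real^'n \<Rightarrow> 'n \<Rightarrow> 'n \<Rightarrow> real) \<Rightarrow> real^'n \<Rightarrow> 'n \<Rightarrow> real" where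
  "divergence2 g h x j = - (\<Sum>k\<in>UNIV. \<Sum>i\<in>UNIV. ginv g x k i * cov2 g h x k i j)"

definition inner2 ::
  "(real^'n \<Rightarrow> 'n \<Rightarrow> 'n \<Rightarrow> real) \<Rightarrow> (real^'n \<Rightarrow> 'n \<Rightarrow> 'n \<Rightarrow> real) \<Rightarrow>
     (real^'n \<Rightarrow> 'n \<Rightarrow> 'n \<Rightarrow> real) \<Rightarrow> real^'n \<Rightarrow> real" where
  "inner2 g h k x = (\<Sum>i\<in>UNIV. \<Sum>j\<in>UNIV. \<Sum>a\<in>UNIV. \<Sum>b\<in>UNIV.
     ginv g x i a * ginv g x j b * h x i j * k x a b)"

section \<open>Linear instability and Killing tensors\<close>

text \<open>Integration of a function on a compact Riemannian manifold: cut the manifold into finitely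
  many disjoint Borel pieces, each inside one chart, and integrate against \<open>sqrt (det g) dx\<close>
  on each piece.  By the change of variables formula the value \<open>I\<close> does not depend on the
  pieces.\<close>

definition has_manifold_integral ::
  "('p, 'n::finite) chart set \<Rightarrow> ('p, 'n) tensor2 \<Rightarrow> ('p, 'n) scalar \<Rightarrow> real \<Rightarrow> bool" where
  "has_manifold_integral A g f I \<longleftrightarrow>
     (\<exists>(N::nat) (C :: nat \<Rightarrow> ('p, 'n) chart) (B :: nat \<Rightarrow> (real^'n) set).
        (\<forall>k<N. C k \<in> A \<and> B k \<in> sets borel \<and> B k \<subseteq> fst (C k)) \<and>
        disjoint_family_on (\<lambda>k. snd (C k) ` B k) {..<N} \<and>
        (\<Union>k<N. snd (C k) ` B k) = manifold_points A \<and>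
        (\<forall>k<N. set_integrable lborel (B k)
           (\<lambda>x. f (C k) x * sqrt (det (metric_matrix (g (C k)) x)))) \<and>
        I = (\<Sum>k<N. set_lebesgue_integral lborel (B k)
           (\<lambda>x. f (C k) x * sqrt (det (metric_matrix (g (C k)) x)))))"

definition einstein :: "('p, 'n::finite) chart set \<Rightarrow> ('p, 'n) tensor2 \<Rightarrow> real \<Rightarrow> bool" where
  "einstein A g E \<longleftrightarrow> (\<forall>c\<in>A. \<forall>x\<in>fst c. \<forall>i j. ricci (g c) x i j = E * g c x i j)"

definition tt_tensor :: "('p, 'n::finite) chart set \<Rightarrow> ('p, 'n) tensor2 \<Rightarrow> ('p, 'n) tensor2 \<Rightarrow> bool" where
  "tt_tensor A g h \<longleftrightarrow> tensor2_field A h \<and> symmetric_tensor2 h \<and>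
     (\<forall>c\<in>A. \<forall>x\<in>fst c. trace2 (g c) (h c) x = 0 \<and> (\<forall>j. divergence2 (g c) (h c) x j = 0))"

definition killing_tensor :: "('p, 'n::finite) chart set \<Rightarrow> ('p, 'n) tensor2 \<Rightarrow> ('p, 'n) tensor2 \<Rightarrow> bool" where
  "killing_tensor A g h \<longleftrightarrow> tensor2_field A h \<and> symmetric_tensor2 h \<and>
     (\<forall>c\<in>A. \<forall>x\<in>fst c. \<forall>v :: real^'n.
        (\<Sum>k\<in>UNIV. \<Sum>i\<in>UNIV. \<Sum>j\<in>UNIV. v $ k * v $ i * v $ j * cov2 (g c) (h c) x k i j) = 0)"

definition linearly_unstable :: "('p, 'n::finite) chart set \<Rightarrow> ('p, 'n) tensor2 \<Rightarrow> bool" where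
  "linearly_unstable A g \<longleftrightarrow> (\<exists>E. einstein A g E) \<and>
     (\<exists>h. tt_tensor A g h \<and> h \<noteq> 0 \<and>
        (\<exists>I<0. has_manifold_integral A g
           (\<lambda>c. inner2 (g c)
              (\<lambda>x i j. rough_laplacian (g c) (h c) x i j - 2 * curvature_action (g c) (h c) x i j)
              (h c)) I))"

section \<open>$G_2$-structures\<close>

text \<open>\<open>coframe3 a b d\<close> is \<open>e\<^sup>a \<and> e\<^sup>b \<and> e\<^sup>d\<close> on \<open>\<real>\<^sup>7\<close>.  In the index type \<open>7\<close> the numeral \<open>7\<close>
  equals \<open>0\<close>, so that \<open>1, ..., 7\<close> are its seven distinct elements.\<close>

definition coframe3 :: "7 \<Rightarrow> 7 \<Rightarrow> 7 \<Rightarrow> 7 \<Rightarrow> 7 \<Rightarrow> 7 \<Rightarrow> real" where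
  "coframe3 a b d i j k = det (vector
     [vector [of_bool (a = i), of_bool (a = j), of_bool (a = k)],
      vector [of_bool (b = i), of_bool (b = j), of_bool (b = k)],
      vector [of_bool (d = i), of_bool (d = j), of_bool (d = k)]] :: real^3^3)"

definition phi0 :: "7 \<Rightarrow> 7 \<Rightarrow> 7 \<Rightarrow> real" where
  "phi0 i j k = coframe3 1 2 3 i j k + coframe3 1 4 5 i j k + coframe3 1 6 7 i j k
     + coframe3 2 4 6 i j k - coframe3 2 5 7 i j k - coframe3 3 4 7 i j k - coframe3 3 5 6 i j k"

text \<open>Hodge star of a 3-form on \<open>\<real>\<^sup>7\<close> with its Euclidean metric and standard orientation; the
  determinant is the Levi-Civita symbol.\<close>

definition star3 :: "(7 \<Rightarrow> 7 \<Rightarrow> 7 \<Rightarrow> real) \<Rightarrow> 7 \<Rightarrow> 7 \<Rightarrow> 7 \<Rightarrow> 7 \<Rightarrow> real" where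
  "star3 \<alpha> i j k l = (\<Sum>a\<in>UNIV. \<Sum>b\<in>UNIV. \<Sum>d\<in>UNIV. \<alpha> a b d *
     det (vector [axis a 1, axis b 1, axis d 1, axis i 1, axis j 1, axis k 1, axis l 1]
            :: real^7^7)) / 6"

text \<open>Pullback along the matrix \<open>L\<close>, whose columns are the vectors of a frame.\<close>

definition pull2 :: "real^'n^'n \<Rightarrow> ('n \<Rightarrow> 'n \<Rightarrow> real) \<Rightarrow> 'n \<Rightarrow> 'n \<Rightarrow> real" where
  "pull2 L T i j = (\<Sum>a\<in>UNIV. \<Sum>b\<in>UNIV. T a b * L $ a $ i * L $ b $ j)"

definition pull3 :: "real^'n^'n \<Rightarrow> ('n \<Rightarrow> 'n \<Rightarrow> 'n \<Rightarrow> real) \<Rightarrow> 'n \<Rightarrow> 'n \<Rightarrow> 'n \<Rightarrow> real" where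
  "pull3 L T i j k =
     (\<Sum>a\<in>UNIV. \<Sum>b\<in>UNIV. \<Sum>d\<in>UNIV. T a b d * L $ a $ i * L $ b $ j * L $ d $ k)"

definition pull4 ::
  "real^'n^'n \<Rightarrow> ('n \<Rightarrow> 'n \<Rightarrow> 'n \<Rightarrow> 'n \<Rightarrow> real) \<Rightarrow> 'n \<Rightarrow> 'n \<Rightarrow> 'n \<Rightarrow> 'n \<Rightarrow> real" where
  "pull4 L T i j k l = (\<Sum>a\<in>UNIV. \<Sum>b\<in>UNIV. \<Sum>d\<in>UNIV. \<Sum>e\<in>UNIV.
     T a b d e * L $ a $ i * L $ b $ j * L $ d $ k * L $ e $ l)"

definition adapted_frame :: "(7 \<Rightarrow> 7 \<Rightarrow> 7 \<Rightarrow> real) \<Rightarrow> real^7^7 \<Rightarrow> bool" where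
  "adapted_frame \<phi>x L \<longleftrightarrow> invertible L \<and> pull3 L \<phi>x = phi0"

definition g2_structure :: "('p, 7) chart set \<Rightarrow> ('p, 7) tensor3 \<Rightarrow> bool" where
  "g2_structure A \<phi> \<longleftrightarrow> tensor3_field A \<phi> \<and>
     (\<forall>c\<in>A. \<forall>x\<in>fst c. \<exists>L. adapted_frame (\<phi> c x) L)"

text \<open>The metric and the orientation induced by a $G_2$-structure are those for which adapted
  frames are orthonormal and positively oriented.\<close>

definition g2_metric :: "('p, 7) chart set \<Rightarrow> ('p, 7) tensor3 \<Rightarrow> ('p, 7) tensor2 \<Rightarrow> bool" where
  "g2_metric A \<phi> g \<longleftrightarrow> tensor2_field A g \<and>
     (\<forall>c\<in>A. \<forall>x\<in>fst c. \<forall>L. adapted_frame (\<phi> c x) L \<longrightarrow>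
        pull2 L (g c x) = (\<lambda>i j. of_bool (i = j)))"

definition ext_deriv3 ::
  "(real^'n \<Rightarrow> 'n \<Rightarrow> 'n \<Rightarrow> 'n \<Rightarrow> real) \<Rightarrow> real^'n \<Rightarrow> 'n \<Rightarrow> 'n \<Rightarrow> 'n \<Rightarrow> 'n \<Rightarrow> real" where
  "ext_deriv3 \<phi> x i j k l =
     pd i (\<lambda>y. \<phi> y j k l) x - pd j (\<lambda>y. \<phi> y i k l) x
     + pd k (\<lambda>y. \<phi> y i j l) x - pd l (\<lambda>y. \<phi> y i j k) x"

text \<open>\<open>d\<phi> = \<mu> \<star>\<phi>\<close>, with both sides evaluated on adapted frames.\<close>

definition nearly_parallel :: "('p, 7) chart set \<Rightarrow> ('p, 7) tensor3 \<Rightarrow> bool" where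
  "nearly_parallel A \<phi> \<longleftrightarrow> (\<exists>\<mu>::real. \<mu> \<noteq> 0 \<and>
     (\<forall>c\<in>A. \<forall>x\<in>fst c. \<forall>L. adapted_frame (\<phi> c x) L \<longrightarrow>
        pull4 L (ext_deriv3 (\<phi> c) x) = (\<lambda>i j k l. \<mu> * star3 phi0 i j k l)))"

section \<open>The Berger space\<close>

text \<open>The irreducible 5-dimensional representation of \<open>SO(3)\<close> is realised as conjugation on
  traceless symmetric \<open>3 \<times> 3\<close> matrices; \<open>sym_traceless\<close> identifies these with \<open>\<real>\<^sup>5\<close>,
  isometrically for the inner product \<open>tr (S T) / 2\<close>.\<close>

definition sym_traceless :: "real^5 \<Rightarrow> real^3^3" where
  "sym_traceless x = vector
     [vector [x $ 1 - x $ 2 / sqrt 3, x $ 3, x $ 4],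
      vector [x $ 3, - x $ 1 - x $ 2 / sqrt 3, x $ 5],
      vector [x $ 4, x $ 5, 2 * x $ 2 / sqrt 3]]"

definition SO5 :: "(real^5^5) set" where
  "SO5 = {R. rotation_matrix R}"

definition SO3_irr :: "(real^5^5) set" where
  "SO3_irr = {R. \<exists>A :: real^3^3. rotation_matrix A \<and>
     (\<forall>x. sym_traceless (R *v x) = A ** sym_traceless x ** transpose A)}"

text \<open>The Lie algebra of \<^term>\<open>SO3_irr\<close>: the image of \<open>so(3)\<close> under the differential of the
  representation.\<close>

definition so3_irr :: "(real^5^5) set" where
  "so3_irr = {Y. \<exists>a :: real^3^3. transpose a = - a \<and>
     (\<forall>x. sym_traceless (Y *v x) = a ** sym_traceless x - sym_traceless x ** a)}"

definition berger_coset :: "real^5^5 \<Rightarrow> (real^5^5) set" where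
  "berger_coset R = (\<lambda>Q. R ** Q) ` SO3_irr"

text \<open>The quotient smooth structure on \<open>SO(5)/SO(3)\<close>: charts are the injective maps \<open>\<pi> \<circ> \<sigma>\<close> for
  smooth \<open>\<sigma> : U \<rightarrow> SO(5)\<close> such that \<open>\<pi> \<circ> \<sigma>\<close> is an immersion, \<open>\<pi>\<close> being the projection onto
  cosets; their images cover the set of all cosets.  The kernel of \<open>d\<pi>\<close> at \<open>R\<close> is \<open>R so(3)\<close>, hence the last condition.\<close>

definition berger_atlas :: "((real^5^5) set, 7) chart set" where
  "berger_atlas = {(U, \<psi>). open U \<and> inj_on \<psi> U \<and>
     (\<exists>\<sigma> :: real^7 \<Rightarrow> real^5^5. smooth_on \<sigma> U \<and>
        (\<forall>x\<in>U. \<sigma> x \<in> SO5 \<and> \<psi> x = berger_coset (\<sigma> x) \<and>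
           (\<forall>v. v \<noteq> 0 \<longrightarrow> transpose (\<sigma> x) ** frechet_derivative \<sigma> (at x) v \<notin> so3_irr)))}"

text \<open>Invariance under left translations \<open>\<tau>\<^sub>R\<close>, \<open>R \<in> SO(5)\<close>: if \<open>(U, \<psi>)\<close> is a chart then so is
  \<open>(U, \<tau>\<^sub>R \<circ> \<psi>)\<close>, and in this pair of charts \<open>\<tau>\<^sub>R\<close> is the identity of \<open>U\<close>, so that
  \<open>\<tau>\<^sub>R\<^sup>* \<phi> = \<phi>\<close> says that the components agree.\<close>

definition berger_homogeneous :: "((real^5^5) set, 7) tensor3 \<Rightarrow> bool" where
  "berger_homogeneous \<phi> \<longleftrightarrow> (\<forall>R\<in>SO5. \<forall>(U, \<psi>)\<in>berger_atlas. \<forall>x\<in>U.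
     \<phi> (U, \<lambda>y. (\<lambda>Q. R ** Q) ` \<psi> y) x = \<phi> (U, \<psi>) x)"

end

theory Submission
  imports Defs
begin

text \<open>On a normal homogeneous space everything is computed in the frame of \<open>m\<close> pulled back by the
  Maurer--Cartan form of a local section: there the Levi-Civita connection is a fixed linear function of
  that form, and covariant derivatives of tensors built from equivariant maps are algebraic.  As \<open>m\<close> is
  irreducible under the isotropy group, the metric induced by an invariant \<open>G\<^sub>2\<close>-structure is a
  multiple of the normal one.  The five-dimensional representation of \<open>SO(5)\<close>
  restricts to an irreducible summand of \<open>Sym\<^sup>2 m\<close>; hence every \<open>v \<in> \<real>\<^sup>5\<close> yields a tensor field
  \<open>h\<^sub>v\<close>, which is trace-free and Killing and is an eigentensor of both \<open>\<nabla>\<^sup>*\<nabla>\<close>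
  and the curvature action, with eigenvalues \<open>19/(10k)\<close> and \<open>7/(4k)\<close> on the metric of scale \<open>k\<close>.
  Since \<open>19/10 - 2 * 7/4 = -8/5 < 0\<close>, these are destabilising directions.\<close>

section \<open>Smooth maps\<close>

text \<open>The main obstacle is that the atlas contains every local section and knows a change of
  charts only as \<open>the_inv_into\<close>. Its derivative is obtained by implicit
  differentiation: near the identity each orthogonal matrix factors into a section value and an
  isotropy element. In coframes the resulting Jacobian is \<open>Ad q\<close>, where q relates the
  two sections, so that an equivariant form on m is a tensor field. Equivariance of
  \<open>iota\<close> under the group, and not just its Lie algebra, rests on a formula for it:
  \<open>iota w\<close> is the form tr(L (X Y + Y X)), where L is traceless Jordan multiplication by
  w on symmetric 3x3 matrices, and rotations preserve that product. The same product supplies an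
  invariant separating nearby cosets, which makes the Cayley transform a slice. All numerical
  identities are evaluated over the integers. For the integral it is decisive that the tensors have
  constant norm: the integrand is a negative constant, and only a finite Borel decomposition of the
  space has to be built, from compactness of SO(5).\<close>

abbreviation fd :: "('a::real_normed_vector \<Rightarrow> 'b::real_normed_vector) \<Rightarrow> 'a \<Rightarrow> 'a \<Rightarrow> 'b" where
  "fd f x \<equiv> frechet_derivative f (at x)"

lemma fd_eqI: "(f has_derivative f') (at x) \<Longrightarrow> fd f x = f'"
  using frechet_derivative_at by metis

lemma differentiable_cong_open:
  assumes "open U" "x \<in> U" "\<And>y. y \<in> U \<Longrightarrow> f y = g y" "f differentiable (at x)"
  shows "g differentiable (at x)" "fd g x = fd f x"
proof -
  have "(f has_derivative fd f x) (at x)"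
    using assms(4) frechet_derivative_works by blast
  then have "(g has_derivative fd f x) (at x)"
    using has_derivative_transform_within_open[OF _ assms(1,2)] assms(3) by metis
  then show "g differentiable (at x)" "fd g x = fd f x"
    by (auto simp: differentiable_def dest: fd_eqI)
qed

text \<open>Identities between components hold on the chart domain only, while a derivative looks at
  a neighbourhood; openness of U reconciles the two.\<close>

lemma Ck_on_cong:
  assumes "open U" "\<And>x. x \<in> U \<Longrightarrow> f x = g x" "Ck_on k f U"
  shows "Ck_on k g U"
  using assms(2,3)
proof (induction k arbitrary: f g)
  case 0
  then show ?case by (simp cong: continuous_on_cong)
next
  case (Suc k)
  have "g differentiable (at x) \<and> fd g x = fd f x" if "x \<in> U" for x
    using differentiable_cong_open[OF assms(1) that, of f g] Suc.prems that by auto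
  moreover have "Ck_on k (\<lambda>x. fd g x v) U" for v
    by (rule Suc.IH[of "\<lambda>x. fd f x v"]) (use Suc.prems calculation in auto)
  ultimately show ?case by simp
qed

text \<open>Replaces the choice operator behind \<open>fd\<close> by a derivative known explicitly.
  The closure properties below are inductions through this rule.\<close>

lemma Ck_on_SucI:
  assumes "open U" "\<And>x. x \<in> U \<Longrightarrow> (f has_derivative f' x) (at x)"
    and "\<And>v. Ck_on k (\<lambda>x. f' x v) U"
  shows "Ck_on (Suc k) f U"
proof -
  have "Ck_on k (\<lambda>x. fd f x v) U" for v
    by (rule Ck_on_cong[OF assms(1) _ assms(3)[of v]]) (metis assms(2) fd_eqI)
  then show ?thesis using assms(2) by (auto simp: differentiable_def)
qed

lemma Ck_on_SucD:
  assumes "Ck_on (Suc k) f U" "x \<in> U"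
  shows "(f has_derivative fd f x) (at x)"
  using assms frechet_derivative_works by auto

text \<open>The product rule keeps one factor undifferentiated, so its induction has to lower the
  order of that factor.\<close>

lemma Ck_on_Suc_lower: "Ck_on (Suc k) f U \<Longrightarrow> Ck_on k f U"
proof (induction k arbitrary: f)
  case 0
  then show ?case
    by (auto intro!: continuous_at_imp_continuous_on differentiable_imp_continuous_within)
next
  case (Suc k)
  then show ?case by (metis Ck_on.simps(2))
qed

lemma Ck_on_const: "open U \<Longrightarrow> Ck_on k (\<lambda>_. c) U"
proof (induction k arbitrary: c)
  case (Suc k)
  then show ?case by (intro Ck_on_SucI[where f' = "\<lambda>_ _. 0"]) auto
qed simp

lemma Ck_on_add:
  "open U \<Longrightarrow> Ck_on k f U \<Longrightarrow> Ck_on k g U \<Longrightarrow> Ck_on k (\<lambda>x. f x + g x) U"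
proof (induction k arbitrary: f g)
  case 0
  then show ?case by (simp add: continuous_on_add)
next
  case (Suc k)
  show ?case
  proof (rule Ck_on_SucI[OF Suc.prems(1)])
    show "((\<lambda>x. f x + g x) has_derivative (\<lambda>v. fd f x v + fd g x v)) (at x)" if "x \<in> U" for x
      using that Suc.prems by (intro has_derivative_add Ck_on_SucD)
    show "Ck_on k (\<lambda>x. fd f x v + fd g x v) U" for v
      using Suc by simp
  qed
qed

lemma Ck_on_linear:
  assumes "bounded_linear L" "open U"
  shows "Ck_on k f U \<Longrightarrow> Ck_on k (\<lambda>x. L (f x)) U"
proof (induction k arbitrary: f)
  case 0
  then show ?case using assms bounded_linear.continuous_on by auto
next
  case (Suc k)
  show ?case
  proof (rule Ck_on_SucI[OF assms(2)])
    show "((\<lambda>x. L (f x)) has_derivative (\<lambda>v. L (fd f x v))) (at x)" if "x \<in> U" for x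
      using that Suc.prems by (intro bounded_linear.has_derivative[OF assms(1)] Ck_on_SucD)
    show "Ck_on k (\<lambda>x. L (fd f x v)) U" for v
      using Suc by simp
  qed
qed

text \<open>A single product rule for inner, matrix-vector, matrix-matrix and Jordan
  products.\<close>

lemma Ck_on_bilinear:
  assumes "bounded_bilinear bop" "open U"
  shows "Ck_on k f U \<Longrightarrow> Ck_on k g U \<Longrightarrow> Ck_on k (\<lambda>x. bop (f x) (g x)) U"
proof (induction k arbitrary: f g)
  case 0
  then show ?case using bounded_bilinear.continuous_on[OF assms(1)] by simp
next
  case (Suc k)
  show ?case
  proof (rule Ck_on_SucI[OF assms(2)])
    show "((\<lambda>x. bop (f x) (g x)) has_derivative
        (\<lambda>v. bop (f x) (fd g x v) + bop (fd f x v) (g x))) (at x)" if "x \<in> U" for x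
      using that Suc.prems by (intro bounded_bilinear.FDERIV[OF assms(1)]) (auto intro: Ck_on_SucD simp del: Ck_on.simps)
    show "Ck_on k (\<lambda>x. bop (f x) (fd g x v) + bop (fd f x v) (g x)) U" for v
      using Suc.prems Ck_on_Suc_lower[OF Suc.prems(1)] Ck_on_Suc_lower[OF Suc.prems(2)]
      by (intro Ck_on_add[OF assms(2)] Suc.IH) simp_all
  qed
qed

lemma smooth_on_has_derivative:
  "smooth_on f U \<Longrightarrow> x \<in> U \<Longrightarrow> (f has_derivative fd f x) (at x)"
  unfolding smooth_on_def using Ck_on_SucD by blast

lemma smooth_on_differentiable: "smooth_on f U \<Longrightarrow> x \<in> U \<Longrightarrow> f differentiable (at x)"
  using smooth_on_has_derivative differentiable_def by blast

lemma smooth_on_continuous: "smooth_on f U \<Longrightarrow> continuous_on U f"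
  unfolding smooth_on_def using Ck_on.simps(1) by blast

lemma smooth_on_fd: "smooth_on f U \<Longrightarrow> smooth_on (\<lambda>x. fd f x v) U"
  unfolding smooth_on_def by (metis Ck_on.simps(2))

lemma smooth_on_cong:
  "open U \<Longrightarrow> (\<And>x. x \<in> U \<Longrightarrow> f x = g x) \<Longrightarrow> smooth_on f U \<Longrightarrow> smooth_on g U"
  unfolding smooth_on_def using Ck_on_cong by blast

lemma smooth_on_const: "open U \<Longrightarrow> smooth_on (\<lambda>_. c) U"
  by (simp add: smooth_on_def Ck_on_const)

lemma smooth_on_add:
  "open U \<Longrightarrow> smooth_on f U \<Longrightarrow> smooth_on g U \<Longrightarrow> smooth_on (\<lambda>x. f x + g x) U"
  by (simp add: smooth_on_def Ck_on_add)

lemma smooth_on_linear: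
  "bounded_linear L \<Longrightarrow> open U \<Longrightarrow> smooth_on f U \<Longrightarrow> smooth_on (\<lambda>x. L (f x)) U"
  by (simp add: smooth_on_def Ck_on_linear)

lemma smooth_on_bilinear:
  "bounded_bilinear bop \<Longrightarrow> open U \<Longrightarrow> smooth_on f U \<Longrightarrow> smooth_on g U
    \<Longrightarrow> smooth_on (\<lambda>x. bop (f x) (g x)) U"
  by (simp add: smooth_on_def Ck_on_bilinear)

lemma smooth_on_sum:
  assumes "open U" "\<And>i. i \<in> I \<Longrightarrow> smooth_on (f i) U"
  shows "smooth_on (\<lambda>x. \<Sum>i\<in>I. f i x) U"
  using assms(2) by (induction I rule: infinite_finite_induct)
    (auto intro!: smooth_on_add smooth_on_const assms(1))

text \<open>The mean value theorem twice: along u for the difference of f on two opposite sides of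
  the parallelogram, then along v for its derivative. The second difference is symmetric in u and v,
  so comparing both orders gives the symmetry of second derivatives.\<close>

lemma second_difference_mean_value:
  fixes f :: "'a::real_normed_vector \<Rightarrow> real"
  assumes h: "0 < h" "h * (norm u + norm v) < r"
    and f: "\<And>y. y \<in> ball x r \<Longrightarrow> f differentiable (at y)"
    and f': "\<And>y. y \<in> ball x r \<Longrightarrow> (\<lambda>y. fd f y u) differentiable (at y)"
  obtains y where "y \<in> ball x r"
    "f (x + h *\<^sub>R u + h *\<^sub>R v) - f (x + h *\<^sub>R u) - f (x + h *\<^sub>R v) + f x
       = h * h * fd (\<lambda>y. fd f y u) y v"
proof -
  have ball: "x + s *\<^sub>R u + t *\<^sub>R v \<in> ball x r" if "0 \<le> s" "s \<le> h" "0 \<le> t" "t \<le> h" for s t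
  proof -
    have "norm (s *\<^sub>R u + t *\<^sub>R v) \<le> s * norm u + t * norm v"
      using norm_triangle_ineq[of "s *\<^sub>R u" "t *\<^sub>R v"] that by simp
    also have "\<dots> \<le> h * (norm u + norm v)"
      using that by (simp add: distrib_left add_mono mult_right_mono)
    finally have "norm (s *\<^sub>R u + t *\<^sub>R v) < r" using h(2) by simp
    moreover have "dist x (x + s *\<^sub>R u + t *\<^sub>R v) = norm (s *\<^sub>R u + t *\<^sub>R v)"
      by (metis add.assoc add_diff_cancel_left' dist_commute dist_norm)
    ultimately show ?thesis by simp
  qed
  have deriv: "((\<lambda>s. F (a + s *\<^sub>R w)) has_real_derivative fd F (a + s *\<^sub>R w) w) (at s)"
    if "F differentiable (at (a + s *\<^sub>R w))" for F :: "'a \<Rightarrow> real" and a w s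
  proof -
    have F: "(F has_derivative fd F (a + s *\<^sub>R w)) (at (a + s *\<^sub>R w))"
      using that frechet_derivative_works by blast
    have "((\<lambda>s. a + s *\<^sub>R w) has_derivative (\<lambda>t. t *\<^sub>R w)) (at s)"
      by (auto intro!: derivative_eq_intros)
    from diff_chain_at[OF this F]
    have "((\<lambda>s. F (a + s *\<^sub>R w)) has_derivative (\<lambda>t. fd F (a + s *\<^sub>R w) (t *\<^sub>R w))) (at s)"
      by (simp add: o_def)
    moreover have "fd F (a + s *\<^sub>R w) (t *\<^sub>R w) = fd F (a + s *\<^sub>R w) w * t" for t
      using F has_derivative_linear linear_cmul by (metis mult.commute real_scaleR_def)
    ultimately show ?thesis
      by (simp add: has_field_derivative_def)
  qed
  have "((\<lambda>s. f (x + h *\<^sub>R v + s *\<^sub>R u) - f (x + s *\<^sub>R u)) has_real_derivative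
      fd f (x + h *\<^sub>R v + s *\<^sub>R u) u - fd f (x + s *\<^sub>R u) u) (at s)" if "0 \<le> s" "s \<le> h" for s
    using ball[OF that, of h] ball[OF that, of 0] h
    by (intro DERIV_diff deriv f) (simp_all add: algebra_simps)
  from MVT2[OF h(1) this]
  obtain s where s: "0 < s" "s < h" and es:
    "(f (x + h *\<^sub>R v + h *\<^sub>R u) - f (x + h *\<^sub>R u)) - (f (x + h *\<^sub>R v + 0 *\<^sub>R u) - f (x + 0 *\<^sub>R u))
      = (h - 0) * (fd f (x + h *\<^sub>R v + s *\<^sub>R u) u - fd f (x + s *\<^sub>R u) u)" by blast
  have "((\<lambda>t. fd f (x + s *\<^sub>R u + t *\<^sub>R v) u) has_real_derivative
      fd (\<lambda>y. fd f y u) (x + s *\<^sub>R u + t *\<^sub>R v) v) (at t)" if "0 \<le> t" "t \<le> h" for t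
    using ball[OF _ _ that, of s] s by (intro deriv[where F = "\<lambda>y. fd f y u"] f') simp_all
  from MVT2[OF h(1) this]
  obtain t where t: "0 < t" "t < h" and et:
    "fd f (x + s *\<^sub>R u + h *\<^sub>R v) u - fd f (x + s *\<^sub>R u + 0 *\<^sub>R v) u
      = (h - 0) * fd (\<lambda>y. fd f y u) (x + s *\<^sub>R u + t *\<^sub>R v) v" by blast
  show ?thesis
    using that[of "x + s *\<^sub>R u + t *\<^sub>R v"] ball[of s t] s t es et by (simp add: algebra_simps)
qed

lemma smooth_on_symmetric_real:
  fixes f :: "'a::euclidean_space \<Rightarrow> real"
  assumes "open U" "smooth_on f U" "x \<in> U"
  shows "fd (\<lambda>y. fd f y u) x v = fd (\<lambda>y. fd f y v) x u"
proof -
  define P where "P = (\<lambda>y. fd (\<lambda>y. fd f y u) y v)"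
  define Q where "Q = (\<lambda>y. fd (\<lambda>y. fd f y v) y u)"
  have "continuous_on U P" "continuous_on U Q"
    unfolding P_def Q_def by (rule smooth_on_continuous[OF smooth_on_fd[OF smooth_on_fd[OF assms(2)]]])+
  then have cont: "isCont P x" "isCont Q x"
    using assms(1,3) continuous_on_eq_continuous_at by blast+
  have "\<bar>P x - Q x\<bar> \<le> e" if e: "e > 0" for e
  proof -
    obtain d1 where d1: "d1 > 0" "\<And>y. dist y x < d1 \<Longrightarrow> dist (P y) (P x) < e / 2"
      using cont(1)[unfolded continuous_at_eps_delta, rule_format, of "e / 2"] e by auto
    obtain d2 where d2: "d2 > 0" "\<And>y. dist y x < d2 \<Longrightarrow> dist (Q y) (Q x) < e / 2"
      using cont(2)[unfolded continuous_at_eps_delta, rule_format, of "e / 2"] e by auto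
    obtain d3 where d3: "d3 > 0" "ball x d3 \<subseteq> U"
      using assms(1,3) open_contains_ball by blast
    define r where "r = min d1 (min d2 d3)"
    have r: "r > 0" "ball x r \<subseteq> U" using d1 d2 d3 by (auto simp: r_def)
    \<comment> \<open>Small enough for the parallelogram to stay in the ball; the summand 1 keeps
      the denominator positive when u and v vanish.\<close>
    define h where "h = r / (2 * (norm u + norm v + 1))"
    have nn: "norm u + norm v + 1 > 0" by (simp add: add_nonneg_pos)
    have h: "0 < h" using r nn by (simp add: h_def)
    have "h * (norm u + norm v) < h * (2 * (norm u + norm v + 1))"
      using h nn by (intro mult_strict_left_mono) auto
    also have "\<dots> = r" using nn by (simp add: h_def)
    finally have hr: "h * (norm u + norm v) < r" .
    have D: "f differentiable (at y)" "(\<lambda>y. fd f y w) differentiable (at y)" if "y \<in> ball x r" for y w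
      using smooth_on_differentiable[OF assms(2), of y]
        smooth_on_differentiable[OF smooth_on_fd[OF assms(2)], of y] that r by blast+
    obtain y where y: "y \<in> ball x r"
      "f (x + h *\<^sub>R u + h *\<^sub>R v) - f (x + h *\<^sub>R u) - f (x + h *\<^sub>R v) + f x = h * h * P y"
      unfolding P_def by (rule second_difference_mean_value[OF h hr, of x f]) (use D in simp_all)
    obtain z where z: "z \<in> ball x r"
      "f (x + h *\<^sub>R v + h *\<^sub>R u) - f (x + h *\<^sub>R v) - f (x + h *\<^sub>R u) + f x = h * h * Q z"
      unfolding Q_def
      by (rule second_difference_mean_value[OF h, of v u r x f]) (use D hr in \<open>simp_all add: add.commute\<close>)
    have "h * h * P y = h * h * Q z" using y z by (simp add: algebra_simps)
    then have "P y = Q z" using h by simp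
    moreover have "dist (P y) (P x) < e / 2" "dist (Q z) (Q x) < e / 2"
      using y z d1(2)[of y] d2(2)[of z] by (auto simp: r_def dist_commute)
    ultimately show ?thesis by (auto simp: dist_real_def abs_if split: if_splits)
  qed
  then have "\<bar>P x - Q x\<bar> \<le> 0"
    by (rule field_le_epsilon) simp
  then show ?thesis by (simp add: P_def Q_def)
qed

lemma fd_linear:
  assumes "bounded_linear L" "f differentiable (at x)"
  shows "fd (\<lambda>y. L (f y)) x = (\<lambda>v. L (fd f x v))"
  using bounded_linear.has_derivative[OF assms(1)] assms(2) by (intro fd_eqI) (simp add: frechet_derivative_works)

lemma smooth_on_symmetric:
  fixes f :: "'a::euclidean_space \<Rightarrow> 'b::euclidean_space"
  assumes "open U" "smooth_on f U" "x \<in> U"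
  shows "fd (\<lambda>y. fd f y u) x v = fd (\<lambda>y. fd f y v) x u"
proof (rule euclidean_eqI)
  fix b :: 'b
  have L: "bounded_linear (\<lambda>z. z \<bullet> b)" by (rule bounded_linear_inner_left)
  have *: "fd (\<lambda>y. fd (\<lambda>y. f y \<bullet> b) y u) x v = fd (\<lambda>y. fd f y u) x v \<bullet> b" for u v
  proof -
    have "fd (\<lambda>y. fd f y u \<bullet> b) x v = fd (\<lambda>y. fd f y u) x v \<bullet> b"
      by (subst fd_linear[OF L smooth_on_differentiable[OF smooth_on_fd[OF assms(2)] assms(3)]]) simp
    moreover have "fd (\<lambda>y. fd (\<lambda>y. f y \<bullet> b) y u) x = fd (\<lambda>y. fd f y u \<bullet> b) x"
    proof (rule differentiable_cong_open(2)[OF assms(1,3)])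
      show "fd f y u \<bullet> b = fd (\<lambda>y. f y \<bullet> b) y u" if "y \<in> U" for y
        by (subst fd_linear[OF L smooth_on_differentiable[OF assms(2) that]]) simp
      show "(\<lambda>y. fd f y u \<bullet> b) differentiable (at x)"
        by (rule smooth_on_differentiable[OF smooth_on_linear[OF L assms(1) smooth_on_fd[OF assms(2)]] assms(3)])
    qed
    ultimately show ?thesis by simp
  qed
  show "fd (\<lambda>y. fd f y u) x v \<bullet> b = fd (\<lambda>y. fd f y v) x u \<bullet> b"
    using smooth_on_symmetric_real[OF assms(1) smooth_on_linear[OF L assms(1,2)] assms(3), of u v]
    by (simp add: *)
qed

section \<open>The Levi-Civita connection in a moving frame\<close>

lemma bounded_bilinear_matrix_vector_mult:
  "bounded_bilinear ((*v) :: real^'n^'m \<Rightarrow> real^'n \<Rightarrow> real^'m)"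
  unfolding bilinear_conv_bounded_bilinear[symmetric] bilinear_def
  by (auto simp: linear_iff matrix_vector_right_distrib matrix_vector_mult_add_rdistrib
      scaleR_matrix_vector_assoc matrix_vector_mult_scaleR)

lemma bounded_bilinear_matrix_matrix_mult:
  "bounded_bilinear ((**) :: real^'n^'m \<Rightarrow> real^'p^'n \<Rightarrow> real^'p^'m)"
  unfolding bilinear_conv_bounded_bilinear[symmetric] bilinear_def
  by (auto simp: linear_iff vec_eq_iff matrix_matrix_mult_def distrib_left distrib_right
      sum.distrib sum_distrib_left mult_ac)

lemma bounded_linear_transpose: "bounded_linear (transpose :: real^'n^'m \<Rightarrow> real^'m^'n)"
  unfolding linear_conv_bounded_linear[symmetric]
  by (auto simp: linear_iff transpose_def vec_eq_iff)

lemma matrix_entry_eq: "(A :: real^'n^'m) $ i $ j = axis i 1 \<bullet> (A *v axis j 1)"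
  by (simp add: inner_axis' matrix_vector_mult_basis column_def)

lemma dot_matrix_vector_mult:
  "u \<bullet> ((A :: real^'n^'m) *v v) = (\<Sum>a\<in>UNIV. \<Sum>b\<in>UNIV. u $ a * A $ a $ b * v $ b)"
  by (simp add: inner_vec_def matrix_vector_mult_def sum_distrib_left mult.assoc)

lemma dot_vector_matrix_mult: "u \<bullet> (v v* (A :: real^'n^'m)) = v \<bullet> (A *v u)"
  by (metis dot_lmul_matrix inner_commute)

lemma matrix_inv_right_left:
  fixes A :: "real^'n^'n"
  assumes "invertible A"
  shows matrix_inv_right: "A ** matrix_inv A = mat 1"
    and matrix_inv_left: "matrix_inv A ** A = mat 1"
  using someI_ex[OF assms[unfolded invertible_def]] by (simp_all add: matrix_inv_def)

lemma det_differentiable: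
  fixes A :: "'a::real_normed_vector \<Rightarrow> real^'m^'m"
  assumes "\<And>i j. (\<lambda>y. A y $ i $ j) differentiable (at x)"
  shows "(\<lambda>y. det (A y)) differentiable (at x)"
proof -
  have "\<exists>f'. ((\<lambda>y. \<Prod>i\<in>UNIV. A y $ i $ p i) has_derivative f') (at x)" for p
  proof -
    have "\<forall>i. \<exists>f'. ((\<lambda>y. A y $ i $ p i) has_derivative f') (at x)"
      using assms by (simp add: differentiable_def)
    then obtain f' where "\<And>i. ((\<lambda>y. A y $ i $ p i) has_derivative f' i) (at x)" by metis
    then show ?thesis using has_derivative_prod[of UNIV "\<lambda>i y. A y $ i $ p i" f'] by blast
  qed
  then show ?thesis
    unfolding det_def
    by (intro differentiable_sum ballI differentiable_mult differentiable_const)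
       (auto simp: differentiable_def finite_permutations)
qed

text \<open>By Cramer's rule an entry of the inverse is a quotient of determinants.\<close>

lemma matrix_inv_differentiable:
  fixes A :: "'a::real_normed_vector \<Rightarrow> real^'m^'m"
  assumes "open U" "x \<in> U" "\<And>y. y \<in> U \<Longrightarrow> invertible (A y)"
    and A: "\<And>i j. (\<lambda>y. A y $ i $ j) differentiable (at x)"
  shows "(\<lambda>y. matrix_inv (A y) $ k $ m) differentiable (at x)"
proof -
  define N where "N = (\<lambda>y. \<chi> i j. if j = k then axis m 1 $ i else A y $ i $ j)"
  have inv: "matrix_inv (A y) $ k $ m = det (N y) / det (A y)" if "y \<in> U" for y
  proof -
    have "A y *v (matrix_inv (A y) *v axis m 1) = axis m 1"
      using assms(3)[OF that] by (simp add: matrix_vector_mul_assoc matrix_inv_right)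
    then have "matrix_inv (A y) *v axis m 1
        = (\<chi> k. det (\<chi> i j. if j = k then axis m 1 $ i else A y $ i $ j) / det (A y))"
      using assms(3)[OF that] by (intro iffD1[OF cramer]) (simp_all add: invertible_det_nz)
    moreover have "(matrix_inv (A y) *v axis m 1) $ k = matrix_inv (A y) $ k $ m"
      by (simp add: matrix_vector_mult_basis column_def)
    ultimately show ?thesis by (simp add: N_def)
  qed
  have "(\<lambda>y. N y $ i $ j) differentiable (at x)" for i j
    using A by (cases "j = k") (simp_all add: N_def)
  then have "(\<lambda>y. det (N y) / det (A y)) differentiable (at x)"
    using assms(2,3) by (intro differentiable_divide det_differentiable A) (auto simp: invertible_det_nz)
  from differentiable_cong_open(1)[OF assms(1,2) _ this, of "\<lambda>y. matrix_inv (A y) $ k $ m"] inv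
  show ?thesis by simp
qed

section \<open>Partial derivatives of vector-valued and matrix-valued maps\<close>

definition pdv :: "'n \<Rightarrow> (real^'n \<Rightarrow> 'b::real_normed_vector) \<Rightarrow> real^'n \<Rightarrow> 'b" where
  "pdv i f x = fd f x (axis i 1)"

lemma pd_eq_pdv: "pd i f x = pdv i f x"
  by (simp add: pd_def pdv_def)

lemma pdv_eqI: "(f has_derivative f') (at x) \<Longrightarrow> pdv i f x = f' (axis i 1)"
  by (simp add: pdv_def fd_eqI)

lemma pdv_cong_open:
  assumes "open U" "x \<in> U" "\<And>y. y \<in> U \<Longrightarrow> f y = g y" "f differentiable (at x)"
  shows "pdv i f x = pdv i g x"
  using differentiable_cong_open(2)[OF assms] by (simp add: pdv_def)

lemma pdv_add:
  "f differentiable (at x) \<Longrightarrow> g differentiable (at x)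
    \<Longrightarrow> pdv i (\<lambda>y. f y + g y) x = pdv i f x + pdv i g x"
  by (simp add: frechet_derivative_works pdv_def fd_eqI[OF has_derivative_add])

lemma pdv_sum:
  assumes "\<And>k. k \<in> I \<Longrightarrow> f k differentiable (at x)"
  shows "pdv i (\<lambda>y. \<Sum>k\<in>I. f k y) x = (\<Sum>k\<in>I. pdv i (f k) x)"
proof -
  have "((\<lambda>y. \<Sum>k\<in>I. f k y) has_derivative (\<lambda>v. \<Sum>k\<in>I. fd (f k) x v)) (at x)"
    by (rule has_derivative_sum) (use assms frechet_derivative_works in blast)
  from pdv_eqI[OF this] show ?thesis by (simp add: pdv_def)
qed

lemma pdv_linear:
  "bounded_linear L \<Longrightarrow> f differentiable (at x) \<Longrightarrow> pdv i (\<lambda>y. L (f y)) x = L (pdv i f x)"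
  by (simp add: pdv_def fd_linear)

lemma pdv_bilinear:
  assumes "bounded_bilinear b" "f differentiable (at x)" "g differentiable (at x)"
  shows "pdv i (\<lambda>y. b (f y) (g y)) x = b (f x) (pdv i g x) + b (pdv i f x) (g x)"
proof -
  have "((\<lambda>y. b (f y) (g y)) has_derivative (\<lambda>v. b (f x) (fd g x v) + b (fd f x v) (g x))) (at x)"
    by (rule bounded_bilinear.FDERIV[OF assms(1)]) (use assms(2,3) frechet_derivative_works in blast)+
  from pdv_eqI[OF this] show ?thesis by (simp add: pdv_def)
qed

lemma bilinear_differentiable:
  assumes "bounded_bilinear b" "f differentiable (at x)" "g differentiable (at x)"
  shows "(\<lambda>y. b (f y) (g y)) differentiable (at x)"
  using assms(2,3) bounded_bilinear.FDERIV[OF assms(1)] unfolding differentiable_def by blast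

lemma linear_differentiable:
  assumes "bounded_linear L" "f differentiable (at x)"
  shows "(\<lambda>y. L (f y)) differentiable (at x)"
  using assms(2) bounded_linear.has_derivative[OF assms(1)] unfolding differentiable_def by blast

lemma smooth_on_pdv: "smooth_on f U \<Longrightarrow> smooth_on (pdv i f) U"
  unfolding pdv_def by (rule smooth_on_fd)

lemma pdv_commute:
  fixes f :: "real^'n \<Rightarrow> 'b::euclidean_space"
  shows "open U \<Longrightarrow> smooth_on f U \<Longrightarrow> x \<in> U \<Longrightarrow> pdv i (pdv j f) x = pdv j (pdv i f) x"
  unfolding pdv_def by (rule smooth_on_symmetric)

lemmas pdv_mv = pdv_bilinear[OF bounded_bilinear_matrix_vector_mult]
  and pdv_inner = pdv_bilinear[OF bounded_bilinear_inner]
  and pdv_mult = pdv_bilinear[OF bounded_bilinear_mult]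
  and pdv_scaleR = pdv_bilinear[OF bounded_bilinear_scaleR]
  and diff_mv = bilinear_differentiable[OF bounded_bilinear_matrix_vector_mult]
  and diff_inner = bilinear_differentiable[OF bounded_bilinear_inner]
  and diff_mult = bilinear_differentiable[OF bounded_bilinear_mult]
  and diff_scaleR = bilinear_differentiable[OF bounded_bilinear_scaleR]

lemma sum_swap3:
  "(\<Sum>j\<in>K. \<Sum>a\<in>A. \<Sum>b\<in>B. h j a b) = (\<Sum>a\<in>A. \<Sum>b\<in>B. \<Sum>j\<in>K. h j a b)"
proof -
  have "(\<Sum>j\<in>K. \<Sum>a\<in>A. \<Sum>b\<in>B. h j a b) = (\<Sum>a\<in>A. \<Sum>j\<in>K. \<Sum>b\<in>B. h j a b)"
    by (rule sum.swap)
  also have "\<dots> = (\<Sum>a\<in>A. \<Sum>b\<in>B. \<Sum>j\<in>K. h j a b)"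
    by (subst sum.swap) (rule refl)
  finally show ?thesis .
qed

lemma sum_swap4:
  "(\<Sum>i\<in>I. \<Sum>j\<in>J. \<Sum>a\<in>A. \<Sum>b\<in>B. f i j a b) = (\<Sum>a\<in>A. \<Sum>b\<in>B. \<Sum>i\<in>I. \<Sum>j\<in>J. f i j a b)"
proof -
  have "(\<Sum>j\<in>J. \<Sum>a\<in>A. \<Sum>b\<in>B. f i j a b) = (\<Sum>a\<in>A. \<Sum>b\<in>B. \<Sum>j\<in>J. f i j a b)" for i
    by (rule sum_swap3)
  then have "(\<Sum>i\<in>I. \<Sum>j\<in>J. \<Sum>a\<in>A. \<Sum>b\<in>B. f i j a b) = (\<Sum>i\<in>I. \<Sum>a\<in>A. \<Sum>b\<in>B. \<Sum>j\<in>J. f i j a b)"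
    by (simp only:)
  also have "\<dots> = (\<Sum>a\<in>A. \<Sum>b\<in>B. \<Sum>i\<in>I. \<Sum>j\<in>J. f i j a b)"
    by (rule sum_swap3)
  finally show ?thesis .
qed

text \<open>\<open>th i x\<close> and \<open>W i x\<close> are the values on \<open>\<partial>\<^sub>i\<close> of a coframe in which \<open>g\<close> has the constant
  matrix \<open>G\<close>, and of its Levi-Civita connection form: the latter is characterised by the
  conditions \<open>torsion\<close> and \<open>skew\<close>.\<close>

locale moving_frame =
  fixes U :: "(real^'n) set" and g :: "real^'n \<Rightarrow> 'n \<Rightarrow> 'n \<Rightarrow> real" and G :: "real^'n^'n"
    and th :: "'n \<Rightarrow> real^'n \<Rightarrow> real^'n" and W :: "'n \<Rightarrow> real^'n \<Rightarrow> real^'n^'n"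
  assumes open_U: "open U"
    and smooth_th: "smooth_on (th i) U"
    and smooth_W: "smooth_on (W i) U"
    and G_sym: "transpose G = G"
    and G_inv: "invertible G"
    and metric: "x \<in> U \<Longrightarrow> g x i j = th i x \<bullet> (G *v th j x)"
    and indep: "x \<in> U \<Longrightarrow> (\<Sum>i\<in>UNIV. v $ i *\<^sub>R th i x) = 0 \<Longrightarrow> v = 0"
    and torsion: "x \<in> U \<Longrightarrow>
      pdv i (th j) x + W i x *v th j x = pdv j (th i) x + W j x *v th i x"
    and skew: "x \<in> U \<Longrightarrow> u \<bullet> (G *v (W i x *v v)) = - ((W i x *v u) \<bullet> (G *v v))"
begin

text \<open>Multiplication by this matrix converts coordinate components of a tangent vector into
  frame components.\<close>

definition Th :: "real^'n \<Rightarrow> real^'n^'n" where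
  "Th x = (\<chi> a i. th i x $ a)"

lemma Th_mult: "Th x *v v = (\<Sum>i\<in>UNIV. v $ i *\<^sub>R th i x)"
  by (simp add: Th_def matrix_vector_mult_def vec_eq_iff sum_component mult.commute)

lemma Th_axis: "Th x *v axis i 1 = th i x"
  by (simp add: Th_def matrix_vector_mult_basis column_def)

lemma Th_vector_mult: "(v v* Th x) $ i = th i x \<bullet> v"
  by (simp add: Th_def vector_matrix_mult_def inner_vec_def mult.commute)

lemma Th_invertible: "x \<in> U \<Longrightarrow> invertible (Th x)"
  unfolding invertible_left_inverse matrix_left_invertible_ker Th_mult using indep by blast

lemma metric_matrix_eq:
  assumes "x \<in> U"
  shows "metric_matrix g x = transpose (Th x) ** G ** Th x"
proof -
  have "metric_matrix g x $ i $ j = (transpose (Th x) ** G ** Th x) $ i $ j" for i j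
    unfolding matrix_entry_eq[of "transpose (Th x) ** G ** Th x"]
    by (simp add: metric_matrix_def metric[OF assms] Th_axis Th_vector_mult inner_axis'
        flip: matrix_vector_mul_assoc)
  then show ?thesis by (simp add: vec_eq_iff)
qed

lemma metric_matrix_invertible: "x \<in> U \<Longrightarrow> invertible (metric_matrix g x)"
  by (simp add: metric_matrix_eq invertible_mult G_inv Th_invertible transpose_invertible)

text \<open>Invert g = T^t G T. This turns every contraction with the variable \<open>ginv\<close>
  into one with the constant inverse of G.\<close>

lemma Th_ginv_Th:
  assumes "x \<in> U"
  shows "Th x ** matrix_inv (metric_matrix g x) ** transpose (Th x) = matrix_inv G"
proof -
  let ?M = "metric_matrix g x" and ?T = "Th x"
  have T: "invertible ?T" "invertible (transpose ?T)"
    using Th_invertible[OF assms] by (simp_all add: transpose_invertible)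
  have 1: "?T ** matrix_inv ?M ** transpose ?T ** G ** ?T = ?T"
    using matrix_inv_left[OF metric_matrix_invertible[OF assms]]
    by (simp add: metric_matrix_eq[OF assms] flip: matrix_mul_assoc)
  have "?T ** matrix_inv ?M ** transpose ?T ** G = ?T ** matrix_inv ?M ** transpose ?T ** G ** ?T ** matrix_inv ?T"
    using matrix_inv_right[OF T(1)] by (simp flip: matrix_mul_assoc)
  also have "\<dots> = mat 1" using 1 matrix_inv_right[OF T(1)] by simp
  finally have "?T ** matrix_inv ?M ** transpose ?T ** G ** matrix_inv G = matrix_inv G" by simp
  then show ?thesis using matrix_inv_right[OF G_inv] by (simp flip: matrix_mul_assoc)
qed

lemma ginv_contract:
  assumes "x \<in> U"
  shows "(\<Sum>i\<in>UNIV. \<Sum>l\<in>UNIV. ginv g x i l * (th i x \<bullet> (B *v th l x)))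
    = (\<Sum>a\<in>UNIV. \<Sum>b\<in>UNIV. matrix_inv G $ a $ b * B $ a $ b)"
proof -
  have "(\<Sum>i\<in>UNIV. \<Sum>l\<in>UNIV. ginv g x i l * (th i x \<bullet> (B *v th l x)))
      = (\<Sum>i\<in>UNIV. \<Sum>l\<in>UNIV. \<Sum>a\<in>UNIV. \<Sum>b\<in>UNIV. ginv g x i l * th i x $ a * B $ a $ b * th l x $ b)"
    by (simp add: dot_matrix_vector_mult sum_distrib_left mult.assoc)
  also have "\<dots> = (\<Sum>a\<in>UNIV. \<Sum>b\<in>UNIV. \<Sum>i\<in>UNIV. \<Sum>l\<in>UNIV. ginv g x i l * th i x $ a * B $ a $ b * th l x $ b)"
    by (rule sum_swap4)
  also have "\<dots> = (\<Sum>a\<in>UNIV. \<Sum>b\<in>UNIV. (Th x ** matrix_inv (metric_matrix g x) ** transpose (Th x)) $ a $ b * B $ a $ b)"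
  proof (intro sum.cong refl)
    fix a b
    have "(Th x ** matrix_inv (metric_matrix g x) ** transpose (Th x)) $ a $ b
       = (\<Sum>l\<in>UNIV. (\<Sum>i\<in>UNIV. th i x $ a * ginv g x i l) * th l x $ b)"
      by (simp add: matrix_matrix_mult_def Th_def transpose_def ginv_def)
    also have "\<dots> = (\<Sum>i\<in>UNIV. \<Sum>l\<in>UNIV. th i x $ a * ginv g x i l * th l x $ b)"
      unfolding sum_distrib_right by (rule sum.swap)
    finally have *: "(Th x ** matrix_inv (metric_matrix g x) ** transpose (Th x)) $ a $ b = \<dots>" .
    show "(\<Sum>i\<in>UNIV. \<Sum>l\<in>UNIV. ginv g x i l * th i x $ a * B $ a $ b * th l x $ b)
      = (Th x ** matrix_inv (metric_matrix g x) ** transpose (Th x)) $ a $ b * B $ a $ b"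
      unfolding * sum_distrib_right by (simp add: mult_ac)
  qed
  finally show ?thesis by (simp add: Th_ginv_Th[OF assms])
qed

text \<open>Index raising: a frame vector is recovered from its products with the coordinate
  fields.\<close>

lemma ginv_dual:
  assumes "x \<in> U"
  shows "(\<Sum>k\<in>UNIV. (\<Sum>m\<in>UNIV. ginv g x k m * (th m x \<bullet> (G *v z))) *\<^sub>R th k x) = z"
proof -
  have "(\<Sum>k\<in>UNIV. (\<Sum>m\<in>UNIV. ginv g x k m * (th m x \<bullet> (G *v z))) *\<^sub>R th k x)
      = Th x *v (matrix_inv (metric_matrix g x) *v (transpose (Th x) *v (G *v z)))"
    unfolding Th_mult
    by (simp add: matrix_vector_mult_def[of "matrix_inv _"] Th_vector_mult ginv_def)
  also have "\<dots> = (Th x ** matrix_inv (metric_matrix g x) ** transpose (Th x)) *v (G *v z)"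
    by (simp add: matrix_vector_mul_assoc matrix_mul_assoc)
  also have "\<dots> = z"
    by (simp add: Th_ginv_Th[OF assms] matrix_vector_mul_assoc matrix_inv_left[OF G_inv])
  finally show ?thesis .
qed

text \<open>The frame components of the covariant derivative of the j-th coordinate field along the
  i-th, as \<open>christoffel_frame\<close> confirms.\<close>

definition Z :: "'n \<Rightarrow> 'n \<Rightarrow> real^'n \<Rightarrow> real^'n" where
  "Z i j x = pdv i (th j) x + W i x *v th j x"

lemma Z_sym: "x \<in> U \<Longrightarrow> Z i j x = Z j i x"
  by (simp add: Z_def torsion)

lemma th_diff: "x \<in> U \<Longrightarrow> th i differentiable (at x)"
  using smooth_on_differentiable[OF smooth_th] .

lemma W_diff: "x \<in> U \<Longrightarrow> W i differentiable (at x)"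
  using smooth_on_differentiable[OF smooth_W] .

lemma smooth_metric: "smooth_on (\<lambda>y. g y i j) U"
proof (rule smooth_on_cong[OF open_U])
  show "smooth_on (\<lambda>y. th i y \<bullet> (G *v th j y)) U"
    by (rule smooth_on_bilinear[OF bounded_bilinear_inner open_U smooth_th])
      (rule smooth_on_linear[OF matrix_vector_mul_bounded_linear open_U smooth_th])
qed (simp add: metric)

lemma G_commute: "u \<bullet> (G *v v) = v \<bullet> (G *v u)"
  by (metis G_sym dot_lmul_matrix inner_commute transpose_matrix_vector)

text \<open>Metric compatibility: passing from derivatives of the coframe to \<open>Z\<close> adds
  two connection terms, which cancel by \<open>skew\<close>.\<close>

lemma pd_metric:
  assumes "x \<in> U"
  shows "pd k (\<lambda>y. g y i j) x = Z k i x \<bullet> (G *v th j x) + th i x \<bullet> (G *v Z k j x)"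
proof -
  have dG: "(\<lambda>y. G *v th j y) differentiable (at x)"
    by (rule linear_differentiable[OF matrix_vector_mul_bounded_linear th_diff[OF assms]])
  have "pd k (\<lambda>y. g y i j) x = pdv k (\<lambda>y. th i y \<bullet> (G *v th j y)) x"
    unfolding pd_eq_pdv
    by (rule pdv_cong_open[OF open_U assms _ smooth_on_differentiable[OF smooth_metric assms]])
      (simp add: metric)
  also have "\<dots> = th i x \<bullet> (G *v pdv k (th j) x) + pdv k (th i) x \<bullet> (G *v th j x)"
    by (simp add: pdv_inner[OF th_diff[OF assms] dG]
        pdv_linear[OF matrix_vector_mul_bounded_linear th_diff[OF assms]])
  also have "\<dots> = Z k i x \<bullet> (G *v th j x) + th i x \<bullet> (G *v Z k j x)"
    using skew[OF assms, of "th i x" k "th j x"]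
    by (simp add: Z_def inner_add_left inner_add_right matrix_vector_right_distrib)
  finally show ?thesis .
qed

text \<open>The Koszul formula. Of the six terms in the combination of metric derivatives four
  cancel by symmetry of \<open>Z\<close>, which is the vanishing of torsion;
  \<open>ginv_dual\<close> then raises the index.\<close>

lemma christoffel_frame:
  assumes "x \<in> U"
  shows "(\<Sum>k\<in>UNIV. christoffel g x k i j *\<^sub>R th k x) = Z i j x"
proof -
  have "pd i (\<lambda>y. g y m j) x + pd j (\<lambda>y. g y m i) x - pd m (\<lambda>y. g y i j) x
      = 2 * (th m x \<bullet> (G *v Z i j x))" for m
    unfolding pd_metric[OF assms]
    using Z_sym[OF assms, of i m] Z_sym[OF assms, of j m] Z_sym[OF assms, of j i]
    by (simp add: G_commute[of "Z m i x"] G_commute[of "th i x"])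
  then have "christoffel g x k i j = (\<Sum>m\<in>UNIV. ginv g x k m * (th m x \<bullet> (G *v Z i j x)))" for k
    by (simp add: christoffel_def mult.left_commute[of _ 2] flip: sum_distrib_left)
  then show ?thesis using ginv_dual[OF assms] by simp
qed

lemma christoffel_inner:
  assumes "x \<in> U"
  shows "(\<Sum>m\<in>UNIV. christoffel g x m i j * (th m x \<bullet> v)) = Z i j x \<bullet> v"
  by (simp flip: christoffel_frame[OF assms] add: inner_sum_left)

lemma christoffel_inner':
  assumes "x \<in> U"
  shows "(\<Sum>m\<in>UNIV. christoffel g x m i j * (v \<bullet> (B *v th m x))) = v \<bullet> (B *v Z i j x)"
  using christoffel_inner[OF assms, of i j "v v* B"] by (simp add: dot_vector_matrix_mult)

lemma christoffel_differentiable: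
  assumes "x \<in> U"
  shows "(\<lambda>y. christoffel g y k i j) differentiable (at x)"
proof -
  have d: "(\<lambda>y. pd a (\<lambda>z. g z b c) y) differentiable (at x)" for a b c
    unfolding pd_def by (rule smooth_on_differentiable[OF smooth_on_fd[OF smooth_metric] assms])
  have gi: "(\<lambda>y. ginv g y k m) differentiable (at x)" for m
    unfolding ginv_def
  proof (rule matrix_inv_differentiable[OF open_U assms])
    show "invertible (metric_matrix g y)" if "y \<in> U" for y
      by (rule metric_matrix_invertible[OF that])
    show "(\<lambda>y. metric_matrix g y $ i $ j) differentiable (at x)" for i j
      using smooth_on_differentiable[OF smooth_metric assms] by (simp add: metric_matrix_def)
  qed
  show ?thesis
    unfolding christoffel_def
    by (intro differentiable_divide differentiable_sum ballI differentiable_mult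
        differentiable_diff differentiable_add d gi) auto
qed

text \<open>Once the Christoffel symbols are expressed by \<open>Z\<close>, the derivatives of the
  coframe cancel and only the frame formula dB - W^t B - B W is left.\<close>

lemma cov2_frame:
  assumes x: "x \<in> U" and h: "\<And>y i j. y \<in> U \<Longrightarrow> h y i j = th i y \<bullet> (B y *v th j y)"
    and B: "B differentiable (at x)"
  shows "cov2 g h x k i j =
    th i x \<bullet> ((pdv k B x - transpose (W k x) ** B x - B x ** W k x) *v th j x)"
proof -
  note dt = th_diff[OF x]
  have dB: "(\<lambda>y. B y *v th j y) differentiable (at x)" by (rule diff_mv[OF B dt])
  have "pd k (\<lambda>y. h y i j) x = pdv k (\<lambda>y. th i y \<bullet> (B y *v th j y)) x"
    unfolding pd_eq_pdv
    by (rule pdv_cong_open[OF open_U x _ diff_inner[OF dt dB], symmetric]) (simp add: h)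
  also have "\<dots> = th i x \<bullet> (pdv k B x *v th j x) + th i x \<bullet> (B x *v pdv k (th j) x)
      + pdv k (th i) x \<bullet> (B x *v th j x)"
    by (simp add: pdv_inner[OF dt dB] pdv_mv[OF B dt] inner_add_right)
  finally have "pd k (\<lambda>y. h y i j) x = \<dots>" .
  moreover have "(\<Sum>m\<in>UNIV. christoffel g x m k i * h x m j + christoffel g x m k j * h x i m)
      = Z k i x \<bullet> (B x *v th j x) + th i x \<bullet> (B x *v Z k j x)"
    by (simp add: h[OF x] sum.distrib christoffel_inner[OF x] christoffel_inner'[OF x])
  ultimately show ?thesis
    unfolding cov2_def
    by (simp add: Z_def inner_add_left inner_add_right inner_diff_right matrix_vector_right_distrib
        matrix_vector_mult_diff_rdistrib dot_vector_matrix_mult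
        inner_commute[of "W k x *v th i x"] flip: matrix_vector_mul_assoc)
qed

text \<open>A 3-tensor is kept as a family of bilinear forms indexed by the frame component of its
  first slot; that slot contributes the sum over d.\<close>

lemma cov3_frame:
  assumes x: "x \<in> U"
    and T: "\<And>y k i j. y \<in> U \<Longrightarrow> T y k i j = (\<Sum>c\<in>UNIV. th k y $ c * (th i y \<bullet> (B c y *v th j y)))"
    and B: "\<And>c. B c differentiable (at x)"
  shows "cov3 g T x l k i j = (\<Sum>c\<in>UNIV. th k x $ c * (th i x \<bullet>
    ((pdv l (B c) x - (\<Sum>d\<in>UNIV. W l x $ d $ c *\<^sub>R B d x)
       - transpose (W l x) ** B c x - B c x ** W l x) *v th j x)))"
proof -
  note dt = th_diff[OF x]
  have dc: "(\<lambda>y. th k y $ c) differentiable (at x)" for c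
    by (rule linear_differentiable[OF bounded_linear_vec_nth dt])
  have dB: "(\<lambda>y. B c y *v th j y) differentiable (at x)" for c by (rule diff_mv[OF B dt])
  have dS: "(\<lambda>y. th i y \<bullet> (B c y *v th j y)) differentiable (at x)" for c
    by (rule diff_inner[OF dt dB])
  have "pd l (\<lambda>y. T y k i j) x = pdv l (\<lambda>y. \<Sum>c\<in>UNIV. th k y $ c * (th i y \<bullet> (B c y *v th j y))) x"
    unfolding pd_eq_pdv
    by (rule pdv_cong_open[OF open_U x, symmetric])
      (simp_all add: T differentiable_sum diff_mult[OF dc dS])
  also have "\<dots> = (\<Sum>c\<in>UNIV. th k x $ c * (th i x \<bullet> (pdv l (B c) x *v th j x) + th i x \<bullet> (B c x *v pdv l (th j) x)
      + pdv l (th i) x \<bullet> (B c x *v th j x)) + pdv l (th k) x $ c * (th i x \<bullet> (B c x *v th j x)))"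
    by (simp add: pdv_sum diff_mult[OF dc dS] pdv_mult[OF dc dS] pdv_inner[OF dt dB] pdv_mv[OF B dt]
        inner_add_right pdv_linear[OF bounded_linear_vec_nth dt] add_ac)
  finally have 1: "pd l (\<lambda>y. T y k i j) x = \<dots>" .
  have zk: "(\<Sum>m\<in>UNIV. christoffel g x m l k * T x m i j)
      = (\<Sum>c\<in>UNIV. Z l k x $ c * (th i x \<bullet> (B c x *v th j x)))"
  proof -
    have "(\<Sum>m\<in>UNIV. christoffel g x m l k * T x m i j)
        = (\<Sum>m\<in>UNIV. \<Sum>c\<in>UNIV. christoffel g x m l k * th m x $ c * (th i x \<bullet> (B c x *v th j x)))"
      by (simp add: T[OF x] sum_distrib_left mult.assoc)
    also have "\<dots> = (\<Sum>c\<in>UNIV. \<Sum>m\<in>UNIV. christoffel g x m l k * th m x $ c * (th i x \<bullet> (B c x *v th j x)))"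
      by (rule sum.swap)
    also have "\<dots> = (\<Sum>c\<in>UNIV. Z l k x $ c * (th i x \<bullet> (B c x *v th j x)))"
      by (simp flip: christoffel_frame[OF x] add: sum_component sum_distrib_right)
    finally show ?thesis .
  qed
  have zi: "(\<Sum>m\<in>UNIV. christoffel g x m l i * T x k m j)
      = (\<Sum>c\<in>UNIV. th k x $ c * (Z l i x \<bullet> (B c x *v th j x)))"
  proof -
    have "(\<Sum>m\<in>UNIV. christoffel g x m l i * T x k m j)
        = (\<Sum>c\<in>UNIV. \<Sum>m\<in>UNIV. christoffel g x m l i * (th k x $ c * (th m x \<bullet> (B c x *v th j x))))"
      by (subst sum.swap) (simp add: T[OF x] sum_distrib_left)
    then show ?thesis
      by (simp add: mult.left_commute christoffel_inner[OF x] flip: sum_distrib_left)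
  qed
  have zj: "(\<Sum>m\<in>UNIV. christoffel g x m l j * T x k i m)
      = (\<Sum>c\<in>UNIV. th k x $ c * (th i x \<bullet> (B c x *v Z l j x)))"
  proof -
    have "(\<Sum>m\<in>UNIV. christoffel g x m l j * T x k i m)
        = (\<Sum>c\<in>UNIV. \<Sum>m\<in>UNIV. christoffel g x m l j * (th k x $ c * (th i x \<bullet> (B c x *v th m x))))"
      by (subst sum.swap) (simp add: T[OF x] sum_distrib_left)
    then show ?thesis
      by (simp add: mult.left_commute christoffel_inner'[OF x] flip: sum_distrib_left)
  qed
  \<comment> \<open>Shifts the connection from the vector in the first slot to the index of the
    family.\<close>
  have sw: "(\<Sum>c\<in>UNIV. (W l x *v th k x) $ c * (th i x \<bullet> (B c x *v th j x)))
      = (\<Sum>c\<in>UNIV. th k x $ c * (th i x \<bullet> ((\<Sum>d\<in>UNIV. W l x $ d $ c *\<^sub>R B d x) *v th j x)))"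
  proof -
    have "(\<Sum>c\<in>UNIV. (W l x *v th k x) $ c * (th i x \<bullet> (B c x *v th j x)))
        = (\<Sum>c\<in>UNIV. \<Sum>d\<in>UNIV. W l x $ c $ d * th k x $ d * (th i x \<bullet> (B c x *v th j x)))"
      by (simp add: matrix_vector_mult_def[of "W l x"] sum_distrib_right)
    also have "\<dots> = (\<Sum>d\<in>UNIV. \<Sum>c\<in>UNIV. W l x $ c $ d * th k x $ d * (th i x \<bullet> (B c x *v th j x)))"
      by (rule sum.swap)
    also have "\<dots> = (\<Sum>c\<in>UNIV. th k x $ c * (th i x \<bullet> ((\<Sum>d\<in>UNIV. W l x $ d $ c *\<^sub>R B d x) *v th j x)))"
      by (simp add: bounded_bilinear.sum_left[OF bounded_bilinear_matrix_vector_mult] inner_sum_right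
          sum_distrib_left mult_ac flip: scaleR_matrix_vector_assoc)
    finally show ?thesis .
  qed
  have e: "th i x \<bullet> ((pdv l (B c) x - D - transpose (W l x) ** B c x - B c x ** W l x) *v th j x)
      = th i x \<bullet> (pdv l (B c) x *v th j x) - th i x \<bullet> (D *v th j x)
        - (W l x *v th i x) \<bullet> (B c x *v th j x) - th i x \<bullet> (B c x *v (W l x *v th j x))" for c D
    by (simp add: inner_diff_right matrix_vector_mult_diff_rdistrib dot_vector_matrix_mult
        inner_commute[of "W l x *v th i x"]
        flip: matrix_vector_mul_assoc)
  show ?thesis
    unfolding cov3_def sum.distrib 1 zk zi zj e Z_def
    using sw
    by (simp add: algebra_simps sum.distrib sum_subtractf matrix_vector_right_distrib inner_add_right
        inner_add_left)
qed

text \<open>The curvature form dW + W wedge W on the i-th and j-th coordinate fields.\<close>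

definition Om :: "'n \<Rightarrow> 'n \<Rightarrow> real^'n \<Rightarrow> real^'n^'n" where
  "Om i j x = pdv i (W j) x - pdv j (W i) x + W i x ** W j x - W j x ** W i x"

text \<open>Cartan's structure equation. Antisymmetrising the second covariant derivative of the
  k-th coordinate field removes the mixed partials of the coframe and the terms with one derivative
  of it.\<close>

lemma riemann_frame:
  assumes x: "x \<in> U"
  shows "(\<Sum>l\<in>UNIV. riemann g x l k i j *\<^sub>R th l x) = Om i j x *v th k x"
proof -
  \<comment> \<open>Both sides are the frame components of the iterated covariant derivative of the
    k-th coordinate field, along j first and then along i.\<close>
  have half: "(\<Sum>l\<in>UNIV. (pd i (\<lambda>y. christoffel g y l j k) x
      + (\<Sum>m\<in>UNIV. christoffel g x l i m * christoffel g x m j k)) *\<^sub>R th l x)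
    = pdv i (pdv j (th k)) x + pdv i (W j) x *v th k x + W j x *v pdv i (th k) x
      + W i x *v pdv j (th k) x + (W i x ** W j x) *v th k x" for i j
  proof -
    note dG = christoffel_differentiable[OF x]
    note dt = th_diff[OF x]
    have dZ: "Z j k differentiable (at x)"
      unfolding Z_def
      by (intro differentiable_add diff_mv dt W_diff[OF x] smooth_on_differentiable[OF smooth_on_pdv[OF smooth_th] x])
    have "pdv i (Z j k) x = pdv i (\<lambda>y. \<Sum>l\<in>UNIV. christoffel g y l j k *\<^sub>R th l y) x"
      by (rule pdv_cong_open[OF open_U x _ dZ]) (simp add: christoffel_frame)
    also have "\<dots> = (\<Sum>l\<in>UNIV. christoffel g x l j k *\<^sub>R pdv i (th l) x + pd i (\<lambda>y. christoffel g y l j k) x *\<^sub>R th l x)"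
      by (simp add: pdv_sum diff_scaleR[OF dG dt] pdv_scaleR[OF dG dt] pd_eq_pdv)
    finally have 1: "pdv i (Z j k) x = \<dots>" .
    have "pdv i (Z j k) x = pdv i (pdv j (th k)) x + (pdv i (W j) x *v th k x + W j x *v pdv i (th k) x)"
      unfolding Z_def
      by (simp add: pdv_add pdv_mv[OF W_diff[OF x] dt] diff_mv[OF W_diff[OF x] dt] add.commute
          smooth_on_differentiable[OF smooth_on_pdv[OF smooth_th] x])
    note 2 = this[unfolded 1]
    have "(\<Sum>l\<in>UNIV. (\<Sum>m\<in>UNIV. christoffel g x l i m * christoffel g x m j k) *\<^sub>R th l x)
      = (\<Sum>l\<in>UNIV. \<Sum>m\<in>UNIV. christoffel g x m j k *\<^sub>R (christoffel g x l i m *\<^sub>R th l x))"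
      by (simp add: scaleR_sum_left mult.commute)
    also have "\<dots> = (\<Sum>m\<in>UNIV. \<Sum>l\<in>UNIV. christoffel g x m j k *\<^sub>R (christoffel g x l i m *\<^sub>R th l x))"
      by (rule sum.swap)
    also have "\<dots> = (\<Sum>m\<in>UNIV. christoffel g x m j k *\<^sub>R Z i m x)"
      by (simp add: scaleR_sum_right flip: christoffel_frame[OF x])
    also have "\<dots> = (\<Sum>m\<in>UNIV. christoffel g x m j k *\<^sub>R pdv i (th m) x)
        + W i x *v (\<Sum>m\<in>UNIV. christoffel g x m j k *\<^sub>R th m x)"
      by (simp add: Z_def scaleR_add_right sum.distrib matrix_vector_mult_scaleR
          bounded_bilinear.sum_right[OF bounded_bilinear_matrix_vector_mult])
    also have "W i x *v (\<Sum>m\<in>UNIV. christoffel g x m j k *\<^sub>R th m x)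
        = W i x *v pdv j (th k) x + (W i x ** W j x) *v th k x"
      by (simp add: christoffel_frame[OF x] Z_def matrix_vector_right_distrib matrix_vector_mul_assoc)
    finally have 3: "(\<Sum>l\<in>UNIV. (\<Sum>m\<in>UNIV. christoffel g x l i m * christoffel g x m j k) *\<^sub>R th l x)
      = (\<Sum>m\<in>UNIV. christoffel g x m j k *\<^sub>R pdv i (th m) x)
        + (W i x *v pdv j (th k) x + (W i x ** W j x) *v th k x)" .
    have 4: "(\<Sum>l\<in>UNIV. pd i (\<lambda>y. christoffel g y l j k) x *\<^sub>R th l x)
      = pdv i (pdv j (th k)) x + (pdv i (W j) x *v th k x + W j x *v pdv i (th k) x)
        - (\<Sum>l\<in>UNIV. christoffel g x l j k *\<^sub>R pdv i (th l) x)"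
      using 2 by (simp add: sum.distrib eq_diff_eq add.commute)
    show ?thesis
      unfolding scaleR_add_left sum.distrib 3 4 by simp
  qed
  have "(\<Sum>l\<in>UNIV. riemann g x l k i j *\<^sub>R th l x)
      = (\<Sum>l\<in>UNIV. (pd i (\<lambda>y. christoffel g y l j k) x
          + (\<Sum>m\<in>UNIV. christoffel g x l i m * christoffel g x m j k)) *\<^sub>R th l x)
        - (\<Sum>l\<in>UNIV. (pd j (\<lambda>y. christoffel g y l i k) x
          + (\<Sum>m\<in>UNIV. christoffel g x l j m * christoffel g x m i k)) *\<^sub>R th l x)"
    unfolding sum_subtractf[symmetric] scaleR_diff_left[symmetric]
    by (simp add: riemann_def sum_subtractf diff_diff_eq diff_add_eq add_diff_eq)
  also have "\<dots> = Om i j x *v th k x"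
    unfolding half Om_def
    using pdv_commute[OF open_U smooth_th x, of i j k]
    by (simp add: algebra_simps matrix_vector_mult_diff_rdistrib matrix_vector_mult_add_rdistrib)
  finally show ?thesis .
qed

text \<open>A trace can be taken in any basis: \<open>c\<close> gives coordinates in the basis of
  coordinate fields and is exchanged for frame components. The hypothesis on N says that curvature
  is linear in the frame components of its first argument.\<close>

lemma ricci_frame:
  assumes x: "x \<in> U" and N: "\<And>i. Om i j x = (\<Sum>a\<in>UNIV. th i x $ a *\<^sub>R N a)"
  shows "ricci g x j k = (\<Sum>a\<in>UNIV. (N a *v th k x) $ a)"
proof -
  define c where "c z = matrix_inv (Th x) *v z" for z
  have T: "invertible (Th x)" by (rule Th_invertible[OF x])
  have c: "(\<Sum>i\<in>UNIV. c z $ i *\<^sub>R th i x) = z" for z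
    by (simp add: c_def flip: Th_mult) (simp add: matrix_vector_mul_assoc matrix_inv_right[OF T])
  have c': "c (\<Sum>i\<in>UNIV. v i *\<^sub>R th i x) $ l = v l" for v :: "'n \<Rightarrow> real" and l
  proof -
    have "(\<Sum>i\<in>UNIV. v i *\<^sub>R th i x) = Th x *v (\<chi> i. v i)" by (simp add: Th_mult)
    then show ?thesis by (simp add: c_def matrix_vector_mul_assoc matrix_inv_left[OF T])
  qed
  have lin: "linear c" unfolding c_def by (rule matrix_vector_mul_linear)
  have "riemann g x l k i j = c (Om i j x *v th k x) $ l" for l i
    by (simp add: c' flip: riemann_frame[OF x])
  then have "ricci g x j k = (\<Sum>i\<in>UNIV. c (\<Sum>a\<in>UNIV. th i x $ a *\<^sub>R (N a *v th k x)) $ i)"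
    by (simp add: ricci_def N bounded_bilinear.sum_left[OF bounded_bilinear_matrix_vector_mult]
        scaleR_matrix_vector_assoc)
  also have "\<dots> = (\<Sum>i\<in>UNIV. \<Sum>a\<in>UNIV. th i x $ a * c (N a *v th k x) $ i)"
    by (simp add: linear_sum[OF lin] linear_cmul[OF lin] sum_component)
  also have "\<dots> = (\<Sum>a\<in>UNIV. \<Sum>i\<in>UNIV. th i x $ a * c (N a *v th k x) $ i)"
    by (rule sum.swap)
  also have "\<dots> = (\<Sum>a\<in>UNIV. (\<Sum>i\<in>UNIV. c (N a *v th k x) $ i *\<^sub>R th i x) $ a)"
    by (simp add: sum_component mult.commute)
  finally show ?thesis by (simp add: c)
qed

lemma curvature_action_frame:
  assumes x: "x \<in> U" and N: "\<And>i. Om i j x = (\<Sum>a\<in>UNIV. th i x $ a *\<^sub>R N a)"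
    and h: "\<And>i j. h x i j = th i x \<bullet> (B *v th j x)"
  shows "curvature_action g h x j k =
    (\<Sum>a\<in>UNIV. \<Sum>b\<in>UNIV. matrix_inv G $ a $ b * ((N a *v th k x) \<bullet> (B *v axis b 1)))"
proof -
  define Q :: "real^'n^'n" where "Q = (\<chi> a b. ((N a *v th k x) v* B) $ b)"
  have Q: "u \<bullet> (Q *v v) = (\<Sum>a\<in>UNIV. u $ a * ((N a *v th k x) \<bullet> (B *v v)))" for u v
  proof -
    have "(Q *v v) $ a = (N a *v th k x) \<bullet> (B *v v)" for a
      unfolding dot_lmul_matrix[symmetric]
      by (simp add: Q_def matrix_vector_mult_def[of "vec_lambda _"] inner_vec_def)
    then show ?thesis by (simp add: inner_vec_def)
  qed
  have "(\<Sum>m\<in>UNIV. riemann g x m k i j * h x m l) = th i x \<bullet> (Q *v th l x)" for i l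
  proof -
    have "(\<Sum>m\<in>UNIV. riemann g x m k i j * h x m l) = (Om i j x *v th k x) \<bullet> (B *v th l x)"
      by (simp add: h inner_sum_left flip: riemann_frame[OF x])
    also have "\<dots> = th i x \<bullet> (Q *v th l x)"
      by (simp add: Q N bounded_bilinear.sum_left[OF bounded_bilinear_matrix_vector_mult] inner_sum_left
          flip: scaleR_matrix_vector_assoc)
    finally show ?thesis .
  qed
  then have "curvature_action g h x j k = (\<Sum>i\<in>UNIV. \<Sum>l\<in>UNIV. ginv g x i l * (th i x \<bullet> (Q *v th l x)))"
    by (simp add: curvature_action_def mult.assoc flip: sum_distrib_left)
  moreover have "Q $ a $ b = (N a *v th k x) \<bullet> (B *v axis b 1)" for a b
    unfolding dot_lmul_matrix[symmetric] by (simp add: Q_def inner_axis)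
  ultimately show ?thesis by (simp add: ginv_contract[OF x])
qed

lemma trace2_frame:
  assumes "x \<in> U" "\<And>i j. h x i j = th i x \<bullet> (B *v th j x)"
  shows "trace2 g h x = (\<Sum>a\<in>UNIV. \<Sum>b\<in>UNIV. matrix_inv G $ a $ b * B $ a $ b)"
  by (simp add: trace2_def assms(2) ginv_contract[OF assms(1)])

lemma divergence2_frame:
  assumes "x \<in> U"
    and "\<And>k i. cov2 g h x k i j = (\<Sum>c\<in>UNIV. th k x $ c * (th i x \<bullet> (T c *v th j x)))"
  shows "divergence2 g h x j = - (\<Sum>a\<in>UNIV. \<Sum>b\<in>UNIV. matrix_inv G $ a $ b * (T a *v th j x) $ b)"
proof -
  define N :: "real^'n^'n" where "N = (\<chi> c a. (T c *v th j x) $ a)"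
  have "cov2 g h x k i j = th k x \<bullet> (N *v th i x)" for k i
    by (simp add: assms(2) N_def matrix_vector_mult_def[of "vec_lambda _"] inner_vec_def[of "th k x"]
        inner_vec_def[of "th i x"] mult.commute)
  then show ?thesis by (simp add: divergence2_def ginv_contract[OF assms(1)] N_def)
qed

lemma rough_laplacian_frame:
  assumes "x \<in> U"
    and "\<And>l k. cov3 g (cov2 g h) x l k i j
      = (\<Sum>d\<in>UNIV. \<Sum>c\<in>UNIV. th l x $ d * th k x $ c * (th i x \<bullet> (T d c *v th j x)))"
  shows "rough_laplacian g h x i j
    = - (\<Sum>a\<in>UNIV. \<Sum>b\<in>UNIV. matrix_inv G $ a $ b * (th i x \<bullet> (T a b *v th j x)))"
proof -
  define N :: "real^'n^'n" where "N = (\<chi> d c. th i x \<bullet> (T d c *v th j x))"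
  have "cov3 g (cov2 g h) x l k i j = th l x \<bullet> (N *v th k x)" for l k
    by (simp add: assms(2) N_def dot_matrix_vector_mult[of "th l x"] mult_ac)
  then show ?thesis by (simp add: rough_laplacian_def ginv_contract[OF assms(1)] N_def)
qed

text \<open>One pair of indices is contracted at a time; the first contraction leaves the form N, to
  which \<open>ginv_contract\<close> applies again.\<close>

lemma inner2_frame:
  assumes x: "x \<in> U" and h: "\<And>i j. h x i j = th i x \<bullet> (B *v th j x)"
    and k: "\<And>i j. k x i j = th i x \<bullet> (C *v th j x)"
  shows "inner2 g h k x = (\<Sum>a\<in>UNIV. \<Sum>b\<in>UNIV. matrix_inv G $ a $ b
    * (\<Sum>c\<in>UNIV. \<Sum>d\<in>UNIV. matrix_inv G $ c $ d * B $ a $ c * C $ b $ d))"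
proof -
  define N :: "real^'n^'n" where
    "N = (\<chi> a b. \<Sum>c\<in>UNIV. \<Sum>d\<in>UNIV. matrix_inv G $ c $ d * B $ a $ c * C $ b $ d)"
  have 1: "(\<Sum>j\<in>UNIV. \<Sum>b\<in>UNIV. ginv g x j b * ((th i x \<bullet> (B *v th j x)) * (th a x \<bullet> (C *v th b x))))
      = th i x \<bullet> (N *v th a x)" for i a
  proof -
    define P :: "real^'n^'n" where
      "P = (\<chi> c d. (th i x v* B) $ c * (th a x v* C) $ d)"
    have "(th i x \<bullet> (B *v u)) * (th a x \<bullet> (C *v v)) = u \<bullet> (P *v v)" for u v
    proof -
      have "(th i x \<bullet> (B *v u)) * (th a x \<bullet> (C *v v))
          = (\<Sum>c\<in>UNIV. (th i x v* B) $ c * u $ c) * (\<Sum>d\<in>UNIV. (th a x v* C) $ d * v $ d)"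
        unfolding dot_lmul_matrix[symmetric] by (simp add: inner_vec_def)
      also have "\<dots> = u \<bullet> (P *v v)"
        by (simp add: dot_matrix_vector_mult P_def sum_product mult_ac)
      finally show ?thesis .
    qed
    then have "(\<Sum>j\<in>UNIV. \<Sum>b\<in>UNIV. ginv g x j b * ((th i x \<bullet> (B *v th j x)) * (th a x \<bullet> (C *v th b x))))
      = (\<Sum>c\<in>UNIV. \<Sum>d\<in>UNIV. matrix_inv G $ c $ d * P $ c $ d)"
      by (simp add: ginv_contract[OF x])
    also have "\<dots> = (\<Sum>c\<in>UNIV. \<Sum>d\<in>UNIV. \<Sum>p\<in>UNIV. \<Sum>q\<in>UNIV. matrix_inv G $ c $ d * (th i x $ p * B $ p $ c) * (th a x $ q * C $ q $ d))"
    proof -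
      have "P $ c $ d = (\<Sum>p\<in>UNIV. \<Sum>q\<in>UNIV. (th i x $ p * B $ p $ c) * (th a x $ q * C $ q $ d))" for c d
        by (simp add: P_def vector_matrix_mult_def sum_product)
      then show ?thesis by (simp add: sum_distrib_left mult.assoc)
    qed
    also have "\<dots> = (\<Sum>p\<in>UNIV. \<Sum>q\<in>UNIV. \<Sum>c\<in>UNIV. \<Sum>d\<in>UNIV. matrix_inv G $ c $ d * (th i x $ p * B $ p $ c) * (th a x $ q * C $ q $ d))"
      by (rule sum_swap4)
    also have "\<dots> = th i x \<bullet> (N *v th a x)"
      by (simp add: dot_matrix_vector_mult N_def sum_distrib_left sum_distrib_right mult_ac)
    finally show ?thesis .
  qed
  have "inner2 g h k x = (\<Sum>i\<in>UNIV. \<Sum>a\<in>UNIV. ginv g x i a *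
     (\<Sum>j\<in>UNIV. \<Sum>b\<in>UNIV. ginv g x j b * ((th i x \<bullet> (B *v th j x)) * (th a x \<bullet> (C *v th b x)))))"
    unfolding inner2_def h k
  proof (rule sum.cong[OF refl])
    fix i
    show "(\<Sum>j\<in>UNIV. \<Sum>a\<in>UNIV. \<Sum>b\<in>UNIV. ginv g x i a * ginv g x j b
        * (th i x \<bullet> (B *v th j x)) * (th a x \<bullet> (C *v th b x)))
      = (\<Sum>a\<in>UNIV. ginv g x i a * (\<Sum>j\<in>UNIV. \<Sum>b\<in>UNIV. ginv g x j b
        * ((th i x \<bullet> (B *v th j x)) * (th a x \<bullet> (C *v th b x)))))"
      by (subst sum.swap) (simp add: sum_distrib_left mult_ac)
  qed
  also have "\<dots> = (\<Sum>i\<in>UNIV. \<Sum>a\<in>UNIV. ginv g x i a * (th i x \<bullet> (N *v th a x)))"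
    by (simp only: 1)
  finally show ?thesis by (simp add: ginv_contract[OF x] N_def)
qed

end

section \<open>Integer tables for the Berger space\<close>

text \<open>Square integer matrices are lists of rows; \<open>code_simp\<close> evaluates identities between them.\<close>

fun rowmul :: "nat \<Rightarrow> int list \<Rightarrow> int list list \<Rightarrow> int list" where
  "rowmul n (x # xs) (b # B) =
    (if x = 0 then rowmul n xs B else map2 (\<lambda>p q. x * p + q) b (rowmul n xs B))"
| "rowmul n _ _ = replicate n 0"

definition mmul :: "nat \<Rightarrow> int list list \<Rightarrow> int list list \<Rightarrow> int list list" where
  "mmul n A B = map (\<lambda>r. rowmul n r B) A"

definition madd :: "int list list \<Rightarrow> int list list \<Rightarrow> int list list" where
  "madd A B = map2 (map2 (+)) A B"

definition mscale :: "int \<Rightarrow> int list list \<Rightarrow> int list list" where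
  "mscale k A = map (map ((*) k)) A"

definition mtrans :: "nat \<Rightarrow> int list list \<Rightarrow> int list list" where
  "mtrans n A = map (\<lambda>i. map (\<lambda>r. r ! i) A) [0..<n]"

text \<open>Like \<open>rowmul\<close>, it skips zero coefficients: the tables are sparse and are
  evaluated by rewriting.\<close>

fun mlin :: "nat \<Rightarrow> int list \<Rightarrow> int list list list \<Rightarrow> int list list" where
  "mlin n (c # cs) (M # Ms) = (if c = 0 then mlin n cs Ms else madd (mscale c M) (mlin n cs Ms))"
| "mlin n _ _ = replicate n (replicate n 0)"

definition mcomm :: "nat \<Rightarrow> int list list \<Rightarrow> int list list \<Rightarrow> int list list" where
  "mcomm n A B = madd (mmul n A B) (mscale (-1) (mmul n B A))"

definition mzero :: "int list list \<Rightarrow> bool" where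
  "mzero A = list_all (list_all (\<lambda>x. x = 0)) A"

definition square :: "nat \<Rightarrow> int list list \<Rightarrow> bool" where
  "square n A \<longleftrightarrow> length A = n \<and> (\<forall>r\<in>set A. length r = n)"

lemma square_code: "square n A \<longleftrightarrow> length A = n \<and> list_all (\<lambda>r. length r = n) A"
  by (simp add: square_def list_all_iff)

lemma square_nth: "square n A \<Longrightarrow> i < n \<Longrightarrow> length (A ! i) = n"
  by (simp add: square_def)

lemma length_rowmul:
  "(\<And>b. b \<in> set B \<Longrightarrow> length b = n) \<Longrightarrow> length (rowmul n r B) = n"
  by (induction n r B rule: rowmul.induct) simp_all

lemma rowmul_nth:
  "(\<And>b. b \<in> set B \<Longrightarrow> length b = n) \<Longrightarrow> length r = length B \<Longrightarrow> j < n
    \<Longrightarrow> rowmul n r B ! j = (\<Sum>k<length r. r ! k * B ! k ! j)"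
  by (induction n r B rule: rowmul.induct) (simp_all add: sum.lessThan_Suc_shift length_rowmul del: sum.lessThan_Suc)

lemma square_mmul: "square n A \<Longrightarrow> square n B \<Longrightarrow> square n (mmul n A B)"
  by (auto simp: square_def mmul_def length_rowmul)

lemma square_madd: "square n A \<Longrightarrow> square n B \<Longrightarrow> square n (madd A B)"
  by (auto simp: square_def madd_def set_zip)

lemma square_mscale: "square n A \<Longrightarrow> square n (mscale k A)"
  by (auto simp: square_def mscale_def)

lemma square_mtrans: "square n A \<Longrightarrow> square n (mtrans n A)"
  by (auto simp: square_def mtrans_def)

lemma square_mlin: "(\<And>M. M \<in> set Ms \<Longrightarrow> square n M) \<Longrightarrow> square n (mlin n cs Ms)"
  by (induction n cs Ms rule: mlin.induct)
     (auto intro!: square_madd square_mscale, auto simp: square_def)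

lemma square_mcomm: "square n A \<Longrightarrow> square n B \<Longrightarrow> square n (mcomm n A B)"
  by (simp add: mcomm_def square_madd square_mmul square_mscale)

text \<open>Here f enumerates the index type by 0, ..., n - 1. The lemmas that follow make this a
  homomorphism, so identities between tables become identities between real matrices.\<close>

definition lmat :: "('n \<Rightarrow> nat) \<Rightarrow> int list list \<Rightarrow> real^'n^'n" where
  "lmat f A = (\<chi> i j. of_int (A ! f i ! f j))"

lemma sum_index:
  "bij_betw f UNIV {..<n} \<Longrightarrow> (\<Sum>i\<in>UNIV. g (f i)) = (\<Sum>k<n. g k)"
  by (rule sum.reindex_bij_betw)

lemma index_less: "bij_betw f UNIV {..<n} \<Longrightarrow> f i < n"
  using bij_betwE by blast

lemma sum_list_upt: "sum_list (map f [0..<n]) = (\<Sum>k<n. f k)"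
  by (simp add: interv_sum_list_conv_sum_set_nat atLeast0LessThan)

context
  fixes f :: "'n::finite \<Rightarrow> nat" and n :: nat
  assumes f: "bij_betw f UNIV {..<n}"
begin

lemma lmat_mmul:
  assumes "square n A" "square n B"
  shows "lmat f (mmul n A B) = lmat f A ** lmat f B"
proof -
  have "mmul n A B ! f i ! f j = (\<Sum>k\<in>UNIV. A ! f i ! f k * B ! f k ! f j)" for i j
  proof -
    have "mmul n A B ! f i ! f j = (\<Sum>k<n. A ! f i ! k * B ! k ! f j)"
      using assms index_less[OF f] square_nth[OF assms(1), of "f i"]
      by (simp add: mmul_def rowmul_nth square_def)
    also have "\<dots> = (\<Sum>k\<in>UNIV. A ! f i ! f k * B ! f k ! f j)"
      by (rule sum_index[OF f, symmetric])
    finally show ?thesis .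
  qed
  then show ?thesis by (simp add: lmat_def matrix_matrix_mult_def vec_eq_iff)
qed

lemma lmat_madd:
  "square n A \<Longrightarrow> square n B \<Longrightarrow> lmat f (madd A B) = lmat f A + lmat f B"
  using index_less[OF f] by (simp add: lmat_def vec_eq_iff madd_def square_def)

lemma lmat_mscale: "square n A \<Longrightarrow> lmat f (mscale k A) = of_int k *\<^sub>R lmat f A"
  using index_less[OF f] by (simp add: lmat_def vec_eq_iff mscale_def square_def)

lemma lmat_mtrans: "square n A \<Longrightarrow> lmat f (mtrans n A) = transpose (lmat f A)"
  using index_less[OF f] by (simp add: lmat_def vec_eq_iff mtrans_def square_def transpose_def)

lemma lmat_mlin:
  "length cs = length Ms \<Longrightarrow> (\<And>M. M \<in> set Ms \<Longrightarrow> square n M)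
    \<Longrightarrow> lmat f (mlin n cs Ms) = (\<Sum>k<length cs. of_int (cs ! k) *\<^sub>R lmat f (Ms ! k))"
proof (induction n\<equiv>n cs Ms rule: mlin.induct)
  case (1 c cs M Ms)
  then show ?case
    by (simp add: lmat_madd lmat_mscale square_mscale square_mlin sum.lessThan_Suc_shift
        del: sum.lessThan_Suc)
qed (use index_less[OF f] in \<open>simp_all add: lmat_def vec_eq_iff\<close>)

lemma lmat_mcomm:
  "square n A \<Longrightarrow> square n B
    \<Longrightarrow> lmat f (mcomm n A B) = lmat f A ** lmat f B - lmat f B ** lmat f A"
  by (simp add: mcomm_def lmat_madd lmat_mscale lmat_mmul square_mmul square_mscale)

lemma lmat_mzero:
  assumes "square n A" "mzero A"
  shows "lmat f A = 0"
proof -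
  have "A ! f i ! f j = 0" for i j
    using assms index_less[OF f] by (simp add: square_def mzero_def list_all_length)
  then show ?thesis by (simp add: lmat_def vec_eq_iff)
qed

end

text \<open>\<open>basis_mats\<close> is a basis of \<open>so(5)\<close> adapted to the splitting into \<open>m\<close> (the first seven) and
  \<open>so(3)\<close> (the last three), orthogonal with squared norms \<open>basis_norms\<close>.  The matrices refer to the
  coordinates of \<open>\<real>\<^sup>5\<close> in which the second one is divided by \<open>sqrt 3\<close>; this makes them integral.
  Further scalings make all other tables integral: \<open>struct_consts\<close> is 10 times the structure constants,
  \<open>conn_mats\<close> is 20 times the Levi-Civita connection, \<open>curv_mat\<close> is 400 times the curvature,
  \<open>nabla_mat\<close> and \<open>nabla2_mat\<close> are 20 and 400 times the first and second covariant derivatives of the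
  tensors \<open>iota_mats\<close>, and \<open>jordan_mats\<close> is 3 times the multiplication \<open>(S, T) \<mapsto> ST + TS\<close>, up to
  its trace, on traceless symmetric matrices.\<close>

definition basis_mats :: "int list list list" where
  "basis_mats = [[[0, 0, 1, 0, 0], [0, 0, 0, 0, 0], [-1, 0, 0, 0, 0], [0, 0, 0, 0, -2], [0, 0, 0, 2, 0]],
    [[0, 0, 0, 0, 1], [0, 0, 0, 0, 0], [0, 0, 0, 1, 0], [0, 0, -1, 0, 0], [-1, 0, 0, 0, 0]],
    [[0, 0, 0, 0, 3], [0, 0, 0, 0, -2], [0, 0, 0, -3, 0], [0, 0, 3, 0, 0], [-3, 6, 0, 0, 0]],
    [[0, 0, 0, 1, 0], [0, 0, 0, 0, 0], [0, 0, 0, 0, -1], [-1, 0, 0, 0, 0], [0, 0, 1, 0, 0]],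
    [[0, 0, 0, 3, 0], [0, 0, 0, 2, 0], [0, 0, 0, 0, 3], [-3, -6, 0, 0, 0], [0, 0, -3, 0, 0]],
    [[0, 3, 0, 0, 0], [-1, 0, 0, 0, 0], [0, 0, 0, 0, 0], [0, 0, 0, 0, 0], [0, 0, 0, 0, 0]],
    [[0, 0, 0, 0, 0], [0, 0, 1, 0, 0], [0, -3, 0, 0, 0], [0, 0, 0, 0, 0], [0, 0, 0, 0, 0]],
    [[0, 0, 0, 0, 1], [0, 0, 0, 0, 1], [0, 0, 0, -1, 0], [0, 0, 1, 0, 0], [-1, -3, 0, 0, 0]],
    [[0, 0, 0, 1, 0], [0, 0, 0, -1, 0], [0, 0, 0, 0, 1], [-1, 3, 0, 0, 0], [0, 0, -1, 0, 0]],
    [[0, 0, -2, 0, 0], [0, 0, 0, 0, 0], [2, 0, 0, 0, 0], [0, 0, 0, 0, -1], [0, 0, 0, 1, 0]]]"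

text \<open>Squares for the inner product -tr(X Y) / 2, half of the entrywise one; confirmed by
  \<open>orthogonal_check\<close>.\<close>

definition basis_norms :: "int list" where "basis_norms = [5, 2, 30, 2, 30, 3, 3, 5, 5, 5]"

text \<open>30 / n for the first seven norms n. Their least common multiple 30 keeps contractions
  with the inverse metric integral.\<close>

definition inv_norms :: "int list" where "inv_norms = [6, 15, 1, 15, 1, 10, 10]"

definition struct_consts :: "int list list list" where
  "struct_consts = [[[0, 0, 0, 0, 0, 0, 0, 0, 0, 0], [0, 0, 0, -10, 0, 0, 0, 0, 0, 0],
    [0, 0, 0, 0, -10, 0, 0, 0, -60, 0], [0, 10, 0, 0, 0, 0, 0, 0, 0, 0],
    [0, 0, 10, 0, 0, 0, 0, 60, 0, 0], [0, 0, 0, 0, 0, 0, 10, 0, 0, 0],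
    [0, 0, 0, 0, 0, -10, 0, 0, 0, 0], [0, 0, 0, 0, -10, 0, 0, 0, 0, 0],
    [0, 0, 10, 0, 0, 0, 0, 0, 0, 0], [0, 0, 0, 0, 0, 0, 0, 0, 0, 0]],
    [[0, 0, 0, 10, 0, 0, 0, 0, 0, 0], [0, 0, 0, 0, 0, 0, 0, 0, 0, 0],
    [0, 0, 0, 0, 0, 20, 0, 0, 0, 0], [-4, 0, 0, 0, 0, 0, 0, 0, 0, -12],
    [0, 0, 0, 0, 0, 0, 20, 0, 0, 0], [0, 0, -2, 0, 0, 0, 0, 6, 0, 0],
    [0, 0, 0, 0, -2, 0, 0, 0, 6, 0], [0, 0, 0, 0, 0, -10, 0, 0, 0, 0],
    [0, 0, 0, 0, 0, 0, -10, 0, 0, 0], [0, 0, 0, 30, 0, 0, 0, 0, 0, 0]],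
    [[0, 0, 0, 0, 10, 0, 0, 0, 60, 0], [0, 0, 0, 0, 0, -20, 0, 0, 0, 0],
    [0, 0, 0, 0, 0, 0, 0, 0, 0, 0], [0, 0, 0, 0, 0, 0, -20, 0, 0, 0],
    [-60, 0, 0, 0, 0, 0, 0, 0, 0, 60], [0, 30, 0, 0, 0, 0, 0, 30, 0, 0],
    [0, 0, 0, 30, 0, 0, 0, 0, -30, 0], [0, 0, 0, 0, 0, -50, 0, 0, 0, 0],
    [-60, 0, 0, 0, 0, 0, 50, 0, 0, 0], [0, 0, 0, 0, -10, 0, 0, 0, 0, 0]],
    [[0, -10, 0, 0, 0, 0, 0, 0, 0, 0], [4, 0, 0, 0, 0, 0, 0, 0, 0, 12],
    [0, 0, 0, 0, 0, 0, 20, 0, 0, 0], [0, 0, 0, 0, 0, 0, 0, 0, 0, 0],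
    [0, 0, 0, 0, 0, -20, 0, 0, 0, 0], [0, 0, 0, 0, 2, 0, 0, 0, -6, 0],
    [0, 0, -2, 0, 0, 0, 0, 6, 0, 0], [0, 0, 0, 0, 0, 0, -10, 0, 0, 0],
    [0, 0, 0, 0, 0, 10, 0, 0, 0, 0], [0, -30, 0, 0, 0, 0, 0, 0, 0, 0]],
    [[0, 0, -10, 0, 0, 0, 0, -60, 0, 0], [0, 0, 0, 0, 0, 0, -20, 0, 0, 0],
    [60, 0, 0, 0, 0, 0, 0, 0, 0, -60], [0, 0, 0, 0, 0, 20, 0, 0, 0, 0],
    [0, 0, 0, 0, 0, 0, 0, 0, 0, 0], [0, 0, 0, -30, 0, 0, 0, 0, -30, 0],
    [0, 30, 0, 0, 0, 0, 0, -30, 0, 0], [60, 0, 0, 0, 0, 0, 50, 0, 0, 0],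
    [0, 0, 0, 0, 0, 50, 0, 0, 0, 0], [0, 0, 10, 0, 0, 0, 0, 0, 0, 0]],
    [[0, 0, 0, 0, 0, 0, -10, 0, 0, 0], [0, 0, 2, 0, 0, 0, 0, -6, 0, 0],
    [0, -30, 0, 0, 0, 0, 0, -30, 0, 0], [0, 0, 0, 0, -2, 0, 0, 0, 6, 0],
    [0, 0, 0, 30, 0, 0, 0, 0, 30, 0], [0, 0, 0, 0, 0, 0, 0, 0, 0, 0],
    [6, 0, 0, 0, 0, 0, 0, 0, 0, -12], [0, 15, 5, 0, 0, 0, 0, 0, 0, 0],
    [0, 0, 0, -15, -5, 0, 0, 0, 0, 0], [0, 0, 0, 0, 0, 0, 20, 0, 0, 0]],
    [[0, 0, 0, 0, 0, 10, 0, 0, 0, 0], [0, 0, 0, 0, 2, 0, 0, 0, -6, 0],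
    [0, 0, 0, -30, 0, 0, 0, 0, 30, 0], [0, 0, 2, 0, 0, 0, 0, -6, 0, 0],
    [0, -30, 0, 0, 0, 0, 0, 30, 0, 0], [-6, 0, 0, 0, 0, 0, 0, 0, 0, 12],
    [0, 0, 0, 0, 0, 0, 0, 0, 0, 0], [0, 0, 0, 15, -5, 0, 0, 0, 0, 0],
    [0, 15, -5, 0, 0, 0, 0, 0, 0, 0], [0, 0, 0, 0, 0, -20, 0, 0, 0, 0]],
    [[0, 0, 0, 0, 10, 0, 0, 0, 0, 0], [0, 0, 0, 0, 0, 10, 0, 0, 0, 0],
    [0, 0, 0, 0, 0, 50, 0, 0, 0, 0], [0, 0, 0, 0, 0, 0, 10, 0, 0, 0],
    [-60, 0, 0, 0, 0, 0, -50, 0, 0, 0], [0, -15, -5, 0, 0, 0, 0, 0, 0, 0],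
    [0, 0, 0, -15, 5, 0, 0, 0, 0, 0], [0, 0, 0, 0, 0, 0, 0, 0, 0, 0],
    [0, 0, 0, 0, 0, 0, 0, 0, 0, 10], [0, 0, 0, 0, 0, 0, 0, 0, -10, 0]],
    [[0, 0, -10, 0, 0, 0, 0, 0, 0, 0], [0, 0, 0, 0, 0, 0, 10, 0, 0, 0],
    [60, 0, 0, 0, 0, 0, -50, 0, 0, 0], [0, 0, 0, 0, 0, -10, 0, 0, 0, 0],
    [0, 0, 0, 0, 0, -50, 0, 0, 0, 0], [0, 0, 0, 15, 5, 0, 0, 0, 0, 0],
    [0, -15, 5, 0, 0, 0, 0, 0, 0, 0], [0, 0, 0, 0, 0, 0, 0, 0, 0, -10],
    [0, 0, 0, 0, 0, 0, 0, 0, 0, 0], [0, 0, 0, 0, 0, 0, 0, 10, 0, 0]],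
    [[0, 0, 0, 0, 0, 0, 0, 0, 0, 0], [0, 0, 0, -30, 0, 0, 0, 0, 0, 0],
    [0, 0, 0, 0, 10, 0, 0, 0, 0, 0], [0, 30, 0, 0, 0, 0, 0, 0, 0, 0],
    [0, 0, -10, 0, 0, 0, 0, 0, 0, 0], [0, 0, 0, 0, 0, 0, -20, 0, 0, 0],
    [0, 0, 0, 0, 0, 20, 0, 0, 0, 0], [0, 0, 0, 0, 0, 0, 0, 0, 10, 0],
    [0, 0, 0, 0, 0, 0, 0, -10, 0, 0], [0, 0, 0, 0, 0, 0, 0, 0, 0, 0]]]"

text \<open>Origin: matrix q is the form tr(L (X Y + Y X)) on m, where L sends T to the traceless
  part of S T + T S and S is the q-th basis vector in the rescaled coordinates. This is
  \<open>jordan_check\<close>.\<close>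

definition iota_mats :: "int list list list" where
  "iota_mats = [[[0, 0, 0, 0, 0, 0, 4], [0, 0, 4, 0, 0, 0, 0], [0, 4, -24, 0, 0, 0, 0],
    [0, 0, 0, 0, -4, 0, 0], [0, 0, 0, -4, 24, 0, 0], [0, 0, 0, 0, 0, 0, 0],
    [4, 0, 0, 0, 0, 0, 0]], [[-8, 0, 0, 0, 0, 0, 0], [0, 4, 0, 0, 0, 0, 0],
    [0, 0, -36, 0, 0, 0, 0], [0, 0, 0, 4, 0, 0, 0], [0, 0, 0, 0, -36, 0, 0],
    [0, 0, 0, 0, 0, 0, 0], [0, 0, 0, 0, 0, 0, 0]], [[0, 0, 0, 0, 0, 4, 0],
    [0, 0, 0, 0, -4, 0, 0], [0, 0, 0, -4, -24, 0, 0], [0, 0, -4, 0, 0, 0, 0],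
    [0, -4, -24, 0, 0, 0, 0], [4, 0, 0, 0, 0, 0, 0], [0, 0, 0, 0, 0, 0, 0]],
    [[0, 0, 4, 0, 0, 0, 0], [0, 0, 0, 0, 0, 0, 2], [4, 0, 0, 0, 0, 0, 6],
    [0, 0, 0, 0, 0, -2, 0], [0, 0, 0, 0, 0, 6, 0], [0, 0, 0, -2, 6, 0, 0],
    [0, 2, 6, 0, 0, 0, 0]], [[0, 0, 0, 0, 4, 0, 0], [0, 0, 0, 0, 0, -2, 0],
    [0, 0, 0, 0, 0, 6, 0], [0, 0, 0, 0, 0, 0, -2], [4, 0, 0, 0, 0, 0, -6],
    [0, -2, 6, 0, 0, 0, 0], [0, 0, 0, -2, -6, 0, 0]]]"

definition jordan_mats :: "int list list list" where
  "jordan_mats = [[[0, -6, 0, 0, 0], [-2, 0, 0, 0, 0], [0, 0, 0, 0, 0], [0, 0, 0, 3, 0], [0, 0, 0, 0, -3]],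
    [[-6, 0, 0, 0, 0], [0, 6, 0, 0, 0], [0, 0, -6, 0, 0], [0, 0, 0, 3, 0], [0, 0, 0, 0, 3]],
    [[0, 0, 0, 0, 0], [0, 0, -2, 0, 0], [0, -6, 0, 0, 0], [0, 0, 0, 0, 3], [0, 0, 0, 3, 0]],
    [[0, 0, 0, 3, 0], [0, 0, 0, 1, 0], [0, 0, 0, 0, 3], [3, 3, 0, 0, 0], [0, 0, 3, 0, 0]],
    [[0, 0, 0, 0, -3], [0, 0, 0, 0, 1], [0, 0, 0, 3, 0], [0, 0, 3, 0, 0], [-3, 3, 0, 0, 0]]]"

text \<open>The Levi-Civita connection of a normal metric: X sends Y in m to the m-part of [X, Y],
  halved when X is in m. In units of 1/20, against structure constants in units of 1/10, half is the
  factor 1 and the whole is the factor 2.\<close>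

definition conn_mats :: "int list list list" where
  "conn_mats = map (\<lambda>n. map (\<lambda>a. map (\<lambda>b. (if n < 7 then 1 else 2) * struct_consts ! n ! b ! a)
     [0..<7]) [0..<7]) [0..<10]"

text \<open>400 times [W X, W Y] - W [X, Y] for the true connection W; the factor 2 is 400 / (10 *
  20).\<close>

definition curv_mat :: "int list list list \<Rightarrow> nat \<Rightarrow> nat \<Rightarrow> int list list" where
  "curv_mat W n m = madd (mcomm 7 (W ! n) (W ! m)) (mscale (-2) (mlin 7 (struct_consts ! n ! m) W))"

text \<open>Along X the vector w = \<open>transpose \<sigma> *v v\<close> changes by - X w, which
  gives the first term; the other two are the connection on bilinear forms. The factor 20 matches
  the scale of W.\<close>

definition nabla_mat :: "int list list list \<Rightarrow> nat \<Rightarrow> nat \<Rightarrow> int list list" where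
  "nabla_mat W n q = mscale (-1) (madd
     (mscale 20 (mlin 7 (map (\<lambda>p. basis_mats ! n ! p ! q) [0..<5]) iota_mats))
     (madd (mmul 7 (mtrans 7 (W ! n)) (iota_mats ! q)) (mmul 7 (iota_mats ! q) (W ! n))))"

text \<open>The same derivative applied to the first derivatives T; the additional sum is the
  connection acting on the slot n of differentiation.\<close>

definition nabla2_mat ::
  "int list list list \<Rightarrow> int list list list list \<Rightarrow> nat \<Rightarrow> nat \<Rightarrow> nat \<Rightarrow> int list list" where
  "nabla2_mat W T m n q = mscale (-1) (madd
     (madd (mscale 20 (mlin 7 (map (\<lambda>p. basis_mats ! m ! p ! q) [0..<5]) (T ! n)))
       (mlin 7 (map (\<lambda>d. W ! m ! d ! n) [0..<7]) (map (\<lambda>d. T ! d ! q) [0..<7])))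
     (madd (mmul 7 (mtrans 7 (W ! m)) (T ! n ! q)) (mmul 7 (T ! n ! q) (W ! m))))"

text \<open>Derived tables are named and handed to the checks as arguments, so that they are
  evaluated once and shared.\<close>

definition curv_mats :: "int list list list list" where
  "curv_mats = map (\<lambda>n. map (curv_mat conn_mats n) [0..<7]) [0..<7]"

definition curv_iota_mats :: "int list list list list \<Rightarrow> int list list list list list" where
  "curv_iota_mats K = map (\<lambda>q. map (\<lambda>m. map (\<lambda>a. mmul 7 (mtrans 7 (K ! a ! m)) (iota_mats ! q))
     [0..<7]) [0..<7]) [0..<5]"

definition nabla_mats :: "int list list list list" where
  "nabla_mats = map (\<lambda>n. map (nabla_mat conn_mats n) [0..<5]) [0..<10]"

definition "tables_square_check \<longleftrightarrow>
    list_all (\<lambda>A. square 5 A) basis_mats \<and> list_all (\<lambda>A. square 7 A)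
    iota_mats \<and> list_all (\<lambda>A. square 5 A) jordan_mats \<and> length basis_mats
    = 10 \<and> length iota_mats = 5 \<and> length jordan_mats = 5 \<and> length
    struct_consts = 10 \<and> list_all (\<lambda>R. length R = 10 \<and> list_all
    (\<lambda>r. length r = 10) R) struct_consts"

definition "basis_comm_check \<longleftrightarrow>
    list_all (\<lambda>n. (list_all (\<lambda>m. mlin 5 (struct_consts ! n ! m) basis_mats =
    mscale 10 (mcomm 5 (basis_mats ! n) (basis_mats ! m))) [0..<10])) [0..<10]"

definition "torsion_check W \<longleftrightarrow>
    list_all (\<lambda>n. (list_all (\<lambda>m. (list_all (\<lambda>a. 2 * struct_consts !
    n ! m ! a = (if m < 7 then W ! n ! a ! m else 0) - (if n < 7 then W ! m ! a ! n else 0))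
    [0..<7])) [0..<10])) [0..<10]"

definition "skew_check W \<longleftrightarrow>
    list_all (\<lambda>n. (list_all (\<lambda>a. (list_all (\<lambda>b. basis_norms ! a * W
    ! n ! a ! b = - (basis_norms ! b * W ! n ! b ! a)) [0..<7])) [0..<7])) [0..<10]"

text \<open>The connection map is equivariant under so(3), so the curvature expression vanishes when
  an argument is vertical, that is, has index 7, 8 or 9.\<close>

definition "curv_horizontal_check W \<longleftrightarrow>
    list_all (\<lambda>n. (list_all (\<lambda>m. mzero (curv_mat W n m) \<and> mzero
    (curv_mat W m n)) [0..<10])) [7..<10]"

text \<open>1080 = 400 * 27/10: the Einstein constant is 27/10 at scale 1.\<close>

definition "ricci_check K \<longleftrightarrow>
    list_all (\<lambda>m. (list_all (\<lambda>b. sum_list (map (\<lambda>a. K ! a ! m ! a !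
    b) [0..<7]) = (if b = m then 1080 * basis_norms ! m else 0)) [0..<7])) [0..<7]"

text \<open>21000 = 400 * 30 * 7/4, with 400 from the curvature and 30 from
  \<open>inv_norms\<close>.\<close>

definition "curv_iota_check P \<longleftrightarrow>
    list_all (\<lambda>q. (list_all (\<lambda>m. (list_all (\<lambda>b. sum_list (map
    (\<lambda>a. inv_norms ! a * P ! q ! m ! a ! b ! a) [0..<7]) = 21000 * iota_mats ! q ! m
    ! b) [0..<7])) [0..<7])) [0..<5]"

text \<open>Infinitesimal equivariance of the forms under so(3); it makes the covariant derivative
  depend on the m-part of its direction alone.\<close>

definition "nabla_horizontal_check T \<longleftrightarrow>
    list_all (\<lambda>n. (list_all (\<lambda>q. mzero (T ! n ! q)) [0..<5])) [7..<10]"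

definition "killing_check T \<longleftrightarrow>
    list_all (\<lambda>q. (list_all (\<lambda>a. (list_all (\<lambda>b. (list_all
    (\<lambda>c. T ! a ! q ! b ! c + T ! b ! q ! c ! a + T ! c ! q ! a ! b = 0) [0..<7]))
    [0..<7])) [0..<7])) [0..<5]"

definition "divergence_check T \<longleftrightarrow>
    list_all (\<lambda>q. (list_all (\<lambda>b. sum_list (map (\<lambda>c. inv_norms ! c *
    T ! c ! q ! c ! b) [0..<7]) = 0) [0..<7])) [0..<5]"

definition "nabla2_horizontal_check W T \<longleftrightarrow>
    list_all (\<lambda>m. (list_all (\<lambda>n. (list_all (\<lambda>q. mzero (nabla2_mat W
    T m n q)) [0..<5])) [0..<7])) [7..<10]"

text \<open>22800 = 400 * 30 * 19/10. The sign is negative because the trace of the second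
  derivative is minus the rough Laplacian.\<close>

definition "laplacian_check W T \<longleftrightarrow>
    list_all (\<lambda>q. mlin 7 inv_norms (map (\<lambda>c. nabla2_mat W T c c q) [0..<7])
    = mscale (- 22800) (iota_mats ! q)) [0..<5]"

definition "trace_check \<longleftrightarrow>
    list_all (\<lambda>q. sum_list (map (\<lambda>a. inv_norms ! a * iota_mats ! q ! a ! a)
    [0..<7]) = 0) [0..<5]"

text \<open>4032 = 30 * 30 * 112/25. The entry p = 1 is three times as large since that coordinate
  was divided by sqrt 3.\<close>

definition "inner_check \<longleftrightarrow>
    list_all (\<lambda>q. (list_all (\<lambda>p. sum_list (map (\<lambda>a. sum_list (map
    (\<lambda>b. inv_norms ! a * inv_norms ! b * iota_mats ! p ! a ! b * iota_mats ! q ! a !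
    b) [0..<7])) [0..<7]) = (if p = q then 4032 * (if p = 1 then 3 else 1) else 0))
    [0..<5])) [0..<5]"

definition "jordan_check \<longleftrightarrow>
    list_all (\<lambda>q. (list_all (\<lambda>a. (list_all (\<lambda>b. sum_list (map
    (\<lambda>i. mmul 5 (jordan_mats ! q) (madd (mmul 5 (basis_mats ! a) (basis_mats ! b))
    (mmul 5 (basis_mats ! b) (basis_mats ! a))) ! i ! i) [0..<5]) = 3 * iota_mats ! q ! a !
    b) [0..<7])) [0..<7])) [0..<5]"

definition "orthogonal_check \<longleftrightarrow>
    list_all (\<lambda>a. (list_all (\<lambda>b. sum_list (map (\<lambda>i. mmul 5
    (basis_mats ! a) (basis_mats ! b) ! i ! i) [0..<5]) = (if a = b then - 2 * basis_norms !
    a else 0)) [0..<10])) [0..<10]"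

definition "iota_symmetric_check \<longleftrightarrow>
    list_all (\<lambda>q. (list_all (\<lambda>a. (list_all (\<lambda>b. iota_mats ! q ! a !
    b = iota_mats ! q ! b ! a) [0..<7])) [0..<7])) [0..<5]"

section \<open>Evaluation of the identities between tables\<close>

lemma tables_square_checked: "tables_square_check"
  unfolding tables_square_check_def square_code by code_simp

lemma basis_comm_checked: "basis_comm_check"
  by code_simp

lemma torsion_checked: "torsion_check conn_mats"
  by code_simp

lemma skew_checked: "skew_check conn_mats"
  by code_simp

lemma curv_horizontal_checked: "curv_horizontal_check conn_mats"
  by code_simp

lemma ricci_checked: "ricci_check curv_mats"
  by code_simp

lemma curv_iota_checked: "curv_iota_check (curv_iota_mats curv_mats)"
  by code_simp

lemma nabla_horizontal_checked: "nabla_horizontal_check nabla_mats"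
  by code_simp

lemma killing_checked: "killing_check nabla_mats"
  by code_simp

lemma divergence_checked: "divergence_check nabla_mats"
  by code_simp

lemma nabla2_horizontal_checked: "nabla2_horizontal_check conn_mats nabla_mats"
  by code_simp

lemma laplacian_checked: "laplacian_check conn_mats nabla_mats"
  by code_simp

lemma trace_checked: "trace_check"
  by code_simp

lemma inner_checked: "inner_check"
  by code_simp

lemma jordan_checked: "jordan_check"
  by code_simp

lemma orthogonal_checked: "orthogonal_check"
  by code_simp

lemma iota_symmetric_checked: "iota_symmetric_check"
  by code_simp

section \<open>The Lie algebra so(5) and its isotropy module\<close>

lemma exhaust_5:
  fixes x :: 5
  shows "x = 1 \<or> x = 2 \<or> x = 3 \<or> x = 4 \<or> x = 5"
proof (induct x)
  case (of_int z)
  then have "z = 0 \<or> z = 1 \<or> z = 2 \<or> z = 3 \<or> z = 4" by fastforce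
  then show ?case by auto
qed

lemma forall_5: "(\<forall>i::5. P i) \<longleftrightarrow> P 1 \<and> P 2 \<and> P 3 \<and> P 4 \<and> P 5"
  by (metis exhaust_5)

lemma UNIV_5: "UNIV = {1, 2, 3, 4, 5::5}"
  using exhaust_5 by auto

lemma sum_5: "sum f (UNIV::5 set) = f 1 + f 2 + f 3 + f 4 + f 5"
  unfolding UNIV_5 by (simp add: ac_simps)

definition i5 :: "5 \<Rightarrow> nat" where
  "i5 i = (if i = 1 then 0 else if i = 2 then 1 else if i = 3 then 2 else if i = 4 then 3 else 4)"

lemma bij_i5: "bij_betw i5 UNIV {..<5}"
proof (rule bij_betwI')
  show "(i5 x = i5 y) = (x = y)" for x y
    using exhaust_5[of x] exhaust_5[of y] by (auto simp: i5_def)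
  show "i5 x \<in> {..<5}" for x by (simp add: i5_def)
  show "\<exists>x\<in>UNIV. y = i5 x" if "y \<in> {..<5}" for y
  proof -
    have "y = i5 1 \<or> y = i5 2 \<or> y = i5 3 \<or> y = i5 4 \<or> y = i5 5"
      using that by (auto simp: i5_def)
    then show ?thesis by blast
  qed
qed

text \<open>Any enumeration serves for the frame of m. By contrast \<open>i5\<close> is explicit,
  because \<open>sym_traceless\<close> names the coordinates 1, ..., 5.\<close>

definition i7 :: "7 \<Rightarrow> nat" where
  "i7 = (SOME f. bij_betw f UNIV {..<7})"

lemma bij_i7: "bij_betw i7 UNIV {..<7}"
proof -
  have "\<exists>f. bij_betw f (UNIV :: 7 set) {..<7::nat}"
    by (rule finite_same_card_bij) simp_all
  then show ?thesis unfolding i7_def by (rule someI_ex)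
qed

lemmas i5_less = index_less[OF bij_i5] and i7_less = index_less[OF bij_i7]

lemma i7_eq: "i7 a = i7 b \<longleftrightarrow> a = b"
  using bij_i7 by (auto simp: bij_betw_def inj_on_def)

lemma i5_eq: "i5 a = i5 b \<longleftrightarrow> a = b"
  using bij_i5 by (auto simp: bij_betw_def inj_on_def)

lemma i7_less10: "i7 a < 10"
  using i7_less[of a] by simp

text \<open>For quantities that vanish on so(3): a sum over the basis of so(5) becomes a sum over
  the frame of m.\<close>

lemma sum_10_7:
  fixes F :: "nat \<Rightarrow> 'a::comm_monoid_add"
  assumes "\<And>n. 7 \<le> n \<Longrightarrow> n < 10 \<Longrightarrow> F n = 0"
  shows "(\<Sum>n<10. F n) = (\<Sum>a\<in>UNIV. F (i7 a))"
proof -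
  have "(\<Sum>n<10. F n) = (\<Sum>n<7. F n)"
    by (rule sum.mono_neutral_right) (use assms in auto)
  then show ?thesis by (simp add: sum_index[OF bij_i7])
qed

lemma square_basis: "n < 10 \<Longrightarrow> square 5 (basis_mats ! n)"
  and square_iota: "q < 5 \<Longrightarrow> square 7 (iota_mats ! q)"
  and square_jordan: "q < 5 \<Longrightarrow> square 5 (jordan_mats ! q)"
  and length_basis: "length basis_mats = 10"
  and length_iota: "length iota_mats = 5"
  and length_struct: "n < 10 \<Longrightarrow> m < 10 \<Longrightarrow> length (struct_consts ! n ! m) = 10"
  using tables_square_checked by (auto simp: tables_square_check_def list_all_length)

lemma length_conn: "length conn_mats = 10"
  by (simp add: conn_mats_def)

lemma square_conn: "n < 10 \<Longrightarrow> square 7 (conn_mats ! n)"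
  by (auto simp: conn_mats_def square_def)

lemma square_curv: "n < 10 \<Longrightarrow> m < 10 \<Longrightarrow> square 7 (curv_mat conn_mats n m)"
  unfolding curv_mat_def
  by (intro square_madd square_mcomm square_mscale square_mlin square_conn)
     (auto simp: in_set_conv_nth length_conn square_conn)

lemma square_nabla_mat: "n < 10 \<Longrightarrow> q < 5 \<Longrightarrow> square 7 (nabla_mat conn_mats n q)"
  unfolding nabla_mat_def
  by (intro square_madd square_mmul square_mtrans square_mscale square_mlin square_conn square_iota)
     (auto simp: in_set_conv_nth length_iota square_iota)

lemma nabla_mats_nth: "n < 10 \<Longrightarrow> q < 5 \<Longrightarrow> nabla_mats ! n ! q = nabla_mat conn_mats n q"
  by (simp add: nabla_mats_def)

lemma square_nabla: "n < 10 \<Longrightarrow> q < 5 \<Longrightarrow> square 7 (nabla_mats ! n ! q)"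
  by (simp add: nabla_mats_nth square_nabla_mat)

lemmas matrix_scaleR_mult = bounded_bilinear.scaleR_left[OF bounded_bilinear_matrix_matrix_mult]
  bounded_bilinear.scaleR_right[OF bounded_bilinear_matrix_matrix_mult]

lemma transpose_scaleR: "transpose (c *\<^sub>R A) = c *\<^sub>R transpose (A :: real^'n^'m)"
  by (simp add: transpose_def vec_eq_iff)

abbreviation br :: "real^'n^'n \<Rightarrow> real^'n^'n \<Rightarrow> real^'n^'n" where
  "br X Y \<equiv> X ** Y - Y ** X"

section \<open>The basis of so(5) adapted to m and so(3)\<close>

definition dd :: "5 \<Rightarrow> real" where
  "dd i = (if i = 2 then sqrt 3 else 1)"

lemma dd_nz: "dd i \<noteq> 0"
  by (simp add: dd_def)

text \<open>Conjugation by diag(1, sqrt 3, 1, 1, 1) undoes the rescaling of the second coordinate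
  and makes the basis matrices skew. It respects products and traces, which can therefore be
  computed on integers.\<close>

definition conjD :: "real^5^5 \<Rightarrow> real^5^5" where
  "conjD A = (\<chi> i j. dd i * A $ i $ j / dd j)"

lemma conjD_mult: "conjD (A ** B) = conjD A ** conjD B"
  by (simp add: vec_eq_iff conjD_def matrix_matrix_mult_def dd_nz sum_distrib_left sum_divide_distrib mult.assoc)

lemma linear_conjD: "linear conjD"
  by (simp add: linear_iff conjD_def vec_eq_iff distrib_left add_divide_distrib)

lemma trace_conjD: "trace (conjD A) = trace A"
  by (simp add: trace_def conjD_def dd_nz)

definition bas :: "nat \<Rightarrow> real^5^5" where
  "bas n = conjD (lmat i5 (basis_mats ! n))"

definition nrm :: "nat \<Rightarrow> real" where
  "nrm n = of_int (basis_norms ! n)"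

definition coef :: "nat \<Rightarrow> real^5^5 \<Rightarrow> real" where
  "coef n Y = (Y \<bullet> bas n) / (2 * nrm n)"

lemma less_10_cases:
  "n < (10::nat) \<Longrightarrow> n = 0 \<or> n = 1 \<or> n = 2 \<or> n = 3 \<or> n = 4 \<or> n = 5 \<or> n = 6 \<or> n = 7 \<or> n = 8 \<or> n = 9"
  by auto

lemma less_7_cases: "n < (7::nat) \<Longrightarrow> n = 0 \<or> n = 1 \<or> n = 2 \<or> n = 3 \<or> n = 4 \<or> n = 5 \<or> n = 6"
  by auto

lemma nrm_pos: "n < 10 \<Longrightarrow> nrm n > 0"
  using less_10_cases[of n] by (auto simp: nrm_def basis_norms_def)

lemma inv_norms_nth: "n < 7 \<Longrightarrow> of_int (inv_norms ! n) = 30 / nrm n"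
  using less_7_cases[of n] by (auto simp: nrm_def basis_norms_def inv_norms_def)

lemma basis_mats_nth:
  "basis_mats ! 0 = [[0, 0, 1, 0, 0], [0, 0, 0, 0, 0], [-1, 0, 0, 0, 0], [0, 0, 0, 0, -2], [0, 0, 0, 2, 0]]"
  "basis_mats ! Suc 0 = [[0, 0, 0, 0, 1], [0, 0, 0, 0, 0], [0, 0, 0, 1, 0], [0, 0, -1, 0, 0], [-1, 0, 0, 0, 0]]"
  "basis_mats ! 2 = [[0, 0, 0, 0, 3], [0, 0, 0, 0, -2], [0, 0, 0, -3, 0], [0, 0, 3, 0, 0], [-3, 6, 0, 0, 0]]"
  "basis_mats ! 3 = [[0, 0, 0, 1, 0], [0, 0, 0, 0, 0], [0, 0, 0, 0, -1], [-1, 0, 0, 0, 0], [0, 0, 1, 0, 0]]"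
  "basis_mats ! 4 = [[0, 0, 0, 3, 0], [0, 0, 0, 2, 0], [0, 0, 0, 0, 3], [-3, -6, 0, 0, 0], [0, 0, -3, 0, 0]]"
  "basis_mats ! 5 = [[0, 3, 0, 0, 0], [-1, 0, 0, 0, 0], [0, 0, 0, 0, 0], [0, 0, 0, 0, 0], [0, 0, 0, 0, 0]]"
  "basis_mats ! 6 = [[0, 0, 0, 0, 0], [0, 0, 1, 0, 0], [0, -3, 0, 0, 0], [0, 0, 0, 0, 0], [0, 0, 0, 0, 0]]"
  "basis_mats ! 7 = [[0, 0, 0, 0, 1], [0, 0, 0, 0, 1], [0, 0, 0, -1, 0], [0, 0, 1, 0, 0], [-1, -3, 0, 0, 0]]"
  "basis_mats ! 8 = [[0, 0, 0, 1, 0], [0, 0, 0, -1, 0], [0, 0, 0, 0, 1], [-1, 3, 0, 0, 0], [0, 0, -1, 0, 0]]"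
  "basis_mats ! 9 = [[0, 0, -2, 0, 0], [0, 0, 0, 0, 0], [2, 0, 0, 0, 0], [0, 0, 0, 0, -1], [0, 0, 0, 1, 0]]"
  by (simp_all add: basis_mats_def)

lemma bas_skew:
  assumes "n < 10"
  shows "transpose (bas n) = - bas n"
  using less_10_cases[OF assms]
  by (elim disjE) (simp_all add: vec_eq_iff forall_5 transpose_def bas_def conjD_def lmat_def i5_def
    basis_mats_nth dd_def field_simps)

lemma inner_matrix: "(A :: real^'n^'m) \<bullet> B = trace (A ** transpose B)"
  by (simp add: inner_vec_def trace_def matrix_matrix_mult_def transpose_def)

lemma trace_lmat: "bij_betw f UNIV {..<n} \<Longrightarrow> trace (lmat f A) = of_int (\<Sum>k<n. A ! k ! k)"
  using sum_index[of f n "\<lambda>k. real_of_int (A ! k ! k)"] by (simp add: trace_def lmat_def)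

lemma coef_bas:
  assumes "n < 10" "m < 10"
  shows "coef n (bas m) = (if n = m then 1 else 0)"
proof -
  have "bas m \<bullet> bas n = - trace (bas m ** bas n)"
    by (simp add: inner_matrix bas_skew[OF assms(1)] trace_def matrix_matrix_mult_def sum_negf)
  also have "bas m ** bas n = conjD (lmat i5 (mmul 5 (basis_mats ! m) (basis_mats ! n)))"
    using assms by (simp add: bas_def conjD_mult lmat_mmul[OF bij_i5] square_basis)
  also have "trace \<dots> = (if m = n then - 2 * nrm m else 0)"
    using orthogonal_checked assms
    by (simp add: trace_conjD trace_lmat[OF bij_i5] orthogonal_check_def list_all_iff sum_list_upt nrm_def)
  finally show ?thesis using nrm_pos[OF assms(1)] by (auto simp: coef_def)
qed

lemma bounded_linear_coef: "bounded_linear (coef n)"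
  unfolding linear_conv_bounded_linear[symmetric] coef_def
  by (simp add: linear_iff inner_add_left add_divide_distrib)

lemma coef_trace:
  assumes "n < 10"
  shows "coef n (conjD A) = - trace (A ** lmat i5 (basis_mats ! n)) / (2 * nrm n)"
proof -
  have "conjD A \<bullet> bas n = - trace (conjD A ** bas n)"
    by (simp add: inner_matrix bas_skew[OF assms] trace_def matrix_matrix_mult_def sum_negf)
  then show ?thesis by (simp add: coef_def bas_def trace_conjD flip: conjD_mult)
qed

lemma skew_expand:
  assumes "transpose Y = - Y"
  shows "Y = (\<Sum>n<10. coef n Y *\<^sub>R bas n)"
proof -
  define A where "A = (\<chi> i j. dd j * Y $ i $ j / dd i)"
  have Y: "Y = conjD A" by (simp add: A_def conjD_def vec_eq_iff dd_nz)
  have y: "Y $ j $ i = - Y $ i $ j" for i j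
    using arg_cong[OF assms, of "\<lambda>B. B $ i $ j"] by (simp add: transpose_def)
  \<comment> \<open>With d = \<open>dd\<close>, skewness of Y becomes a relation of A with the
    weights d^2. These are 1 or 3, so the square root disappears.\<close>
  have h: "A $ j $ i = - (dd i * dd i) * A $ i $ j / (dd j * dd j)" for i j
    unfolding A_def vec_lambda_beta y[of i j] by (simp add: dd_nz)
  have e: "A $ j $ i = - ((if i = 2 then 3 else 1) * A $ i $ j / (if j = 2 then 3 else 1))" for i j
    unfolding h[of j i] by (simp add: dd_def)
  have "A $ i $ i = 0" for i
    using e[of i i] by (simp split: if_splits)
  note e = this e[of 2 1] e[of 3 1] e[of 4 1] e[of 5 1] e[of 3 2] e[of 4 2] e[of 5 2] e[of 4 3] e[of 5 3] e[of 5 4]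
  have tr: "trace (A ** B) = (\<Sum>i\<in>UNIV. \<Sum>k\<in>UNIV. A $ i $ k * B $ k $ i)" for B
    by (simp add: trace_def matrix_matrix_mult_def)
  \<comment> \<open>Traces against sparse tables. They reduce the expansion to identities in the ten
    entries of A above the diagonal.\<close>
  have c: "coef 0 Y = (A $ 1 $ 3 - 2 * A $ 4 $ 5) / 5"
    "coef (Suc 0) Y = (A $ 1 $ 5 + A $ 3 $ 4) / 2"
    "coef 2 Y = (3 * A $ 1 $ 5 - 6 * A $ 2 $ 5 - 3 * A $ 3 $ 4) / 30"
    "coef 3 Y = (A $ 1 $ 4 - A $ 3 $ 5) / 2"
    "coef 4 Y = (3 * A $ 1 $ 4 + 6 * A $ 2 $ 4 + 3 * A $ 3 $ 5) / 30"
    "coef 5 Y = A $ 1 $ 2 / 3"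
    "coef 6 Y = A $ 2 $ 3"
    "coef 7 Y = (A $ 1 $ 5 + 3 * A $ 2 $ 5 - A $ 3 $ 4) / 5"
    "coef 8 Y = (A $ 1 $ 4 - 3 * A $ 2 $ 4 + A $ 3 $ 5) / 5"
    "coef 9 Y = (- 2 * A $ 1 $ 3 - A $ 4 $ 5) / 5"
    by (simp_all add: Y coef_trace tr sum_5 lmat_def i5_def basis_mats_nth nrm_def basis_norms_def e)
  have lt: "{..<10::nat} = {0, 1, 2, 3, 4, 5, 6, 7, 8, 9}" by auto
  have "A = (\<Sum>n<10. coef n Y *\<^sub>R lmat i5 (basis_mats ! n))"
    by (simp add: vec_eq_iff forall_5 lt lmat_def i5_def basis_mats_nth) (simp add: c e field_simps)
  from arg_cong[OF this, of conjD] show ?thesis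
    by (simp add: Y[symmetric] linear_sum[OF linear_conjD] linear_cmul[OF linear_conjD] bas_def)
qed

section \<open>The invariant connection, its torsion and its curvature\<close>

definition mcoord :: "real^5^5 \<Rightarrow> real^7" where
  "mcoord Y = (\<chi> a. coef (i7 a) Y)"

definition wB :: "nat \<Rightarrow> real^7^7" where
  "wB n = (1 / 20) *\<^sub>R lmat i7 (conn_mats ! n)"

definition conn :: "real^5^5 \<Rightarrow> real^7^7" where
  "conn Y = (\<Sum>n<10. coef n Y *\<^sub>R wB n)"

definition struct :: "nat \<Rightarrow> nat \<Rightarrow> nat \<Rightarrow> real" where
  "struct n m k = of_int (struct_consts ! n ! m ! k) / 10"

lemma bounded_linear_mcoord: "bounded_linear mcoord"
  using bounded_linear.linear[OF bounded_linear_coef]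
  unfolding linear_conv_bounded_linear[symmetric] linear_iff mcoord_def
  by (simp add: vec_eq_iff)

lemma bounded_linear_conn: "bounded_linear conn"
  unfolding conn_def
  by (intro bounded_linear_sum bounded_linear_compose[OF bounded_linear_scaleR_left bounded_linear_coef])

lemma bas_comm:
  assumes "n < 10" "m < 10"
  shows "br (bas n) (bas m) = (\<Sum>k<10. struct n m k *\<^sub>R bas k)"
proof -
  note lin = linear_conjD
  have "mlin 5 (struct_consts ! n ! m) basis_mats = mscale 10 (mcomm 5 (basis_mats ! n) (basis_mats ! m))"
    using basis_comm_checked assms by (simp add: basis_comm_check_def list_all_iff)
  then have "lmat i5 (mlin 5 (struct_consts ! n ! m) basis_mats)
      = 10 *\<^sub>R br (lmat i5 (basis_mats ! n)) (lmat i5 (basis_mats ! m))"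
    using assms by (simp add: lmat_mscale[OF bij_i5] lmat_mcomm[OF bij_i5] square_mcomm square_basis)
  moreover have "lmat i5 (mlin 5 (struct_consts ! n ! m) basis_mats)
      = (\<Sum>k<10. of_int (struct_consts ! n ! m ! k) *\<^sub>R lmat i5 (basis_mats ! k))"
    by (subst lmat_mlin[OF bij_i5])
       (auto simp: length_struct[OF assms] length_basis in_set_conv_nth square_basis)
  ultimately have "(1 / 10) *\<^sub>R (10 *\<^sub>R br (lmat i5 (basis_mats ! n)) (lmat i5 (basis_mats ! m)))
      = (1 / 10) *\<^sub>R (\<Sum>k<10. of_int (struct_consts ! n ! m ! k) *\<^sub>R lmat i5 (basis_mats ! k))"
    by (simp only:)
  then have "br (lmat i5 (basis_mats ! n)) (lmat i5 (basis_mats ! m))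
      = (\<Sum>k<10. struct n m k *\<^sub>R lmat i5 (basis_mats ! k))"
    unfolding scaleR_sum_right scaleR_scaleR by (simp add: struct_def)
  from arg_cong[OF this, of conjD] show ?thesis
    by (simp add: linear_diff[OF lin] conjD_mult linear_sum[OF lin] linear_cmul[OF lin] bas_def)
qed

lemma bilinear_expand:
  assumes "bounded_bilinear h" "transpose X = - X" "transpose Y = - Y"
  shows "h X Y = (\<Sum>n<10. \<Sum>m<10. (coef n X * coef m Y) *\<^sub>R h (bas n) (bas m))"
proof -
  interpret h: bounded_bilinear h by fact
  have "h X Y = h (\<Sum>n<10. coef n X *\<^sub>R bas n) (\<Sum>m<10. coef m Y *\<^sub>R bas m)"
    using skew_expand[OF assms(2)] skew_expand[OF assms(3)] by simp
  also have "\<dots> = (\<Sum>n<10. \<Sum>m<10. h (coef n X *\<^sub>R bas n) (coef m Y *\<^sub>R bas m))"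
    by (simp only: h.sum_left) (simp only: h.sum_right)
  also have "\<dots> = (\<Sum>n<10. \<Sum>m<10. (coef n X * coef m Y) *\<^sub>R h (bas n) (bas m))"
    by (simp add: h.scaleR_left h.scaleR_right mult.commute)
  finally show ?thesis .
qed

lemma bounded_bilinear_br: "bounded_bilinear (br :: real^'n^'n \<Rightarrow> real^'n^'n \<Rightarrow> real^'n^'n)"
proof -
  interpret m: bounded_bilinear "(**) :: real^'n^'n \<Rightarrow> real^'n^'n \<Rightarrow> real^'n^'n"
    by (rule bounded_bilinear_matrix_matrix_mult)
  show ?thesis
    unfolding bilinear_conv_bounded_bilinear[symmetric] bilinear_def linear_iff
    by (simp add: m.add_left m.add_right m.scaleR_left m.scaleR_right algebra_simps)
qed

lemma coef_br:
  assumes "transpose X = - X" "transpose Y = - Y" "k < 10"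
  shows "coef k (br X Y) = (\<Sum>n<10. \<Sum>m<10. coef n X * coef m Y * struct n m k)"
proof -
  note lin = bounded_linear.linear[OF bounded_linear_coef]
  have "coef k (br (bas n) (bas m)) = struct n m k" if "n < 10" "m < 10" for n m
    using that assms(3)
    by (simp add: bas_comm linear_sum[OF lin] linear_cmul[OF lin] coef_bas if_distrib[of "\<lambda>x. _ * x"] sum.delta cong: if_cong)
  then show ?thesis
    by (simp add: bilinear_expand[OF bounded_bilinear_br assms(1,2)] linear_sum[OF lin] linear_cmul[OF lin])
qed

text \<open>For X and Y in m two halves of the m-part of [X, Y] add up; if only X is vertical, the
  first term is all of it and the second vanishes; so(3) is closed under brackets. The identity is
  bilinear and checked on the basis.\<close>

lemma torsion_free:
  assumes "transpose X = - X" "transpose Y = - Y"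
  shows "mcoord (br X Y) = conn X *v mcoord Y - conn Y *v mcoord X"
proof -
  have half: "(conn X *v mcoord Y) $ a
      = (\<Sum>n<10. \<Sum>m<10. coef n X * coef m Y * ((if m < 7 then of_int (conn_mats ! n ! i7 a ! m) else 0) / 20))"
    for X Y :: "real^5^5" and a
  proof -
    have "(conn X *v mcoord Y) $ a = (\<Sum>n<10. \<Sum>b\<in>UNIV. coef n X * (of_int (conn_mats ! n ! i7 a ! i7 b) / 20) * coef (i7 b) Y)"
      by (simp add: conn_def bounded_bilinear.sum_left[OF bounded_bilinear_matrix_vector_mult] mcoord_def
          matrix_vector_mult_def[of "_ *\<^sub>R _"] wB_def lmat_def sum_component mult.assoc)
    also have "\<dots> = (\<Sum>n<10. \<Sum>m<10. coef n X * coef m Y * ((if m < 7 then of_int (conn_mats ! n ! i7 a ! m) else 0) / 20))"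
      by (subst sum_10_7) (auto simp: i7_less mult_ac)
    finally show ?thesis .
  qed
  have "mcoord (br X Y) $ a = (conn X *v mcoord Y) $ a - (conn Y *v mcoord X) $ a" for a
  proof -
    have "struct n m (i7 a) = (if m < 7 then of_int (conn_mats ! n ! i7 a ! m) else 0) / 20
        - (if n < 7 then of_int (conn_mats ! m ! i7 a ! n) else 0) / 20" if "n < 10" "m < 10" for n m
    proof -
      have "2 * struct_consts ! n ! m ! i7 a = (if m < 7 then conn_mats ! n ! i7 a ! m else 0)
          - (if n < 7 then conn_mats ! m ! i7 a ! n else 0)"
        by (rule torsion_checked[unfolded torsion_check_def list_all_iff set_upt, rule_format])
          (use that i7_less in simp_all)
      from arg_cong[OF this, of real_of_int] show ?thesis
        by (simp add: struct_def field_simps split: if_splits)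
    qed
    then have "mcoord (br X Y) $ a = (\<Sum>n<10. \<Sum>m<10. coef n X * coef m Y
        * ((if m < 7 then of_int (conn_mats ! n ! i7 a ! m) else 0) / 20))
      - (\<Sum>n<10. \<Sum>m<10. coef n X * coef m Y * ((if n < 7 then of_int (conn_mats ! m ! i7 a ! n) else 0) / 20))"
      by (simp add: mcoord_def coef_br[OF assms i7_less10] right_diff_distrib sum_subtractf)
    also have "(\<Sum>n<10. \<Sum>m<10. coef n X * coef m Y * ((if n < 7 then of_int (conn_mats ! m ! i7 a ! n) else 0) / 20))
        = (conn Y *v mcoord X) $ a"
      unfolding half by (subst sum.swap) (simp add: mult_ac)
    finally show ?thesis unfolding half .
  qed
  then show ?thesis by (simp add: vec_eq_iff)
qed

text \<open>The normal inner product -tr(X Y) / 2 on m, in the chosen frame.\<close>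

definition G0 :: "real^7^7" where
  "G0 = (\<chi> a b. if a = b then nrm (i7 a) else 0)"

lemma G0_mult: "(G0 *v v) $ a = nrm (i7 a) * v $ a"
  by (simp add: G0_def matrix_vector_mult_def if_distrib[of "\<lambda>x. x * _"] cong: if_cong)

text \<open>Invariance of -tr(X Y) / 2 makes ad X skew; so is its compression to m, with or without
  the factor 1/2.\<close>

lemma conn_skew: "u \<bullet> (G0 *v (conn Y *v v)) = - ((conn Y *v u) \<bullet> (G0 *v v))"
proof -
  have w: "nrm (i7 a) * wB n $ a $ b = - (nrm (i7 b) * wB n $ b $ a)" if "n < 10" for n a b
  proof -
    have "basis_norms ! i7 a * conn_mats ! n ! i7 a ! i7 b = - (basis_norms ! i7 b * conn_mats ! n ! i7 b ! i7 a)"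
      by (rule skew_checked[unfolded skew_check_def list_all_iff set_upt, rule_format])
        (use that i7_less in simp_all)
    from arg_cong[OF this, of real_of_int] show ?thesis
      by (simp add: wB_def lmat_def nrm_def)
  qed
  have c: "nrm (i7 a) * conn Y $ a $ b = - (nrm (i7 b) * conn Y $ b $ a)" for a b
  proof -
    have e: "conn Y $ a $ b = (\<Sum>n<10. coef n Y * wB n $ a $ b)" for a b
      by (simp add: conn_def sum_component)
    have "nrm (i7 a) * conn Y $ a $ b = (\<Sum>n<10. coef n Y * (nrm (i7 a) * wB n $ a $ b))"
      by (simp add: e sum_distrib_left mult.left_commute)
    also have "\<dots> = (\<Sum>n<10. coef n Y * - (nrm (i7 b) * wB n $ b $ a))"
      by (intro sum.cong refl) (subst w, simp_all)
    also have "\<dots> = - (nrm (i7 b) * conn Y $ b $ a)"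
      by (simp add: e sum_distrib_left sum_negf mult.left_commute)
    finally show ?thesis .
  qed
  have "u \<bullet> (G0 *v (conn Y *v v)) = (\<Sum>a\<in>UNIV. \<Sum>b\<in>UNIV. nrm (i7 a) * conn Y $ a $ b * (u $ a * v $ b))"
    by (simp add: inner_vec_def G0_mult matrix_vector_mult_def[of "conn Y"] sum_distrib_left mult_ac)
  also have "\<dots> = - (\<Sum>a\<in>UNIV. \<Sum>b\<in>UNIV. nrm (i7 b) * conn Y $ b $ a * (u $ a * v $ b))"
  proof -
    have "(\<Sum>a\<in>UNIV. \<Sum>b\<in>UNIV. nrm (i7 a) * conn Y $ a $ b * (u $ a * v $ b))
        = (\<Sum>a\<in>UNIV. \<Sum>b\<in>UNIV. - (nrm (i7 b) * conn Y $ b $ a * (u $ a * v $ b)))"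
      by (intro sum.cong refl) (subst c, simp)
    then show ?thesis by (simp only: sum_negf)
  qed
  also have "(\<Sum>a\<in>UNIV. \<Sum>b\<in>UNIV. nrm (i7 b) * conn Y $ b $ a * (u $ a * v $ b)) = (conn Y *v u) \<bullet> (G0 *v v)"
    by (subst sum.swap)
       (simp add: inner_vec_def G0_mult matrix_vector_mult_def[of "conn Y"] sum_distrib_left sum_distrib_right mult_ac)
  finally show ?thesis .
qed

definition KB :: "7 \<Rightarrow> 7 \<Rightarrow> real^7^7" where
  "KB a m = (1 / 400) *\<^sub>R lmat i7 (curv_mat conn_mats (i7 a) (i7 m))"

lemma lmat_curv:
  assumes "n < 10" "m < 10"
  shows "(1 / 400) *\<^sub>R lmat i7 (curv_mat conn_mats n m) = br (wB n) (wB m) - (\<Sum>k<10. struct n m k *\<^sub>R wB k)"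
proof -
  have sq: "square 7 M" if "M \<in> set conn_mats" for M
    using that by (auto simp: in_set_conv_nth length_conn square_conn)
  have "lmat i7 (curv_mat conn_mats n m) = br (lmat i7 (conn_mats ! n)) (lmat i7 (conn_mats ! m))
      + (-2) *\<^sub>R (\<Sum>k<10. of_int (struct_consts ! n ! m ! k) *\<^sub>R lmat i7 (conn_mats ! k))"
    unfolding curv_mat_def
    using assms sq by (simp add: lmat_madd[OF bij_i7] lmat_mcomm[OF bij_i7] lmat_mscale[OF bij_i7]
        lmat_mlin[OF bij_i7] square_mcomm square_mscale square_mlin square_conn length_struct length_conn)
  then show ?thesis
    by (simp add: wB_def struct_def matrix_scaleR_mult scaleR_diff_right scaleR_add_right scaleR_sum_right sum_negf)
qed

text \<open>Bilinear and zero as soon as one argument is in so(3), hence a form in the m-coordinates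
  alone: the curvature form is horizontal.\<close>

lemma curvature_form:
  assumes "transpose X = - X" "transpose Y = - Y"
  shows "br (conn X) (conn Y) - conn (br X Y)
    = (\<Sum>a\<in>UNIV. mcoord X $ a *\<^sub>R (\<Sum>m\<in>UNIV. mcoord Y $ m *\<^sub>R KB a m))"
proof -
  interpret b: bounded_bilinear "br :: real^7^7 \<Rightarrow> real^7^7 \<Rightarrow> real^7^7"
    by (rule bounded_bilinear_br)
  let ?K = "\<lambda>n m. (1 / 400) *\<^sub>R lmat i7 (curv_mat conn_mats n m)"
  have "br (conn X) (conn Y) = (\<Sum>n<10. \<Sum>m<10. (coef n X * coef m Y) *\<^sub>R br (wB n) (wB m))"
  proof -
    have "br (conn X) (conn Y) = (\<Sum>n<10. \<Sum>m<10. br (coef n X *\<^sub>R wB n) (coef m Y *\<^sub>R wB m))"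
      unfolding conn_def by (simp only: b.sum_left) (simp only: b.sum_right)
    then show ?thesis by (simp add: b.scaleR_left b.scaleR_right mult.commute del: scaleR_diff_right)
  qed
  moreover have "conn (br X Y) = (\<Sum>n<10. \<Sum>m<10. (coef n X * coef m Y) *\<^sub>R (\<Sum>k<10. struct n m k *\<^sub>R wB k))"
  proof -
    have "conn (br X Y) = (\<Sum>k<10. \<Sum>n<10. \<Sum>m<10. (coef n X * coef m Y * struct n m k) *\<^sub>R wB k)"
      by (simp add: conn_def coef_br[OF assms] scaleR_sum_left)
    also have "\<dots> = (\<Sum>n<10. \<Sum>k<10. \<Sum>m<10. (coef n X * coef m Y * struct n m k) *\<^sub>R wB k)"
      by (rule sum.swap)
    also have "\<dots> = (\<Sum>n<10. \<Sum>m<10. \<Sum>k<10. (coef n X * coef m Y * struct n m k) *\<^sub>R wB k)"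
      by (rule sum.cong[OF refl]) (rule sum.swap)
    finally show ?thesis by (simp add: scaleR_sum_right)
  qed
  ultimately have "br (conn X) (conn Y) - conn (br X Y) = (\<Sum>n<10. \<Sum>m<10. (coef n X * coef m Y) *\<^sub>R ?K n m)"
    by (simp add: lmat_curv scaleR_diff_right sum_subtractf)
  moreover have z: "?K n m = 0" if "7 \<le> n \<or> 7 \<le> m" "n < 10" "m < 10" for n m
  proof -
    have "mzero (curv_mat conn_mats n m)"
      using curv_horizontal_checked[unfolded curv_horizontal_check_def list_all_iff set_upt] that
      by (meson atLeastLessThan_iff zero_le)
    then show ?thesis using lmat_mzero[OF bij_i7 square_curv] that(2,3) by simp
  qed
  have "(\<Sum>n<10. \<Sum>m<10. (coef n X * coef m Y) *\<^sub>R ?K n m)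
      = (\<Sum>a\<in>UNIV. \<Sum>m\<in>UNIV. (coef (i7 a) X * coef (i7 m) Y) *\<^sub>R ?K (i7 a) (i7 m))"
    using z by (simp add: sum_10_7 i7_less10 del: scaleR_scaleR)
  ultimately show ?thesis
    by (simp add: mcoord_def KB_def scaleR_sum_right)
qed

lemma ricci_contract:
  "(\<Sum>a\<in>UNIV. ((\<Sum>m\<in>UNIV. u $ m *\<^sub>R KB a m) *v v) $ a) = 27 / 10 * (u \<bullet> (G0 *v v))"
proof -
  have k: "(\<Sum>a\<in>UNIV. KB a m $ a $ b) = (if b = m then 27 / 10 * nrm (i7 m) else 0)" for m b
  proof -
    have "(\<Sum>a\<in>UNIV. KB a m $ a $ b)
        = (\<Sum>a\<in>UNIV. of_int (curv_mats ! i7 a ! i7 m ! i7 a ! i7 b) / 400)"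
      using i7_less by (simp add: KB_def lmat_def curv_mats_def)
    also have "\<dots> = of_int (\<Sum>n<7. curv_mats ! n ! i7 m ! n ! i7 b) / 400"
      using sum_index[OF bij_i7, of "\<lambda>n. real_of_int (curv_mats ! n ! i7 m ! n ! i7 b) / 400"]
      by (simp add: sum_divide_distrib)
    also have "(\<Sum>n<7. curv_mats ! n ! i7 m ! n ! i7 b) = (if i7 b = i7 m then 1080 * basis_norms ! i7 m else 0)"
      using ricci_checked i7_less[of m] i7_less[of b]
      by (simp add: ricci_check_def list_all_iff flip: sum_list_upt)
    finally show ?thesis by (cases "b = m") (simp_all add: i7_eq nrm_def)
  qed
  have "(\<Sum>a\<in>UNIV. ((\<Sum>m\<in>UNIV. u $ m *\<^sub>R KB a m) *v v) $ a)
      = (\<Sum>a\<in>UNIV. \<Sum>m\<in>UNIV. \<Sum>b\<in>UNIV. KB a m $ a $ b * (u $ m * v $ b))"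
    by (simp add: bounded_bilinear.sum_left[OF bounded_bilinear_matrix_vector_mult] sum_component
        matrix_vector_mult_def[of "_ *\<^sub>R _"] mult_ac)
  also have "\<dots> = (\<Sum>m\<in>UNIV. \<Sum>b\<in>UNIV. \<Sum>a\<in>UNIV. KB a m $ a $ b * (u $ m * v $ b))"
    by (rule sum_swap3)
  also have "\<dots> = (\<Sum>m\<in>UNIV. \<Sum>b\<in>UNIV. (if b = m then 27 / 10 * nrm (i7 m) else 0) * (u $ m * v $ b))"
    by (simp add: k flip: sum_distrib_right)
  also have "\<dots> = 27 / 10 * (u \<bullet> (G0 *v v))"
  proof -
    have "(\<Sum>b\<in>UNIV. (if b = m then 27 / 10 * nrm (i7 m) else 0) * (u $ m * v $ b))
      = 27 / 10 * (u $ m * (nrm (i7 m) * v $ m))" for m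
      by (simp add: if_distrib[of "\<lambda>x. x * _"] cong: if_cong)
    then show ?thesis by (simp only: inner_vec_def G0_mult sum_distrib_left inner_real_def)
  qed
  finally show ?thesis .
qed

section \<open>The map \<open>iota\<close> into symmetric forms on m and its covariant
  derivatives\<close>

definition ycoord :: "real^5 \<Rightarrow> 5 \<Rightarrow> real" where
  "ycoord w j = w $ j / dd j"

definition iota :: "real^5 \<Rightarrow> real^7^7" where
  "iota w = (\<Sum>j\<in>UNIV. ycoord w j *\<^sub>R lmat i7 (iota_mats ! i5 j))"

lemma ycoord_linear: "linear (\<lambda>w. ycoord w j)"
  by (simp add: linear_iff ycoord_def add_divide_distrib)

lemma ycoord_sum_bas:
  "ycoord (bas n *v w) j = (\<Sum>k\<in>UNIV. of_int (basis_mats ! n ! i5 j ! i5 k) * ycoord w k)"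
  by (simp add: ycoord_def bas_def conjD_def lmat_def matrix_vector_mult_def sum_divide_distrib dd_nz)

lemma linear_iota: "linear iota"
  unfolding iota_def
  by (intro linear_compose_sum ballI) (simp add: linear_iff ycoord_def add_divide_distrib scaleR_add_left)

lemma bounded_linear_iota: "bounded_linear iota"
  using linear_iota by (simp add: linear_conv_bounded_linear)

text \<open>The covariant derivative in frame direction a, at a point where the fixed vector of R^5
  appears as w.\<close>

definition TB :: "7 \<Rightarrow> real^5 \<Rightarrow> real^7^7" where
  "TB a w = (\<Sum>k\<in>UNIV. ycoord w k *\<^sub>R ((1 / 20) *\<^sub>R lmat i7 (nabla_mats ! i7 a ! i5 k)))"

lemma linear_TB: "linear (TB a)"
  unfolding TB_def
  by (intro linear_compose_sum ballI) (simp add: linear_iff ycoord_def add_divide_distrib scaleR_add_left)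

lemma bounded_linear_TB: "bounded_linear (TB a)"
  using linear_TB by (simp add: linear_conv_bounded_linear)

lemma lmat_nabla:
  assumes "n < 10" "q < 5"
  shows "(1 / 20) *\<^sub>R lmat i7 (nabla_mats ! n ! q) = - (\<Sum>p<5. of_int (basis_mats ! n ! p ! q) *\<^sub>R lmat i7 (iota_mats ! p))
    - transpose (wB n) ** lmat i7 (iota_mats ! q) - lmat i7 (iota_mats ! q) ** wB n"
proof -
  have sq: "square 7 M" if "M \<in> set iota_mats" for M
    using that by (auto simp: in_set_conv_nth length_iota square_iota)
  have "lmat i7 (nabla_mats ! n ! q) = (-1) *\<^sub>R (20 *\<^sub>R (\<Sum>p<5. of_int (basis_mats ! n ! p ! q) *\<^sub>R lmat i7 (iota_mats ! p))
    + (transpose (lmat i7 (conn_mats ! n)) ** lmat i7 (iota_mats ! q) + lmat i7 (iota_mats ! q) ** lmat i7 (conn_mats ! n)))"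
    unfolding nabla_mats_nth[OF assms] nabla_mat_def
    using assms sq by (simp add: lmat_madd[OF bij_i7] lmat_mmul[OF bij_i7] lmat_mscale[OF bij_i7] lmat_mtrans[OF bij_i7]
        lmat_mlin[OF bij_i7] square_madd square_mmul square_mtrans square_mscale square_mlin square_conn square_iota length_iota)
  then show ?thesis
    by (simp add: wB_def transpose_scaleR matrix_scaleR_mult scaleR_add_right scaleR_diff_right)
qed

lemma nabla_basis:
  assumes "n < 10"
  shows "- iota (bas n *v w) - transpose (wB n) ** iota w - iota w ** wB n
    = (\<Sum>k\<in>UNIV. ycoord w k *\<^sub>R ((1 / 20) *\<^sub>R lmat i7 (nabla_mats ! n ! i5 k)))"
proof -
  have "iota (bas n *v w) = (\<Sum>j\<in>UNIV. \<Sum>k\<in>UNIV. ycoord w k *\<^sub>R (of_int (basis_mats ! n ! i5 j ! i5 k) *\<^sub>R lmat i7 (iota_mats ! i5 j)))"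
    by (simp add: iota_def ycoord_sum_bas scaleR_sum_left mult.commute)
  also have "\<dots> = (\<Sum>k\<in>UNIV. ycoord w k *\<^sub>R (\<Sum>j\<in>UNIV. of_int (basis_mats ! n ! i5 j ! i5 k) *\<^sub>R lmat i7 (iota_mats ! i5 j)))"
    by (subst sum.swap) (simp only: scaleR_sum_right)
  also have "\<dots> = (\<Sum>k\<in>UNIV. ycoord w k *\<^sub>R (\<Sum>p<5. of_int (basis_mats ! n ! p ! i5 k) *\<^sub>R lmat i7 (iota_mats ! p)))"
    by (simp only: sum_index[OF bij_i5, of "\<lambda>p. of_int (basis_mats ! n ! p ! i5 _) *\<^sub>R lmat i7 (iota_mats ! p)"])
  finally show ?thesis
    by (simp add: lmat_nabla[OF assms i5_less] iota_def scaleR_diff_right sum_subtractf sum_negf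
        bounded_bilinear.sum_left[OF bounded_bilinear_matrix_matrix_mult]
        bounded_bilinear.sum_right[OF bounded_bilinear_matrix_matrix_mult] matrix_scaleR_mult del: scaleR_scaleR)
qed

text \<open>With the Maurer-Cartan form for X, the left side is what \<open>cov2_frame\<close>
  produces. Vertical directions drop out by equivariance of \<open>iota\<close>.\<close>

lemma nabla_form:
  assumes "transpose X = - X"
  shows "- iota (X *v w) - transpose (conn X) ** iota w - iota w ** conn X
    = (\<Sum>a\<in>UNIV. mcoord X $ a *\<^sub>R TB a w)"
proof -
  let ?N = "\<lambda>n. - iota (bas n *v w) - transpose (wB n) ** iota w - iota w ** wB n"
  note mm = bounded_bilinear_matrix_matrix_mult
  have "X *v w = (\<Sum>n<10. coef n X *\<^sub>R (bas n *v w))"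
    by (subst skew_expand[OF assms])
      (simp add: bounded_bilinear.sum_left[OF bounded_bilinear_matrix_vector_mult] scaleR_matrix_vector_assoc)
  then have "iota (X *v w) = (\<Sum>n<10. coef n X *\<^sub>R iota (bas n *v w))"
    by (simp add: linear_sum[OF linear_iota] linear_cmul[OF linear_iota])
  moreover have "transpose (conn X) = (\<Sum>n<10. coef n X *\<^sub>R transpose (wB n))"
    by (simp add: conn_def linear_sum[OF bounded_linear.linear[OF bounded_linear_transpose]] transpose_scaleR)
  ultimately have "- iota (X *v w) - transpose (conn X) ** iota w - iota w ** conn X = (\<Sum>n<10. coef n X *\<^sub>R ?N n)"
    by (simp add: conn_def bounded_bilinear.sum_left[OF mm] bounded_bilinear.sum_right[OF mm] matrix_scaleR_mult
        scaleR_diff_right sum_subtractf sum_negf)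
  also have "\<dots> = (\<Sum>a\<in>UNIV. coef (i7 a) X *\<^sub>R ?N (i7 a))"
  proof (rule sum_10_7)
    show "coef n X *\<^sub>R ?N n = 0" if "7 \<le> n" "n < 10" for n
    proof -
      have "lmat i7 (nabla_mats ! n ! i5 k) = 0" for k
      proof (rule lmat_mzero[OF bij_i7 square_nabla[OF that(2) i5_less]])
        show "mzero (nabla_mats ! n ! i5 k)"
          using nabla_horizontal_checked[unfolded nabla_horizontal_check_def list_all_iff set_upt] that i5_less[of k]
          by (meson atLeastLessThan_iff zero_le)
      qed
      then show ?thesis using nabla_basis[OF that(2)] by simp
    qed
  qed
  also have "\<dots> = (\<Sum>a\<in>UNIV. mcoord X $ a *\<^sub>R TB a w)"
    by (simp only: nabla_basis[OF i7_less10] TB_def mcoord_def vec_lambda_beta)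
  finally show ?thesis .
qed

text \<open>Sym^2 m splits under SO(3) into summands of dimensions 1, 5, 9 and 13, each occurring
  once. An invariant operator is therefore scalar on the image of \<open>iota\<close>; the table
  supplies the scalar.\<close>

lemma curv_iota_contract:
  "(\<Sum>a\<in>UNIV. ((\<Sum>m\<in>UNIV. u $ m *\<^sub>R KB a m) *v v) \<bullet> (iota w *v axis a 1) / nrm (i7 a))
    = 7 / 4 * (u \<bullet> (iota w *v v))"
proof -
  let ?I = "\<lambda>j. lmat i7 (iota_mats ! i5 j)"
  have k: "(\<Sum>a\<in>UNIV. (transpose (KB a m) ** ?I j) $ b $ a / nrm (i7 a)) = 7 / 4 * ?I j $ m $ b" for m b j
  proof -
    let ?P = "curv_iota_mats curv_mats"
    have "lmat i7 (?P ! i5 j ! i7 m ! i7 a) = 400 *\<^sub>R (transpose (KB a m) ** ?I j)" for a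
      using i7_less[of a] i7_less[of m] i5_less[of j]
      by (simp add: curv_iota_mats_def curv_mats_def KB_def lmat_mmul[OF bij_i7] lmat_mtrans[OF bij_i7]
          square_curv square_iota square_mtrans transpose_scaleR matrix_scaleR_mult)
    then have e: "(transpose (KB a m) ** ?I j) $ b $ a = of_int (?P ! i5 j ! i7 m ! i7 a ! i7 b ! i7 a) / 400" for a
      by (simp add: lmat_def[of i7 "?P ! _ ! _ ! _"] vec_eq_iff)
    have "(\<Sum>n<7. inv_norms ! n * ?P ! i5 j ! i7 m ! n ! i7 b ! n) = 21000 * iota_mats ! i5 j ! i7 m ! i7 b"
      using curv_iota_checked i7_less[of m] i7_less[of b] i5_less[of j]
      by (simp add: curv_iota_check_def list_all_iff flip: sum_list_upt)
    note c = arg_cong[OF this, of "\<lambda>x. real_of_int x / 12000"]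
    have "(\<Sum>n<7. of_int (?P ! i5 j ! i7 m ! n ! i7 b ! n) / 400 / nrm n)
        = (\<Sum>n<7. of_int (inv_norms ! n * ?P ! i5 j ! i7 m ! n ! i7 b ! n) / 12000)"
      by (intro sum.cong refl) (simp add: inv_norms_nth)
    also have "\<dots> = 7 / 4 * of_int (iota_mats ! i5 j ! i7 m ! i7 b)"
      using c by (simp add: sum_divide_distrib)
    finally show ?thesis
      unfolding e by (simp add: lmat_def flip: sum_index[OF bij_i7])
  qed
  have "(\<Sum>a\<in>UNIV. (transpose (KB a m) ** iota w) $ b $ a / nrm (i7 a)) = 7 / 4 * iota w $ m $ b" for m b
  proof -
    have "(\<Sum>a\<in>UNIV. (transpose (KB a m) ** iota w) $ b $ a / nrm (i7 a))
        = (\<Sum>a\<in>UNIV. \<Sum>j\<in>UNIV. ycoord w j * ((transpose (KB a m) ** ?I j) $ b $ a / nrm (i7 a)))"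
      by (simp add: iota_def bounded_bilinear.sum_right[OF bounded_bilinear_matrix_matrix_mult] matrix_scaleR_mult
          sum_component sum_divide_distrib)
    also have "\<dots> = (\<Sum>j\<in>UNIV. ycoord w j * (7 / 4 * ?I j $ m $ b))"
      by (subst sum.swap) (simp only: k flip: sum_distrib_left)
    finally show ?thesis
      by (simp add: iota_def sum_component sum_distrib_left mult.left_commute)
  qed
  note k = this
  have e: "((\<Sum>m\<in>UNIV. u $ m *\<^sub>R KB a m) *v v) \<bullet> (iota w *v axis a 1)
      = (\<Sum>m\<in>UNIV. \<Sum>b\<in>UNIV. u $ m * (v $ b * (transpose (KB a m) ** iota w) $ b $ a))" for a
  proof -
    have "(KB a m *v v) \<bullet> (iota w *v axis a 1) = v \<bullet> ((transpose (KB a m) ** iota w) *v axis a 1)" for m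
      by (simp add: dot_vector_matrix_mult inner_commute flip: matrix_vector_mul_assoc)
    also have "v \<bullet> ((transpose (KB a m) ** iota w) *v axis a 1)
        = (\<Sum>b\<in>UNIV. v $ b * (transpose (KB a m) ** iota w) $ b $ a)" for m
      by (simp add: inner_vec_def matrix_vector_mult_basis column_def)
    finally show ?thesis
      by (simp add: bounded_bilinear.sum_left[OF bounded_bilinear_matrix_vector_mult] inner_sum_left
          sum_distrib_left flip: scaleR_matrix_vector_assoc)
  qed
  have "(\<Sum>a\<in>UNIV. ((\<Sum>m\<in>UNIV. u $ m *\<^sub>R KB a m) *v v) \<bullet> (iota w *v axis a 1) / nrm (i7 a))
      = (\<Sum>a\<in>UNIV. \<Sum>m\<in>UNIV. \<Sum>b\<in>UNIV. u $ m * v $ b * ((transpose (KB a m) ** iota w) $ b $ a / nrm (i7 a)))"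
    by (simp add: e sum_divide_distrib mult.assoc)
  also have "\<dots> = (\<Sum>m\<in>UNIV. \<Sum>b\<in>UNIV. \<Sum>a\<in>UNIV. u $ m * v $ b * ((transpose (KB a m) ** iota w) $ b $ a / nrm (i7 a)))"
    by (rule sum_swap3)
  also have "\<dots> = (\<Sum>m\<in>UNIV. \<Sum>b\<in>UNIV. u $ m * v $ b * (7 / 4 * iota w $ m $ b))"
    by (simp only: k flip: sum_distrib_left)
  also have "\<dots> = 7 / 4 * (u \<bullet> (iota w *v v))"
    by (simp add: dot_matrix_vector_mult sum_distrib_left mult_ac)
  finally show ?thesis .
qed

definition T2B :: "7 \<Rightarrow> 7 \<Rightarrow> real^5 \<Rightarrow> real^7^7" where
  "T2B m a w = (\<Sum>k\<in>UNIV. ycoord w k *\<^sub>R ((1 / 400) *\<^sub>R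
     lmat i7 (nabla2_mat conn_mats nabla_mats (i7 m) (i7 a) (i5 k))))"

lemma length_nabla: "n < 10 \<Longrightarrow> length (nabla_mats ! n) = 5"
  by (simp add: nabla_mats_def)

lemma square_nabla2:
  "m < 10 \<Longrightarrow> n < 7 \<Longrightarrow> q < 5 \<Longrightarrow> square 7 (nabla2_mat conn_mats nabla_mats m n q)"
  unfolding nabla2_mat_def
  by (intro square_madd square_mmul square_mtrans square_mscale square_mlin square_conn square_nabla)
     (auto simp: in_set_conv_nth length_nabla square_nabla)

lemma lmat_nabla2:
  assumes "m < 10" "n < 7" "q < 5"
  shows "(1 / 400) *\<^sub>R lmat i7 (nabla2_mat conn_mats nabla_mats m n q)
    = - (\<Sum>p<5. of_int (basis_mats ! m ! p ! q) *\<^sub>R ((1 / 20) *\<^sub>R lmat i7 (nabla_mats ! n ! p)))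
      - (\<Sum>d<7. (of_int (conn_mats ! m ! d ! n) / 20) *\<^sub>R ((1 / 20) *\<^sub>R lmat i7 (nabla_mats ! d ! q)))
      - transpose (wB m) ** ((1 / 20) *\<^sub>R lmat i7 (nabla_mats ! n ! q))
      - ((1 / 20) *\<^sub>R lmat i7 (nabla_mats ! n ! q)) ** wB m"
proof -
  have n10: "n < 10" using assms(2) by simp
  have sq: "square 7 M" if "M \<in> set (nabla_mats ! n)" for M
    using that n10 by (auto simp: in_set_conv_nth length_nabla square_nabla)
  have sq': "square 7 M" if "M \<in> set (map (\<lambda>d. nabla_mats ! d ! q) [0..<7])" for M
    using that assms(3) by (auto simp: square_nabla)
  have "lmat i7 (nabla2_mat conn_mats nabla_mats m n q) = (-1) *\<^sub>R
      (20 *\<^sub>R (\<Sum>p<5. of_int (basis_mats ! m ! p ! q) *\<^sub>R lmat i7 (nabla_mats ! n ! p))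
      + (\<Sum>d<7. of_int (conn_mats ! m ! d ! n) *\<^sub>R lmat i7 (nabla_mats ! d ! q))
      + (transpose (lmat i7 (conn_mats ! m)) ** lmat i7 (nabla_mats ! n ! q)
         + lmat i7 (nabla_mats ! n ! q) ** lmat i7 (conn_mats ! m)))"
  proof -
    have "lmat i7 (mlin 7 (map (\<lambda>p. basis_mats ! m ! p ! q) [0..<5]) (nabla_mats ! n))
        = (\<Sum>p<5. of_int (basis_mats ! m ! p ! q) *\<^sub>R lmat i7 (nabla_mats ! n ! p))"
      by (subst lmat_mlin[OF bij_i7]) (simp_all add: sq length_nabla[OF n10])
    moreover have "lmat i7 (mlin 7 (map (\<lambda>d. conn_mats ! m ! d ! n) [0..<7]) (map (\<lambda>d. nabla_mats ! d ! q) [0..<7]))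
        = (\<Sum>d<7. of_int (conn_mats ! m ! d ! n) *\<^sub>R lmat i7 (nabla_mats ! d ! q))"
      by (subst lmat_mlin[OF bij_i7]) (simp_all add: sq' del: upt_rec_numeral)
    moreover have "square 7 (mlin 7 (map (\<lambda>p. basis_mats ! m ! p ! q) [0..<5]) (nabla_mats ! n))"
      "square 7 (mlin 7 (map (\<lambda>d. conn_mats ! m ! d ! n) [0..<7]) (map (\<lambda>d. nabla_mats ! d ! q) [0..<7]))"
      by (rule square_mlin, erule sq sq')+
    moreover have "square 7 (conn_mats ! m)" "square 7 (nabla_mats ! n ! q)"
      using assms n10 by (simp_all add: square_conn square_nabla)
    ultimately show ?thesis
      unfolding nabla2_mat_def
      by (simp add: lmat_madd[OF bij_i7] lmat_mmul[OF bij_i7] lmat_mscale[OF bij_i7] lmat_mtrans[OF bij_i7]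
        square_madd square_mmul square_mtrans square_mscale del: upt_rec_numeral)
  qed
  then show ?thesis
    by (simp add: wB_def transpose_scaleR matrix_scaleR_mult scaleR_add_right scaleR_diff_right scaleR_sum_right sum_negf)
qed

lemma nabla2_basis:
  assumes "m < 10"
  shows "- TB a (bas m *v w) - (\<Sum>d\<in>UNIV. wB m $ d $ a *\<^sub>R TB d w) - transpose (wB m) ** TB a w - TB a w ** wB m
    = (\<Sum>k\<in>UNIV. ycoord w k *\<^sub>R ((1 / 400) *\<^sub>R lmat i7 (nabla2_mat conn_mats nabla_mats m (i7 a) (i5 k))))"
proof -
  note mm = bounded_bilinear_matrix_matrix_mult
  let ?N = "\<lambda>a k. (1 / 20) *\<^sub>R lmat i7 (nabla_mats ! i7 a ! i5 k)"
  have 1: "TB a (bas m *v w) = (\<Sum>k\<in>UNIV. ycoord w k *\<^sub>R (\<Sum>p<5. of_int (basis_mats ! m ! p ! i5 k) *\<^sub>R ((1 / 20) *\<^sub>R lmat i7 (nabla_mats ! i7 a ! p))))"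
  proof -
    have "TB a (bas m *v w) = (\<Sum>j\<in>UNIV. \<Sum>k\<in>UNIV. ycoord w k *\<^sub>R (of_int (basis_mats ! m ! i5 j ! i5 k) *\<^sub>R ?N a j))"
      unfolding TB_def ycoord_sum_bas scaleR_sum_left by (intro sum.cong refl) (simp add: mult_ac)
    also have "\<dots> = (\<Sum>k\<in>UNIV. ycoord w k *\<^sub>R (\<Sum>j\<in>UNIV. of_int (basis_mats ! m ! i5 j ! i5 k) *\<^sub>R ?N a j))"
      by (subst sum.swap) (simp only: scaleR_sum_right)
    finally show ?thesis
      by (simp only: sum_index[OF bij_i5, of "\<lambda>p. of_int (basis_mats ! m ! p ! i5 _) *\<^sub>R ((1 / 20) *\<^sub>R lmat i7 (nabla_mats ! i7 a ! p))"])
  qed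
  have 2: "(\<Sum>d\<in>UNIV. wB m $ d $ a *\<^sub>R TB d w)
      = (\<Sum>k\<in>UNIV. ycoord w k *\<^sub>R (\<Sum>d<7. (of_int (conn_mats ! m ! d ! i7 a) / 20) *\<^sub>R ((1 / 20) *\<^sub>R lmat i7 (nabla_mats ! d ! i5 k))))"
  proof -
    have "(\<Sum>d\<in>UNIV. wB m $ d $ a *\<^sub>R TB d w) = (\<Sum>d\<in>UNIV. \<Sum>k\<in>UNIV. ycoord w k *\<^sub>R ((of_int (conn_mats ! m ! i7 d ! i7 a) / 20) *\<^sub>R ?N d k))"
      by (simp add: TB_def wB_def lmat_def[of i7 "conn_mats ! m"] scaleR_sum_right mult_ac)
    also have "\<dots> = (\<Sum>k\<in>UNIV. ycoord w k *\<^sub>R (\<Sum>d\<in>UNIV. (of_int (conn_mats ! m ! i7 d ! i7 a) / 20) *\<^sub>R ?N d k))"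
      by (subst sum.swap) (simp only: scaleR_sum_right)
    finally show ?thesis
      by (simp only: sum_index[OF bij_i7, of "\<lambda>d. (of_int (conn_mats ! m ! d ! i7 a) / 20) *\<^sub>R ((1 / 20) *\<^sub>R lmat i7 (nabla_mats ! d ! i5 _))"])
  qed
  have 3: "transpose (wB m) ** TB a w = (\<Sum>k\<in>UNIV. ycoord w k *\<^sub>R (transpose (wB m) ** ?N a k))"
    by (simp only: TB_def bounded_bilinear.sum_right[OF mm] bounded_bilinear.scaleR_right[OF mm])
  have 4: "TB a w ** wB m = (\<Sum>k\<in>UNIV. ycoord w k *\<^sub>R (?N a k ** wB m))"
    by (simp only: TB_def bounded_bilinear.sum_left[OF mm] bounded_bilinear.scaleR_left[OF mm])
  show ?thesis
    unfolding 1 2 3 4 lmat_nabla2[OF assms i7_less i5_less] scaleR_diff_right sum_subtractf scaleR_minus_right sum_negf ..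
qed

text \<open>The family \<open>TB\<close> is again equivariant, now together with its index a, so the
  second derivative is horizontal too.\<close>

lemma nabla2_form:
  assumes "transpose X = - X"
  shows "- TB a (X *v w) - (\<Sum>d\<in>UNIV. conn X $ d $ a *\<^sub>R TB d w) - transpose (conn X) ** TB a w - TB a w ** conn X
    = (\<Sum>m\<in>UNIV. mcoord X $ m *\<^sub>R T2B m a w)"
proof -
  let ?N = "\<lambda>n. - TB a (bas n *v w) - (\<Sum>d\<in>UNIV. wB n $ d $ a *\<^sub>R TB d w) - transpose (wB n) ** TB a w - TB a w ** wB n"
  note mm = bounded_bilinear_matrix_matrix_mult
  have "X *v w = (\<Sum>n<10. coef n X *\<^sub>R (bas n *v w))"
    by (subst skew_expand[OF assms])
      (simp add: bounded_bilinear.sum_left[OF bounded_bilinear_matrix_vector_mult] scaleR_matrix_vector_assoc)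
  then have "TB a (X *v w) = (\<Sum>n<10. coef n X *\<^sub>R TB a (bas n *v w))"
    by (simp add: linear_sum[OF linear_TB] linear_cmul[OF linear_TB])
  moreover have "(\<Sum>d\<in>UNIV. conn X $ d $ a *\<^sub>R TB d w) = (\<Sum>n<10. coef n X *\<^sub>R (\<Sum>d\<in>UNIV. wB n $ d $ a *\<^sub>R TB d w))"
    by (simp add: conn_def sum_component scaleR_sum_left scaleR_sum_right) (rule sum.swap)
  moreover have "transpose (conn X) = (\<Sum>n<10. coef n X *\<^sub>R transpose (wB n))"
    by (simp add: conn_def linear_sum[OF bounded_linear.linear[OF bounded_linear_transpose]] transpose_scaleR)
  ultimately have "- TB a (X *v w) - (\<Sum>d\<in>UNIV. conn X $ d $ a *\<^sub>R TB d w) - transpose (conn X) ** TB a w - TB a w ** conn X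
      = (\<Sum>n<10. coef n X *\<^sub>R ?N n)"
    by (simp add: conn_def bounded_bilinear.sum_left[OF mm] bounded_bilinear.sum_right[OF mm] matrix_scaleR_mult
        scaleR_diff_right sum_subtractf sum_negf)
  also have "\<dots> = (\<Sum>m\<in>UNIV. coef (i7 m) X *\<^sub>R ?N (i7 m))"
  proof (rule sum_10_7)
    show "coef n X *\<^sub>R ?N n = 0" if "7 \<le> n" "n < 10" for n
    proof -
      have "lmat i7 (nabla2_mat conn_mats nabla_mats n (i7 a) (i5 k)) = 0" for k
      proof (rule lmat_mzero[OF bij_i7 square_nabla2[OF that(2) i7_less i5_less]])
        show "mzero (nabla2_mat conn_mats nabla_mats n (i7 a) (i5 k))"
          by (rule nabla2_horizontal_checked[unfolded nabla2_horizontal_check_def list_all_iff set_upt, rule_format])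
            (use that i7_less i5_less in simp_all)
      qed
      then show ?thesis using nabla2_basis[OF that(2)] by simp
    qed
  qed
  also have "\<dots> = (\<Sum>m\<in>UNIV. mcoord X $ m *\<^sub>R T2B m a w)"
    by (simp only: nabla2_basis[OF i7_less10] T2B_def mcoord_def vec_lambda_beta)
  finally show ?thesis .
qed

text \<open>The metric trace of the second derivative is an equivariant map from R^5 to Sym^2 m.
  Such maps form a line, spanned by \<open>iota\<close>.\<close>

lemma laplacian_contract:
  "(\<Sum>a\<in>UNIV. (1 / nrm (i7 a)) *\<^sub>R T2B a a w) = - (19 / 10) *\<^sub>R iota w"
proof -
  have k: "(\<Sum>a\<in>UNIV. (1 / nrm (i7 a)) *\<^sub>R ((1 / 400) *\<^sub>R lmat i7 (nabla2_mat conn_mats nabla_mats (i7 a) (i7 a) q)))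
      = - (19 / 10) *\<^sub>R lmat i7 (iota_mats ! q)" if q: "q < 5" for q
  proof -
    let ?M = "map (\<lambda>c. nabla2_mat conn_mats nabla_mats c c q) [0..<7]"
    have l: "length inv_norms = 7" by (simp add: inv_norms_def)
    have "lmat i7 (mlin 7 inv_norms ?M) = (\<Sum>n<7. of_int (inv_norms ! n) *\<^sub>R lmat i7 (nabla2_mat conn_mats nabla_mats n n q))"
      by (subst lmat_mlin[OF bij_i7]) (use q in \<open>auto simp: l square_nabla2 simp del: upt_rec_numeral\<close>)
    moreover have "mlin 7 inv_norms ?M = mscale (- 22800) (iota_mats ! q)"
      by (rule laplacian_checked[unfolded laplacian_check_def list_all_iff set_upt, rule_format])
        (use q in simp_all)
    ultimately have "(\<Sum>n<7. of_int (inv_norms ! n) *\<^sub>R lmat i7 (nabla2_mat conn_mats nabla_mats n n q)) = - 22800 *\<^sub>R lmat i7 (iota_mats ! q)"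
      using q by (simp add: lmat_mscale[OF bij_i7] square_iota)
    from arg_cong[OF this, of "\<lambda>A. (1 / 12000) *\<^sub>R A"]
    have "(\<Sum>n<7. (1 / nrm n) *\<^sub>R ((1 / 400) *\<^sub>R lmat i7 (nabla2_mat conn_mats nabla_mats n n q))) = - (19 / 10) *\<^sub>R lmat i7 (iota_mats ! q)"
      by (simp add: scaleR_sum_right inv_norms_nth mult.commute)
    then show ?thesis
      by (simp only: sum_index[OF bij_i7, of "\<lambda>n. (1 / nrm n) *\<^sub>R ((1 / 400) *\<^sub>R lmat i7 (nabla2_mat conn_mats nabla_mats n n q))"])
  qed
  have "(\<Sum>a\<in>UNIV. (1 / nrm (i7 a)) *\<^sub>R T2B a a w) = (\<Sum>j\<in>UNIV. ycoord w j *\<^sub>R (\<Sum>a\<in>UNIV. (1 / nrm (i7 a)) *\<^sub>R ((1 / 400) *\<^sub>R lmat i7 (nabla2_mat conn_mats nabla_mats (i7 a) (i7 a) (i5 j)))))"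
    unfolding T2B_def scaleR_sum_right by (subst sum.swap) (simp add: mult_ac)
  then show ?thesis
    unfolding k[OF i5_less] by (simp add: iota_def scaleR_sum_right mult.commute sum_negf)
qed

section \<open>Killing equation, divergence, trace and norm on the level of m\<close>

lemma trilinear_cyclic_zero:
  fixes t :: "'n::finite \<Rightarrow> 'n \<Rightarrow> 'n \<Rightarrow> real"
  assumes "\<And>a b c. t a b c + t b c a + t c a b = 0"
  shows "(\<Sum>a\<in>UNIV. \<Sum>b\<in>UNIV. \<Sum>c\<in>UNIV. v a * v b * v c * t a b c) = 0"
proof -
  let ?S = "\<Sum>a\<in>UNIV. \<Sum>b\<in>UNIV. \<Sum>c\<in>UNIV. v a * v b * v c * t a b c"
  have 1: "(\<Sum>a\<in>UNIV. \<Sum>b\<in>UNIV. \<Sum>c\<in>UNIV. v a * v b * v c * t b c a) = ?S"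
    by (subst sum_swap3) (simp add: mult_ac)
  have 2: "(\<Sum>a\<in>UNIV. \<Sum>b\<in>UNIV. \<Sum>c\<in>UNIV. v a * v b * v c * t c a b) = ?S"
    by (subst sum_swap3[symmetric]) (simp add: mult_ac)
  have "?S + (\<Sum>a\<in>UNIV. \<Sum>b\<in>UNIV. \<Sum>c\<in>UNIV. v a * v b * v c * t b c a)
      + (\<Sum>a\<in>UNIV. \<Sum>b\<in>UNIV. \<Sum>c\<in>UNIV. v a * v b * v c * t c a b)
      = (\<Sum>a\<in>UNIV. \<Sum>b\<in>UNIV. \<Sum>c\<in>UNIV. v a * v b * v c * (t a b c + t b c a + t c a b))"
    by (simp only: distrib_left sum.distrib)
  then show ?thesis unfolding 1 2 by (simp add: assms)
qed

lemma TB_entry: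
  "TB a w $ b $ c = (\<Sum>k\<in>UNIV. ycoord w k * (of_int (nabla_mats ! i7 a ! i5 k ! i7 b ! i7 c) / 20))"
  by (simp add: TB_def lmat_def sum_component)

text \<open>A cubic form depends only on the cyclic sums of its coefficients, and those vanish by
  \<open>killing_check\<close>.\<close>

lemma killing_contract: "(\<Sum>a\<in>UNIV. v $ a * (v \<bullet> (TB a w *v v))) = 0"
proof -
  have "TB a w $ b $ c + TB b w $ c $ a + TB c w $ a $ b = 0" for a b c
  proof -
    have "nabla_mats ! i7 a ! i5 k ! i7 b ! i7 c + nabla_mats ! i7 b ! i5 k ! i7 c ! i7 a
        + nabla_mats ! i7 c ! i5 k ! i7 a ! i7 b = 0" for k
      by (rule killing_checked[unfolded killing_check_def list_all_iff set_upt, rule_format])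
        (use i7_less i5_less in simp_all)
    from arg_cong[OF this, of real_of_int] show ?thesis
      unfolding TB_entry sum.distrib[symmetric] distrib_left[symmetric] add_divide_distrib[symmetric]
      by (simp flip: of_int_add)
  qed
  from trilinear_cyclic_zero[of "\<lambda>a b c. TB a w $ b $ c" "\<lambda>a. v $ a", OF this] show ?thesis
    by (simp add: dot_matrix_vector_mult sum_distrib_left mult_ac)
qed

lemma divergence_contract: "(\<Sum>a\<in>UNIV. (TB a w *v v) $ a / nrm (i7 a)) = 0"
proof -
  have k: "(\<Sum>a\<in>UNIV. TB a w $ a $ b / nrm (i7 a)) = 0" for b
  proof -
    have "(\<Sum>n<7. of_int (nabla_mats ! n ! i5 k ! n ! i7 b) / nrm n) = 0" for k
    proof -
      have "(\<Sum>n<7. inv_norms ! n * nabla_mats ! n ! i5 k ! n ! i7 b) = 0"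
        unfolding sum_list_upt[symmetric]
        by (rule divergence_checked[unfolded divergence_check_def list_all_iff set_upt, rule_format])
          (use i7_less i5_less in simp_all)
      from arg_cong[OF this, of real_of_int] show ?thesis
        by (simp add: inv_norms_nth sum_distrib_left[symmetric] flip: times_divide_eq_right)
    qed
    then have z: "(\<Sum>a\<in>UNIV. of_int (nabla_mats ! i7 a ! i5 k ! i7 a ! i7 b) / nrm (i7 a)) = 0" for k
      by (simp only: sum_index[OF bij_i7, of "\<lambda>n. of_int (nabla_mats ! n ! i5 k ! n ! i7 b) / nrm n"])
    have "(\<Sum>a\<in>UNIV. TB a w $ a $ b / nrm (i7 a)) = (\<Sum>k\<in>UNIV. ycoord w k / 20 * (\<Sum>a\<in>UNIV. of_int (nabla_mats ! i7 a ! i5 k ! i7 a ! i7 b) / nrm (i7 a)))"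
      unfolding TB_entry sum_divide_distrib sum_distrib_left by (subst sum.swap) simp
    then show ?thesis by (simp add: z)
  qed
  have "(\<Sum>a\<in>UNIV. (TB a w *v v) $ a / nrm (i7 a)) = (\<Sum>b\<in>UNIV. v $ b * (\<Sum>a\<in>UNIV. TB a w $ a $ b / nrm (i7 a)))"
    unfolding matrix_vector_mult_def sum_distrib_left
    by (subst sum.swap) (simp add: sum_divide_distrib mult.commute)
  then show ?thesis by (simp add: k)
qed

lemma iota_entry:
  "iota w $ a $ b = (\<Sum>k\<in>UNIV. ycoord w k * of_int (iota_mats ! i5 k ! i7 a ! i7 b))"
  by (simp add: iota_def lmat_def sum_component)

lemma iota_symmetric: "iota w $ a $ b = iota w $ b $ a"
proof -
  have "iota_mats ! i5 k ! i7 a ! i7 b = iota_mats ! i5 k ! i7 b ! i7 a" for k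
    by (rule iota_symmetric_checked[unfolded iota_symmetric_check_def list_all_iff set_upt, rule_format])
      (use i7_less i5_less in simp_all)
  then show ?thesis by (simp add: iota_entry)
qed

lemma trace_contract: "(\<Sum>a\<in>UNIV. iota w $ a $ a / nrm (i7 a)) = 0"
proof -
  have "(\<Sum>n<7. of_int (iota_mats ! i5 k ! n ! n) / nrm n) = 0" for k
  proof -
    have "(\<Sum>n<7. inv_norms ! n * iota_mats ! i5 k ! n ! n) = 0"
      unfolding sum_list_upt[symmetric]
      by (rule trace_checked[unfolded trace_check_def list_all_iff set_upt, rule_format])
        (use i7_less i5_less in simp_all)
    from arg_cong[OF this, of real_of_int] show ?thesis
      by (simp add: inv_norms_nth sum_distrib_left[symmetric] flip: times_divide_eq_right)
  qed
  then have z: "(\<Sum>a\<in>UNIV. of_int (iota_mats ! i5 k ! i7 a ! i7 a) / nrm (i7 a)) = 0" for k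
    by (simp only: sum_index[OF bij_i7, of "\<lambda>n. of_int (iota_mats ! i5 k ! n ! n) / nrm n"])
  have "(\<Sum>a\<in>UNIV. iota w $ a $ a / nrm (i7 a)) = (\<Sum>k\<in>UNIV. ycoord w k * (\<Sum>a\<in>UNIV. of_int (iota_mats ! i5 k ! i7 a ! i7 a) / nrm (i7 a)))"
    unfolding iota_entry sum_divide_distrib sum_distrib_left by (subst sum.swap) simp
  then show ?thesis by (simp add: z)
qed

text \<open>Gives the pointwise norm of the tensors and, being definite, injectivity of
  \<open>iota\<close>.\<close>

lemma inner_contract:
  "(\<Sum>a\<in>UNIV. \<Sum>b\<in>UNIV. iota w $ a $ b * iota w $ a $ b / (nrm (i7 a) * nrm (i7 b))) = 112 / 25 * (w \<bullet> w)"
proof -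
  let ?I = "\<lambda>k n m. of_int (iota_mats ! i5 k ! n ! m) :: real"
  have z: "(\<Sum>a\<in>UNIV. \<Sum>b\<in>UNIV. ?I k (i7 a) (i7 b) * ?I l (i7 a) (i7 b) / (nrm (i7 a) * nrm (i7 b)))
      = (if k = l then 112 / 25 * (dd k * dd k) else 0)" for k l
  proof -
    have "(\<Sum>n<7. \<Sum>m<7. inv_norms ! n * inv_norms ! m * iota_mats ! i5 k ! n ! m * iota_mats ! i5 l ! n ! m)
        = (if i5 k = i5 l then 4032 * (if i5 k = 1 then 3 else 1) else 0)"
      unfolding sum_list_upt[symmetric]
      by (rule inner_checked[unfolded inner_check_def list_all_iff set_upt, rule_format])
        (use i7_less i5_less in simp_all)
    note c = arg_cong[OF this, of real_of_int]
    have "900 * (\<Sum>n<7. \<Sum>m<7. ?I k n m * ?I l n m / (nrm n * nrm m))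
        = (\<Sum>n<7. \<Sum>m<7. of_int (inv_norms ! n * inv_norms ! m * iota_mats ! i5 k ! n ! m * iota_mats ! i5 l ! n ! m))"
      unfolding sum_distrib_left by (intro sum.cong refl) (simp add: inv_norms_nth)
    also have "\<dots> = of_int (if i5 k = i5 l then 4032 * (if i5 k = 1 then 3 else 1) else 0)"
      unfolding c[symmetric] by simp
    also have "\<dots> = (if k = l then 4032 * (dd k * dd k) else 0)"
      by (simp add: i5_eq) (simp add: dd_def i5_def)
    finally have "(\<Sum>n<7. \<Sum>m<7. ?I k n m * ?I l n m / (nrm n * nrm m)) = (if k = l then 112 / 25 * (dd k * dd k) else 0)"
      by (simp split: if_splits)
    then show ?thesis
      by (simp only: sum_index[OF bij_i7, of "\<lambda>m. ?I k (i7 _) m * ?I l (i7 _) m / (nrm (i7 _) * nrm m)"]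
          sum_index[OF bij_i7, of "\<lambda>n. \<Sum>m<7. ?I k n m * ?I l n m / (nrm n * nrm m)"])
  qed
  have "(\<Sum>a\<in>UNIV. \<Sum>b\<in>UNIV. iota w $ a $ b * iota w $ a $ b / (nrm (i7 a) * nrm (i7 b)))
      = (\<Sum>a\<in>UNIV. \<Sum>b\<in>UNIV. \<Sum>k\<in>UNIV. \<Sum>l\<in>UNIV. ycoord w k * ycoord w l
          * (?I k (i7 a) (i7 b) * ?I l (i7 a) (i7 b) / (nrm (i7 a) * nrm (i7 b))))"
    unfolding iota_entry sum_product sum_divide_distrib by (intro sum.cong refl) (simp add: mult_ac)
  also have "\<dots> = (\<Sum>k\<in>UNIV. \<Sum>l\<in>UNIV. ycoord w k * ycoord w l * (\<Sum>a\<in>UNIV. \<Sum>b\<in>UNIV.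
          ?I k (i7 a) (i7 b) * ?I l (i7 a) (i7 b) / (nrm (i7 a) * nrm (i7 b))))"
    unfolding sum_distrib_left by (rule sum_swap4)
  also have "\<dots> = (\<Sum>k\<in>UNIV. 112 / 25 * (ycoord w k * dd k) * (ycoord w k * dd k))"
  proof (rule sum.cong[OF refl])
    fix k
    have "(\<Sum>l\<in>UNIV. ycoord w k * ycoord w l * (if k = l then 112 / 25 * (dd k * dd k) else 0))
        = ycoord w k * ycoord w k * (112 / 25 * (dd k * dd k))"
      by (simp add: if_distrib[of "\<lambda>x. _ * x"] cong: if_cong)
    then show "(\<Sum>l\<in>UNIV. ycoord w k * ycoord w l * (\<Sum>a\<in>UNIV. \<Sum>b\<in>UNIV.
          ?I k (i7 a) (i7 b) * ?I l (i7 a) (i7 b) / (nrm (i7 a) * nrm (i7 b))))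
        = 112 / 25 * (ycoord w k * dd k) * (ycoord w k * dd k)"
      unfolding z by (simp add: mult_ac)
  qed
  also have "\<dots> = 112 / 25 * (w \<bullet> w)"
    by (simp add: ycoord_def dd_nz inner_vec_def sum_distrib_left mult.assoc)
  finally show ?thesis .
qed

lemma iota_eq_0: "iota w = 0 \<Longrightarrow> w = 0"
  using inner_contract[of w] by simp

lemma invertible_metric:
  assumes "k \<noteq> 0"
  shows "invertible (k *\<^sub>R G0)"
    and "matrix_inv (k *\<^sub>R G0) = (\<chi> a b. if a = b then 1 / (k * nrm (i7 a)) else 0)"
proof -
  define E :: "real^7^7" where "E = (\<chi> a b. if a = b then 1 / (k * nrm (i7 a)) else 0)"
  have n: "nrm (i7 a) \<noteq> 0" for a using nrm_pos[OF i7_less10, of a] by simp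
  have D: "(E *v v) $ a = v $ a / (k * nrm (i7 a))" for v a
    by (simp add: E_def matrix_vector_mult_def if_distrib[of "\<lambda>x. x * _"] cong: if_cong)
  have "(k *\<^sub>R G0) *v (E *v v) = v" "E *v ((k *\<^sub>R G0) *v v) = v" for v
    using n assms by (simp_all add: vec_eq_iff D G0_mult flip: scaleR_matrix_vector_assoc)
  then have 1: "(k *\<^sub>R G0) ** E = mat 1" "E ** (k *\<^sub>R G0) = mat 1"
    by (simp_all add: matrix_eq flip: matrix_vector_mul_assoc)
  then show i: "invertible (k *\<^sub>R G0)" by (auto simp: invertible_def)
  have "matrix_inv (k *\<^sub>R G0) ** ((k *\<^sub>R G0) ** E) = E"
    by (simp add: matrix_mul_assoc matrix_inv_left[OF i])
  then show "matrix_inv (k *\<^sub>R G0) = (\<chi> a b. if a = b then 1 / (k * nrm (i7 a)) else 0)"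
    unfolding 1 by (simp add: E_def)
qed

lemma sum_inverse_metric:
  "k \<noteq> 0 \<Longrightarrow> (\<Sum>a\<in>UNIV. \<Sum>b\<in>UNIV. matrix_inv (k *\<^sub>R G0) $ a $ b * F a b)
    = (\<Sum>a\<in>UNIV. F a a / nrm (i7 a)) / k"
  by (simp add: invertible_metric if_distrib[of "\<lambda>x. x * _"] sum_divide_distrib cong: if_cong)
    (simp add: mult.commute)

section \<open>Uniqueness of the invariant inner product on m\<close>

lemma conn_mats_so3:
  "conn_mats ! 7 = [[0, 0, 0, 0, -120, 0, 0], [0, 0, 0, 0, 0, -30, 0], [0, 0, 0, 0, 0, -10, 0], [0, 0, 0, 0, 0, 0, -30], [20, 0, 0, 0, 0, 0, 10], [0, 20, 100, 0, 0, 0, 0], [0, 0, 0, 20, -100, 0, 0]]"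
  "conn_mats ! 8 = [[0, 0, 120, 0, 0, 0, 0], [0, 0, 0, 0, 0, 0, -30], [-20, 0, 0, 0, 0, 0, 10], [0, 0, 0, 0, 0, 30, 0], [0, 0, 0, 0, 0, 10, 0], [0, 0, 0, -20, -100, 0, 0], [0, 20, -100, 0, 0, 0, 0]]"
  "conn_mats ! 9 = [[0, 0, 0, 0, 0, 0, 0], [0, 0, 0, 60, 0, 0, 0], [0, 0, 0, 0, -20, 0, 0], [0, -60, 0, 0, 0, 0, 0], [0, 0, 20, 0, 0, 0, 0], [0, 0, 0, 0, 0, 0, 40], [0, 0, 0, 0, 0, -40, 0]]"
  by code_simp+

text \<open>\<open>m\<close> is an irreducible representation of \<open>so(3)\<close>, hence its invariant inner product is unique.\<close>

lemma invariant_form_unique: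
  fixes b :: "real^7^7"
  assumes sym: "transpose b = b"
    and inv: "\<And>n. 7 \<le> n \<Longrightarrow> n < 10 \<Longrightarrow> transpose (wB n) ** b + b ** wB n = 0"
  obtains k where "b = k *\<^sub>R G0"
proof -
  define j7 where "j7 = inv_into UNIV i7"
  have j7: "j7 (i7 a) = a" for a
    using bij_i7 by (simp add: j7_def bij_betw_def)
  have i7j: "i7 (j7 n) = n" if "n < 7" for n
    using that bij_i7 by (auto simp: j7_def bij_betw_def intro: f_inv_into_f)
  define \<beta> where "\<beta> n m = b $ j7 n $ j7 m" for n m
  have bsym: "\<beta> n m = \<beta> m n" for n m
    using arg_cong[OF sym, of "\<lambda>B. B $ j7 n $ j7 m"] by (simp add: transpose_def \<beta>_def)
  have eq: "(\<Sum>c<7. of_int (conn_mats ! n ! c ! i) * \<beta> c j + \<beta> i c * of_int (conn_mats ! n ! c ! j)) = 0"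
    if n: "7 \<le> n" "n < 10" and ij: "i < 7" "j < 7" for n i j
  proof -
    have "20 * (transpose (wB n) ** b + b ** wB n) $ j7 i $ j7 j = 0"
      using inv[OF n] by simp
    also have "20 * (transpose (wB n) ** b + b ** wB n) $ j7 i $ j7 j
        = (\<Sum>c\<in>UNIV. of_int (conn_mats ! n ! i7 c ! i) * \<beta> (i7 c) j + \<beta> i (i7 c) * of_int (conn_mats ! n ! i7 c ! j))"
      by (simp add: matrix_matrix_mult_def transpose_def wB_def lmat_def \<beta>_def j7 i7j ij sum.distrib sum_distrib_left)
    finally show ?thesis
      by (simp only: sum_index[OF bij_i7, of "\<lambda>c. of_int (conn_mats ! n ! c ! i) * \<beta> c j + \<beta> i c * of_int (conn_mats ! n ! c ! j)"])
  qed
  have lt: "{..<7::nat} = {0, 1, 2, 3, 4, 5, 6}" by auto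
  note bs = bsym[of "Suc 0" 0] bsym[of 2 0] bsym[of 3 0] bsym[of 4 0] bsym[of 5 0] bsym[of 6 0] bsym[of 2 "Suc 0"] bsym[of 3 "Suc 0"]
    bsym[of 4 "Suc 0"] bsym[of 5 "Suc 0"] bsym[of 6 "Suc 0"] bsym[of 3 2] bsym[of 4 2] bsym[of 5 2] bsym[of 6 2] bsym[of 4 3]
    bsym[of 5 3] bsym[of 6 3] bsym[of 5 4] bsym[of 6 4] bsym[of 6 5]
  \<comment> \<open>A selection of entries of the invariance condition in triangular form:
    \<open>e0\<close> to \<open>e20\<close> yield one vanishing off-diagonal entry each,
    \<open>e21\<close> to \<open>e26\<close> link the seven diagonal ones.\<close>
  have e0: "40 * \<beta> 0 4 = 0"
    by (rule trans[OF _ eq[of 7 0 0]]) (simp_all add: lt conn_mats_so3 bs)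
  have e1: "40 * \<beta> (Suc 0) 5 = 0"
    by (rule trans[OF _ eq[of 7 1 1]]) (simp_all add: lt conn_mats_so3 bs)
  have e2: "20 * \<beta> 2 5 + 100 * \<beta> (Suc 0) 5 = 0"
    by (rule trans[OF _ eq[of 7 1 2]]) (simp_all add: lt conn_mats_so3 bs)
  have e3: "40 * \<beta> 3 6 = 0"
    by (rule trans[OF _ eq[of 7 3 3]]) (simp_all add: lt conn_mats_so3 bs)
  have e4: "-240 * \<beta> 0 4 - 200 * \<beta> 4 6 = 0"
    by (rule trans[OF _ eq[of 7 4 4]]) (simp_all add: lt conn_mats_so3 bs)
  have e5: "-40 * \<beta> 0 2 = 0"
    by (rule trans[OF _ eq[of 8 0 0]]) (simp_all add: lt conn_mats_so3 bs)
  have e6: "-20 * \<beta> 2 5 + 30 * \<beta> 0 3 + 10 * \<beta> 0 4 = 0"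
    by (rule trans[OF _ eq[of 8 0 5]]) (simp_all add: lt conn_mats_so3 bs)
  have e7: "40 * \<beta> (Suc 0) 6 = 0"
    by (rule trans[OF _ eq[of 8 1 1]]) (simp_all add: lt conn_mats_so3 bs)
  have e8: "240 * \<beta> 0 2 - 200 * \<beta> 2 6 = 0"
    by (rule trans[OF _ eq[of 8 2 2]]) (simp_all add: lt conn_mats_so3 bs)
  have e9: "-40 * \<beta> 3 5 = 0"
    by (rule trans[OF _ eq[of 8 3 3]]) (simp_all add: lt conn_mats_so3 bs)
  have e10: "-20 * \<beta> 4 5 - 100 * \<beta> 3 5 = 0"
    by (rule trans[OF _ eq[of 8 3 4]]) (simp_all add: lt conn_mats_so3 bs)
  have e11: "60 * \<beta> 0 (Suc 0) = 0"
    by (rule trans[OF _ eq[of 9 0 3]]) (simp_all add: lt conn_mats_so3 bs)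
  have e12: "-40 * \<beta> 0 6 = 0"
    by (rule trans[OF _ eq[of 9 0 5]]) (simp_all add: lt conn_mats_so3 bs)
  have e13: "40 * \<beta> 0 5 = 0"
    by (rule trans[OF _ eq[of 9 0 6]]) (simp_all add: lt conn_mats_so3 bs)
  have e14: "-120 * \<beta> (Suc 0) 3 = 0"
    by (rule trans[OF _ eq[of 9 1 1]]) (simp_all add: lt conn_mats_so3 bs)
  have e15: "40 * \<beta> 2 4 = 0"
    by (rule trans[OF _ eq[of 9 2 2]]) (simp_all add: lt conn_mats_so3 bs)
  have e16: "-80 * \<beta> 5 6 = 0"
    by (rule trans[OF _ eq[of 9 5 5]]) (simp_all add: lt conn_mats_so3 bs)
  have e17: "20 * \<beta> (Suc 0) 4 + 20 * \<beta> 0 5 = 0"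
    by (rule trans[OF _ eq[of 7 0 1]]) (simp_all add: lt conn_mats_so3 bs)
  have e18: "20 * \<beta> 3 4 + 20 * \<beta> 0 6 = 0"
    by (rule trans[OF _ eq[of 7 0 3]]) (simp_all add: lt conn_mats_so3 bs)
  have e19: "-30 * \<beta> 2 3 + 10 * \<beta> 2 4 + 100 * \<beta> 5 6 = 0"
    by (rule trans[OF _ eq[of 7 2 6]]) (simp_all add: lt conn_mats_so3 bs)
  have e20: "-20 * \<beta> (Suc 0) 2 + 20 * \<beta> 0 6 = 0"
    by (rule trans[OF _ eq[of 8 0 1]]) (simp_all add: lt conn_mats_so3 bs)
  have e21: "-120 * \<beta> 0 0 + 20 * \<beta> 4 4 - 100 * \<beta> 0 6 = 0"
    by (rule trans[OF _ eq[of 7 0 4]]) (simp_all add: lt conn_mats_so3 bs)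
  have e22: "-30 * \<beta> (Suc 0) (Suc 0) - 10 * \<beta> (Suc 0) 2 + 20 * \<beta> 5 5 = 0"
    by (rule trans[OF _ eq[of 7 1 5]]) (simp_all add: lt conn_mats_so3 bs)
  have e23: "-30 * \<beta> (Suc 0) 2 - 10 * \<beta> 2 2 + 100 * \<beta> 5 5 = 0"
    by (rule trans[OF _ eq[of 7 2 5]]) (simp_all add: lt conn_mats_so3 bs)
  have e24: "-30 * \<beta> 3 3 + 10 * \<beta> 3 4 + 20 * \<beta> 6 6 = 0"
    by (rule trans[OF _ eq[of 7 3 6]]) (simp_all add: lt conn_mats_so3 bs)
  have e25: "-120 * \<beta> 0 6 - 30 * \<beta> 3 4 + 10 * \<beta> 4 4 - 100 * \<beta> 6 6 = 0"
    by (rule trans[OF _ eq[of 7 4 6]]) (simp_all add: lt conn_mats_so3 bs)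
  have e26: "-30 * \<beta> (Suc 0) (Suc 0) + 10 * \<beta> (Suc 0) 2 + 20 * \<beta> 6 6 = 0"
    by (rule trans[OF _ eq[of 8 1 6]]) (simp_all add: lt conn_mats_so3 bs)
  note e = e0 e1 e2 e3 e4 e5 e6 e7 e8 e9 e10 e11 e12 e13 e14 e15 e16 e17 e18 e19 e20 e21 e22 e23 e24 e25 e26
  have z: "\<beta> 0 4 = 0" "\<beta> (Suc 0) 5 = 0" "\<beta> 2 5 = 0" "\<beta> 3 6 = 0" "\<beta> 4 6 = 0" "\<beta> 0 2 = 0" "\<beta> (Suc 0) 6 = 0" "\<beta> 2 6 = 0"
    "\<beta> 3 5 = 0" "\<beta> 4 5 = 0" "\<beta> 0 6 = 0" "\<beta> 0 5 = 0" "\<beta> (Suc 0) 3 = 0" "\<beta> 2 4 = 0" "\<beta> 5 6 = 0" "\<beta> 0 3 = 0" "\<beta> 0 (Suc 0) = 0"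
    "\<beta> (Suc 0) 4 = 0" "\<beta> 3 4 = 0" "\<beta> 2 3 = 0" "\<beta> (Suc 0) 2 = 0"
    using e by linarith+
  \<comment> \<open>The factors are the ratios of \<open>basis_norms\<close> to its first entry
    5.\<close>
  have d: "\<beta> (Suc 0) (Suc 0) = 2 / 5 * \<beta> 0 0" "\<beta> 2 2 = 6 * \<beta> 0 0" "\<beta> 3 3 = 2 / 5 * \<beta> 0 0" "\<beta> 4 4 = 6 * \<beta> 0 0"
    "\<beta> 5 5 = 3 / 5 * \<beta> 0 0" "\<beta> 6 6 = 3 / 5 * \<beta> 0 0"
    using e z by linarith+
  have "b $ a $ c = ((\<beta> 0 0 / 5) *\<^sub>R G0) $ a $ c" for a c
  proof -
    have "b $ a $ c = \<beta> (i7 a) (i7 c)" by (simp add: \<beta>_def j7)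
    also have "\<dots> = (if i7 a = i7 c then \<beta> 0 0 / 5 * nrm (i7 a) else 0)"
      using less_7_cases[OF i7_less[of a]] less_7_cases[OF i7_less[of c]]
      by (elim disjE) (simp_all add: z d bs nrm_def basis_norms_def)
    also have "\<dots> = ((\<beta> 0 0 / 5) *\<^sub>R G0) $ a $ c" by (simp add: G0_def i7_eq)
    finally show ?thesis .
  qed
  then show ?thesis by (intro that[of "\<beta> 0 0 / 5"]) (simp add: vec_eq_iff)
qed

section \<open>The isotropy group\<close>

lemma sym_traceless_entry:
  "sym_traceless x $ 1 $ 1 = x $ 1 - x $ 2 / sqrt 3" "sym_traceless x $ 1 $ 2 = x $ 3"
  "sym_traceless x $ 1 $ 3 = x $ 4" "sym_traceless x $ 2 $ 1 = x $ 3"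
  "sym_traceless x $ 2 $ 2 = - x $ 1 - x $ 2 / sqrt 3" "sym_traceless x $ 2 $ 3 = x $ 5"
  "sym_traceless x $ 3 $ 1 = x $ 4" "sym_traceless x $ 3 $ 2 = x $ 5"
  "sym_traceless x $ 3 $ 3 = 2 * x $ 2 / sqrt 3"
  by (simp_all add: sym_traceless_def vector_3)

definition unsym :: "real^3^3 \<Rightarrow> real^5" where
  "unsym M = (\<chi> i. if i = 1 then (M $ 1 $ 1 - M $ 2 $ 2) / 2 else if i = 2 then sqrt 3 / 2 * M $ 3 $ 3
     else if i = 3 then M $ 1 $ 2 else if i = 4 then M $ 1 $ 3 else M $ 2 $ 3)"

lemma unsym_sym_traceless: "unsym (sym_traceless x) = x"
  by (simp add: unsym_def vec_eq_iff forall_5 sym_traceless_entry)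

lemma sym_traceless_unsym:
  assumes "transpose M = M" "trace M = 0"
  shows "sym_traceless (unsym M) = M"
proof -
  have s: "M $ 2 $ 1 = M $ 1 $ 2" "M $ 3 $ 1 = M $ 1 $ 3" "M $ 3 $ 2 = M $ 2 $ 3"
    using arg_cong[OF assms(1), of "\<lambda>B. B $ 1 $ 2"] arg_cong[OF assms(1), of "\<lambda>B. B $ 1 $ 3"]
      arg_cong[OF assms(1), of "\<lambda>B. B $ 2 $ 3"] by (simp_all add: transpose_def)
  have t: "M $ 3 $ 3 = - M $ 1 $ 1 - M $ 2 $ 2"
    using assms(2) by (simp add: trace_def sum_3)
  show ?thesis
    by (simp add: vec_eq_iff forall_3 sym_traceless_entry unsym_def s) (simp add: t field_simps)
qed

lemma linear_sym_traceless: "linear sym_traceless"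
  by (simp add: linear_iff vec_eq_iff forall_3 sym_traceless_entry add_divide_distrib diff_divide_distrib algebra_simps)

lemma linear_unsym: "linear unsym"
  by (simp add: linear_iff vec_eq_iff forall_5 unsym_def algebra_simps add_divide_distrib diff_divide_distrib)

lemma sym_traceless_inject: "sym_traceless x = sym_traceless y \<longleftrightarrow> x = y"
  by (metis unsym_sym_traceless)

lemma transpose_sym_traceless: "transpose (sym_traceless x) = sym_traceless x"
  by (simp add: vec_eq_iff forall_3 transpose_def sym_traceless_entry)

lemma trace_sym_traceless: "trace (sym_traceless x) = 0"
  by (simp add: trace_def sum_3 sym_traceless_entry)

lemma inner_sym_traceless: "x \<bullet> y = trace (sym_traceless x ** sym_traceless y) / 2"
  by (simp add: trace_def matrix_matrix_mult_def sum_3 sym_traceless_entry inner_vec_def sum_5 field_simps)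

lemma rotation_mult_transpose:
  "rotation_matrix (A :: real^'n^'n) \<Longrightarrow> A ** transpose A = mat 1"
  "rotation_matrix A \<Longrightarrow> transpose A ** A = mat 1"
  by (auto simp: rotation_matrix_def orthogonal_matrix_def)

lemma rotation_conj:
  fixes A :: "real^'n^'n"
  assumes "rotation_matrix A"
  shows "(A ** S ** transpose A) ** (A ** T ** transpose A) = A ** (S ** T) ** transpose A"
proof -
  have "(A ** S ** transpose A) ** (A ** T ** transpose A) = A ** S ** (transpose A ** A) ** T ** transpose A"
    by (simp add: matrix_mul_assoc)
  then show ?thesis by (simp add: rotation_mult_transpose[OF assms] matrix_mul_assoc)
qed

lemma trace_conj:
  fixes A :: "real^'n^'n"
  assumes "rotation_matrix A"
  shows "trace (A ** S ** transpose A) = trace S"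
  using trace_mul_sym[of "A ** S" "transpose A"]
  by (simp add: matrix_mul_assoc rotation_mult_transpose[OF assms])

lemma rotation_matrix_transpose: "rotation_matrix (A :: real^'n^'n) \<Longrightarrow> rotation_matrix (transpose A)"
  by (simp add: rotation_matrix_def)

lemma rotation_matrix_mult:
  "rotation_matrix (A :: real^'n^'n) \<Longrightarrow> rotation_matrix B \<Longrightarrow> rotation_matrix (A ** B)"
  by (simp add: rotation_matrix_def orthogonal_matrix_mul det_mul)

lemma rotation_matrix_mat_1: "rotation_matrix (mat 1 :: real^'n^'n)"
  by (simp add: rotation_matrix_def orthogonal_matrix_id)

text \<open>Conjugation by A preserves tr(S T), which is twice the inner product of R^5.\<close>

lemma SO3_irr_orthogonal:
  assumes "Q \<in> SO3_irr"
  shows "transpose Q ** Q = mat 1" "Q ** transpose Q = mat 1"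
proof -
  obtain A :: "real^3^3" where A: "rotation_matrix A"
    "\<And>x. sym_traceless (Q *v x) = A ** sym_traceless x ** transpose A"
    using assms unfolding SO3_irr_def by blast
  have "(Q *v x) \<bullet> (Q *v y) = x \<bullet> y" for x y
    by (simp add: inner_sym_traceless A(2) rotation_conj[OF A(1)] trace_conj[OF A(1)])
  then have "x \<bullet> ((transpose Q ** Q) *v y) = x \<bullet> y" for x y
    by (simp add: dot_vector_matrix_mult inner_commute flip: matrix_vector_mul_assoc)
  then have "(transpose Q ** Q) *v y = y" for y
    using vector_eq_ldot by blast
  then show 1: "transpose Q ** Q = mat 1"
    by (simp add: matrix_eq)
  then show "Q ** transpose Q = mat 1"
    using matrix_left_right_inverse by blast
qed

lemma SO3_irr_mat_1: "mat 1 \<in> SO3_irr"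
  unfolding SO3_irr_def using rotation_matrix_mat_1[where 'n = 3] by (auto intro!: exI[of _ "mat 1"])

lemma SO3_irr_mult:
  assumes "P \<in> SO3_irr" "Q \<in> SO3_irr"
  shows "P ** Q \<in> SO3_irr"
proof -
  obtain A :: "real^3^3" where A: "rotation_matrix A"
    "\<And>x. sym_traceless (P *v x) = A ** sym_traceless x ** transpose A"
    using assms unfolding SO3_irr_def by blast
  obtain B :: "real^3^3" where B: "rotation_matrix B"
    "\<And>x. sym_traceless (Q *v x) = B ** sym_traceless x ** transpose B"
    using assms unfolding SO3_irr_def by blast
  have "sym_traceless ((P ** Q) *v x) = (A ** B) ** sym_traceless x ** transpose (A ** B)" for x
    by (simp add: A(2) B(2) matrix_transpose_mul matrix_mul_assoc flip: matrix_vector_mul_assoc)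
  then show ?thesis
    unfolding SO3_irr_def using rotation_matrix_mult[OF A(1) B(1)] by blast
qed

lemma SO3_irr_transpose:
  assumes "Q \<in> SO3_irr"
  shows "transpose Q \<in> SO3_irr"
proof -
  obtain A :: "real^3^3" where A: "rotation_matrix A"
    "\<And>x. sym_traceless (Q *v x) = A ** sym_traceless x ** transpose A"
    using assms unfolding SO3_irr_def by blast
  have "sym_traceless (transpose Q *v x) = transpose A ** sym_traceless x ** transpose (transpose A)" for x
  proof -
    have "sym_traceless x = A ** sym_traceless (transpose Q *v x) ** transpose A"
      using A(2)[of "transpose Q *v x"]
      by (simp only: matrix_vector_mul_assoc SO3_irr_orthogonal[OF assms] matrix_vector_mul_lid)
    then have "transpose A ** sym_traceless x ** A
        = (transpose A ** A) ** sym_traceless (transpose Q *v x) ** (transpose A ** A)"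
      by (simp only: matrix_mul_assoc)
    then show ?thesis by (simp add: rotation_mult_transpose[OF A(1)])
  qed
  then show ?thesis
    unfolding SO3_irr_def using rotation_matrix_transpose[OF A(1)] by blast
qed

section \<open>Jordan multiplication and equivariance of \<open>iota\<close>\<close>

definition jordan :: "real^5 \<Rightarrow> real^5^5" where
  "jordan w = (\<Sum>j\<in>UNIV. ycoord w j *\<^sub>R conjD (lmat i5 (jordan_mats ! i5 j)))"

lemma jordan_mats_nth:
  "jordan_mats ! 0 = [[0, -6, 0, 0, 0], [-2, 0, 0, 0, 0], [0, 0, 0, 0, 0], [0, 0, 0, 3, 0], [0, 0, 0, 0, -3]]"
  "jordan_mats ! Suc 0 = [[-6, 0, 0, 0, 0], [0, 6, 0, 0, 0], [0, 0, -6, 0, 0], [0, 0, 0, 3, 0], [0, 0, 0, 0, 3]]"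
  "jordan_mats ! 2 = [[0, 0, 0, 0, 0], [0, 0, -2, 0, 0], [0, -6, 0, 0, 0], [0, 0, 0, 0, 3], [0, 0, 0, 3, 0]]"
  "jordan_mats ! 3 = [[0, 0, 0, 3, 0], [0, 0, 0, 1, 0], [0, 0, 0, 0, 3], [3, 3, 0, 0, 0], [0, 0, 3, 0, 0]]"
  "jordan_mats ! 4 = [[0, 0, 0, 0, -3], [0, 0, 0, 0, 1], [0, 0, 0, 3, 0], [0, 0, 3, 0, 0], [-3, 3, 0, 0, 0]]"
  by (simp_all add: jordan_mats_def)

lemma jordan_nth:
  "(jordan w *v u) $ 1 = 3 * (w $ 4 * u $ 4 - w $ 5 * u $ 5) - 2 * sqrt 3 * (w $ 1 * u $ 2 + w $ 2 * u $ 1)"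
  "(jordan w *v u) $ 2 = sqrt 3 * (2 * w $ 2 * u $ 2 - 2 * w $ 1 * u $ 1 - 2 * w $ 3 * u $ 3 + w $ 4 * u $ 4 + w $ 5 * u $ 5)"
  "(jordan w *v u) $ 3 = 3 * (w $ 4 * u $ 5 + w $ 5 * u $ 4) - 2 * sqrt 3 * (w $ 2 * u $ 3 + w $ 3 * u $ 2)"
  "(jordan w *v u) $ 4 = 3 * (w $ 1 * u $ 4 + w $ 4 * u $ 1 + w $ 3 * u $ 5 + w $ 5 * u $ 3) + sqrt 3 * (w $ 2 * u $ 4 + w $ 4 * u $ 2)"
  "(jordan w *v u) $ 5 = 3 * (w $ 3 * u $ 4 + w $ 4 * u $ 3 - w $ 1 * u $ 5 - w $ 5 * u $ 1) + sqrt 3 * (w $ 2 * u $ 5 + w $ 5 * u $ 2)"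
proof -
  have s: "x / sqrt 3 = x * sqrt 3 / 3" "sqrt 3 * sqrt 3 = 3" "sqrt 3 * (sqrt 3 * x) = 3 * x" for x :: real
    by (simp_all add: field_simps)
  have j: "(jordan w *v u) $ i = (\<Sum>k\<in>UNIV. \<Sum>l\<in>UNIV. ycoord w k * (dd i * of_int (jordan_mats ! i5 k ! i5 i ! i5 l) * ycoord u l))" for i
    by (simp add: jordan_def bounded_bilinear.sum_left[OF bounded_bilinear_matrix_vector_mult]
        matrix_vector_mult_def[of "_ *\<^sub>R _"] sum_component conjD_def lmat_def ycoord_def sum_distrib_left mult_ac)
  show "(jordan w *v u) $ 1 = 3 * (w $ 4 * u $ 4 - w $ 5 * u $ 5) - 2 * sqrt 3 * (w $ 1 * u $ 2 + w $ 2 * u $ 1)"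
    "(jordan w *v u) $ 2 = sqrt 3 * (2 * w $ 2 * u $ 2 - 2 * w $ 1 * u $ 1 - 2 * w $ 3 * u $ 3 + w $ 4 * u $ 4 + w $ 5 * u $ 5)"
    "(jordan w *v u) $ 3 = 3 * (w $ 4 * u $ 5 + w $ 5 * u $ 4) - 2 * sqrt 3 * (w $ 2 * u $ 3 + w $ 3 * u $ 2)"
    "(jordan w *v u) $ 4 = 3 * (w $ 1 * u $ 4 + w $ 4 * u $ 1 + w $ 3 * u $ 5 + w $ 5 * u $ 3) + sqrt 3 * (w $ 2 * u $ 4 + w $ 4 * u $ 2)"
    "(jordan w *v u) $ 5 = 3 * (w $ 3 * u $ 4 + w $ 4 * u $ 3 - w $ 1 * u $ 5 - w $ 5 * u $ 1) + sqrt 3 * (w $ 2 * u $ 5 + w $ 5 * u $ 2)"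
    by (simp_all add: j sum_5 i5_def jordan_mats_nth ycoord_def dd_def) (simp_all add: field_simps s)
qed

text \<open>Identifies the table: the right side is three times the traceless part of the Jordan
  product S T + T S.\<close>

lemma sym_traceless_jordan:
  "sym_traceless (jordan w *v u) = 3 *\<^sub>R (sym_traceless w ** sym_traceless u + sym_traceless u ** sym_traceless w)
    - trace (sym_traceless w ** sym_traceless u + sym_traceless u ** sym_traceless w) *\<^sub>R mat 1"
proof -
  have s: "x / sqrt 3 = x * sqrt 3 / 3" "sqrt 3 * sqrt 3 = 3" "sqrt 3 * (sqrt 3 * x) = 3 * x" for x :: real
    by (simp_all add: field_simps)
  show ?thesis
    by (simp add: vec_eq_iff forall_3 sym_traceless_entry trace_def matrix_matrix_mult_def sum_3 mat_def jordan_nth)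
      (simp add: s algebra_simps add_divide_distrib diff_divide_distrib)
qed

text \<open>Conjugation by a rotation is an automorphism of the Jordan product and keeps
  traces.\<close>

lemma jordan_equivariant:
  assumes "Q \<in> SO3_irr"
  shows "jordan (Q *v w) = Q ** jordan w ** transpose Q"
proof -
  obtain A :: "real^3^3" where A: "rotation_matrix A"
    "\<And>x. sym_traceless (Q *v x) = A ** sym_traceless x ** transpose A"
    using assms unfolding SO3_irr_def by blast
  note mm = bounded_bilinear_matrix_matrix_mult
  have "sym_traceless (jordan (Q *v w) *v (Q *v u)) = sym_traceless (Q *v (jordan w *v u))" for u
  proof -
    let ?C = "sym_traceless w ** sym_traceless u + sym_traceless u ** sym_traceless w"
    have C: "sym_traceless (Q *v w) ** sym_traceless (Q *v u) + sym_traceless (Q *v u) ** sym_traceless (Q *v w)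
        = A ** ?C ** transpose A"
      by (simp add: A(2) rotation_conj[OF A(1)] bounded_bilinear.add_left[OF mm] bounded_bilinear.add_right[OF mm])
    have "sym_traceless (jordan (Q *v w) *v (Q *v u)) = 3 *\<^sub>R (A ** ?C ** transpose A) - trace ?C *\<^sub>R mat 1"
      unfolding sym_traceless_jordan C trace_conj[OF A(1)] ..
    also have "\<dots> = A ** (3 *\<^sub>R ?C - trace ?C *\<^sub>R mat 1) ** transpose A"
      by (simp add: bounded_bilinear.diff_left[OF mm] bounded_bilinear.diff_right[OF mm] matrix_scaleR_mult
          rotation_mult_transpose[OF A(1)])
    also have "\<dots> = sym_traceless (Q *v (jordan w *v u))"
      unfolding A(2) sym_traceless_jordan ..
    finally show ?thesis .
  qed
  then have "(jordan (Q *v w) ** Q) *v u = (Q ** jordan w) *v u" for u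
    by (simp add: sym_traceless_inject flip: matrix_vector_mul_assoc)
  then have "jordan (Q *v w) ** Q = Q ** jordan w"
    unfolding matrix_eq by blast
  then have "jordan (Q *v w) ** (Q ** transpose Q) = Q ** jordan w ** transpose Q"
    by (simp add: matrix_mul_assoc)
  then show ?thesis by (simp add: SO3_irr_orthogonal[OF assms])
qed

definition emb :: "real^7 \<Rightarrow> real^5^5" where
  "emb u = (\<Sum>a\<in>UNIV. u $ a *\<^sub>R bas (i7 a))"

text \<open>The conceptual form of \<open>iota\<close>: every factor under the trace transforms by
  conjugation, so equivariance under the whole isotropy group becomes visible.\<close>

lemma iota_eq_trace:
  "trace (jordan w ** (emb u ** emb v + emb v ** emb u)) = 3 * (u \<bullet> (iota w *v v))"
proof -
  note mm = bounded_bilinear_matrix_matrix_mult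
  let ?J = "\<lambda>j. conjD (lmat i5 (jordan_mats ! i5 j))"
  have lin: "linear (trace :: real^5^5 \<Rightarrow> real)"
    by (simp add: linear_iff trace_def sum.distrib sum_distrib_left)
  have b: "trace (?J j ** (bas (i7 a) ** bas (i7 b) + bas (i7 b) ** bas (i7 a))) = 3 * of_int (iota_mats ! i5 j ! i7 a ! i7 b)" for a b j
  proof -
    let ?M = "mmul 5 (jordan_mats ! i5 j) (madd (mmul 5 (basis_mats ! i7 a) (basis_mats ! i7 b)) (mmul 5 (basis_mats ! i7 b) (basis_mats ! i7 a)))"
    have "?J j ** (bas (i7 a) ** bas (i7 b) + bas (i7 b) ** bas (i7 a)) = conjD (lmat i5 ?M)"
      using i7_less10 i5_less
      by (simp add: bas_def lmat_mmul[OF bij_i5] lmat_madd[OF bij_i5] square_jordan square_basis square_mmul square_madd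
          conjD_mult linear_add[OF linear_conjD])
    moreover have "(\<Sum>i<5. ?M ! i ! i) = 3 * iota_mats ! i5 j ! i7 a ! i7 b"
      unfolding sum_list_upt[symmetric]
      by (rule jordan_checked[unfolded jordan_check_def list_all_iff set_upt, rule_format])
        (use i7_less i5_less in simp_all)
    ultimately show ?thesis by (simp add: trace_conjD trace_lmat[OF bij_i5])
  qed
  have "emb u ** emb v + emb v ** emb u = (\<Sum>a\<in>UNIV. \<Sum>b\<in>UNIV. (u $ a * v $ b) *\<^sub>R (bas (i7 a) ** bas (i7 b) + bas (i7 b) ** bas (i7 a)))"
  proof -
    have "emb u ** emb v = (\<Sum>a\<in>UNIV. \<Sum>b\<in>UNIV. (u $ a * v $ b) *\<^sub>R (bas (i7 a) ** bas (i7 b)))" for u v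
      unfolding emb_def bounded_bilinear.sum_left[OF mm]
      unfolding bounded_bilinear.sum_right[OF mm] by (simp add: matrix_scaleR_mult mult.commute)
    note 1 = this
    have "emb v ** emb u = (\<Sum>a\<in>UNIV. \<Sum>b\<in>UNIV. (u $ a * v $ b) *\<^sub>R (bas (i7 b) ** bas (i7 a)))"
      unfolding 1 by (subst sum.swap) (simp add: mult.commute)
    then show ?thesis using 1[of u v] by (simp add: scaleR_add_right sum.distrib)
  qed
  then have "trace (jordan w ** (emb u ** emb v + emb v ** emb u))
      = (\<Sum>a\<in>UNIV. \<Sum>b\<in>UNIV. \<Sum>j\<in>UNIV. u $ a * (v $ b * (ycoord w j * (3 * of_int (iota_mats ! i5 j ! i7 a ! i7 b)))))"
    by (simp add: jordan_def bounded_bilinear.sum_left[OF mm] bounded_bilinear.sum_right[OF mm] matrix_scaleR_mult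
        linear_sum[OF lin] linear_cmul[OF lin] b sum_distrib_left mult.assoc del: mult_scaleR_right)
  also have "\<dots> = 3 * (u \<bullet> (iota w *v v))"
    by (simp add: dot_matrix_vector_mult iota_entry sum_distrib_left sum_distrib_right mult_ac)
  finally show ?thesis .
qed

text \<open>The matrix of the cross product with (p, q, r).\<close>

definition skew3 :: "real \<Rightarrow> real \<Rightarrow> real \<Rightarrow> real^3^3" where
  "skew3 p q r = vector [vector [0, - r, q], vector [r, 0, - p], vector [- q, p, 0]]"

text \<open>Shows that \<open>bas 7\<close>, \<open>bas 8\<close> and \<open>bas 9\<close> represent
  the infinitesimal rotations about the three axes.\<close>

lemma sym_traceless_so3:
  "sym_traceless ((p *\<^sub>R bas 7 + q *\<^sub>R bas 8 + r *\<^sub>R bas 9) *v x)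
    = skew3 p q r ** sym_traceless x - sym_traceless x ** skew3 p q r"
proof -
  have s: "x / sqrt 3 = x * sqrt 3 / 3" "sqrt 3 * sqrt 3 = 3" "sqrt 3 * (sqrt 3 * x) = 3 * x" for x :: real
    by (simp_all add: field_simps)
  show ?thesis
    by (simp add: vec_eq_iff forall_3 sym_traceless_entry matrix_matrix_mult_def sum_3 skew3_def vector_3
        matrix_vector_mult_def sum_5 bas_def conjD_def lmat_def i5_def basis_mats_nth dd_def)
      (simp add: s algebra_simps add_divide_distrib diff_divide_distrib)
qed

lemma skew3_eq:
  assumes "transpose a = - (a :: real^3^3)"
  shows "a = skew3 (a $ 3 $ 2) (a $ 1 $ 3) (a $ 2 $ 1)"
proof -
  have y: "a $ j $ i = - a $ i $ j" for i j
    using arg_cong[OF assms, of "\<lambda>B. B $ i $ j"] by (simp add: transpose_def)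
  have "a $ i $ i = 0" for i using y[of i i] by simp
  then show ?thesis
    using y[of 1 2] y[of 2 3] y[of 3 1]
    by (simp add: vec_eq_iff forall_3 skew3_def vector_3)
qed

lemma so3_irr_iff_combination: "Y \<in> so3_irr \<longleftrightarrow> (\<exists>p q r. Y = p *\<^sub>R bas 7 + q *\<^sub>R bas 8 + r *\<^sub>R bas 9)"
proof
  assume "Y \<in> so3_irr"
  then obtain a :: "real^3^3" where a: "transpose a = - a"
    "\<And>x. sym_traceless (Y *v x) = a ** sym_traceless x - sym_traceless x ** a"
    unfolding so3_irr_def by blast
  obtain p q r where e: "a = skew3 p q r" using skew3_eq[OF a(1)] by blast
  have "sym_traceless (Y *v x) = sym_traceless ((p *\<^sub>R bas 7 + q *\<^sub>R bas 8 + r *\<^sub>R bas 9) *v x)" for x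
    unfolding sym_traceless_so3 a(2) e ..
  then have "Y *v x = (p *\<^sub>R bas 7 + q *\<^sub>R bas 8 + r *\<^sub>R bas 9) *v x" for x
    unfolding sym_traceless_inject .
  then have "Y = p *\<^sub>R bas 7 + q *\<^sub>R bas 8 + r *\<^sub>R bas 9"
    unfolding matrix_eq by blast
  then show "\<exists>p q r. Y = p *\<^sub>R bas 7 + q *\<^sub>R bas 8 + r *\<^sub>R bas 9" by blast
next
  assume "\<exists>p q r. Y = p *\<^sub>R bas 7 + q *\<^sub>R bas 8 + r *\<^sub>R bas 9"
  then obtain p q r where Y: "Y = p *\<^sub>R bas 7 + q *\<^sub>R bas 8 + r *\<^sub>R bas 9" by blast
  have "transpose (skew3 p q r) = - skew3 p q r"
    by (simp add: vec_eq_iff forall_3 skew3_def vector_3 transpose_def)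
  then show "Y \<in> so3_irr"
    unfolding so3_irr_def using Y sym_traceless_so3 by blast
qed

lemma linear_mcoord: "linear mcoord"
  using bounded_linear_mcoord bounded_linear.linear by blast

lemma mcoord_bas: "7 \<le> n \<Longrightarrow> n < 10 \<Longrightarrow> mcoord (bas n) = 0"
  using i7_less by (auto simp: mcoord_def vec_eq_iff coef_bas i7_less10 dest: less_le_trans)

lemma skew_decompose:
  assumes "transpose Y = - Y"
  shows "Y = emb (mcoord Y) + (coef 7 Y *\<^sub>R bas 7 + coef 8 Y *\<^sub>R bas 8 + coef 9 Y *\<^sub>R bas 9)"
proof -
  have "(\<Sum>n<10. coef n Y *\<^sub>R bas n) = (\<Sum>n<7. coef n Y *\<^sub>R bas n) + (coef 7 Y *\<^sub>R bas 7 + coef 8 Y *\<^sub>R bas 8 + coef 9 Y *\<^sub>R bas 9)"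
    by (simp add: eval_nat_numeral add.assoc)
  also have "(\<Sum>n<7. coef n Y *\<^sub>R bas n) = emb (mcoord Y)"
    by (simp add: emb_def mcoord_def flip: sum_index[OF bij_i7])
  finally show ?thesis using skew_expand[OF assms] by simp
qed

text \<open>so(3) and m are orthogonal complements in so(5). In this form the immersion condition of
  the atlas becomes a statement about m-coordinates.\<close>

lemma so3_irr_iff: "Y \<in> so3_irr \<longleftrightarrow> transpose Y = - Y \<and> mcoord Y = 0"
proof
  assume "Y \<in> so3_irr"
  then obtain p q r where Y: "Y = p *\<^sub>R bas 7 + q *\<^sub>R bas 8 + r *\<^sub>R bas 9"
    unfolding so3_irr_iff_combination by blast
  have "transpose Y = p *\<^sub>R transpose (bas 7) + q *\<^sub>R transpose (bas 8) + r *\<^sub>R transpose (bas 9)"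
    unfolding Y by (simp add: transpose_def vec_eq_iff)
  then show "transpose Y = - Y \<and> mcoord Y = 0"
    by (simp add: Y bas_skew linear_add[OF linear_mcoord] linear_cmul[OF linear_mcoord] mcoord_bas)
next
  assume "transpose Y = - Y \<and> mcoord Y = 0"
  then have "Y = coef 7 Y *\<^sub>R bas 7 + coef 8 Y *\<^sub>R bas 8 + coef 9 Y *\<^sub>R bas 9"
    using skew_decompose[of Y] by (simp add: emb_def)
  then show "Y \<in> so3_irr" unfolding so3_irr_iff_combination by blast
qed

lemma bas_so3_irr: "7 \<le> n \<Longrightarrow> n < 10 \<Longrightarrow> bas n \<in> so3_irr"
  by (simp add: so3_irr_iff bas_skew mcoord_bas)

lemma so3_irr_conj:
  assumes "Y \<in> so3_irr" "Q \<in> SO3_irr"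
  shows "Q ** Y ** transpose Q \<in> so3_irr"
proof -
  obtain a :: "real^3^3" where a: "transpose a = - a"
    "\<And>x. sym_traceless (Y *v x) = a ** sym_traceless x - sym_traceless x ** a"
    using assms unfolding so3_irr_def by blast
  obtain A :: "real^3^3" where A: "rotation_matrix A"
    "\<And>x. sym_traceless (Q *v x) = A ** sym_traceless x ** transpose A"
    using assms unfolding SO3_irr_def by blast
  note mm = bounded_bilinear_matrix_matrix_mult
  have "sym_traceless ((Q ** Y ** transpose Q) *v x)
      = (A ** a ** transpose A) ** sym_traceless x - sym_traceless x ** (A ** a ** transpose A)" for x
  proof -
    define y where "y = transpose Q *v x"
    have "x = Q *v y"
      by (simp only: y_def matrix_vector_mul_assoc SO3_irr_orthogonal[OF assms(2)] matrix_vector_mul_lid)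
    then have x: "sym_traceless x = A ** sym_traceless y ** transpose A" by (simp add: A(2))
    have "sym_traceless ((Q ** Y ** transpose Q) *v x) = sym_traceless (Q *v (Y *v y))"
      by (simp only: y_def matrix_vector_mul_assoc matrix_mul_assoc)
    also have "\<dots> = A ** (a ** sym_traceless y) ** transpose A - A ** (sym_traceless y ** a) ** transpose A"
      by (simp only: A(2) a(2) bounded_bilinear.diff_left[OF mm] bounded_bilinear.diff_right[OF mm])
    finally show ?thesis unfolding x rotation_conj[OF A(1)] .
  qed
  moreover have "transpose (A ** a ** transpose A) = - (A ** a ** transpose A)"
    by (simp add: matrix_transpose_mul a(1) bounded_bilinear.minus_left[OF mm] bounded_bilinear.minus_right[OF mm] matrix_mul_assoc)
  ultimately show ?thesis unfolding so3_irr_def by blast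
qed

lemma skew_conj: "transpose X = - X \<Longrightarrow> transpose (Q ** X ** transpose Q) = - (Q ** X ** transpose (Q :: real^'n^'n))"
  by (simp add: matrix_transpose_mul bounded_bilinear.minus_left[OF bounded_bilinear_matrix_matrix_mult]
      bounded_bilinear.minus_right[OF bounded_bilinear_matrix_matrix_mult] matrix_mul_assoc)

lemma linear_emb: "linear emb"
  by (simp add: linear_iff emb_def scaleR_add_left sum.distrib scaleR_sum_right)

lemma emb_skew: "transpose (emb u) = - emb u"
  by (simp add: emb_def linear_sum[OF bounded_linear.linear[OF bounded_linear_transpose]] transpose_scaleR
      bas_skew i7_less10 sum_negf)

lemma coef_emb:
  assumes "7 \<le> n" "n < 10"
  shows "coef n (emb u) = 0"
proof -
  have "n \<noteq> i7 a" for a using i7_less[of a] assms by simp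
  then show ?thesis
    using bounded_linear.linear[OF bounded_linear_coef] assms(2)
    by (simp add: emb_def linear_sum linear_cmul coef_bas i7_less10)
qed

lemma mcoord_emb: "mcoord (emb u) = u"
  using bounded_linear.linear[OF bounded_linear_coef]
  by (simp add: mcoord_def vec_eq_iff emb_def linear_sum linear_cmul coef_bas i7_less10 i7_eq
      if_distrib[of "\<lambda>x. _ * x"] cong: if_cong)

text \<open>On skew matrices \<open>emb \<circ> mcoord\<close> is the projection onto m. Conjugation
  by Q preserves so(3) and the inner product, hence m, and so commutes with this projection.\<close>

lemma emb_mcoord_conj:
  assumes X: "transpose X = - X" and Q: "Q \<in> SO3_irr"
  shows "emb (mcoord (Q ** X ** transpose Q)) = Q ** emb (mcoord X) ** transpose Q"
proof -
  note mm = bounded_bilinear_matrix_matrix_mult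
  let ?E = "emb (mcoord X)"
  define h where "h = X - ?E"
  have "h = coef 7 X *\<^sub>R bas 7 + coef 8 X *\<^sub>R bas 8 + coef 9 X *\<^sub>R bas 9"
    using skew_decompose[OF X] by (simp add: h_def algebra_simps)
  then have "h \<in> so3_irr" unfolding so3_irr_iff_combination by blast
  from so3_irr_conj[OF this Q] have h0: "mcoord (Q ** h ** transpose Q) = 0" by (simp add: so3_irr_iff)
  have "Q ** X ** transpose Q = Q ** ?E ** transpose Q + Q ** h ** transpose Q"
    by (simp add: h_def bounded_bilinear.diff_left[OF mm] bounded_bilinear.diff_right[OF mm])
  then have "mcoord (Q ** X ** transpose Q) = mcoord (Q ** ?E ** transpose Q)"
    by (simp add: linear_add[OF linear_mcoord] h0)
  \<comment> \<open>Conjugation is moved to the other factor of the inner product, where it turns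
    one vertical matrix into another.\<close>
  moreover have "coef n (Q ** ?E ** transpose Q) = 0" if n: "7 \<le> n" "n < 10" for n
  proof -
    obtain p q r where pqr: "transpose Q ** bas n ** transpose (transpose Q) = p *\<^sub>R bas 7 + q *\<^sub>R bas 8 + r *\<^sub>R bas 9"
      using so3_irr_conj[OF bas_so3_irr[OF n] SO3_irr_transpose[OF Q]] unfolding so3_irr_iff_combination by blast
    have "(Q ** ?E ** transpose Q) \<bullet> bas n = trace (Q ** (?E ** transpose Q ** transpose (bas n)))"
      by (simp add: inner_matrix matrix_mul_assoc)
    also have "\<dots> = ?E \<bullet> (transpose Q ** bas n ** transpose (transpose Q))"
      by (subst trace_mul_sym) (simp add: inner_matrix matrix_mul_assoc matrix_transpose_mul)
    also have "\<dots> = 0"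
      unfolding pqr using coef_emb[of 7 "mcoord X"] coef_emb[of 8 "mcoord X"] coef_emb[of 9 "mcoord X"]
        nrm_pos[of 7] nrm_pos[of 8] nrm_pos[of 9]
      by (simp add: inner_add_right coef_def)
    finally show ?thesis by (simp add: coef_def)
  qed
  ultimately show ?thesis
    using skew_decompose[OF skew_conj[OF emb_skew[of "mcoord X"]], of Q] by simp
qed

text \<open>Read through \<open>iota_eq_trace\<close>, all factors are conjugated by Q, which the
  trace ignores. This makes the tensors below independent of the section.\<close>

lemma iota_equivariant:
  assumes "transpose X = - X" "transpose Y = - Y" "Q \<in> SO3_irr"
  shows "mcoord (Q ** X ** transpose Q) \<bullet> (iota (Q *v w) *v mcoord (Q ** Y ** transpose Q))
    = mcoord X \<bullet> (iota w *v mcoord Y)"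
proof -
  let ?q = "\<lambda>Z. Q ** Z ** transpose Q" and ?E = "emb (mcoord X)" and ?F = "emb (mcoord Y)"
  note mm = bounded_bilinear_matrix_matrix_mult
  have m: "?q S ** ?q T = ?q (S ** T)" for S T
  proof -
    have "?q S ** ?q T = Q ** S ** (transpose Q ** Q) ** T ** transpose Q" by (simp only: matrix_mul_assoc)
    then show ?thesis by (simp add: SO3_irr_orthogonal[OF assms(3)] matrix_mul_assoc)
  qed
  have t: "trace (?q S) = trace S" for S
    using trace_mul_sym[of "Q ** S" "transpose Q"]
    by (simp add: matrix_mul_assoc SO3_irr_orthogonal[OF assms(3)])
  have "3 * (mcoord (?q X) \<bullet> (iota (Q *v w) *v mcoord (?q Y)))
      = trace (?q (jordan w) ** (?q ?E ** ?q ?F + ?q ?F ** ?q ?E))"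
    unfolding iota_eq_trace[symmetric] jordan_equivariant[OF assms(3)]
      emb_mcoord_conj[OF assms(1,3)] emb_mcoord_conj[OF assms(2,3)] ..
  also have "\<dots> = trace (?q (jordan w ** (?E ** ?F + ?F ** ?E)))"
    unfolding m by (simp add: bounded_bilinear.add_left[OF mm] bounded_bilinear.add_right[OF mm] m flip: m)
  also have "\<dots> = 3 * (mcoord X \<bullet> (iota w *v mcoord Y))"
    unfolding t iota_eq_trace ..
  finally show ?thesis by simp
qed

section \<open>Local sections of SO(5) over the Berger space\<close>

lemma fd_eq_sum_pdv:
  fixes f :: "real^'n \<Rightarrow> 'b::real_normed_vector"
  assumes "f differentiable (at x)"
  shows "fd f x v = (\<Sum>i\<in>UNIV. v $ i *\<^sub>R pdv i f x)"
proof -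
  have lin: "linear (fd f x)"
    using assms frechet_derivative_works has_derivative_linear by blast
  have "v = (\<Sum>i\<in>UNIV. v $ i *\<^sub>R axis i 1)"
    using basis_expansion[of v] by (simp add: scalar_mult_eq_scaleR)
  then have "fd f x v = fd f x (\<Sum>i\<in>UNIV. v $ i *\<^sub>R axis i 1)" by simp
  then show ?thesis by (simp add: linear_sum[OF lin] linear_cmul[OF lin] pdv_def)
qed

lemma G0_form: "u \<bullet> ((k *\<^sub>R G0) *v v) = k * (u \<bullet> (G0 *v v))"
  by (simp flip: scaleR_matrix_vector_assoc)

text \<open>A lift of a chart to SO(5). By \<open>immersion\<close>, a tangent vector moved to the
  identity is never vertical.\<close>

locale berger_section =
  fixes U :: "(real^7) set" and \<sigma> :: "real^7 \<Rightarrow> real^5^5"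
  assumes open_dom: "open U"
    and smooth_section: "smooth_on \<sigma> U"
    and section_SO5: "x \<in> U \<Longrightarrow> \<sigma> x \<in> SO5"
    and immersion: "x \<in> U \<Longrightarrow> v \<noteq> 0 \<Longrightarrow> transpose (\<sigma> x) ** fd \<sigma> x v \<notin> so3_irr"
begin

text \<open>The Maurer-Cartan form pulled back by the section. Its m-part is the coframe, and the
  invariant connection turns it into the connection form.\<close>

definition om :: "7 \<Rightarrow> real^7 \<Rightarrow> real^5^5" where
  "om i x = transpose (\<sigma> x) ** pdv i \<sigma> x"

definition th :: "7 \<Rightarrow> real^7 \<Rightarrow> real^7" where
  "th i x = mcoord (om i x)"

definition W :: "7 \<Rightarrow> real^7 \<Rightarrow> real^7^7" where
  "W i x = conn (om i x)"

lemma section_orthogonal: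
  assumes "x \<in> U"
  shows "transpose (\<sigma> x) ** \<sigma> x = mat 1" "\<sigma> x ** transpose (\<sigma> x) = mat 1"
  using section_SO5[OF assms] by (auto simp: SO5_def rotation_mult_transpose)

lemma section_diff: "x \<in> U \<Longrightarrow> \<sigma> differentiable (at x)"
  by (rule smooth_on_differentiable[OF smooth_section])

lemma transpose_diff: "x \<in> U \<Longrightarrow> (\<lambda>y. transpose (\<sigma> y)) differentiable (at x)"
  by (rule linear_differentiable[OF bounded_linear_transpose section_diff])

lemma pdv_transpose: "x \<in> U \<Longrightarrow> pdv i (\<lambda>y. transpose (\<sigma> y)) x = transpose (pdv i \<sigma> x)"
  by (rule pdv_linear[OF bounded_linear_transpose section_diff])

lemma om_skew:
  assumes x: "x \<in> U"
  shows "transpose (om i x) = - om i x"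
proof -
  have "pdv i (\<lambda>y. transpose (\<sigma> y) ** \<sigma> y) x = pdv i (\<lambda>_. mat 1) x"
    by (rule pdv_cong_open[OF open_dom x])
      (simp_all add: section_orthogonal bilinear_differentiable[OF bounded_bilinear_matrix_matrix_mult transpose_diff[OF x] section_diff[OF x]])
  also have "\<dots> = 0" by (simp add: pdv_eqI[OF has_derivative_const])
  finally have "transpose (\<sigma> x) ** pdv i \<sigma> x + transpose (pdv i \<sigma> x) ** \<sigma> x = 0"
    by (simp add: pdv_bilinear[OF bounded_bilinear_matrix_matrix_mult transpose_diff[OF x] section_diff[OF x]] pdv_transpose[OF x])
  moreover have "transpose (om i x) = transpose (pdv i \<sigma> x) ** \<sigma> x"
    by (simp add: om_def matrix_transpose_mul)
  ultimately show ?thesis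
    by (simp add: om_def eq_neg_iff_add_eq_0 add.commute)
qed

lemma transpose_pdv_section:
  assumes x: "x \<in> U"
  shows "transpose (pdv i \<sigma> x) = - (om i x ** transpose (\<sigma> x))"
proof -
  have "transpose (pdv i \<sigma> x) = transpose (om i x) ** transpose (\<sigma> x)"
    by (simp add: om_def matrix_transpose_mul section_orthogonal[OF x] flip: matrix_mul_assoc)
  then show ?thesis
    by (simp add: om_skew[OF x] bounded_bilinear.minus_left[OF bounded_bilinear_matrix_matrix_mult])
qed

lemma smooth_om: "smooth_on (om i) U"
  unfolding om_def
  by (rule smooth_on_bilinear[OF bounded_bilinear_matrix_matrix_mult open_dom
    smooth_on_linear[OF bounded_linear_transpose open_dom smooth_section] smooth_on_pdv[OF smooth_section]])

lemma om_diff: "x \<in> U \<Longrightarrow> om i differentiable (at x)"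
  by (rule smooth_on_differentiable[OF smooth_om])

text \<open>In the derivative of \<sigma>^t d\<sigma> the second derivatives of \<sigma> are
  symmetric and cancel; differentiating \<sigma>^t leaves the bracket.\<close>

lemma maurer_cartan:
  assumes x: "x \<in> U"
  shows "pdv i (om j) x - pdv j (om i) x = - br (om i x) (om j x)"
proof -
  have p: "pdv i (om j) x = transpose (\<sigma> x) ** pdv i (pdv j \<sigma>) x - om i x ** om j x" for i j
  proof -
    have "pdv i (om j) x = transpose (\<sigma> x) ** pdv i (pdv j \<sigma>) x + transpose (pdv i \<sigma> x) ** pdv j \<sigma> x"
      unfolding om_def
      by (simp add: pdv_bilinear[OF bounded_bilinear_matrix_matrix_mult transpose_diff[OF x]
          smooth_on_differentiable[OF smooth_on_pdv[OF smooth_section] x]] pdv_transpose[OF x])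
    then show ?thesis
      by (simp add: transpose_pdv_section[OF x] bounded_bilinear.minus_left[OF bounded_bilinear_matrix_matrix_mult]
          om_def[of j] matrix_mul_assoc)
  qed
  show ?thesis
    unfolding p pdv_commute[OF open_dom smooth_section x, of i j] by simp
qed

lemma smooth_th: "smooth_on (th i) U"
  unfolding th_def by (rule smooth_on_linear[OF bounded_linear_mcoord open_dom smooth_om])

lemma smooth_W: "smooth_on (W i) U"
  unfolding W_def by (rule smooth_on_linear[OF bounded_linear_conn open_dom smooth_om])

lemma pdv_th: "x \<in> U \<Longrightarrow> pdv i (th j) x = mcoord (pdv i (om j) x)"
  unfolding th_def by (rule pdv_linear[OF bounded_linear_mcoord om_diff])

lemma pdv_W: "x \<in> U \<Longrightarrow> pdv i (W j) x = conn (pdv i (om j) x)"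
  unfolding W_def by (rule pdv_linear[OF bounded_linear_conn om_diff])

lemma linear_conn: "linear conn"
  using bounded_linear_conn bounded_linear.linear by blast

text \<open>The m-part of the Maurer-Cartan equation, rewritten by
  \<open>torsion_free\<close>.\<close>

lemma section_torsion:
  assumes x: "x \<in> U"
  shows "pdv i (th j) x + W i x *v th j x = pdv j (th i) x + W j x *v th i x"
proof -
  have "pdv i (th j) x - pdv j (th i) x = mcoord (pdv i (om j) x - pdv j (om i) x)"
    by (simp add: pdv_th[OF x] linear_diff[OF linear_mcoord])
  also have "\<dots> = - mcoord (br (om i x) (om j x))"
    by (simp only: maurer_cartan[OF x] linear_neg[OF linear_mcoord])
  also have "\<dots> = W j x *v th i x - W i x *v th j x"
    by (simp add: torsion_free[OF om_skew[OF x] om_skew[OF x]] W_def th_def)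
  finally show ?thesis by (simp add: algebra_simps)
qed

text \<open>A linear relation in the coframe would make some tangent vector vertical, against
  \<open>immersion\<close>.\<close>

lemma section_indep:
  assumes x: "x \<in> U" and v: "(\<Sum>i\<in>UNIV. v $ i *\<^sub>R th i x) = 0"
  shows "v = 0"
proof (rule ccontr)
  assume "v \<noteq> 0"
  let ?Y = "transpose (\<sigma> x) ** fd \<sigma> x v"
  have Y: "?Y = (\<Sum>i\<in>UNIV. v $ i *\<^sub>R om i x)"
    by (simp add: fd_eq_sum_pdv[OF section_diff[OF x]] om_def matrix_scaleR_mult
        bounded_bilinear.sum_right[OF bounded_bilinear_matrix_matrix_mult])
  have "transpose ?Y = - ?Y"
    unfolding Y by (simp add: linear_sum[OF bounded_linear.linear[OF bounded_linear_transpose]] transpose_scaleR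
        om_skew[OF x] sum_negf)
  moreover have "mcoord ?Y = 0"
    unfolding Y using v by (simp add: linear_sum[OF linear_mcoord] linear_cmul[OF linear_mcoord] th_def)
  ultimately have "?Y \<in> so3_irr" by (simp add: so3_irr_iff)
  then show False using immersion[OF x \<open>v \<noteq> 0\<close>] by blast
qed

end

text \<open>The normal metric of scale k. That the metric of an invariant G2-structure is of this
  kind is \<open>metric_scale\<close>.\<close>

locale berger_metric = berger_section +
  fixes g :: "real^7 \<Rightarrow> 7 \<Rightarrow> 7 \<Rightarrow> real" and k :: real
  assumes k_pos: "k > 0"
    and metric_eq: "x \<in> U \<Longrightarrow> g x i j = k * (th i x \<bullet> (G0 *v th j x))"
begin

lemma k_nz: "k \<noteq> 0"
  using k_pos by simp

sublocale moving_frame U g "k *\<^sub>R G0" th W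
proof
  show "transpose (k *\<^sub>R G0) = k *\<^sub>R G0"
    by (simp add: transpose_def G0_def vec_eq_iff)
  show "u \<bullet> ((k *\<^sub>R G0) *v (W i x *v v)) = - ((W i x *v u) \<bullet> ((k *\<^sub>R G0) *v v))" for u v i x
    unfolding G0_form W_def conn_skew by simp
qed (use open_dom smooth_th smooth_W invertible_metric(1)[OF k_nz] metric_eq section_indep section_torsion
    in \<open>simp_all add: G0_form\<close>)

text \<open>The derivatives of the connection form combine, by the Maurer-Cartan equation, to the
  term with the bracket in \<open>curvature_form\<close>.\<close>

lemma curvature_eq:
  assumes x: "x \<in> U"
  shows "Om i j x = (\<Sum>a\<in>UNIV. th i x $ a *\<^sub>R (\<Sum>m\<in>UNIV. th j x $ m *\<^sub>R KB a m))"
proof -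
  have "Om i j x = conn (pdv i (om j) x - pdv j (om i) x) + br (conn (om i x)) (conn (om j x))"
    by (simp add: Om_def pdv_W[OF x] linear_diff[OF linear_conn] W_def)
  also have "\<dots> = br (conn (om i x)) (conn (om j x)) - conn (br (om i x) (om j x))"
    unfolding maurer_cartan[OF x] linear_neg[OF linear_conn] by simp
  finally show ?thesis
    using curvature_form[OF om_skew[OF x] om_skew[OF x], of i j] by (simp add: th_def)
qed

lemma ricci_eq:
  assumes x: "x \<in> U"
  shows "ricci g x i j = 27 / (10 * k) * g x i j"
  using k_nz by (simp add: ricci_frame[OF x curvature_eq[OF x]] ricci_contract metric_eq[OF x])

context
  fixes v :: "real^5" and h :: "real^7 \<Rightarrow> 7 \<Rightarrow> 7 \<Rightarrow> real"
  assumes h: "\<And>x i j. x \<in> U \<Longrightarrow> h x i j = th i x \<bullet> (iota (transpose (\<sigma> x) *v v) *v th j x)"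
begin

lemma vec_diff: "x \<in> U \<Longrightarrow> (\<lambda>y. transpose (\<sigma> y) *v v) differentiable (at x)"
  by (intro linear_differentiable[OF bounded_bilinear.bounded_linear_left[OF bounded_bilinear_matrix_vector_mult]] transpose_diff)

text \<open>The vector v is constant, but seen from the moving frame \<sigma> it rotates. The
  coefficient matrices of h depend on the point only through this.\<close>

lemma pdv_vec:
  assumes x: "x \<in> U"
  shows "pdv i (\<lambda>y. transpose (\<sigma> y) *v v) x = - (om i x *v (transpose (\<sigma> x) *v v))"
proof -
  have "pdv i (\<lambda>y. transpose (\<sigma> y) *v v) x = transpose (pdv i \<sigma> x) *v v"
    by (subst pdv_linear[OF bounded_bilinear.bounded_linear_left[OF bounded_bilinear_matrix_vector_mult] transpose_diff[OF x]])
      (simp only: pdv_transpose[OF x])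
  then show ?thesis
    unfolding transpose_pdv_section[OF x]
    by (simp only: bounded_bilinear.minus_left[OF bounded_bilinear_matrix_vector_mult] matrix_vector_mul_assoc)
qed

lemma cov2_eq:
  assumes x: "x \<in> U"
  shows "cov2 g h x c i j = (\<Sum>a\<in>UNIV. th c x $ a * (th i x \<bullet> (TB a (transpose (\<sigma> x) *v v) *v th j x)))"
proof -
  let ?w = "transpose (\<sigma> x) *v v"
  have "pdv c (\<lambda>y. iota (transpose (\<sigma> y) *v v)) x = - iota (om c x *v ?w)"
    by (subst pdv_linear[OF bounded_linear_iota vec_diff[OF x]])
      (simp only: pdv_vec[OF x] linear_neg[OF linear_iota])
  then have "cov2 g h x c i j
      = th i x \<bullet> ((- iota (om c x *v ?w) - transpose (conn (om c x)) ** iota ?w - iota ?w ** conn (om c x)) *v th j x)"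
    by (simp only: cov2_frame[OF x h linear_differentiable[OF bounded_linear_iota vec_diff[OF x]]] W_def)
  also have "\<dots> = th i x \<bullet> ((\<Sum>a\<in>UNIV. th c x $ a *\<^sub>R TB a ?w) *v th j x)"
    by (simp only: nabla_form[OF om_skew[OF x]] th_def)
  finally show ?thesis
    by (simp only: bounded_bilinear.sum_left[OF bounded_bilinear_matrix_vector_mult] inner_sum_right
        bounded_bilinear.scaleR_left[OF bounded_bilinear_matrix_vector_mult] inner_scaleR_right)
qed

lemma cov3_eq:
  assumes x: "x \<in> U"
  shows "cov3 g (cov2 g h) x l c i j = (\<Sum>b\<in>UNIV. \<Sum>a\<in>UNIV. th l x $ b * th c x $ a
    * (th i x \<bullet> (T2B b a (transpose (\<sigma> x) *v v) *v th j x)))"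
proof -
  let ?w = "transpose (\<sigma> x) *v v"
  have p: "pdv l (\<lambda>y. TB a (transpose (\<sigma> y) *v v)) x = - TB a (om l x *v ?w)" for a
    by (subst pdv_linear[OF bounded_linear_TB vec_diff[OF x]])
      (simp only: pdv_vec[OF x] linear_neg[OF linear_TB])
  have "cov3 g (cov2 g h) x l c i j = (\<Sum>a\<in>UNIV. th c x $ a * (th i x \<bullet>
    ((- TB a (om l x *v ?w) - (\<Sum>d\<in>UNIV. conn (om l x) $ d $ a *\<^sub>R TB d ?w)
       - transpose (conn (om l x)) ** TB a ?w - TB a ?w ** conn (om l x)) *v th j x)))"
    by (simp only: cov3_frame[OF x cov2_eq linear_differentiable[OF bounded_linear_TB vec_diff[OF x]]] p W_def)
  also have "\<dots> = (\<Sum>a\<in>UNIV. th c x $ a * (th i x \<bullet> ((\<Sum>b\<in>UNIV. th l x $ b *\<^sub>R T2B b a ?w) *v th j x)))"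
    by (simp only: nabla2_form[OF om_skew[OF x]] th_def)
  also have "\<dots> = (\<Sum>a\<in>UNIV. \<Sum>b\<in>UNIV. th l x $ b * th c x $ a * (th i x \<bullet> (T2B b a ?w *v th j x)))"
    by (simp add: bounded_bilinear.sum_left[OF bounded_bilinear_matrix_vector_mult] inner_sum_right
        bounded_bilinear.scaleR_left[OF bounded_bilinear_matrix_vector_mult] sum_distrib_left mult_ac)
  finally show ?thesis by (subst sum.swap)
qed

lemma rough_laplacian_eq:
  assumes x: "x \<in> U"
  shows "rough_laplacian g h x i j = 19 / (10 * k) * h x i j"
proof -
  let ?w = "transpose (\<sigma> x) *v v"
  have "(\<Sum>a\<in>UNIV. (th i x \<bullet> (T2B a a ?w *v th j x)) / nrm (i7 a))
      = th i x \<bullet> ((\<Sum>a\<in>UNIV. (1 / nrm (i7 a)) *\<^sub>R T2B a a ?w) *v th j x)"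
    by (simp add: bounded_bilinear.sum_left[OF bounded_bilinear_matrix_vector_mult] inner_sum_right
        bounded_bilinear.scaleR_left[OF bounded_bilinear_matrix_vector_mult])
  also have "\<dots> = - (19 / 10) * h x i j"
    unfolding laplacian_contract h[OF x]
    by (simp only: bounded_bilinear.scaleR_left[OF bounded_bilinear_matrix_vector_mult] inner_scaleR_right)
  finally show ?thesis
    using k_nz by (simp add: rough_laplacian_frame[OF x cov3_eq[OF x]] sum_inverse_metric)
qed

lemma curvature_action_eq:
  assumes x: "x \<in> U"
  shows "curvature_action g h x i j = 7 / (4 * k) * h x i j"
  using k_nz by (simp add: curvature_action_frame[where h = h and B = "iota (transpose (\<sigma> x) *v v)", OF x curvature_eq[OF x] h[OF x]] sum_inverse_metric
      curv_iota_contract h[OF x])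

lemma trace2_eq:
  assumes x: "x \<in> U"
  shows "trace2 g h x = 0"
  using k_nz by (simp add: trace2_frame[where h = h and B = "iota (transpose (\<sigma> x) *v v)", OF x h[OF x]] sum_inverse_metric trace_contract)

lemma divergence2_eq:
  assumes x: "x \<in> U"
  shows "divergence2 g h x j = 0"
  using k_nz by (simp add: divergence2_frame[OF x cov2_eq[OF x]] sum_inverse_metric divergence_contract)

lemma killing_eq:
  assumes x: "x \<in> U"
  shows "(\<Sum>c\<in>UNIV. \<Sum>i\<in>UNIV. \<Sum>j\<in>UNIV. u $ c * u $ i * u $ j * cov2 g h x c i j) = 0"
proof -
  let ?w = "transpose (\<sigma> x) *v v"
  define X where "X = (\<Sum>i\<in>UNIV. u $ i *\<^sub>R th i x)"
  have q: "(\<Sum>i\<in>UNIV. \<Sum>j\<in>UNIV. u $ i * (u $ j * (th i x \<bullet> (M *v th j x)))) = X \<bullet> (M *v X)" for M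
  proof -
    have 1: "X \<bullet> z = (\<Sum>i\<in>UNIV. u $ i * (th i x \<bullet> z))" for z
      by (simp add: X_def inner_sum_left)
    have 2: "z \<bullet> (M *v X) = (\<Sum>j\<in>UNIV. u $ j * (z \<bullet> (M *v th j x)))" for z
      by (simp add: X_def inner_sum_right bounded_bilinear.sum_right[OF bounded_bilinear_matrix_vector_mult]
          matrix_vector_mult_scaleR)
    show ?thesis unfolding 1 2 by (subst sum.swap) (simp add: sum_distrib_left mult.left_commute)
  qed
  have "(\<Sum>c\<in>UNIV. \<Sum>i\<in>UNIV. \<Sum>j\<in>UNIV. u $ c * u $ i * u $ j * cov2 g h x c i j)
      = (\<Sum>c\<in>UNIV. \<Sum>i\<in>UNIV. \<Sum>j\<in>UNIV. \<Sum>a\<in>UNIV. u $ c * th c x $ a * (u $ i * (u $ j * (th i x \<bullet> (TB a ?w *v th j x)))))"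
    by (simp add: cov2_eq[OF x] sum_distrib_left mult_ac)
  also have "\<dots> = (\<Sum>c\<in>UNIV. \<Sum>a\<in>UNIV. \<Sum>i\<in>UNIV. \<Sum>j\<in>UNIV. u $ c * th c x $ a * (u $ i * (u $ j * (th i x \<bullet> (TB a ?w *v th j x)))))"
    by (rule sum.cong[OF refl]) (rule sum_swap3[symmetric])
  also have "\<dots> = (\<Sum>c\<in>UNIV. \<Sum>a\<in>UNIV. u $ c * th c x $ a * (X \<bullet> (TB a ?w *v X)))"
    by (simp only: q[symmetric] sum_distrib_left)
  also have "\<dots> = (\<Sum>a\<in>UNIV. \<Sum>c\<in>UNIV. u $ c * th c x $ a * (X \<bullet> (TB a ?w *v X)))"
    by (rule sum.swap)
  also have "\<dots> = (\<Sum>a\<in>UNIV. X $ a * (X \<bullet> (TB a ?w *v X)))"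
    by (simp add: X_def sum_component sum_distrib_right)
  finally show ?thesis by (simp add: killing_contract)
qed

text \<open>The operator scales by 1/k and the squared norm by 1/k^2. Orthogonality of \<sigma>
  removes the dependence on the point.\<close>

lemma stability_integrand_eq:
  assumes x: "x \<in> U"
  shows "inner2 g (\<lambda>x i j. rough_laplacian g h x i j - 2 * curvature_action g h x i j) h x
    = - (8 / (5 * k)) * (112 / (25 * k\<^sup>2)) * (v \<bullet> v)"
proof -
  let ?w = "transpose (\<sigma> x) *v v"
  have "rough_laplacian g h x i j - 2 * curvature_action g h x i j
      = th i x \<bullet> ((- (8 / (5 * k)) *\<^sub>R iota ?w) *v th j x)" for i j
    unfolding bounded_bilinear.scaleR_left[OF bounded_bilinear_matrix_vector_mult] inner_scaleR_right
      rough_laplacian_eq[OF x] curvature_action_eq[OF x] h[OF x]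
    using k_nz by (simp add: field_simps)
  then have "inner2 g (\<lambda>x i j. rough_laplacian g h x i j - 2 * curvature_action g h x i j) h x
      = (\<Sum>a\<in>UNIV. \<Sum>b\<in>UNIV. matrix_inv (k *\<^sub>R G0) $ a $ b * (\<Sum>c\<in>UNIV. \<Sum>d\<in>UNIV.
          matrix_inv (k *\<^sub>R G0) $ c $ d * ((- (8 / (5 * k)) *\<^sub>R iota ?w) $ a $ c * iota ?w $ b $ d)))"
    by (subst inner2_frame[where h = "\<lambda>x i j. rough_laplacian g h x i j - 2 * curvature_action g h x i j"
        and k = h and B = "- (8 / (5 * k)) *\<^sub>R iota ?w" and C = "iota ?w", OF x _ h[OF x]])
      (simp_all only: mult.assoc)
  also have "\<dots> = - (8 / (5 * k)) * ((\<Sum>a\<in>UNIV. \<Sum>b\<in>UNIV. iota ?w $ a $ b * iota ?w $ a $ b / (nrm (i7 a) * nrm (i7 b))) / (k * k))"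
    unfolding sum_inverse_metric[OF k_nz]
    by (simp add: sum_distrib_left sum_divide_distrib mult_ac)
  also have "\<dots> = - (8 / (5 * k)) * (112 / (25 * k\<^sup>2)) * (?w \<bullet> ?w)"
    unfolding inner_contract by (simp add: power2_eq_square)
  also have "?w \<bullet> ?w = v \<bullet> v"
  proof -
    have "?w \<bullet> ?w = v \<bullet> (\<sigma> x *v ?w)"
      unfolding transpose_matrix_vector dot_lmul_matrix ..
    also have "\<sigma> x *v ?w = v"
      by (simp only: matrix_vector_mul_assoc section_orthogonal[OF x] matrix_vector_mul_lid)
    finally show ?thesis .
  qed
  finally show ?thesis .
qed

lemma tensor_smooth: "smooth_on (\<lambda>x. h x i j) U"
proof (rule smooth_on_cong[OF open_dom])
  have "smooth_on (\<lambda>x. transpose (\<sigma> x)) U"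
    by (rule smooth_on_linear[OF bounded_linear_transpose open_dom smooth_section])
  then have "smooth_on (\<lambda>x. transpose (\<sigma> x) *v v) U"
    by (rule smooth_on_linear[OF bounded_bilinear.bounded_linear_left[OF bounded_bilinear_matrix_vector_mult] open_dom])
  then have "smooth_on (\<lambda>x. iota (transpose (\<sigma> x) *v v)) U"
    by (rule smooth_on_linear[OF bounded_linear_iota open_dom])
  then have "smooth_on (\<lambda>x. iota (transpose (\<sigma> x) *v v) *v th j x) U"
    by (rule smooth_on_bilinear[OF bounded_bilinear_matrix_vector_mult open_dom _ smooth_th])
  then show "smooth_on (\<lambda>x. th i x \<bullet> (iota (transpose (\<sigma> x) *v v) *v th j x)) U"
    by (rule smooth_on_bilinear[OF bounded_bilinear_inner open_dom smooth_th])
qed (simp add: h)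

end

end

text \<open>Here f is known only through solutions w near z of F w = E y, with L w = f y. As P is a
  left inverse of F', w - z differs from P (E' (y - x)) by P applied to the remainders of E and
  F.\<close>

lemma implicit_has_derivative:
  fixes F :: "'w::real_normed_vector \<Rightarrow> 'm::real_normed_vector" and E :: "'x::real_normed_vector \<Rightarrow> 'm"
    and f :: "'x \<Rightarrow> 'y::real_normed_vector"
  assumes F: "(F has_derivative F') (at z)" and P: "bounded_linear P" "\<And>w. P (F' w) = w"
    and E: "(E has_derivative E') (at x)" "E x = F z"
    and L: "bounded_linear L" "\<And>w. norm (L w) \<le> norm w" "L z = f x"
    and near: "\<And>e. e > 0 \<Longrightarrow> \<exists>d>0. \<forall>y. norm (y - x) < d \<longrightarrow> (\<exists>w. F w = E y \<and> norm (w - z) < e \<and> L w = f y)"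
  shows "(f has_derivative (\<lambda>h. L (P (E' h)))) (at x)"
  unfolding has_derivative_at_alt
proof (intro conjI allI impI)
  interpret P: bounded_linear P by fact
  interpret L: bounded_linear L by fact
  have E': "bounded_linear E'" using E(1) has_derivative_bounded_linear by blast
  interpret PE: bounded_linear "\<lambda>h. P (E' h)" by (rule bounded_linear_compose[OF P(1) E'])
  show "bounded_linear (\<lambda>h. L (P (E' h)))"
    by (rule bounded_linear_compose[OF L(1) PE.bounded_linear_axioms])
  fix e :: real
  assume e: "0 < e"
  obtain K where K: "K > 0" "\<And>u. norm (P u) \<le> norm u * K" using P.pos_bounded by blast
  obtain C where C: "C > 0" "\<And>u. norm (P (E' u)) \<le> norm u * C" using PE.pos_bounded by blast
  \<comment> \<open>The first bound absorbs half of \<open>norm (w - z)\<close>, which is thereby at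
    most (2 C + 1) times \<open>norm (y - x)\<close>; the second then makes the total error at most
    e times \<open>norm (y - x)\<close>.\<close>
  define \<epsilon> where "\<epsilon> = min (1 / (2 * K)) (e / (K * (2 * C + 2)))"
  have \<epsilon>1: "\<epsilon> \<le> 1 / (2 * K)" and \<epsilon>2: "\<epsilon> \<le> e / (K * (2 * C + 2))"
    by (simp_all add: \<epsilon>_def)
  have KC: "0 < K * (2 * C + 2)" using K(1) C(1) by simp
  then have \<epsilon>0: "\<epsilon> > 0" using K(1) e by (simp add: \<epsilon>_def)
  have "K * \<epsilon> \<le> 1 / 2"
    using \<epsilon>1 K(1) by (simp add: pos_le_divide_eq mult_ac)
  moreover have "K * \<epsilon> * (2 * C + 2) \<le> e"
    using \<epsilon>2 KC by (simp add: pos_le_divide_eq mult_ac)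
  ultimately have \<epsilon>: "\<epsilon> > 0" "K * \<epsilon> \<le> 1 / 2" "K * \<epsilon> * (2 * C + 2) \<le> e"
    using \<epsilon>0 by blast+
  obtain dF where dF: "dF > 0" "\<And>w. norm (w - z) < dF \<Longrightarrow> norm (F w - F z - F' (w - z)) \<le> \<epsilon> * norm (w - z)"
    using F \<epsilon>(1) unfolding has_derivative_at_alt by blast
  obtain dE where dE: "dE > 0" "\<And>y. norm (y - x) < dE \<Longrightarrow> norm (E y - E x - E' (y - x)) \<le> \<epsilon> * norm (y - x)"
    using E(1) \<epsilon>(1) unfolding has_derivative_at_alt by blast
  obtain d where d: "d > 0" "\<And>y. norm (y - x) < d \<Longrightarrow> \<exists>w. F w = E y \<and> norm (w - z) < dF \<and> L w = f y"
    using near[OF dF(1)] by blast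
  show "\<exists>d>0. \<forall>y. norm (y - x) < d \<longrightarrow> norm (f y - f x - L (P (E' (y - x)))) \<le> e * norm (y - x)"
  proof (intro exI conjI allI impI)
    show "min d dE > 0" using d dE by simp
    fix y
    assume y: "norm (y - x) < min d dE"
    obtain w where w: "F w = E y" "norm (w - z) < dF" "L w = f y" using d(2)[of y] y by auto
    define r where "r = w - z - P (E' (y - x))"
    have "r = P (E y - E x - E' (y - x)) - P (F w - F z - F' (w - z))"
      by (simp add: r_def P.diff P(2) w(1) E(2))
    then have "norm r \<le> norm (P (E y - E x - E' (y - x))) + norm (P (F w - F z - F' (w - z)))"
      by (simp add: norm_triangle_ineq4)
    also have "\<dots> \<le> norm (E y - E x - E' (y - x)) * K + norm (F w - F z - F' (w - z)) * K"
      by (intro add_mono K(2))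
    also have "\<dots> \<le> \<epsilon> * norm (y - x) * K + \<epsilon> * norm (w - z) * K"
      using dE(2)[of y] dF(2)[OF w(2)] y K(1) by (intro add_mono mult_right_mono) auto
    finally have r: "norm r \<le> K * \<epsilon> * (norm (y - x) + norm (w - z))" by (simp add: algebra_simps)
    have "norm (w - z) \<le> norm r + norm (P (E' (y - x)))"
      using norm_triangle_ineq[of r "P (E' (y - x))"] by (simp add: r_def)
    also have "\<dots> \<le> 1 / 2 * (norm (y - x) + norm (w - z)) + norm (y - x) * C"
    proof (rule add_mono[OF _ C(2)])
      have "K * \<epsilon> * (norm (y - x) + norm (w - z)) \<le> 1 / 2 * (norm (y - x) + norm (w - z))"
        by (rule mult_right_mono[OF \<epsilon>(2)]) simp
      then show "norm r \<le> 1 / 2 * (norm (y - x) + norm (w - z))" using r by linarith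
    qed
    finally have "norm (w - z) \<le> (2 * C + 1) * norm (y - x)" by (simp add: algebra_simps)
    then have "norm (y - x) + norm (w - z) \<le> (2 * C + 2) * norm (y - x)" by (simp add: algebra_simps)
    then have "K * \<epsilon> * (norm (y - x) + norm (w - z)) \<le> K * \<epsilon> * ((2 * C + 2) * norm (y - x))"
      using K(1) \<epsilon>(1) by (intro mult_left_mono) simp_all
    also have "\<dots> \<le> e * norm (y - x)"
      unfolding mult.assoc[symmetric] using \<epsilon>(3) by (intro mult_right_mono) (simp_all add: mult.assoc)
    finally have "norm r \<le> e * norm (y - x)" using r by linarith
    moreover have "f y - f x - L (P (E' (y - x))) = L r"
      by (simp add: r_def L.diff w(3) L(3))
    ultimately show "norm (f y - f x - L (P (E' (y - x)))) \<le> e * norm (y - x)"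
      using L(2)[of r] by simp
  qed
qed

section \<open>The representation of SO(3) and a parametrisation of the isotropy group\<close>

definition rho_bilinear :: "real^3^3 \<Rightarrow> real^3^3 \<Rightarrow> real^5^5" where
  "rho_bilinear A B = (\<chi> i j. unsym (A ** sym_traceless (axis j 1) ** transpose B) $ i)"

definition rho :: "real^3^3 \<Rightarrow> real^5^5" where
  "rho A = rho_bilinear A A"

text \<open>\<open>rho\<close> is quadratic; its polarisation brings derivative and continuity under
  the rules for bilinear maps.\<close>

lemma bounded_bilinear_rho: "bounded_bilinear rho_bilinear"
  unfolding bilinear_conv_bounded_bilinear[symmetric] bilinear_def
proof (intro conjI allI)
  note mm = bounded_bilinear_matrix_matrix_mult
  show "linear (\<lambda>B. rho_bilinear A B)" for A
    by (simp add: linear_iff rho_bilinear_def vec_eq_iff transpose_scaleR matrix_scaleR_mult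
      linear_add[OF bounded_linear.linear[OF bounded_linear_transpose]] bounded_bilinear.add_right[OF mm]
      linear_add[OF linear_unsym] linear_cmul[OF linear_unsym])
  show "linear (\<lambda>A. rho_bilinear A B)" for B
    by (simp add: linear_iff rho_bilinear_def vec_eq_iff matrix_scaleR_mult bounded_bilinear.add_left[OF mm]
      linear_add[OF linear_unsym] linear_cmul[OF linear_unsym])
qed

lemma rho_bilinear_mult: "rho_bilinear A B *v x = unsym (A ** sym_traceless x ** transpose B)"
proof -
  note mm = bounded_bilinear_matrix_matrix_mult
  have "x = (\<Sum>j\<in>UNIV. x $ j *\<^sub>R axis j 1)"
    using basis_expansion[of x] by (simp add: scalar_mult_eq_scaleR)
  then have "sym_traceless x = (\<Sum>j\<in>UNIV. x $ j *\<^sub>R sym_traceless (axis j 1))"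
    by (metis (no_types, lifting) linear_sum[OF linear_sym_traceless] linear_cmul[OF linear_sym_traceless] sum.cong)
  note x = this
  have "unsym (A ** sym_traceless x ** transpose B) = (\<Sum>j\<in>UNIV. x $ j *\<^sub>R unsym (A ** sym_traceless (axis j 1) ** transpose B))"
    unfolding x by (simp add: bounded_bilinear.sum_left[OF mm]
        bounded_bilinear.sum_right[OF mm] matrix_scaleR_mult linear_sum[OF linear_unsym] linear_cmul[OF linear_unsym])
  then show ?thesis
    by (simp add: vec_eq_iff rho_bilinear_def matrix_vector_mult_def sum_component mult.commute)
qed

lemma sym_traceless_rho:
  assumes "rotation_matrix A"
  shows "sym_traceless (rho A *v x) = A ** sym_traceless x ** transpose A"
  unfolding rho_def rho_bilinear_mult
  by (rule sym_traceless_unsym)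
     (simp_all add: trace_conj[OF assms] trace_sym_traceless matrix_transpose_mul transpose_sym_traceless matrix_mul_assoc)

lemma rho_SO3_irr: "rotation_matrix A \<Longrightarrow> rho A \<in> SO3_irr"
  unfolding SO3_irr_def using sym_traceless_rho by blast

lemma rho_mat_1: "rho (mat 1) = mat 1"
  by (simp add: rho_def matrix_eq rho_bilinear_mult unsym_sym_traceless)

lemma rho_has_derivative:
  fixes A :: "'a::real_normed_vector \<Rightarrow> real^3^3"
  assumes "(A has_derivative (\<lambda>h. skew3 (p h) (q h) (r h))) (at x)" "A x = mat 1"
  shows "((\<lambda>y. rho (A y)) has_derivative (\<lambda>h. p h *\<^sub>R bas 7 + q h *\<^sub>R bas 8 + r h *\<^sub>R bas 9)) (at x)"
proof -
  have "rho_bilinear (mat 1) (skew3 p q r) + rho_bilinear (skew3 p q r) (mat 1) = p *\<^sub>R bas 7 + q *\<^sub>R bas 8 + r *\<^sub>R bas 9" for p q r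
  proof -
    have t: "transpose (skew3 p q r) = - skew3 p q r"
      by (simp add: vec_eq_iff forall_3 skew3_def vector_3 transpose_def)
    have "(rho_bilinear (mat 1) (skew3 p q r) + rho_bilinear (skew3 p q r) (mat 1)) *v x
        = (p *\<^sub>R bas 7 + q *\<^sub>R bas 8 + r *\<^sub>R bas 9) *v x" for x
    proof -
      have "(rho_bilinear (mat 1) (skew3 p q r) + rho_bilinear (skew3 p q r) (mat 1)) *v x
          = unsym (skew3 p q r ** sym_traceless x - sym_traceless x ** skew3 p q r)"
        by (simp add: matrix_vector_mult_add_rdistrib rho_bilinear_mult t linear_diff[OF linear_unsym]
            linear_neg[OF linear_unsym] bounded_bilinear.minus_right[OF bounded_bilinear_matrix_matrix_mult])
      then show ?thesis by (simp only: unsym_sym_traceless flip: sym_traceless_so3)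
    qed
    then show ?thesis unfolding matrix_eq by blast
  qed
  then show ?thesis
    using bounded_bilinear.FDERIV[OF bounded_bilinear_rho assms(1) assms(1)] by (simp add: rho_def assms(2))
qed

definition RX :: "real \<Rightarrow> real^3^3" where
  "RX t = vector [vector [1, 0, 0], vector [0, cos t, - sin t], vector [0, sin t, cos t]]"
definition RY :: "real \<Rightarrow> real^3^3" where
  "RY t = vector [vector [cos t, 0, sin t], vector [0, 1, 0], vector [- sin t, 0, cos t]]"
definition RZ :: "real \<Rightarrow> real^3^3" where
  "RZ t = vector [vector [cos t, - sin t, 0], vector [sin t, cos t, 0], vector [0, 0, 1]]"

lemma rotation_RXYZ: "rotation_matrix (RX t)" "rotation_matrix (RY t)" "rotation_matrix (RZ t)"
  using sin_cos_squared_add[of t] sin_cos_squared_add2[of t]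
  by (simp_all add: rotation_matrix_def orthogonal_matrix_def vec_eq_iff forall_3 RX_def RY_def RZ_def vector_3
      matrix_matrix_mult_def transpose_def sum_3 mat_def det_3 power2_eq_square)

lemma RXYZ_0: "RX 0 = mat 1" "RY 0 = mat 1" "RZ 0 = mat 1"
  by (simp_all add: vec_eq_iff forall_3 RX_def RY_def RZ_def vector_3 mat_def)

lemma RXYZ_has_derivative:
  "(RX has_derivative (\<lambda>h. skew3 h 0 0)) (at 0)"
  "(RY has_derivative (\<lambda>h. skew3 0 h 0)) (at 0)"
  "(RZ has_derivative (\<lambda>h. skew3 0 0 h)) (at 0)"
proof -
  have d: "(cos has_derivative (\<lambda>h. 0)) (at (0::real))" "(sin has_derivative (\<lambda>h. h)) (at (0::real))"
    "((\<lambda>t. - sin t) has_derivative (\<lambda>h. - h)) (at (0::real))"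
    by (auto intro!: derivative_eq_intros)
  show "(RX has_derivative (\<lambda>h. skew3 h 0 0)) (at 0)"
    "(RY has_derivative (\<lambda>h. skew3 0 h 0)) (at 0)"
    "(RZ has_derivative (\<lambda>h. skew3 0 0 h)) (at 0)"
    using d by (simp_all add: has_derivative_componentwise_within[of RX] has_derivative_componentwise_within[of RY]
        has_derivative_componentwise_within[of RZ] Basis_vec_def inner_axis RX_def RY_def RZ_def skew3_def vector_3 forall_3)
qed

text \<open>Rotations about the three axes, multiplied. At 0 the three parameters move in the
  independent directions \<open>bas 7\<close>, \<open>bas 8\<close> and
  \<open>bas 9\<close>.\<close>

definition H_param :: "real^3 \<Rightarrow> real^5^5" where
  "H_param a = rho (RX (a $ 1) ** RY (a $ 2) ** RZ (a $ 3))"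

lemma H_param_SO3_irr: "H_param a \<in> SO3_irr"
  unfolding H_param_def by (intro rho_SO3_irr rotation_matrix_mult rotation_RXYZ)

lemma H_param_0: "H_param 0 = mat 1"
  by (simp add: H_param_def RXYZ_0 rho_mat_1)

lemma H_param_has_derivative:
  "(H_param has_derivative (\<lambda>b. b $ 1 *\<^sub>R bas 7 + b $ 2 *\<^sub>R bas 8 + b $ 3 *\<^sub>R bas 9)) (at 0)"
proof -
  note mm = bounded_bilinear_matrix_matrix_mult
  have c: "((\<lambda>a :: real^3. a $ i) has_derivative (\<lambda>b. b $ i)) (at 0)" for i
    by (rule bounded_linear_imp_has_derivative[OF bounded_linear_vec_nth])
  have 1: "((\<lambda>a. RX (a $ 1)) has_derivative (\<lambda>b. skew3 (b $ 1) 0 0)) (at (0 :: real^3))"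
    using diff_chain_at[OF c[of 1], of RX "\<lambda>h. skew3 h 0 0"] RXYZ_has_derivative(1) by (simp add: o_def)
  have 2: "((\<lambda>a. RY (a $ 2)) has_derivative (\<lambda>b. skew3 0 (b $ 2) 0)) (at (0 :: real^3))"
    using diff_chain_at[OF c[of 2], of RY "\<lambda>h. skew3 0 h 0"] RXYZ_has_derivative(2) by (simp add: o_def)
  have 3: "((\<lambda>a. RZ (a $ 3)) has_derivative (\<lambda>b. skew3 0 0 (b $ 3))) (at (0 :: real^3))"
    using diff_chain_at[OF c[of 3], of RZ "\<lambda>h. skew3 0 0 h"] RXYZ_has_derivative(3) by (simp add: o_def)
  have s: "skew3 0 0 r + (skew3 0 q 0 + skew3 p 0 0) = skew3 p q r" for p q r
    by (simp add: vec_eq_iff forall_3 skew3_def vector_3)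
  have "((\<lambda>a. RX (a $ 1) ** RY (a $ 2) ** RZ (a $ 3)) has_derivative (\<lambda>b. skew3 (b $ 1) (b $ 2) (b $ 3))) (at (0 :: real^3))"
    using bounded_bilinear.FDERIV[OF mm bounded_bilinear.FDERIV[OF mm 1 2] 3] by (simp add: RXYZ_0 s)
  from rho_has_derivative[OF this] show ?thesis
    by (simp add: H_param_def[abs_def] RXYZ_0)
qed

lemma berger_coset_eq_iff:
  assumes "R \<in> SO5" "R' \<in> SO5"
  shows "berger_coset R = berger_coset R' \<longleftrightarrow> transpose R' ** R \<in> SO3_irr"
proof
  have o: "transpose R' ** R' = mat 1" "R' ** transpose R' = mat 1"
    using assms(2) by (simp_all add: SO5_def rotation_mult_transpose)
  show "transpose R' ** R \<in> SO3_irr" if eq: "berger_coset R = berger_coset R'"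
  proof -
    have "R \<in> berger_coset R"
      unfolding berger_coset_def by (rule image_eqI[OF _ SO3_irr_mat_1]) (simp only: matrix_mul_rid)
    then have "R \<in> (\<lambda>q. R' ** q) ` SO3_irr"
      unfolding eq by (simp only: berger_coset_def)
    then show ?thesis
    proof (rule imageE)
      fix q assume q: "R = R' ** q" "q \<in> SO3_irr"
      have "transpose R' ** R = (transpose R' ** R') ** q" by (simp only: q(1) matrix_mul_assoc)
      then show ?thesis by (simp only: o matrix_mul_lid q(2))
    qed
  qed
  show "berger_coset R = berger_coset R'" if q: "transpose R' ** R \<in> SO3_irr"
  proof -
    define q where "q = transpose R' ** R"
    have R: "R = R' ** q" by (simp only: q_def matrix_mul_assoc o matrix_mul_lid)
    have q': "q \<in> SO3_irr" using q by (simp only: q_def)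
    have h1: "R ** p \<in> berger_coset R'" if "p \<in> SO3_irr" for p
      unfolding berger_coset_def
    proof (rule image_eqI)
      show "R ** p = R' ** (q ** p)" by (simp only: R matrix_mul_assoc)
      show "q ** p \<in> SO3_irr" by (rule SO3_irr_mult[OF q' that])
    qed
    have h2: "R' ** p \<in> berger_coset R" if "p \<in> SO3_irr" for p
    proof -
      have "R ** (transpose q ** p) = R' ** (q ** transpose q) ** p"
        by (simp only: R matrix_mul_assoc)
      then have "R' ** p = R ** (transpose q ** p)"
        by (simp only: SO3_irr_orthogonal[OF q'] matrix_mul_rid)
      then show ?thesis
        unfolding berger_coset_def
        by (rule image_eqI) (rule SO3_irr_mult[OF SO3_irr_transpose[OF q'] that])
    qed
    have "(\<lambda>q. R ** q) ` SO3_irr \<subseteq> berger_coset R'" by (rule image_subsetI) (rule h1)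
    moreover have "(\<lambda>q. R' ** q) ` SO3_irr \<subseteq> berger_coset R" by (rule image_subsetI) (rule h2)
    ultimately show ?thesis by (simp only: berger_coset_def subset_antisym)
  qed
qed

text \<open>The equation says 2 t = - t^2, which a small non-zero t cannot satisfy. In
  \<open>local_param_onto\<close> t is symmetric.\<close>

lemma symmetric_square_root_unique:
  obtains \<delta> where "\<delta> > 0" "\<And>t :: real^'n^'n. norm t < \<delta> \<Longrightarrow> (mat 1 + t) ** (mat 1 + t) = mat 1 \<Longrightarrow> t = 0"
proof -
  interpret mm: bounded_bilinear "(**) :: real^'n^'n \<Rightarrow> real^'n^'n \<Rightarrow> real^'n^'n"
    by (rule bounded_bilinear_matrix_matrix_mult)
  from mm.pos_bounded obtain K
    where "0 < K \<and> (\<forall>(a :: real^'n^'n) (b :: real^'n^'n). norm (a ** b) \<le> norm a * norm b * K)" ..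
  then have K: "K > 0" "norm (a ** b) \<le> norm a * norm b * K" for a b :: "real^'n^'n"
    by simp_all
  have "t = 0" if t: "norm t < 1 / K" "(mat 1 + t) ** (mat 1 + t) = mat 1" for t :: "real^'n^'n"
  proof (rule ccontr)
    assume "t \<noteq> 0"
    have "(mat 1 + t) ** (mat 1 + t) = mat 1 + (2 *\<^sub>R t + t ** t)"
      by (simp add: mm.add_left mm.add_right scaleR_2 add.assoc)
    then have "2 *\<^sub>R t = - (t ** t)"
      unfolding t(2) eq_neg_iff_add_eq_0 by (metis add_cancel_right_right)
    then have "norm (2 *\<^sub>R t) = norm (t ** t)" by simp
    then have "2 * norm t \<le> norm t * norm t * K" using K(2)[of t t] by simp
    moreover have "norm t * (norm t * K) < norm t * 1"
      using t(1) K(1) \<open>t \<noteq> 0\<close> by (intro mult_strict_left_mono) (simp_all add: field_simps)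
    ultimately show False using \<open>t \<noteq> 0\<close> by (simp add: mult.assoc)
  qed
  then show ?thesis using that[of "1 / K"] K(1) by simp
qed

section \<open>Transition maps\<close>

lemma continuous_on_matrixI:
  fixes f :: "'a::topological_space \<Rightarrow> real^'m^'n"
  assumes "\<forall>i j. continuous_on S (\<lambda>x. f x $ i $ j)"
  shows "continuous_on S f"
proof -
  have "continuous_on S (\<lambda>x. \<chi> i j. f x $ i $ j)"
    by (rule continuous_on_vec_lambda, rule continuous_on_vec_lambda) (use assms in blast)
  then show ?thesis by simp
qed

lemma continuous_H_param: "continuous_on S H_param"
proof -
  have R: "continuous_on UNIV RX" "continuous_on UNIV RY" "continuous_on UNIV RZ"
    by (rule continuous_on_matrixI,
        simp add: forall_3 RX_def RY_def RZ_def vector_3 continuous_on_sin continuous_on_cos continuous_on_minus continuous_on_id)+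
  have c: "continuous_on S (\<lambda>a :: real^3. a $ i)" for i
    by (rule linear_continuous_on[OF bounded_linear_vec_nth])
  note mm = bounded_bilinear.continuous_on[OF bounded_bilinear_matrix_matrix_mult]
  have "continuous_on S (\<lambda>a. RX (a $ 1) ** RY (a $ 2) ** RZ (a $ 3))"
    by (rule mm[OF mm[OF continuous_on_compose2[OF R(1) c] continuous_on_compose2[OF R(2) c]]
        continuous_on_compose2[OF R(3) c]]) simp_all
  from bounded_bilinear.continuous_on[OF bounded_bilinear_rho this this]
  show ?thesis by (simp add: H_param_def[abs_def] rho_def)
qed

lemma norm_add_transpose_bound:
  obtains C where "C > 0" "\<And>s :: real^'n^'n. norm (s + transpose s) \<le> norm s * C"
proof -
  have "bounded_linear (\<lambda>s :: real^'n^'n. s + transpose s)"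
    by (rule bounded_linear_add[OF bounded_linear_ident bounded_linear_transpose])
  from bounded_linear.pos_bounded[OF this] show ?thesis using that by blast
qed

context berger_section
begin

definition tangent :: "real^7 \<Rightarrow> real^7 \<Rightarrow> real^5^5" where
  "tangent x v = transpose (\<sigma> x) ** fd \<sigma> x v"

lemma tangent_eq:
  assumes "x \<in> U"
  shows "tangent x v = (\<Sum>i\<in>UNIV. v $ i *\<^sub>R om i x)"
  by (simp add: tangent_def fd_eq_sum_pdv[OF section_diff[OF assms]] om_def matrix_scaleR_mult
      bounded_bilinear.sum_right[OF bounded_bilinear_matrix_matrix_mult])

lemma tangent_skew: "x \<in> U \<Longrightarrow> transpose (tangent x v) = - tangent x v"
  by (simp add: tangent_eq linear_sum[OF bounded_linear.linear[OF bounded_linear_transpose]] transpose_scaleR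
      om_skew sum_negf)

lemma mcoord_tangent: "x \<in> U \<Longrightarrow> mcoord (tangent x v) = (\<Sum>i\<in>UNIV. v $ i *\<^sub>R th i x)"
  by (simp add: tangent_eq linear_sum[OF linear_mcoord] linear_cmul[OF linear_mcoord] th_def)

lemma mcoord_tangent_surj:
  assumes "x \<in> U"
  obtains v where "mcoord (tangent x v) = u"
proof -
  have "linear (\<lambda>v. mcoord (tangent x v))"
    by (simp add: mcoord_tangent[OF assms] linear_iff scaleR_add_left sum.distrib scaleR_sum_right)
  note lin = this
  have "inj (\<lambda>v. mcoord (tangent x v))"
    unfolding linear_injective_0[OF lin] by (simp add: mcoord_tangent[OF assms] section_indep[OF assms])
  with lin have "surj (\<lambda>v. mcoord (tangent x v))"
    using linear_injective_imp_surjective by blast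
  then show ?thesis using that by (metis surjD)
qed

text \<open>Left multiplication by \<sigma>^t puts the base point (x, 0) at the identity; the second
  argument moves along the fibre.\<close>

definition local_param :: "real^7 \<Rightarrow> (real^7) \<times> (real^3) \<Rightarrow> real^5^5" where
  "local_param x w = transpose (\<sigma> x) ** \<sigma> (fst w) ** H_param (snd w)"

definition local_param_deriv :: "real^7 \<Rightarrow> (real^7) \<times> (real^3) \<Rightarrow> real^5^5" where
  "local_param_deriv x w = tangent x (fst w) + (snd w $ 1 *\<^sub>R bas 7 + snd w $ 2 *\<^sub>R bas 8 + snd w $ 3 *\<^sub>R bas 9)"

lemma local_param_has_derivative:
  assumes x: "x \<in> U"
  shows "(local_param x has_derivative local_param_deriv x) (at (x, 0))"
proof -
  note mm = bounded_bilinear_matrix_matrix_mult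
  have "(\<sigma> has_derivative fd \<sigma> x) (at (fst (x, 0 :: real^3)))"
    using section_diff[OF x] frechet_derivative_works by simp blast
  from has_derivative_compose[OF bounded_linear_imp_has_derivative[OF bounded_linear_fst] this]
  have "((\<lambda>w. \<sigma> (fst w)) has_derivative (\<lambda>w. fd \<sigma> x (fst w))) (at (x, 0 :: real^3))" .
  from bounded_linear.has_derivative[OF bounded_bilinear.bounded_linear_right[OF mm] this, of "transpose (\<sigma> x)"]
  have 1: "((\<lambda>w. transpose (\<sigma> x) ** \<sigma> (fst w)) has_derivative (\<lambda>w. tangent x (fst w))) (at (x, 0 :: real^3))"
    by (simp add: tangent_def)
  have "(H_param has_derivative (\<lambda>b. b $ 1 *\<^sub>R bas 7 + b $ 2 *\<^sub>R bas 8 + b $ 3 *\<^sub>R bas 9)) (at (snd (x, 0)))"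
    using H_param_has_derivative by simp
  from has_derivative_compose[OF bounded_linear_imp_has_derivative[OF bounded_linear_snd] this]
  have 2: "((\<lambda>w. H_param (snd w)) has_derivative
      (\<lambda>w. snd w $ 1 *\<^sub>R bas 7 + snd w $ 2 *\<^sub>R bas 8 + snd w $ 3 *\<^sub>R bas 9)) (at (x, 0))" .
  show ?thesis
    using bounded_bilinear.FDERIV[OF mm 1 2]
    by (simp add: local_param_def[abs_def] local_param_deriv_def[abs_def] H_param_0 section_orthogonal[OF x] add.commute)
qed

lemma local_param_base: "x \<in> U \<Longrightarrow> local_param x (x, 0) = mat 1"
  by (simp add: local_param_def H_param_0 section_orthogonal)

lemma local_param_deriv_onto_skew:
  assumes x: "x \<in> U" and K: "transpose K = - K"
  obtains w where "local_param_deriv x w = K"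
proof -
  obtain v where v: "mcoord (tangent x v) = mcoord K" using mcoord_tangent_surj[OF x] .
  have "transpose (K - tangent x v) = - (K - tangent x v)"
    by (simp add: linear_diff[OF bounded_linear.linear[OF bounded_linear_transpose]] K tangent_skew[OF x])
  moreover have "mcoord (K - tangent x v) = 0" by (simp add: linear_diff[OF linear_mcoord] v)
  ultimately have "K - tangent x v \<in> so3_irr" by (simp add: so3_irr_iff)
  then obtain p q r where pqr: "K - tangent x v = p *\<^sub>R bas 7 + q *\<^sub>R bas 8 + r *\<^sub>R bas 9"
    unfolding so3_irr_iff_combination by blast
  have "local_param_deriv x (v, vector [p, q, r]) = K"
    using pqr by (simp add: local_param_deriv_def vector_3 algebra_simps)
  then show ?thesis by (rule that)
qed

lemma linear_local_param_deriv:
  assumes x: "x \<in> U"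
  shows "linear (local_param_deriv x)"
  using has_derivative_linear[OF local_param_has_derivative[OF x]] .

lemma local_param_deriv_inj:
  assumes x: "x \<in> U"
  shows "inj (local_param_deriv x)"
  unfolding linear_injective_0[OF linear_local_param_deriv[OF x]]
proof (intro allI impI)
  fix w
  assume w: "local_param_deriv x w = 0"
  have m: "mcoord (snd w $ 1 *\<^sub>R bas 7 + snd w $ 2 *\<^sub>R bas 8 + snd w $ 3 *\<^sub>R bas 9) = 0"
    by (simp add: linear_add[OF linear_mcoord] linear_cmul[OF linear_mcoord] mcoord_bas)
  have "mcoord (local_param_deriv x w) = mcoord (tangent x (fst w))"
    unfolding local_param_deriv_def linear_add[OF linear_mcoord, of "tangent x (fst w)"] m by simp
  then have "(\<Sum>i\<in>UNIV. fst w $ i *\<^sub>R th i x) = 0"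
    using w by (simp add: linear_0[OF linear_mcoord] mcoord_tangent[OF x])
  then have f: "fst w = 0" by (rule section_indep[OF x])
  then have s: "snd w $ 1 *\<^sub>R bas 7 + snd w $ 2 *\<^sub>R bas 8 + snd w $ 3 *\<^sub>R bas 9 = 0"
    using w by (simp add: local_param_deriv_def tangent_eq[OF x])
  have lin: "linear (coef n)" for n using bounded_linear_coef bounded_linear.linear by blast
  have "coef n (snd w $ 1 *\<^sub>R bas 7 + snd w $ 2 *\<^sub>R bas 8 + snd w $ 3 *\<^sub>R bas 9) = 0" for n
    unfolding s by (rule linear_0[OF lin])
  then have "snd w $ 1 * coef n (bas 7) + snd w $ 2 * coef n (bas 8) + snd w $ 3 * coef n (bas 9) = 0" for n
    by (simp add: linear_add[OF lin] linear_cmul[OF lin])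
  from this[of 7] this[of 8] this[of 9] have "snd w = 0"
    by (simp add: coef_bas vec_eq_iff forall_3)
  with f show "w = 0" by (simp add: prod_eq_iff)
qed

text \<open>Near a point of the image, the map \<open>(z, a) \<mapsto> \<sigma>(z) H(a)\<close> covers \<open>SO(5)\<close>: it does so after
  multiplication by symmetric matrices, and orthogonality forces the symmetric factor to be \<open>1\<close>.\<close>

lemma local_param_onto:
  assumes x: "x \<in> U" and e: "e > 0"
  obtains d where "d > 0" "\<And>M. transpose M ** M = mat 1 \<Longrightarrow> norm (M - mat 1) < d \<Longrightarrow>
    \<exists>w. fst w \<in> U \<and> local_param x w = M \<and> norm (w - (x, 0)) < e"
proof -
  note mm = bounded_bilinear_matrix_matrix_mult
  \<comment> \<open>SO(5) has empty interior in the space of matrices, so the open mapping theorem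
    needs a map onto all directions; the factor 1 + s + s^t adds the symmetric ones.\<close>
  define \<Phi> where "\<Phi> = (\<lambda>p. local_param x (fst p) ** (mat 1 + (snd p + transpose (snd p))))"
  define \<Phi>' where "\<Phi>' = (\<lambda>p. local_param_deriv x (fst p) + (snd p + transpose (snd p)))"
  define p0 where "p0 = ((x, 0 :: real^3), 0 :: real^5^5)"
  have ls: "bounded_linear (\<lambda>p :: ((real^7) \<times> (real^3)) \<times> (real^5^5). snd p + transpose (snd p))"
    by (rule bounded_linear_add[OF bounded_linear_snd bounded_linear_compose[OF bounded_linear_transpose bounded_linear_snd]])
  have "(local_param x has_derivative local_param_deriv x) (at (fst p0))"
    using local_param_has_derivative[OF x] by (simp add: p0_def)
  from has_derivative_compose[OF bounded_linear_imp_has_derivative[OF bounded_linear_fst] this]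
  have 1: "((\<lambda>p. local_param x (fst p)) has_derivative (\<lambda>p. local_param_deriv x (fst p))) (at p0)" .
  have 2: "((\<lambda>p :: ((real^7) \<times> (real^3)) \<times> (real^5^5). mat 1 + (snd p + transpose (snd p))) has_derivative (\<lambda>p. snd p + transpose (snd p))) (at p0)"
    using has_derivative_add[OF has_derivative_const bounded_linear_imp_has_derivative[OF ls]] by simp
  have t0: "transpose (0 :: real^5^5) = 0" by (simp add: transpose_def vec_eq_iff)
  have d\<Phi>: "(\<Phi> has_derivative \<Phi>') (at p0)"
    using bounded_bilinear.FDERIV[OF mm 1 2]
    by (simp add: \<Phi>_def \<Phi>'_def p0_def local_param_base[OF x] t0 add.commute)
  have lin: "linear \<Phi>'" using has_derivative_linear[OF d\<Phi>] .
  have "surj \<Phi>'"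
    unfolding surj_def
  proof
    fix M :: "real^5^5"
    have K: "transpose ((1 / 2) *\<^sub>R (M - transpose M)) = - ((1 / 2) *\<^sub>R (M - transpose M))"
      by (simp add: vec_eq_iff transpose_def algebra_simps)
    obtain w where w: "local_param_deriv x w = (1 / 2) *\<^sub>R (M - transpose M)"
      using local_param_deriv_onto_skew[OF x K] .
    \<comment> \<open>Skew plus symmetric part of M; a quarter, because s + s^t doubles a symmetric
      s.\<close>
    have "M = \<Phi>' (w, (1 / 4) *\<^sub>R (M + transpose M))"
      by (simp add: \<Phi>'_def w) (simp add: vec_eq_iff transpose_def algebra_simps)
    then show "\<exists>p. M = \<Phi>' p" by blast
  qed
  then obtain g where g: "linear g" "\<Phi>' \<circ> g = id"
    using linear_surjective_right_inverse[OF lin] by blast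
  define S where "S = (U \<times> (UNIV :: (real^3) set)) \<times> (UNIV :: (real^5^5) set)"
  have S: "open S" unfolding S_def by (intro open_Times open_dom open_UNIV)
  have "continuous_on (U \<times> UNIV) (local_param x)"
  proof -
    have "continuous_on (U \<times> UNIV) (\<lambda>w. \<sigma> (fst w))"
      by (rule continuous_on_compose2[OF smooth_on_continuous[OF smooth_section] continuous_on_fst[OF continuous_on_id]]) auto
    moreover have "continuous_on (U \<times> UNIV) (\<lambda>w. H_param (snd w))"
      by (rule continuous_on_compose2[OF continuous_H_param[of UNIV] continuous_on_snd[OF continuous_on_id]]) auto
    ultimately show ?thesis
      unfolding local_param_def[abs_def]
      by (intro bounded_bilinear.continuous_on[OF mm] continuous_on_const)
  qed
  from continuous_on_compose2[OF this continuous_on_fst[OF continuous_on_id], of S]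
  have c\<Phi>: "continuous_on S \<Phi>"
    unfolding \<Phi>_def
    by (intro bounded_bilinear.continuous_on[OF mm] continuous_on_add continuous_on_const linear_continuous_on[OF ls]) (auto simp: S_def)
  obtain \<delta> where \<delta>: "\<delta> > 0" "\<And>t :: real^5^5. norm t < \<delta> \<Longrightarrow> (mat 1 + t) ** (mat 1 + t) = mat 1 \<Longrightarrow> t = 0"
    using symmetric_square_root_unique by blast
  obtain C where C: "C > 0" "\<And>s :: real^5^5. norm (s + transpose s) \<le> norm s * C"
    using norm_add_transpose_bound by blast
  have p0S: "p0 \<in> S" using x by (simp add: p0_def S_def)
  obtain r0 where r0: "r0 > 0" "ball p0 r0 \<subseteq> S" using S p0S open_contains_ball by blast
  \<comment> \<open>Three demands: stay in S, keep w within e of the base point, and keep the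
    symmetric part t below \<delta>.\<close>
  define r where "r = min r0 (min e (\<delta> / C))"
  have r: "r > 0" "ball p0 r \<subseteq> S" using r0 e \<delta>(1) C(1) by (auto simp: r_def)
  have "\<Phi> p0 \<in> interior (\<Phi> ` ball p0 r)"
    by (rule sussmann_open_mapping[OF S c\<Phi> p0S d\<Phi> _ g(2) r(2)])
      (use g(1) r(1) in \<open>simp_all add: linear_conv_bounded_linear\<close>)
  moreover have "\<Phi> p0 = mat 1" by (simp add: \<Phi>_def p0_def local_param_base[OF x] t0)
  ultimately obtain d where d: "d > 0" "ball (mat 1) d \<subseteq> \<Phi> ` ball p0 r"
    unfolding mem_interior by metis
  show ?thesis
  proof (rule that[OF d(1)])
    fix M :: "real^5^5"
    assume M: "transpose M ** M = mat 1" "norm (M - mat 1) < d"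
    have "M \<in> \<Phi> ` ball p0 r"
      using d(2) M(2) by (auto simp: dist_norm norm_minus_commute)
    then obtain p where p: "p \<in> ball p0 r" "M = \<Phi> p" by (elim imageE) simp
    define w s where "w = fst p" and "s = snd p"
    define t where "t = s + transpose s"
    have ps: "norm (w - (x, 0)) < r" "norm s < r"
    proof -
      have "dist (fst p0) (fst p) < r" "dist (snd p0) (snd p) < r"
        using p(1) dist_fst_le[of p0 p] dist_snd_le[of p0 p] by simp_all
      then show "norm (w - (x, 0)) < r" "norm s < r"
        by (simp_all add: p0_def w_def s_def dist_norm norm_minus_commute)
    qed
    have wU: "fst w \<in> U" using r(2) p(1) by (auto simp: S_def w_def)
    have L: "transpose (local_param x w) ** local_param x w = mat 1"
    proof -
      have "transpose (local_param x w) ** local_param x w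
          = transpose (H_param (snd w)) ** (transpose (\<sigma> (fst w)) ** (\<sigma> x ** transpose (\<sigma> x)) ** \<sigma> (fst w)) ** H_param (snd w)"
        by (simp only: local_param_def matrix_transpose_mul transpose_transpose matrix_mul_assoc)
      then show ?thesis
        by (simp add: section_orthogonal[OF x] section_orthogonal[OF wU] SO3_irr_orthogonal[OF H_param_SO3_irr])
    qed
    have MS: "M = local_param x w ** (mat 1 + t)" by (simp add: p(2) \<Phi>_def w_def s_def t_def)
    have "transpose (mat 1 + t) = mat 1 + t"
      by (simp add: t_def vec_eq_iff transpose_def mat_def)
    then have "transpose M ** M = (mat 1 + t) ** (transpose (local_param x w) ** local_param x w) ** (mat 1 + t)"
      unfolding MS matrix_transpose_mul by (simp only: matrix_mul_assoc)
    then have "(mat 1 + t) ** (mat 1 + t) = mat 1" by (simp add: L M(1))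
    moreover have "norm t < \<delta>"
    proof -
      have "norm t \<le> norm s * C" unfolding t_def by (rule C(2))
      also have "\<dots> < r * C" using ps(2) C(1) by simp
      also have "\<dots> \<le> \<delta> / C * C" using C(1) by (intro mult_right_mono) (auto simp: r_def)
      finally show ?thesis using C(1) by simp
    qed
    ultimately have "t = 0" using \<delta>(2) by blast
    then have "local_param x w = M" using MS by simp
    moreover have "norm (w - (x, 0)) < e" using ps(1) by (simp add: r_def)
    ultimately show "\<exists>w. fst w \<in> U \<and> local_param x w = M \<and> norm (w - (x, 0)) < e"
      using wU by blast
  qed
qed

end

text \<open>E is \<sigma> seen from \<sigma>' x' and corrected by q, so that E x is the identity.
  Near x it factors through \<open>local_param\<close> of the other section, and the first component
  of that factorisation is the transition map, so \<open>implicit_has_derivative\<close> applies.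
  The fibre directions disappear under \<open>mcoord\<close>.\<close>

lemma transition_derivative:
  assumes sec: "berger_section U \<sigma>" "berger_section U' \<sigma>'"
    and x: "x \<in> U" and x': "x' \<in> U'"
    and q: "q \<in> SO3_irr" "\<sigma> x = \<sigma>' x' ** q"
    and inj: "inj_on \<psi>' U'"
    and \<psi>: "\<And>y. y \<in> U \<Longrightarrow> \<psi> y = berger_coset (\<sigma> y)" "\<And>y. y \<in> U' \<Longrightarrow> \<psi>' y = berger_coset (\<sigma>' y)"
  obtains f' where "((\<lambda>y. the_inv_into U' \<psi>' (\<psi> y)) has_derivative f') (at x)"
    "\<And>v. mcoord (berger_section.tangent \<sigma>' x' (f' v)) = mcoord (q ** berger_section.tangent \<sigma> x v ** transpose q)"
proof -
  interpret s: berger_section U \<sigma> by fact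
  interpret t: berger_section U' \<sigma>' by fact
  note mm = bounded_bilinear_matrix_matrix_mult
  let ?f = "\<lambda>y. the_inv_into U' \<psi>' (\<psi> y)"
  define E where "E = (\<lambda>y. transpose (\<sigma>' x') ** \<sigma> y ** transpose q)"
  define E' where "E' = (\<lambda>v. q ** s.tangent x v ** transpose q)"
  have rel: "?f y = z" if "y \<in> U" "z \<in> U'" "transpose (\<sigma>' z) ** \<sigma> y \<in> SO3_irr" for y z
  proof -
    have "\<psi> y = \<psi>' z"
      unfolding \<psi>(1)[OF that(1)] \<psi>(2)[OF that(2)]
      using that(3) berger_coset_eq_iff[OF s.section_SO5[OF that(1)] t.section_SO5[OF that(2)]] by blast
    then show ?thesis using the_inv_into_f_f[OF inj that(2)] by simp
  qed
  have E0: "E x = mat 1"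
  proof -
    have "E x = (transpose (\<sigma>' x') ** \<sigma>' x') ** (q ** transpose q)"
      by (simp only: E_def q(2) matrix_mul_assoc)
    then show ?thesis by (simp add: t.section_orthogonal[OF x'] SO3_irr_orthogonal[OF q(1)])
  qed
  have dE: "(E has_derivative E') (at x)"
  proof -
    have "transpose (\<sigma>' x') = q ** transpose (\<sigma> x)"
    proof -
      have "q ** transpose (\<sigma> x) = (q ** transpose q) ** transpose (\<sigma>' x')"
        by (simp only: q(2) matrix_transpose_mul matrix_mul_assoc)
      then show ?thesis by (simp add: SO3_irr_orthogonal[OF q(1)])
    qed
    then have "E' = (\<lambda>v. transpose (\<sigma>' x') ** fd \<sigma> x v ** transpose q)"
      by (simp only: E'_def s.tangent_def matrix_mul_assoc)
    moreover have "(\<sigma> has_derivative fd \<sigma> x) (at x)"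
      using s.section_diff[OF x] frechet_derivative_works by blast
    ultimately show ?thesis
      unfolding E_def
      by (simp only:) (intro bounded_linear.has_derivative[OF bounded_bilinear.bounded_linear_left[OF mm]]
        bounded_linear.has_derivative[OF bounded_bilinear.bounded_linear_right[OF mm]])
  qed
  have Eorth: "transpose (E y) ** E y = mat 1" if "y \<in> U" for y
  proof -
    have "transpose (E y) ** E y = q ** (transpose (\<sigma> y) ** (\<sigma>' x' ** transpose (\<sigma>' x')) ** \<sigma> y) ** transpose q"
      by (simp only: E_def matrix_transpose_mul transpose_transpose matrix_mul_assoc)
    then show ?thesis
      by (simp add: t.section_orthogonal[OF x'] s.section_orthogonal[OF that] SO3_irr_orthogonal[OF q(1)])
  qed
  obtain P where P: "linear P" "P \<circ> t.local_param_deriv x' = id"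
    using linear_injective_left_inverse[OF t.linear_local_param_deriv[OF x'] t.local_param_deriv_inj[OF x']] by blast
  have "(?f has_derivative (\<lambda>v. fst (P (E' v)))) (at x)"
  proof (rule implicit_has_derivative[where L = fst and P = P, OF t.local_param_has_derivative[OF x'] _ _ dE])
    show "bounded_linear P" using P(1) by (simp add: linear_conv_bounded_linear)
    show "P (t.local_param_deriv x' w) = w" for w using P(2) by (metis comp_apply id_apply)
    show "E x = t.local_param x' (x', 0)" by (simp add: E0 t.local_param_base[OF x'])
    show "bounded_linear (fst :: (real^7) \<times> (real^3) \<Rightarrow> _)" by (rule bounded_linear_fst)
    show "norm (fst w) \<le> norm w" for w :: "(real^7) \<times> (real^3)" by (metis norm_fst_le prod.collapse)
    have "transpose (\<sigma>' x') ** \<sigma> x = q"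
      by (simp add: q(2) matrix_mul_assoc t.section_orthogonal[OF x'])
    then show "fst (x', 0 :: real^3) = ?f x" using rel[OF x x'] q(1) by simp
    fix e :: real
    assume e: "e > 0"
    obtain d where d: "d > 0" "\<And>M. transpose M ** M = mat 1 \<Longrightarrow> norm (M - mat 1) < d \<Longrightarrow>
      \<exists>w. fst w \<in> U' \<and> t.local_param x' w = M \<and> norm (w - (x', 0)) < e"
      using t.local_param_onto[OF x' e] by blast
    have "isCont E x" using has_derivative_continuous[OF dE] .
    then obtain d1 where d1: "d1 > 0" "\<And>y. dist y x < d1 \<Longrightarrow> dist (E y) (E x) < d"
      using d(1) unfolding continuous_at_eps_delta by blast
    obtain d2 where d2: "d2 > 0" "ball x d2 \<subseteq> U" using s.open_dom x open_contains_ball by blast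
    show "\<exists>d>0. \<forall>y. norm (y - x) < d \<longrightarrow> (\<exists>w. t.local_param x' w = E y \<and> norm (w - (x', 0)) < e \<and> fst w = ?f y)"
    proof (rule exI[of _ "min d1 d2"], safe)
      show "0 < min d1 d2" using d1 d2 by simp
      fix y
      assume y: "norm (y - x) < min d1 d2"
      have yU: "y \<in> U" using d2(2) y by (auto simp: dist_norm norm_minus_commute)
      have "norm (E y - mat 1) < d" using d1(2)[of y] y by (simp add: dist_norm E0)
      then obtain w where w: "fst w \<in> U'" "t.local_param x' w = E y" "norm (w - (x', 0)) < e"
        using d(2)[OF Eorth[OF yU]] by blast
      have "\<sigma>' x' ** t.local_param x' w ** q = \<sigma>' x' ** E y ** q" by (simp add: w(2))
      then have "(\<sigma>' x' ** transpose (\<sigma>' x')) ** \<sigma>' (fst w) ** (H_param (snd w) ** q)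
          = (\<sigma>' x' ** transpose (\<sigma>' x')) ** \<sigma> y ** (transpose q ** q)"
        by (simp only: t.local_param_def E_def matrix_mul_assoc)
      then have "\<sigma> y = \<sigma>' (fst w) ** (H_param (snd w) ** q)"
        by (simp add: t.section_orthogonal[OF x'] SO3_irr_orthogonal[OF q(1)])
      then have "transpose (\<sigma>' (fst w)) ** \<sigma> y = (transpose (\<sigma>' (fst w)) ** \<sigma>' (fst w)) ** (H_param (snd w) ** q)"
        by (simp only: matrix_mul_assoc)
      then have "transpose (\<sigma>' (fst w)) ** \<sigma> y \<in> SO3_irr"
        by (simp add: t.section_orthogonal[OF w(1)] SO3_irr_mult[OF H_param_SO3_irr q(1)])
      then show "\<exists>w. t.local_param x' w = E y \<and> norm (w - (x', 0)) < e \<and> fst w = ?f y"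
        using rel[OF yU w(1)] w by (intro exI[of _ w]) simp
    qed
  qed
  moreover have "mcoord (t.tangent x' (fst (P (E' v)))) = mcoord (q ** s.tangent x v ** transpose q)" for v
  proof -
    obtain w where w: "t.local_param_deriv x' w = E' v"
      using t.local_param_deriv_onto_skew[OF x' skew_conj[OF s.tangent_skew[OF x]]] unfolding E'_def by blast
    have "P (E' v) = w" using P(2) by (simp flip: w) (metis comp_apply id_apply)
    moreover have "mcoord (t.local_param_deriv x' w) = mcoord (t.tangent x' (fst w))"
      by (simp add: t.local_param_deriv_def linear_add[OF linear_mcoord] linear_cmul[OF linear_mcoord] mcoord_bas)
    ultimately show ?thesis using w by (simp add: E'_def)
  qed
  ultimately show ?thesis by (rule that)
qed

section \<open>Uniqueness of the invariant metric\<close>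

lemma berger_atlas_section:
  assumes "(U, \<psi>) \<in> berger_atlas"
  obtains \<sigma> where "berger_section U \<sigma>" "\<And>x. x \<in> U \<Longrightarrow> \<psi> x = berger_coset (\<sigma> x)" "inj_on \<psi> U"
  using assms unfolding berger_atlas_def berger_section_def by auto

lemma berger_atlasI:
  assumes "berger_section U \<sigma>" "\<And>x. x \<in> U \<Longrightarrow> \<psi> x = berger_coset (\<sigma> x)" "inj_on \<psi> U"
  shows "(U, \<psi>) \<in> berger_atlas"
  using assms unfolding berger_atlas_def berger_section_def by auto

lemma SO5_mult: "R \<in> SO5 \<Longrightarrow> Q \<in> SO5 \<Longrightarrow> R ** Q \<in> SO5"
  by (simp add: SO5_def rotation_matrix_mult)

lemma SO5_transpose: "R \<in> SO5 \<Longrightarrow> transpose R \<in> SO5"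
  by (simp add: SO5_def rotation_matrix_transpose)

lemma SO5_cancel:
  assumes "R \<in> SO5"
  shows "transpose R ** (R ** M) = M" "R ** (transpose R ** M) = M" "M ** R ** transpose R = M" "M ** transpose R ** R = M"
proof -
  have o: "transpose R ** R = mat 1" "R ** transpose R = mat 1"
    using assms by (simp_all add: SO5_def rotation_mult_transpose)
  show "transpose R ** (R ** M) = M" "R ** (transpose R ** M) = M"
    by (simp_all only: matrix_mul_assoc o matrix_mul_lid)
  show "M ** R ** transpose R = M" "M ** transpose R ** R = M"
    by (simp_all only: matrix_mul_assoc[symmetric] o matrix_mul_rid)
qed

lemma berger_coset_translate: "(\<lambda>Q. R ** Q) ` berger_coset S = berger_coset (R ** S)"
  by (simp add: berger_coset_def image_image matrix_mul_assoc)

context berger_section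
begin

lemma fd_translate:
  assumes "x \<in> U"
  shows "fd (\<lambda>x. R ** \<sigma> x) x v = R ** fd \<sigma> x v"
  using fd_linear[OF bounded_bilinear.bounded_linear_right[OF bounded_bilinear_matrix_matrix_mult, of R] section_diff[OF assms]]
  by (rule fun_cong)

lemma translate:
  assumes R: "R \<in> SO5"
  shows "berger_section U (\<lambda>x. R ** \<sigma> x)"
proof
  show "open U" by (rule open_dom)
  show "smooth_on (\<lambda>x. R ** \<sigma> x) U"
    by (rule smooth_on_linear[OF bounded_bilinear.bounded_linear_right[OF bounded_bilinear_matrix_matrix_mult] open_dom smooth_section])
  show "R ** \<sigma> x \<in> SO5" if "x \<in> U" for x
    by (rule SO5_mult[OF R section_SO5[OF that]])
  show "transpose (R ** \<sigma> x) ** fd (\<lambda>x. R ** \<sigma> x) x v \<notin> so3_irr" if "x \<in> U" "v \<noteq> 0" for x v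
    using immersion[OF that] by (simp add: fd_translate[OF that(1)] matrix_transpose_mul SO5_cancel[OF R] flip: matrix_mul_assoc)
qed

text \<open>Left invariance of the Maurer-Cartan form; the coframe of a translated section is
  therefore the old one.\<close>

lemma tangent_translate:
  assumes "x \<in> U" "R \<in> SO5"
  shows "berger_section.tangent (\<lambda>x. R ** \<sigma> x) x v = tangent x v"
  by (simp add: berger_section.tangent_def[OF translate[OF assms(2)]] tangent_def fd_translate[OF assms(1)]
      matrix_transpose_mul SO5_cancel[OF assms(2)] flip: matrix_mul_assoc)

lemma tangent_axis: "tangent x (axis i 1) = om i x"
  by (simp add: tangent_def om_def pdv_def)

lemma th_eq_tangent: "th i x = mcoord (tangent x (axis i 1))"
  by (simp add: th_def tangent_axis)

lemma th_translate:
  assumes "x \<in> U" "R \<in> SO5"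
  shows "berger_section.th (\<lambda>x. R ** \<sigma> x) i x = th i x"
  by (simp add: berger_section.th_eq_tangent[OF translate[OF assms(2)]] th_eq_tangent tangent_translate[OF assms])

end

lemma berger_atlas_translate:
  assumes c: "(U, \<psi>) \<in> berger_atlas" and R: "R \<in> SO5"
  shows "(U, \<lambda>y. (\<lambda>Q. R ** Q) ` \<psi> y) \<in> berger_atlas"
proof -
  obtain \<sigma> where \<sigma>: "berger_section U \<sigma>" "\<And>x. x \<in> U \<Longrightarrow> \<psi> x = berger_coset (\<sigma> x)" "inj_on \<psi> U"
    using berger_atlas_section[OF c] by blast
  have inj: "inj (\<lambda>Q :: real^5^5. R ** Q)"
    by (rule inj_on_inverseI[of _ "\<lambda>Q. transpose R ** Q"]) (simp add: SO5_cancel[OF R])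
  show ?thesis
  proof (rule berger_atlasI)
    show "berger_section U (\<lambda>x. R ** \<sigma> x)" by (rule berger_section.translate[OF \<sigma>(1) R])
    show "(\<lambda>Q. R ** Q) ` \<psi> x = berger_coset (R ** \<sigma> x)" if "x \<in> U" for x
      by (simp add: \<sigma>(2)[OF that] berger_coset_translate)
    show "inj_on (\<lambda>y. (\<lambda>Q. R ** Q) ` \<psi> y) U"
      using \<sigma>(3) unfolding inj_on_def by (metis inj_image_eq_iff[OF inj])
  qed
qed

text \<open>In coframes the Jacobian of a change of charts is the isotropy action of q, so
  transformation laws become equivariance.\<close>

lemma transition_jac_frame:
  assumes sec: "berger_section U \<sigma>" "berger_section U' \<sigma>'"
    and x: "x \<in> U" and x': "x' \<in> U'"
    and q: "q \<in> SO3_irr" "\<sigma> x = \<sigma>' x' ** q"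
    and inj: "inj_on \<psi>' U'"
    and \<psi>: "\<And>y. y \<in> U \<Longrightarrow> \<psi> y = berger_coset (\<sigma> y)" "\<And>y. y \<in> U' \<Longrightarrow> \<psi>' y = berger_coset (\<sigma>' y)"
  shows "(\<Sum>a\<in>UNIV. transition_jac (U, \<psi>) (U', \<psi>') x a i *\<^sub>R berger_section.th \<sigma>' a x')
    = mcoord (q ** berger_section.om \<sigma> i x ** transpose q)"
proof -
  interpret s: berger_section U \<sigma> by fact
  interpret t: berger_section U' \<sigma>' by fact
  obtain f' where f': "((\<lambda>y. the_inv_into U' \<psi>' (\<psi> y)) has_derivative f') (at x)"
    "\<And>v. mcoord (t.tangent x' (f' v)) = mcoord (q ** s.tangent x v ** transpose q)"
    using transition_derivative[OF sec x x' q inj \<psi>] by blast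
  have "transition_jac (U, \<psi>) (U', \<psi>') x a i = f' (axis i 1) $ a" for a
    using pdv_eqI[OF bounded_linear.has_derivative[OF bounded_linear_vec_nth f'(1)]]
    by (simp add: transition_jac_def pd_eq_pdv)
  then show ?thesis
    using f'(2)[of "axis i 1"] by (simp add: t.mcoord_tangent[OF x'] s.tangent_axis)
qed

section \<open>The isotropy representation and its invariant inner products\<close>

definition Ad :: "real^5^5 \<Rightarrow> real^7 \<Rightarrow> real^7" where
  "Ad q u = mcoord (q ** emb u ** transpose q)"

lemma mcoord_conj:
  assumes "transpose X = - X" "q \<in> SO3_irr"
  shows "mcoord (q ** X ** transpose q) = Ad q (mcoord X)"
  unfolding Ad_def emb_mcoord_conj[OF assms, symmetric] mcoord_emb ..

lemma Ad_1: "Ad (mat 1) u = u"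
  by (simp add: Ad_def mcoord_emb)

lemma linear_Ad: "linear (Ad q)"
proof -
  note mm = bounded_bilinear_matrix_matrix_mult
  show ?thesis
    unfolding linear_iff Ad_def
    by (simp add: linear_add[OF linear_emb] linear_cmul[OF linear_emb] bounded_bilinear.add_left[OF mm]
        bounded_bilinear.add_right[OF mm] matrix_scaleR_mult linear_add[OF linear_mcoord] linear_cmul[OF linear_mcoord])
qed

lemma conn_bas: "n < 10 \<Longrightarrow> conn (bas n) = wB n"
  by (simp add: conn_def coef_bas if_distrib[of "\<lambda>x. x *\<^sub>R _"] cong: if_cong)

text \<open>On so(3) the connection is the isotropy representation itself: for vertical X,
  \<open>torsion_free\<close> identifies it with ad X on m.\<close>

lemma Ad_has_derivative:
  assumes "(q has_derivative (\<lambda>h. h *\<^sub>R bas n)) (at 0)" "q 0 = mat 1" "7 \<le> n" "n < 10"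
  shows "((\<lambda>t. Ad (q t) u) has_derivative (\<lambda>h. h *\<^sub>R (wB n *v u))) (at (0::real))"
proof -
  note mm = bounded_bilinear_matrix_matrix_mult
  have "((\<lambda>t. transpose (q t)) has_derivative (\<lambda>h. transpose (h *\<^sub>R bas n))) (at 0)"
    by (rule bounded_linear.has_derivative[OF bounded_linear_transpose assms(1)])
  then have 1: "((\<lambda>t. transpose (q t)) has_derivative (\<lambda>h. - (h *\<^sub>R bas n))) (at 0)"
    by (simp add: transpose_scaleR bas_skew[OF assms(4)])
  have 2: "((\<lambda>t. q t ** emb u) has_derivative (\<lambda>h. (h *\<^sub>R bas n) ** emb u)) (at 0)"
    by (rule bounded_linear.has_derivative[OF bounded_bilinear.bounded_linear_left[OF mm] assms(1)])
  have "((\<lambda>t. q t ** emb u ** transpose (q t)) has_derivative (\<lambda>h. h *\<^sub>R br (bas n) (emb u))) (at 0)"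
    using bounded_bilinear.FDERIV[OF mm 2 1]
    by (simp add: assms(2) matrix_scaleR_mult bounded_bilinear.minus_right[OF mm] scaleR_diff_right)
  from bounded_linear.has_derivative[OF bounded_linear_mcoord this]
  have "((\<lambda>t. Ad (q t) u) has_derivative (\<lambda>h. h *\<^sub>R mcoord (br (bas n) (emb u)))) (at 0)"
    by (simp add: Ad_def linear_cmul[OF linear_mcoord])
  moreover have "mcoord (br (bas n) (emb u)) = wB n *v u"
    by (simp add: torsion_free[OF bas_skew[OF assms(4)] emb_skew] mcoord_emb conn_bas[OF assms(4)] mcoord_bas[OF assms(3,4)])
  ultimately show ?thesis by simp
qed

lemma rho_mult:
  assumes "rotation_matrix A" "rotation_matrix B"
  shows "rho (A ** B) = rho A ** rho B"
proof -
  have "sym_traceless (rho (A ** B) *v x) = sym_traceless ((rho A ** rho B) *v x)" for x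
    by (simp add: sym_traceless_rho assms rotation_matrix_mult matrix_transpose_mul matrix_mul_assoc
        flip: matrix_vector_mul_assoc)
  then have "rho (A ** B) *v x = (rho A ** rho B) *v x" for x
    by (simp only: sym_traceless_inject)
  then show ?thesis unfolding matrix_eq by blast
qed

lemma RXYZ_half: "RX t = RX (t / 2) ** RX (t / 2)" "RY t = RY (t / 2) ** RY (t / 2)" "RZ t = RZ (t / 2) ** RZ (t / 2)"
  using cos_double[of "t / 2"] sin_double[of "t / 2"]
  by (simp_all add: vec_eq_iff forall_3 RX_def RY_def RZ_def vector_3 matrix_matrix_mult_def sum_3 power2_eq_square)

text \<open>The determinant of \<open>rho A\<close> is 1 or -1, so that of its square is 1. An axis
  rotation is the square of the rotation through half the angle.\<close>

lemma rotation_rho_square: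
  assumes "rotation_matrix A"
  shows "rotation_matrix (rho (A ** A))"
proof -
  have o: "orthogonal_matrix (rho A)"
    using SO3_irr_orthogonal[OF rho_SO3_irr[OF assms]] by (simp add: orthogonal_matrix_def)
  then have "det (rho A) * det (rho A) = 1"
    using det_orthogonal_matrix[OF o] by auto
  then show ?thesis
    using o by (simp add: rho_mult[OF assms assms] rotation_matrix_def orthogonal_matrix_mul det_mul)
qed

text \<open>The curves are recorded with determinant 1, because invariance of the metric is tested
  by translations in SO(5).\<close>

lemma isotropy_curve:
  assumes "7 \<le> n" "n < 10"
  obtains q :: "real \<Rightarrow> real^5^5" where "(q has_derivative (\<lambda>h. h *\<^sub>R bas n)) (at 0)" "q 0 = mat 1"
    "\<And>t. q t \<in> SO3_irr" "\<And>t. rotation_matrix (q t)"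
proof -
  consider "n = 7" | "n = 8" | "n = 9" using assms by linarith
  then show ?thesis
  proof cases
    case 1
    show ?thesis
      using rho_has_derivative[OF RXYZ_has_derivative(1)] rotation_rho_square[OF rotation_RXYZ(1), of "_ / 2", folded RXYZ_half]
      by (intro that[of "\<lambda>t. rho (RX t)"])
        (simp_all add: 1 RXYZ_0 rho_mat_1 rho_SO3_irr rotation_RXYZ)
  next
    case 2
    show ?thesis
      using rho_has_derivative[OF RXYZ_has_derivative(2)] rotation_rho_square[OF rotation_RXYZ(2), of "_ / 2", folded RXYZ_half]
      by (intro that[of "\<lambda>t. rho (RY t)"])
        (simp_all add: 2 RXYZ_0 rho_mat_1 rho_SO3_irr rotation_RXYZ)
  next
    case 3
    show ?thesis
      using rho_has_derivative[OF RXYZ_has_derivative(3)] rotation_rho_square[OF rotation_RXYZ(3), of "_ / 2", folded RXYZ_half]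
      by (intro that[of "\<lambda>t. rho (RZ t)"])
        (simp_all add: 3 RXYZ_0 rho_mat_1 rho_SO3_irr rotation_RXYZ)
  qed
qed

text \<open>Differentiating the invariance along \<open>isotropy_curve\<close> gives the hypothesis
  of \<open>invariant_form_unique\<close>. Injectivity of A makes k positive.\<close>

lemma invariant_gram_unique:
  fixes A :: "real^7^7"
  assumes A: "invertible A"
    and inv: "\<And>q u v. q \<in> SO3_irr \<Longrightarrow> rotation_matrix q \<Longrightarrow> (A *v Ad q u) \<bullet> (A *v Ad q v) = (A *v u) \<bullet> (A *v v)"
  obtains k where "k > 0" "\<And>u v. (A *v u) \<bullet> (A *v v) = k * (u \<bullet> (G0 *v v))"
proof -
  let ?b = "transpose A ** A"
  have b: "u \<bullet> (?b *v v) = (A *v u) \<bullet> (A *v v)" for u v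
    by (simp add: dot_vector_matrix_mult inner_commute flip: matrix_vector_mul_assoc)
  have "transpose (wB n) ** ?b + ?b ** wB n = 0" if n: "7 \<le> n" "n < 10" for n
  proof -
    obtain q :: "real \<Rightarrow> real^5^5" where q: "(q has_derivative (\<lambda>h. h *\<^sub>R bas n)) (at 0)" "q 0 = mat 1"
      "\<And>t. q t \<in> SO3_irr" "\<And>t. rotation_matrix (q t)"
      using isotropy_curve[OF n] by blast
    have "u \<bullet> ((transpose (wB n) ** ?b + ?b ** wB n) *v v) = 0" for u v
    proof -
      have d: "((\<lambda>t. A *v Ad (q t) u) has_derivative (\<lambda>h. A *v (h *\<^sub>R (wB n *v u)))) (at 0)" for u
        by (rule bounded_linear.has_derivative[OF matrix_vector_mul_bounded_linear Ad_has_derivative[OF q(1,2) n]])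
      have "((\<lambda>t. (A *v Ad (q t) u) \<bullet> (A *v Ad (q t) v)) has_derivative
          (\<lambda>h. (A *v Ad (q 0) u) \<bullet> (A *v (h *\<^sub>R (wB n *v v))) + (A *v (h *\<^sub>R (wB n *v u))) \<bullet> (A *v Ad (q 0) v))) (at 0)"
        by (rule bounded_bilinear.FDERIV[OF bounded_bilinear_inner d d])
      moreover have "((\<lambda>t. (A *v Ad (q t) u) \<bullet> (A *v Ad (q t) v)) has_derivative (\<lambda>h. 0)) (at 0)"
        by (simp add: inv[OF q(3,4)])
      ultimately have "(\<lambda>h. (A *v Ad (q 0) u) \<bullet> (A *v (h *\<^sub>R (wB n *v v))) + (A *v (h *\<^sub>R (wB n *v u))) \<bullet> (A *v Ad (q 0) v)) = (\<lambda>h. 0)"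
        by (rule has_derivative_unique)
      from fun_cong[OF this, of 1]
      have z: "(A *v u) \<bullet> (A *v (wB n *v v)) + (A *v (wB n *v u)) \<bullet> (A *v v) = 0"
        by (simp add: q(2) Ad_1)
      have "u \<bullet> ((transpose (wB n) ** ?b) *v v) = (wB n *v u) \<bullet> (?b *v v)"
        unfolding matrix_vector_mul_assoc[of "transpose (wB n)" ?b v, symmetric] transpose_matrix_vector[of "wB n"]
          dot_vector_matrix_mult by (rule inner_commute)
      moreover have "u \<bullet> ((?b ** wB n) *v v) = u \<bullet> (?b *v (wB n *v v))"
        unfolding matrix_vector_mul_assoc ..
      ultimately have "u \<bullet> ((transpose (wB n) ** ?b + ?b ** wB n) *v v)
          = (A *v (wB n *v u)) \<bullet> (A *v v) + (A *v u) \<bullet> (A *v (wB n *v v))"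
        unfolding matrix_vector_mult_add_rdistrib inner_add_right b by (rule arg_cong2)
      then show ?thesis using z by linarith
    qed
    from this[of "(transpose (wB n) ** ?b + ?b ** wB n) *v v" v for v]
    have "(transpose (wB n) ** ?b + ?b ** wB n) *v v = 0 *v v" for v
      unfolding inner_eq_zero_iff matrix_vector_mult_0 .
    then show ?thesis unfolding matrix_eq by blast
  qed
  moreover have "transpose ?b = ?b" by (simp add: matrix_transpose_mul)
  ultimately obtain k where k: "?b = k *\<^sub>R G0" using invariant_form_unique[of ?b] by blast
  have e: "(A *v u) \<bullet> (A *v v) = k * (u \<bullet> (G0 *v v))" for u v
    unfolding b[symmetric] k G0_form ..
  obtain a :: 7 where True by simp
  have "A *v axis a 1 \<noteq> 0"
    using A by (metis axis_eq_0_iff invertible_def matrix_vector_mul_assoc matrix_vector_mul_lid matrix_vector_mult_0_right zero_neq_one)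
  then have "0 < (A *v axis a 1) \<bullet> (A *v axis a 1)" by simp
  then have "0 < k * nrm (i7 a)" unfolding e by (simp add: inner_axis' G0_mult)
  then have "k > 0" using nrm_pos[OF i7_less10, of a] by (simp add: zero_less_mult_iff)
  with e show ?thesis using that by blast
qed

section \<open>The metric of a homogeneous G2-structure\<close>

lemma pull2_matrix: "(\<chi> i j. pull2 L T i j) = transpose L ** (\<chi> a b. T a b) ** L"
proof -
  have "(transpose L ** (\<chi> a b. T a b) ** L) $ i $ j = pull2 L T i j" for i j
    unfolding matrix_matrix_mult_def pull2_def transpose_def
    by (simp add: sum_distrib_right) (subst sum.swap, simp add: mult_ac)
  then show ?thesis by (simp add: vec_eq_iff)
qed

lemma tensor2_field_transform:
  assumes "tensor2_field A h" "(U, \<psi>) \<in> A" "(U', \<psi>') \<in> A" "x \<in> U" "x' \<in> U'" "\<psi> x = \<psi>' x'"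
  shows "h (U, \<psi>) x i j = (\<Sum>a\<in>UNIV. \<Sum>b\<in>UNIV. h (U', \<psi>') x' a b
    * transition_jac (U, \<psi>) (U', \<psi>') x a i * transition_jac (U, \<psi>) (U', \<psi>') x b j)"
proof -
  have "\<forall>c\<in>A. \<forall>c'\<in>A. \<forall>x\<in>fst c. \<forall>x'\<in>fst c'. snd c x = snd c' x' \<longrightarrow>
        (\<forall>i j. h c x i j = (\<Sum>a\<in>UNIV. \<Sum>b\<in>UNIV.
           h c' x' a b * transition_jac c c' x a i * transition_jac c c' x b j))"
    using assms(1) unfolding tensor2_field_def by (elim conjE)
  from this[rule_format, of "(U, \<psi>)" "(U', \<psi>')" x x' i j] show ?thesis
    using assms(2-) by (simp only: fst_conv snd_conv)
qed

lemma adapted_frame_gram: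
  assumes g: "g2_metric A \<phi> g" and c: "c \<in> A" "x \<in> fst c" and L: "adapted_frame (\<phi> c x) L"
  shows "(\<chi> a b. g c x a b) = transpose (matrix_inv L) ** matrix_inv L"
proof -
  define B where "B = matrix_inv L"
  have i: "invertible L" using L by (simp add: adapted_frame_def)
  have "pull2 L (g c x) = (\<lambda>i j. of_bool (i = j))"
    using g c L unfolding g2_metric_def by auto
  then have "transpose L ** (\<chi> a b. g c x a b) ** L = mat 1"
    by (simp flip: pull2_matrix) (simp add: mat_def of_bool_def)
  then have "transpose B ** (transpose L ** (\<chi> a b. g c x a b) ** L) ** B = transpose B ** B" by simp
  then have "transpose (L ** B) ** (\<chi> a b. g c x a b) ** (L ** B) = transpose B ** B"
    by (simp add: matrix_transpose_mul matrix_mul_assoc)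
  then show ?thesis by (simp add: B_def matrix_inv_right[OF i])
qed

lemma g2_metric_gram:
  assumes g2: "g2_structure A \<phi>" and g: "g2_metric A \<phi> g" and c: "c \<in> A" "x \<in> fst c"
  obtains B :: "real^7^7" where "invertible B" "\<And>i j. g c x i j = (B *v axis i 1) \<bullet> (B *v axis j 1)"
proof -
  obtain L where L: "adapted_frame (\<phi> c x) L" using g2 c unfolding g2_structure_def by blast
  define B where "B = matrix_inv L"
  have i: "invertible L" using L by (simp add: adapted_frame_def)
  note B = adapted_frame_gram[OF g c L, folded B_def]
  show ?thesis
  proof (rule that)
    show "invertible B" unfolding B_def invertible_def
      using matrix_inv_right[OF i] matrix_inv_left[OF i] by blast
    have "g c x i j = axis i 1 \<bullet> ((transpose B ** B) *v axis j 1)" for i j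
    proof -
      have "g c x i j = (\<chi> a b. g c x a b) $ i $ j" by simp
      also have "\<dots> = axis i 1 \<bullet> ((\<chi> a b. g c x a b) *v axis j 1)" by (rule matrix_entry_eq)
      finally show ?thesis unfolding B .
    qed
    then show "g c x i j = (B *v axis i 1) \<bullet> (B *v axis j 1)" for i j
      by (simp add: dot_vector_matrix_mult inner_commute flip: matrix_vector_mul_assoc)
  qed
qed

text \<open>A single adapted frame, being orthonormal, fixes the metric at its point. Hence
  invariance of \<phi> passes to g.\<close>

lemma g2_metric_determined:
  assumes g2: "g2_structure A \<phi>" and g: "g2_metric A \<phi> g" and c: "c \<in> A" "x \<in> fst c"
    and c': "c' \<in> A" "x' \<in> fst c'" and eq: "\<phi> c' x' = \<phi> c x"
  shows "g c' x' = g c x"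
proof -
  obtain L where L: "adapted_frame (\<phi> c x) L" using g2 c unfolding g2_structure_def by blast
  have "adapted_frame (\<phi> c' x') L" using L by (simp only: eq)
  from adapted_frame_gram[OF g c' this] adapted_frame_gram[OF g c L]
  have "(\<chi> a b. g c' x' a b) = (\<chi> a b. g c x a b)" by (simp only:)
  then show ?thesis by (simp add: vec_eq_iff fun_eq_iff)
qed

locale berger_g2 =
  fixes \<phi> :: "((real^5^5) set, 7) tensor3" and g :: "((real^5^5) set, 7) tensor2"
  assumes g2: "g2_structure berger_atlas \<phi>" and homogeneous: "berger_homogeneous \<phi>"
    and metric: "g2_metric berger_atlas \<phi> g"
begin

text \<open>The translation R is chosen such that \<sigma> x = R \<sigma>' x' q. In the translated
  chart the components of g are the old ones by homogeneity, and so is the coframe; returning to the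
  chart of \<sigma> costs \<open>Ad q\<close>.\<close>

lemma metric_transport:
  assumes c: "(U, \<psi>) \<in> berger_atlas" "berger_section U \<sigma>" "\<And>y. y \<in> U \<Longrightarrow> \<psi> y = berger_coset (\<sigma> y)" "x \<in> U"
    and c': "(U', \<psi>') \<in> berger_atlas" "berger_section U' \<sigma>'" "\<And>y. y \<in> U' \<Longrightarrow> \<psi>' y = berger_coset (\<sigma>' y)" "x' \<in> U'"
    and B: "\<And>i j. g (U', \<psi>') x' i j = (B *v berger_section.th \<sigma>' i x') \<bullet> (B *v berger_section.th \<sigma>' j x')"
    and q: "q \<in> SO3_irr" "rotation_matrix q"
  shows "g (U, \<psi>) x i j = (B *v Ad q (berger_section.th \<sigma> i x)) \<bullet> (B *v Ad q (berger_section.th \<sigma> j x))"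
proof -
  interpret s: berger_section U \<sigma> by fact
  interpret t: berger_section U' \<sigma>' by fact
  define R where "R = \<sigma> x ** transpose q ** transpose (\<sigma>' x')"
  have R: "R \<in> SO5"
    unfolding R_def using q(2) s.section_SO5[OF c(4)] t.section_SO5[OF c'(4)]
    by (intro SO5_mult SO5_transpose) (simp_all add: SO5_def rotation_matrix_transpose)
  define \<psi>2 where "\<psi>2 = (\<lambda>y. (\<lambda>Q. R ** Q) ` \<psi>' y)"
  have c2: "(U', \<psi>2) \<in> berger_atlas" unfolding \<psi>2_def by (rule berger_atlas_translate[OF c'(1) R])
  have \<psi>2: "\<psi>2 y = berger_coset (R ** \<sigma>' y)" if "y \<in> U'" for y
    by (simp add: \<psi>2_def c'(3)[OF that] berger_coset_translate)
  have inj2: "inj_on \<psi>2 U'" using c2 by (simp add: berger_atlas_def)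
  have \<sigma>x: "\<sigma> x = R ** \<sigma>' x' ** q"
  proof -
    have "R ** \<sigma>' x' ** q = \<sigma> x ** transpose q ** (transpose (\<sigma>' x') ** \<sigma>' x') ** q"
      by (simp only: R_def matrix_mul_assoc)
    also have "\<dots> = \<sigma> x ** (transpose q ** q)"
      by (simp add: t.section_orthogonal[OF c'(4)] matrix_mul_assoc)
    finally show ?thesis by (simp add: SO3_irr_orthogonal[OF q(1)])
  qed
  have same: "\<psi> x = \<psi>2 x'"
    unfolding c(3)[OF c(4)] \<psi>2[OF c'(4)]
    using berger_coset_eq_iff[OF s.section_SO5[OF c(4)] SO5_mult[OF R t.section_SO5[OF c'(4)]]] q(1)
      SO5_cancel(1)[OF SO5_mult[OF R t.section_SO5[OF c'(4)]], of q]
    by (simp add: \<sigma>x)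
  have "\<phi> (U', \<psi>2) x' = \<phi> (U', \<psi>') x'"
    using homogeneous R c'(1,4) unfolding berger_homogeneous_def \<psi>2_def by blast
  then have g2': "g (U', \<psi>2) x' = g (U', \<psi>') x'"
    by (intro g2_metric_determined[OF g2 metric c'(1) _ c2]) (simp_all add: c'(4))
  let ?J = "transition_jac (U, \<psi>) (U', \<psi>2) x"
  have J: "(\<Sum>a\<in>UNIV. ?J a i *\<^sub>R t.th a x') = Ad q (s.th i x)" for i
    using transition_jac_frame[OF c(2) t.translate[OF R] c(4) c'(4) q(1) \<sigma>x inj2 c(3) \<psi>2, of i]
    by (simp add: t.th_translate[OF c'(4) R] mcoord_conj[OF s.om_skew[OF c(4)] q(1)] s.th_def)
  have "tensor2_field berger_atlas g" using metric by (simp add: g2_metric_def)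
  then have "g (U, \<psi>) x i j = (\<Sum>a\<in>UNIV. \<Sum>b\<in>UNIV. g (U', \<psi>2) x' a b * ?J a i * ?J b j)"
    by (rule tensor2_field_transform[OF _ c(1) c2 c(4) c'(4) same])
  also have "\<dots> = (\<Sum>a\<in>UNIV. \<Sum>b\<in>UNIV. ?J a i * (?J b j * ((B *v t.th a x') \<bullet> (B *v t.th b x'))))"
    by (simp add: g2' B mult_ac)
  also have "\<dots> = (B *v (\<Sum>a\<in>UNIV. ?J a i *\<^sub>R t.th a x')) \<bullet> (B *v (\<Sum>b\<in>UNIV. ?J b j *\<^sub>R t.th b x'))"
    by (simp add: bounded_bilinear.sum_right[OF bounded_bilinear_matrix_vector_mult] matrix_vector_mult_scaleR
        inner_sum_left inner_sum_right sum_distrib_left) (subst sum.swap, simp add: mult.left_commute)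
  finally show ?thesis unfolding J .
qed

text \<open>Transport from a base point to itself, with q arbitrary, makes its Gram matrix invariant
  and thus a multiple of \<open>G0\<close>. Transport with q = 1 carries the factor to every other
  chart and point.\<close>

lemma metric_scale:
  obtains k where "k > 0"
    "\<And>U \<psi> \<sigma> x i j. (U, \<psi>) \<in> berger_atlas \<Longrightarrow> berger_section U \<sigma> \<Longrightarrow> (\<And>y. y \<in> U \<Longrightarrow> \<psi> y = berger_coset (\<sigma> y))
      \<Longrightarrow> x \<in> U \<Longrightarrow> g (U, \<psi>) x i j = k * (berger_section.th \<sigma> i x \<bullet> (G0 *v berger_section.th \<sigma> j x))"
proof (cases "\<exists>U \<psi> x. (U, \<psi>) \<in> berger_atlas \<and> x \<in> U")
  case False
  \<comment> \<open>Without points every k is admissible. That charts with points exist is shown by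
    \<open>cayley_slice\<close>.\<close>
  then show ?thesis by (intro that[of 1]) auto
next
  case True
  then obtain U \<psi> x where c: "(U, \<psi>) \<in> berger_atlas" "x \<in> U" by blast
  obtain \<sigma> where \<sigma>: "berger_section U \<sigma>" "\<And>y. y \<in> U \<Longrightarrow> \<psi> y = berger_coset (\<sigma> y)" "inj_on \<psi> U"
    by (rule berger_atlas_section[OF c(1)]) (rule that; blast)
  interpret s: berger_section U \<sigma> by fact
  have cx: "x \<in> fst (U, \<psi>)" using c(2) by simp
  obtain L :: "real^7^7" where L: "invertible L" "\<And>i j. g (U, \<psi>) x i j = (L *v axis i 1) \<bullet> (L *v axis j 1)"
    by (rule g2_metric_gram[OF g2 metric c(1) cx]) (rule that; blast)
  define T :: "real^7^7" where "T = (\<chi> a i. s.th i x $ a)"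
  have T: "T *v v = (\<Sum>i\<in>UNIV. v $ i *\<^sub>R s.th i x)" for v
    by (simp add: T_def matrix_vector_mult_def vec_eq_iff sum_component mult.commute)
  have Ti: "invertible T"
    unfolding invertible_left_inverse matrix_left_invertible_ker T using s.section_indep[OF c(2)] by blast
  have Ta: "T *v axis i 1 = s.th i x" for i
    by (simp add: T_def matrix_vector_mult_basis column_def)
  define A where "A = L ** matrix_inv T"
  have At: "A *v s.th i x = L *v axis i 1" for i
    unfolding A_def Ta[symmetric] matrix_vector_mul_assoc
    by (simp add: matrix_inv_left[OF Ti] flip: matrix_mul_assoc)
  have "invertible (matrix_inv T)"
    unfolding invertible_def using matrix_inv_left[OF Ti] matrix_inv_right[OF Ti] by blast
  then have Ai: "invertible A" unfolding A_def by (rule invertible_mult[OF L(1)])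
  have gA: "g (U, \<psi>) x i j = (A *v s.th i x) \<bullet> (A *v s.th j x)" for i j
    by (simp add: L(2) At)
  note tr = metric_transport[OF _ _ _ _ c(1) \<sigma>(1,2) c(2) gA]
  have "(A *v Ad q u) \<bullet> (A *v Ad q v) = (A *v u) \<bullet> (A *v v)" if q: "q \<in> SO3_irr" "rotation_matrix q" for q u v
  proof -
    have span: "u = (\<Sum>i\<in>UNIV. (matrix_inv T *v u) $ i *\<^sub>R s.th i x)" for u
      unfolding T[symmetric] matrix_vector_mul_assoc matrix_inv_right[OF Ti] by simp
    have e: "(A *v Ad q (s.th i x)) \<bullet> (A *v Ad q (s.th j x)) = (A *v s.th i x) \<bullet> (A *v s.th j x)" for i j
      using tr[OF c(1) \<sigma>(1,2) c(2) _ q, of i j] gA[of i j] by simp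
    have bl: "F (\<Sum>i\<in>UNIV. a i *\<^sub>R s.th i x) \<bullet> F (\<Sum>j\<in>UNIV. b j *\<^sub>R s.th j x)
        = (\<Sum>i\<in>UNIV. \<Sum>j\<in>UNIV. a i * (b j * (F (s.th i x) \<bullet> F (s.th j x))))"
      if "linear F" for F :: "real^7 \<Rightarrow> real^7" and a b
      by (simp add: linear_sum[OF that] linear_cmul[OF that] inner_sum_left inner_sum_right sum_distrib_left)
        (subst sum.swap, simp add: mult.left_commute)
    have "linear (\<lambda>u. A *v Ad q u)"
      using linear_compose[OF linear_Ad matrix_vector_mul_linear] by (simp add: o_def)
    note lin = this
    have "(A *v Ad q (\<Sum>i\<in>UNIV. a i *\<^sub>R s.th i x)) \<bullet> (A *v Ad q (\<Sum>j\<in>UNIV. b j *\<^sub>R s.th j x))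
        = (A *v (\<Sum>i\<in>UNIV. a i *\<^sub>R s.th i x)) \<bullet> (A *v (\<Sum>j\<in>UNIV. b j *\<^sub>R s.th j x))" for a b
      by (simp only: bl[OF lin] bl[OF matrix_vector_mul_linear[of A]] e)
    from this[of "\<lambda>i. (matrix_inv T *v u) $ i" "\<lambda>i. (matrix_inv T *v v) $ i"] show ?thesis
      unfolding span[symmetric] .
  qed
  from invariant_gram_unique[OF Ai this] obtain k where k: "k > 0" "\<And>u v. (A *v u) \<bullet> (A *v v) = k * (u \<bullet> (G0 *v v))"
    by blast
  show ?thesis
  proof (rule that[OF k(1)])
    fix U' \<psi>' \<sigma>' y i j
    assume a: "(U', \<psi>') \<in> berger_atlas" "berger_section U' \<sigma>'" "\<And>y. y \<in> U' \<Longrightarrow> \<psi>' y = berger_coset (\<sigma>' y)" "y \<in> U'"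
    show "g (U', \<psi>') y i j = k * (berger_section.th \<sigma>' i y \<bullet> (G0 *v berger_section.th \<sigma>' j y))"
      using tr[OF a _ SO3_irr_mat_1 rotation_matrix_mat_1, of i j] by (simp add: Ad_1 k(2))
  qed
qed

end

section \<open>A slice for the isotropy group\<close>

lemma dot_skew:
  fixes A :: "real^'n^'n"
  assumes "transpose A = - A"
  shows "u \<bullet> (A *v u) = 0"
proof -
  have "(A *v u) \<bullet> u = u \<bullet> (transpose A *v u)"
    by (simp add: transpose_matrix_vector dot_vector_matrix_mult inner_commute)
  also have "\<dots> = - (u \<bullet> (A *v u))"
    unfolding assms by (simp add: matrix_vector_mult_def inner_vec_def sum_negf)
  finally show ?thesis by (simp add: inner_commute)
qed

lemma differentiable_matrixI:
  fixes f :: "'a::real_normed_vector \<Rightarrow> real^'m^'n"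
  assumes "\<And>i j. (\<lambda>x. f x $ i $ j) differentiable (at x)"
  shows "f differentiable (at x)"
proof -
  have "M = (\<Sum>i\<in>UNIV. \<Sum>j\<in>UNIV. M $ i $ j *\<^sub>R axis i (axis j 1))" for M :: "real^'m^'n"
  proof -
    have "(\<Sum>i\<in>UNIV. \<Sum>j\<in>UNIV. M $ i $ j *\<^sub>R axis i (axis j 1)) $ a $ b
        = (\<Sum>i\<in>UNIV. if i = a then (\<Sum>j\<in>UNIV. if j = b then M $ i $ j else 0) else 0)" for a b
      unfolding sum_component by (rule sum.cong) (auto simp: axis_def sum_component if_distrib[of "\<lambda>x. _ * x"] cong: if_cong)
    then have "(\<Sum>i\<in>UNIV. \<Sum>j\<in>UNIV. M $ i $ j *\<^sub>R axis i (axis j 1)) $ a $ b = M $ a $ b" for a b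
      by (simp only: sum.delta finite UNIV_I if_True)
    then show ?thesis by (simp only: vec_eq_iff simp_thms)
  qed
  then have "f = (\<lambda>x. \<Sum>i\<in>UNIV. \<Sum>j\<in>UNIV. f x $ i $ j *\<^sub>R axis i (axis j 1))" by blast
  moreover have "(\<lambda>x. \<Sum>i\<in>UNIV. \<Sum>j\<in>UNIV. f x $ i $ j *\<^sub>R axis i (axis j 1) :: real^'m^'n) differentiable (at x)"
    by (intro differentiable_sum ballI differentiable_scaleR assms differentiable_const finite)
  ultimately show ?thesis by metis
qed

lemma bounded_linear_emb: "bounded_linear emb"
  using linear_emb by (simp add: linear_conv_bounded_linear)

lemma emb_0: "emb 0 = 0"
  by (rule linear_0[OF linear_emb])

section \<open>The Cayley transform on m\<close>

definition resolvent :: "real^7 \<Rightarrow> real^5^5" where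
  "resolvent x = matrix_inv (mat 1 - emb x)"

text \<open>A real skew matrix does not have the eigenvalue 1.\<close>

lemma invertible_one_minus_emb: "invertible (mat 1 - emb x)"
  unfolding invertible_left_inverse matrix_left_invertible_ker
proof (intro allI impI)
  fix u
  assume "(mat 1 - emb x) *v u = 0"
  then have "u = emb x *v u" by (simp add: matrix_vector_mult_diff_rdistrib)
  then have "u \<bullet> u = u \<bullet> (emb x *v u)" by simp
  also have "\<dots> = 0" by (rule dot_skew[OF emb_skew])
  finally show "u = 0" by simp
qed

lemmas resolvent_right = matrix_inv_right[OF invertible_one_minus_emb, folded resolvent_def]
lemmas resolvent_left = matrix_inv_left[OF invertible_one_minus_emb, folded resolvent_def]

lemma transpose_diff: "transpose (A - B) = transpose A - transpose (B :: real^'n^'m)"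
  by (simp add: transpose_def vec_eq_iff)

lemma transpose_one_minus_emb: "transpose (mat 1 - emb x) = mat 1 + emb x"
  by (simp add: transpose_diff transpose_mat emb_skew)

lemma transpose_resolvent: "transpose (resolvent x) ** (mat 1 + emb x) = mat 1"
  unfolding transpose_one_minus_emb[symmetric] matrix_transpose_mul[symmetric] resolvent_right
  by (rule transpose_mat)

text \<open>Multiply (1 + A) + (1 - A) = 2 by the transposed resolvent on the left and the resolvent
  on the right.\<close>

lemma resolvent_add_transpose:
  "resolvent x + transpose (resolvent x) = 2 *\<^sub>R (transpose (resolvent x) ** resolvent x)"
proof -
  note mm = bounded_bilinear_matrix_matrix_mult
  let ?N = "resolvent x"
  have "transpose ?N = transpose ?N ** ((mat 1 - emb x) ** ?N)" by (simp only: resolvent_right matrix_mul_rid)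
  moreover have "?N = transpose ?N ** (mat 1 + emb x) ** ?N" by (simp only: transpose_resolvent matrix_mul_lid)
  ultimately have "?N + transpose ?N = transpose ?N ** (mat 1 + emb x) ** ?N + transpose ?N ** (mat 1 - emb x) ** ?N"
    by (simp only: matrix_mul_assoc)
  also have "\<dots> = transpose ?N ** ((mat 1 + emb x) + (mat 1 - emb x)) ** ?N"
    by (simp only: bounded_bilinear.add_left[OF mm] bounded_bilinear.add_right[OF mm])
  also have "(mat 1 + emb x) + (mat 1 - emb x) = 2 *\<^sub>R mat 1" by (simp add: scaleR_2)
  finally show ?thesis by (simp add: matrix_scaleR_mult)
qed

text \<open>The Cayley transform \<open>(1 + A) (1 - A)\<^sup>-\<^sup>1 = 2 (1 - A)\<^sup>-\<^sup>1 - 1\<close> restricted to the complement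
  \<open>m\<close> of \<open>so(3)\<close> is a slice for the right action of the isotropy group.\<close>

definition cayley :: "real^7 \<Rightarrow> real^5^5" where
  "cayley x = 2 *\<^sub>R resolvent x - mat 1"

lemma resolvent_0: "resolvent 0 = mat 1"
  using resolvent_left[of 0] by (simp add: emb_0)

lemma cayley_0: "cayley 0 = mat 1"
  by (simp add: cayley_def resolvent_0 scaleR_2)

lemma transpose_cayley: "transpose (cayley x) = 2 *\<^sub>R transpose (resolvent x) - mat 1"
  by (simp add: cayley_def transpose_diff transpose_scaleR transpose_mat)

text \<open>Orthogonality is \<open>resolvent_add_transpose\<close>. For the determinant, (1 - A)
  times the Cayley transform is 1 + A, the transpose of 1 - A.\<close>

lemma cayley_SO5: "cayley x \<in> SO5"
proof -
  note mm = bounded_bilinear_matrix_matrix_mult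
  let ?N = "resolvent x"
  have "transpose (cayley x) ** cayley x = 2 *\<^sub>R (2 *\<^sub>R (transpose ?N ** ?N)) - 2 *\<^sub>R ?N - 2 *\<^sub>R transpose ?N + mat 1"
    unfolding transpose_cayley unfolding cayley_def
    by (simp add: bounded_bilinear.diff_left[OF mm] bounded_bilinear.diff_right[OF mm] matrix_scaleR_mult scaleR_diff_right)
  also have "\<dots> = mat 1"
    unfolding resolvent_add_transpose[symmetric] by (simp add: scaleR_add_right)
  finally have o: "orthogonal_matrix (cayley x)" by (simp add: orthogonal_matrix)
  have "(mat 1 - emb x) ** cayley x = 2 *\<^sub>R mat 1 - (mat 1 - emb x)"
    unfolding cayley_def bounded_bilinear.diff_right[OF mm] matrix_scaleR_mult resolvent_right matrix_mul_rid ..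
  also have "\<dots> = transpose (mat 1 - emb x)"
    by (simp add: transpose_one_minus_emb scaleR_2)
  finally have "det (mat 1 - emb x) * det (cayley x) = det (mat 1 - emb x)"
    by (metis det_mul det_transpose)
  then have "det (cayley x) = 1"
    using invertible_one_minus_emb[of x] by (simp add: invertible_det_nz)
  with o show ?thesis by (simp add: SO5_def rotation_matrix_def)
qed

lemma resolvent_has_derivative:
  "(resolvent has_derivative (\<lambda>v. resolvent x ** emb v ** resolvent x)) (at x)"
proof -
  note mm = bounded_bilinear_matrix_matrix_mult
  have B: "((\<lambda>y. mat 1 - emb y) has_derivative (\<lambda>v. - emb v)) (at x)"
    using has_derivative_diff[OF has_derivative_const bounded_linear_imp_has_derivative[OF bounded_linear_emb]] by simp
  have "(\<lambda>y. (mat 1 - emb y) $ i $ j) differentiable (at x)" for i j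
    using bounded_linear.has_derivative[OF bounded_linear_vec_nth bounded_linear.has_derivative[OF bounded_linear_vec_nth B]]
    unfolding differentiable_def by blast
  from matrix_inv_differentiable[OF open_UNIV UNIV_I invertible_one_minus_emb this]
  have "resolvent differentiable (at x)"
    by (intro differentiable_matrixI) (simp add: resolvent_def)
  then have N: "(resolvent has_derivative fd resolvent x) (at x)"
    by (simp only: frechet_derivative_works)
  have eq: "resolvent x ** emb v ** resolvent x = fd resolvent x v" for v
  proof -
    have "((\<lambda>y. (mat 1 - emb y) ** resolvent y) has_derivative (\<lambda>v. 0)) (at x)"
      by (simp add: resolvent_right)
    from has_derivative_unique[OF this bounded_bilinear.FDERIV[OF mm B N]]
    have "0 = (mat 1 - emb x) ** fd resolvent x v + (- emb v) ** resolvent x" by (rule fun_cong)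
    then have "emb v ** resolvent x = (mat 1 - emb x) ** fd resolvent x v"
      by (simp add: bounded_bilinear.minus_left[OF mm])
    then have "resolvent x ** (emb v ** resolvent x) = (resolvent x ** (mat 1 - emb x)) ** fd resolvent x v"
      by (simp only: matrix_mul_assoc)
    then show ?thesis by (simp only: resolvent_left matrix_mul_lid matrix_mul_assoc)
  qed
  show ?thesis unfolding eq using N by simp
qed

text \<open>The derivative is a product of resolvents and constants, so each order of
  differentiability yields the next.\<close>

lemma smooth_resolvent: "smooth_on resolvent UNIV"
proof -
  have "Ck_on k resolvent UNIV" for k
  proof (induction k)
    case 0
    then show ?case
      by (auto intro!: continuous_at_imp_continuous_on has_derivative_continuous[OF resolvent_has_derivative])
  next
    case (Suc k)
    note bl = Ck_on_bilinear[OF bounded_bilinear_matrix_matrix_mult open_UNIV]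
    show ?case
      by (rule Ck_on_SucI[OF open_UNIV resolvent_has_derivative]) (rule bl[OF bl[OF Suc Ck_on_const[OF open_UNIV]] Suc])
  qed
  then show ?thesis by (simp add: smooth_on_def)
qed

lemma smooth_on_subset_open: "smooth_on f UNIV \<Longrightarrow> smooth_on f U"
proof -
  have "Ck_on k f U" if "Ck_on k f UNIV" for k
    using that by (induction k arbitrary: f) (auto intro: continuous_on_subset)
  then show "smooth_on f UNIV \<Longrightarrow> smooth_on f U" by (simp add: smooth_on_def)
qed

lemma smooth_cayley: "smooth_on cayley U"
proof (rule smooth_on_subset_open)
  have "smooth_on (\<lambda>x. 2 *\<^sub>R resolvent x + (- mat 1)) UNIV"
    by (intro smooth_on_add smooth_on_const open_UNIV smooth_on_linear[OF bounded_linear_scaleR_right _ smooth_resolvent])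
  then show "smooth_on cayley UNIV" by (simp add: cayley_def[abs_def])
qed

lemma cayley_has_derivative:
  "(cayley has_derivative (\<lambda>v. 2 *\<^sub>R (resolvent x ** emb v ** resolvent x))) (at x)"
  using has_derivative_diff[OF has_derivative_scaleR_right[OF resolvent_has_derivative] has_derivative_const]
  by (simp add: cayley_def[abs_def])

lemma cayley_tangent:
  "transpose (cayley x) ** fd cayley x v = 2 *\<^sub>R (transpose (resolvent x) ** emb v ** resolvent x)"
proof -
  note mm = bounded_bilinear_matrix_matrix_mult
  let ?N = "resolvent x"
  have "transpose (cayley x) ** (2 *\<^sub>R ?N) = 2 *\<^sub>R (2 *\<^sub>R (transpose ?N ** ?N)) - 2 *\<^sub>R ?N"
    unfolding transpose_cayley by (simp add: bounded_bilinear.diff_left[OF mm] matrix_scaleR_mult scaleR_diff_right)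
  also have "\<dots> = 2 *\<^sub>R transpose ?N"
    unfolding resolvent_add_transpose[symmetric] by (simp add: scaleR_add_right)
  finally have "transpose (cayley x) ** (2 *\<^sub>R ?N) ** emb v ** ?N = 2 *\<^sub>R (transpose ?N ** emb v ** ?N)"
    by (simp only: matrix_scaleR_mult)
  then show ?thesis
    by (simp add: fd_eqI[OF cayley_has_derivative] matrix_scaleR_mult matrix_mul_assoc)
qed

text \<open>M x is half the m-part of the tangent map. It is the identity at 0, so its determinant
  stays non-zero nearby.\<close>

lemma cayley_immersion:
  obtains r where "r > 0" "\<And>x v. norm x < r \<Longrightarrow> v \<noteq> 0 \<Longrightarrow> transpose (cayley x) ** fd cayley x v \<notin> so3_irr"
proof -
  note mm = bounded_bilinear_matrix_matrix_mult
  let ?L = "\<lambda>x v. mcoord (transpose (resolvent x) ** emb v ** resolvent x)"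
  define M :: "real^7 \<Rightarrow> real^7^7" where "M = (\<lambda>x. \<chi> a i. ?L x (axis i 1) $ a)"
  have lin: "linear (?L x)" for x
    by (simp add: linear_iff linear_add[OF linear_emb] linear_cmul[OF linear_emb] bounded_bilinear.add_left[OF mm]
        bounded_bilinear.add_right[OF mm] matrix_scaleR_mult linear_add[OF linear_mcoord] linear_cmul[OF linear_mcoord])
  have M: "M x *v v = ?L x v" for x v
  proof -
    have "v = (\<Sum>i\<in>UNIV. v $ i *\<^sub>R axis i 1)"
      using basis_expansion[of v] by (simp add: scalar_mult_eq_scaleR)
    then have "?L x v = ?L x (\<Sum>i\<in>UNIV. v $ i *\<^sub>R axis i 1)" by (rule arg_cong)
    also have "\<dots> = (\<Sum>i\<in>UNIV. v $ i *\<^sub>R ?L x (axis i 1))"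
      unfolding linear_sum[OF lin] linear_cmul[OF lin] ..
    finally show ?thesis
      by (simp add: M_def matrix_vector_mult_def vec_eq_iff sum_component mult.commute)
  qed
  have M0: "M 0 = mat 1"
    unfolding matrix_eq M by (simp add: resolvent_0 transpose_mat mcoord_emb)
  have NT: "(\<lambda>x. transpose (resolvent x)) differentiable (at 0)"
    using bounded_linear.has_derivative[OF bounded_linear_transpose resolvent_has_derivative] unfolding differentiable_def by blast
  have N: "resolvent differentiable (at 0)"
    using resolvent_has_derivative unfolding differentiable_def by blast
  have "(\<lambda>x. transpose (resolvent x) ** emb v) differentiable (at 0)" for v
    by (rule bilinear_differentiable[OF mm NT differentiable_const])
  from bilinear_differentiable[OF mm this N]
  have "(\<lambda>x. ?L x v) differentiable (at 0)" for v
    by (rule linear_differentiable[OF bounded_linear_mcoord])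
  from linear_differentiable[OF bounded_linear_vec_nth this]
  have "(\<lambda>x. M x $ a $ i) differentiable (at 0)" for a i
    by (simp add: M_def)
  from det_differentiable[OF this] have "isCont (\<lambda>x. det (M x)) 0"
    by (rule differentiable_imp_continuous_within)
  then obtain r where r: "r > 0" "\<And>x. dist x 0 < r \<Longrightarrow> dist (det (M x)) (det (M 0)) < 1"
    unfolding continuous_at_eps_delta using zero_less_one by blast
  have "transpose (cayley x) ** fd cayley x v \<notin> so3_irr" if x: "norm x < r" and v: "v \<noteq> 0" for x v
  proof
    assume "transpose (cayley x) ** fd cayley x v \<in> so3_irr"
    then have "mcoord (transpose (cayley x) ** fd cayley x v) = 0" by (simp add: so3_irr_iff)
    then have 0: "M x *v v = 0" by (simp add: cayley_tangent linear_cmul[OF linear_mcoord] M)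
    have "det (M x) \<noteq> 0" using r(2)[of x] x by (auto simp: M0 dist_real_def)
    then have "invertible (M x)" by (simp add: invertible_det_nz)
    then have "matrix_inv (M x) ** M x = mat 1" by (rule matrix_inv_left)
    then have "v = matrix_inv (M x) *v (M x *v v)" by (simp add: matrix_vector_mul_assoc)
    then show False using v by (simp add: 0)
  qed
  with r(1) show ?thesis by (rule that)
qed

text \<open>Local injectivity of immersions requires the derivative to be continuous in operator
  norm, while smoothness gives continuity in each direction. The sum s over a basis is continuous
  and dominates the operator norm.\<close>

lemma smooth_locally_injective:
  fixes f :: "'a::euclidean_space \<Rightarrow> 'b::euclidean_space"
  assumes f: "smooth_on f U" and U: "open U" "x \<in> U" and inj: "\<And>v. fd f x v = 0 \<Longrightarrow> v = 0"
  obtains r where "r > 0" "ball x r \<subseteq> U" "inj_on f (ball x r)"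
proof -
  have lin: "linear (fd f y)" if "y \<in> U" for y
    using has_derivative_linear[OF smooth_on_has_derivative[OF f that]] .
  have "inj (fd f x)" unfolding linear_injective_0[OF lin[OF U(2)]] using inj by blast
  then obtain g' where g': "linear g'" "g' \<circ> fd f x = id"
    using linear_injective_left_inverse[OF lin[OF U(2)]] by blast
  show ?thesis
  proof (rule has_derivative_locally_injective[where f' = "fd f" and g' = g', OF U(2,1) _ g'(2) smooth_on_has_derivative[OF f]])
    show "bounded_linear g'" using g'(1) by (simp add: linear_conv_bounded_linear)
    fix e :: real
    assume e: "e > 0"
    define s where "s = (\<lambda>y. \<Sum>b\<in>Basis. norm (fd f y b - fd f x b))"
    have "continuous_on U s"
      unfolding s_def
      by (intro continuous_on_sum continuous_on_norm continuous_on_diff continuous_on_const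
          smooth_on_continuous[OF smooth_on_fd[OF f]])
    then have "isCont s x" using continuous_on_eq_continuous_at[OF U(1)] U(2) by blast
    then obtain d1 where d1: "d1 > 0" "\<And>y. dist y x < d1 \<Longrightarrow> dist (s y) (s x) < e"
      using e unfolding continuous_at_eps_delta by blast
    obtain d2 where d2: "d2 > 0" "ball x d2 \<subseteq> U" using U open_contains_ball by blast
    have "onorm (\<lambda>v. fd f y v - fd f x v) < e" if y: "dist x y < min d1 d2" for y
    proof -
      have yU: "y \<in> U" using d2(2) y by auto
      have ld: "linear (\<lambda>v. fd f y v - fd f x v)"
        by (rule linear_compose_sub[OF lin[OF yU] lin[OF U(2)]])
      have "norm (fd f y v - fd f x v) \<le> s y * norm v" for v
      proof -
        have "fd f y v - fd f x v = fd f y (\<Sum>b\<in>Basis. (v \<bullet> b) *\<^sub>R b) - fd f x (\<Sum>b\<in>Basis. (v \<bullet> b) *\<^sub>R b)"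
          by (simp add: euclidean_representation)
        also have "\<dots> = (\<Sum>b\<in>Basis. (v \<bullet> b) *\<^sub>R (fd f y b - fd f x b))"
          using linear_sum[OF ld, of "\<lambda>b. (v \<bullet> b) *\<^sub>R b" Basis] by (simp add: linear_cmul[OF ld])
        also have "norm \<dots> \<le> (\<Sum>b\<in>Basis. norm ((v \<bullet> b) *\<^sub>R (fd f y b - fd f x b)))" by (rule norm_sum)
        also have "\<dots> \<le> (\<Sum>b\<in>Basis. norm v * norm (fd f y b - fd f x b))"
          by (intro sum_mono) (simp add: mult_right_mono Basis_le_norm)
        finally show ?thesis by (simp add: s_def sum_distrib_left mult.commute)
      qed
      then have "onorm (\<lambda>v. fd f y v - fd f x v) \<le> s y" by (rule onorm_le)
      also have "s y < e" using d1(2)[of y] y by (simp add: s_def dist_commute dist_real_def)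
      finally show ?thesis .
    qed
    then show "\<exists>d>0. \<forall>y. dist x y < d \<longrightarrow> onorm (\<lambda>v. fd f y v - fd f x v) < e"
      using d1(1) d2(1) by (intro exI[of _ "min d1 d2"]) simp
  qed (assumption, rule that)
qed

section \<open>A coset invariant from the Jordan product\<close>

lemma linear_jordan: "linear jordan"
  unfolding jordan_def
  by (intro linear_compose_sum ballI) (simp add: linear_iff linear_add[OF ycoord_linear] linear_cmul[OF ycoord_linear] scaleR_add_left)

lemma bounded_bilinear_jordan: "bounded_bilinear (\<lambda>w u. jordan w *v u)"
proof -
  have "bounded_linear jordan" using linear_jordan by (simp add: linear_conv_bounded_linear)
  from bounded_bilinear.comp[OF bounded_bilinear_matrix_vector_mult this bounded_linear_ident] show ?thesis .
qed

text \<open>\<open>der\<close> is the derivation rule for the traceless Jordan product on squares of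
  basis vectors. The skew derivations are so(3), to which X is orthogonal.\<close>

lemma derivation_horizontal_eq_0:
  assumes skew: "transpose X = - X" and hor: "coef 7 X = 0" "coef 8 X = 0" "coef 9 X = 0"
    and der: "\<And>p. X *v (jordan (axis p 1) *v axis p 1)
      = jordan (X *v axis p 1) *v axis p 1 + jordan (axis p 1) *v (X *v axis p 1)"
  shows "X = 0"
proof -
  have sk: "X $ j $ i = - X $ i $ j" for i j
    using arg_cong[OF skew, of "\<lambda>A. A $ i $ j"] by (simp add: transpose_def)
  have dg: "X $ i $ i = 0" for i using sk[of i i] by simp
  have ax: "(axis 1 1 :: real^5) $ 1 = 1" "(axis 1 1 :: real^5) $ 2 = 0" "(axis 1 1 :: real^5) $ 3 = 0"
    "(axis 1 1 :: real^5) $ 4 = 0" "(axis 1 1 :: real^5) $ 5 = 0" "(axis 2 1 :: real^5) $ 1 = 0"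
    "(axis 2 1 :: real^5) $ 2 = 1" "(axis 2 1 :: real^5) $ 3 = 0" "(axis 2 1 :: real^5) $ 4 = 0"
    "(axis 2 1 :: real^5) $ 5 = 0" "(axis 3 1 :: real^5) $ 1 = 0" "(axis 3 1 :: real^5) $ 2 = 0"
    "(axis 3 1 :: real^5) $ 3 = 1" "(axis 3 1 :: real^5) $ 4 = 0" "(axis 3 1 :: real^5) $ 5 = 0"
    "(axis 4 1 :: real^5) $ 1 = 0" "(axis 4 1 :: real^5) $ 2 = 0" "(axis 4 1 :: real^5) $ 3 = 0"
    "(axis 4 1 :: real^5) $ 4 = 1" "(axis 4 1 :: real^5) $ 5 = 0"
    by (simp_all add: axis_def)
  have Xa: "(X *v axis p 1) $ j = X $ j $ p" for p j
    by (simp add: matrix_vector_mult_basis column_def)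
  have Xv: "(X *v w) $ i = X $ i $ 1 * w $ 1 + X $ i $ 2 * w $ 2 + X $ i $ 3 * w $ 3 + X $ i $ 4 * w $ 4 + X $ i $ 5 * w $ 5" for i w
    by (simp add: matrix_vector_mult_def sum_5)
  have d: "(X *v (jordan (axis p 1) *v axis p 1)) $ i
      = (jordan (X *v axis p 1) *v axis p 1) $ i + (jordan (axis p 1) *v (X *v axis p 1)) $ i" for p i
    using arg_cong[OF der[of p], of "\<lambda>v. v $ i"] by simp
  note L = Xv jordan_nth Xa ax mult_zero_left mult_zero_right mult_1_left mult_1_right add_0_left add_0_right
    diff_0 diff_0_right minus_zero
  define s :: real where "s = sqrt 3"
  have s: "s \<noteq> 0" "s * s = 3" by (simp_all add: s_def)
  \<comment> \<open>These seven scalar equations express X by the entries (4, 1), (5, 1) and (5, 4),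
    as many as so(3) has dimensions; the three orthogonality conditions then remove those.\<close>
  note e12 = d[of 2 1, unfolded L, folded s_def] and e32 = d[of 2 3, unfolded L, folded s_def]
    and e41 = d[of 1 4, unfolded L, folded s_def] and e51 = d[of 1 5, unfolded L, folded s_def]
    and e53 = d[of 3 4, unfolded L, folded s_def] and e43 = d[of 3 5, unfolded L, folded s_def]
    and e31 = d[of 4 3, unfolded L, folded s_def]
  have "6 * (s * X $ 1 $ 2) = 0" "6 * (s * X $ 3 $ 2) = 0"
    using e12 e32 by algebra+
  then have x2: "X $ 1 $ 2 = 0" "X $ 3 $ 2 = 0" using s(1) by simp_all
  have x42: "X $ 4 $ 2 = - (s * X $ 4 $ 1)" using e41 s(2) by algebra
  have x52: "X $ 5 $ 2 = s * X $ 5 $ 1" using e51 s(2) by algebra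
  have x53: "X $ 5 $ 3 = X $ 4 $ 1" using e41 e53 by linarith
  have x43: "X $ 4 $ 3 = - X $ 5 $ 1" using e51 e43 by linarith
  have x31: "X $ 3 $ 1 = 2 * X $ 5 $ 4" using e31 x2(2) by simp
  have h: "X \<bullet> bas 7 = 0" "X \<bullet> bas 8 = 0" "X \<bullet> bas 9 = 0"
    using hor nrm_pos[of 7] nrm_pos[of 8] nrm_pos[of 9] by (simp_all add: coef_def)
  have sq: "x / s = x * s / 3" for x using s by (simp add: field_simps)
  have "X \<bullet> bas 7 = X $ 1 $ 5 + s * X $ 2 $ 5 - X $ 3 $ 4 + X $ 4 $ 3 - X $ 5 $ 1 - s * X $ 5 $ 2"
    "X \<bullet> bas 8 = X $ 1 $ 4 - s * X $ 2 $ 4 + X $ 3 $ 5 - X $ 4 $ 1 + s * X $ 4 $ 2 - X $ 5 $ 3"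
    "X \<bullet> bas 9 = - 2 * X $ 1 $ 3 + 2 * X $ 3 $ 1 - X $ 4 $ 5 + X $ 5 $ 4"
    unfolding inner_vec_def sum_5 bas_def conjD_def lmat_def vec_lambda_beta i5_def dd_def
    by (simp_all add: basis_mats_nth flip: s_def) (simp_all add: sq)
  note b = this[unfolded h]
  have y25: "s * X $ 2 $ 5 = - 3 * X $ 5 $ 1" using sk[of 2 5] x52 s(2) by algebra
  have y52: "s * X $ 5 $ 2 = 3 * X $ 5 $ 1" using x52 s(2) by algebra
  have y24: "s * X $ 2 $ 4 = 3 * X $ 4 $ 1" using sk[of 2 4] x42 s(2) by algebra
  have y42: "s * X $ 4 $ 2 = - 3 * X $ 4 $ 1" using x42 s(2) by algebra
  note ss = y25 y52 y24 y42
  have x51: "X $ 5 $ 1 = 0" using b(1) ss sk[of 5 1] sk[of 4 3] x43 by linarith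
  have x41: "X $ 4 $ 1 = 0" using b(2) ss sk[of 4 1] sk[of 5 3] x53 by linarith
  have x54: "X $ 5 $ 4 = 0" using b(3) sk[of 3 1] sk[of 5 4] x31 by linarith
  have "X $ 2 $ 1 = 0" "X $ 3 $ 1 = 0" "X $ 4 $ 2 = 0" "X $ 5 $ 2 = 0" "X $ 4 $ 3 = 0" "X $ 5 $ 3 = 0"
    using x2 x31 x42 x52 x53 x43 x41 x51 x54 sk[of 1 2] by simp_all
  note low = this x2 x41 x51 x54
  have "X $ 1 $ 3 = 0" "X $ 1 $ 4 = 0" "X $ 1 $ 5 = 0" "X $ 2 $ 3 = 0" "X $ 2 $ 4 = 0" "X $ 2 $ 5 = 0"
    "X $ 3 $ 4 = 0" "X $ 3 $ 5 = 0" "X $ 4 $ 5 = 0"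
    using low sk[of 3 1] sk[of 4 1] sk[of 5 1] sk[of 3 2] sk[of 4 2] sk[of 5 2] sk[of 4 3] sk[of 5 3] sk[of 5 4]
    by simp_all
  then have "\<forall>i j. X $ i $ j = 0"
    unfolding forall_5 using low dg by simp
  then show ?thesis by (simp add: vec_eq_iff)
qed

text \<open>The isotropy group has finite index in the stabiliser of the quadratic map \<open>w \<mapsto> jordan w *v w\<close>,
  so the translates of this map separate nearby cosets.\<close>

definition coset_invariant :: "real^5^5 \<Rightarrow> real^5^5" where
  "coset_invariant R = (\<chi> p. R *v (jordan (transpose R *v axis p 1) *v (transpose R *v axis p 1)))"

text \<open>By \<open>jordan_equivariant\<close> the factors q^t come out of the Jordan product and
  cancel against q.\<close>

lemma coset_invariant_mult:
  assumes q: "q \<in> SO3_irr"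
  shows "coset_invariant (R ** q) = coset_invariant R"
proof -
  have o: "transpose q ** q = mat 1" "q ** transpose q = mat 1" using SO3_irr_orthogonal[OF q] .
  have "(R ** q) *v (jordan (transpose (R ** q) *v e) *v (transpose (R ** q) *v e))
      = R *v (jordan (transpose R *v e) *v (transpose R *v e))" for e
  proof -
    define w where "w = transpose R *v e"
    have "transpose (R ** q) *v e = transpose q *v w"
      by (simp only: w_def matrix_transpose_mul matrix_vector_mul_assoc)
    moreover have "jordan (transpose q *v w) *v (transpose q *v w) = transpose q *v (jordan w *v w)"
    proof -
      have "jordan (transpose q *v w) *v (transpose q *v w) = (transpose q ** jordan w ** (q ** transpose q)) *v w"
        by (simp only: jordan_equivariant[OF SO3_irr_transpose[OF q]] transpose_transpose matrix_vector_mul_assoc matrix_mul_assoc)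
      then show ?thesis by (simp only: o matrix_mul_rid matrix_vector_mul_assoc)
    qed
    moreover have "(R ** q) *v (transpose q *v (jordan w *v w)) = (R ** (q ** transpose q)) *v (jordan w *v w)"
      by (simp only: matrix_vector_mul_assoc matrix_mul_assoc)
    ultimately show ?thesis by (simp only: o matrix_mul_rid w_def)
  qed
  then show ?thesis by (simp only: coset_invariant_def)
qed

lemma bounded_linear_axis: "bounded_linear (axis p :: 'b::euclidean_space \<Rightarrow> 'b^'n)"
  unfolding linear_conv_bounded_linear[symmetric] by (simp add: linear_iff axis_def vec_eq_iff)

lemma coset_invariant_smooth: "smooth_on (\<lambda>x. coset_invariant (cayley x)) UNIV"
proof -
  have w: "smooth_on (\<lambda>x. transpose (cayley x) *v e) UNIV" for e
    by (intro smooth_on_linear[OF bounded_bilinear.bounded_linear_left[OF bounded_bilinear_matrix_vector_mult]]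
        smooth_on_linear[OF bounded_linear_transpose] smooth_cayley open_UNIV)
  have "smooth_on (\<lambda>x. \<Sum>p\<in>UNIV. axis p (cayley x *v (jordan (transpose (cayley x) *v axis p 1) *v (transpose (cayley x) *v axis p 1)))
      :: real^5^5) UNIV"
    by (intro smooth_on_sum smooth_on_linear[OF bounded_linear_axis] open_UNIV
        smooth_on_bilinear[OF bounded_bilinear_matrix_vector_mult] smooth_cayley smooth_on_bilinear[OF bounded_bilinear_jordan] w)
  moreover have "(\<chi> p. f p) = (\<Sum>p\<in>UNIV. axis p (f p))" for f :: "5 \<Rightarrow> real^5"
    by (simp add: vec_eq_iff sum_component axis_def if_distrib[of "\<lambda>x. x $ _"] cong: if_cong)
  ultimately show ?thesis by (simp only: coset_invariant_def)
qed

text \<open>The derivative at 0 measures how far X = 2 \<open>emb v\<close> is from being a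
  derivation of the Jordan product, and X is horizontal.\<close>

lemma coset_invariant_immersion:
  assumes "fd (\<lambda>x. coset_invariant (cayley x)) 0 v = 0"
  shows "v = 0"
proof -
  note mv = bounded_bilinear_matrix_vector_mult
  define X where "X = 2 *\<^sub>R emb v"
  have c: "(cayley has_derivative (\<lambda>v. 2 *\<^sub>R emb v)) (at 0)"
    using cayley_has_derivative[of 0] by (simp add: resolvent_0)
  have w: "((\<lambda>x. transpose (cayley x) *v e) has_derivative (\<lambda>v. - ((2 *\<^sub>R emb v) *v e))) (at 0)" for e
    using bounded_linear.has_derivative[OF bounded_bilinear.bounded_linear_left[OF mv]
        bounded_linear.has_derivative[OF bounded_linear_transpose c], of e]
    by (simp add: transpose_scaleR emb_skew bounded_bilinear.minus_left[OF mv])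
  have X0: "X *v (jordan e *v e) = jordan (X *v e) *v e + jordan e *v (X *v e)" if "e = axis p 1" for p e
  proof -
    have "((\<lambda>x. cayley x *v (jordan (transpose (cayley x) *v e) *v (transpose (cayley x) *v e))) has_derivative
        (\<lambda>v. (2 *\<^sub>R emb v) *v (jordan e *v e) - (jordan ((2 *\<^sub>R emb v) *v e) *v e + jordan e *v ((2 *\<^sub>R emb v) *v e)))) (at 0)"
      using bounded_bilinear.FDERIV[OF mv c bounded_bilinear.FDERIV[OF bounded_bilinear_jordan w[of e] w[of e]]]
      by (simp add: cayley_0 transpose_mat bounded_bilinear.minus_left[OF bounded_bilinear_jordan]
          bounded_bilinear.minus_right[OF bounded_bilinear_jordan] algebra_simps del: scaleR_matrix_vector_assoc)
    moreover have "((\<lambda>x. coset_invariant (cayley x) $ p) has_derivative (\<lambda>v. fd (\<lambda>x. coset_invariant (cayley x)) 0 v $ p)) (at 0)"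
      by (rule bounded_linear.has_derivative[OF bounded_linear_vec_nth smooth_on_has_derivative[OF coset_invariant_smooth UNIV_I]])
    ultimately have "fd (\<lambda>x. coset_invariant (cayley x)) 0 v $ p = X *v (jordan e *v e) - (jordan (X *v e) *v e + jordan e *v (X *v e))"
      unfolding coset_invariant_def vec_lambda_beta that X_def by (rule fun_cong[OF has_derivative_unique, rotated])
    then show ?thesis using assms by simp
  qed
  have "linear (coef n)" for n using bounded_linear_coef bounded_linear.linear by blast
  then have "X = 0"
    by (intro derivation_horizontal_eq_0 X0[OF refl])
      (simp_all add: X_def transpose_scaleR emb_skew linear_cmul coef_emb)
  then have "mcoord (emb v) = mcoord 0" by (simp add: X_def)
  then show ?thesis by (simp add: mcoord_emb linear_0[OF linear_mcoord])
qed

text \<open>Equal cosets have equal \<open>coset_invariant\<close>, which is injective near 0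
  because it is an immersion there.\<close>

lemma cayley_slice:
  obtains r where "r > 0" "berger_section (ball 0 r) cayley" "inj_on (\<lambda>x. berger_coset (cayley x)) (ball 0 r)"
proof -
  obtain r1 where r1: "r1 > 0" "\<And>x v. norm x < r1 \<Longrightarrow> v \<noteq> 0 \<Longrightarrow> transpose (cayley x) ** fd cayley x v \<notin> so3_irr"
    using cayley_immersion by blast
  obtain r2 where r2: "r2 > 0" "inj_on (\<lambda>x. coset_invariant (cayley x)) (ball 0 r2)"
    by (rule smooth_locally_injective[OF coset_invariant_smooth open_UNIV UNIV_I[of "0 :: real^7"]])
      (rule coset_invariant_immersion, assumption, rule that)
  show ?thesis
  proof (rule that[of "min r1 r2"])
    show "min r1 r2 > 0" using r1 r2 by simp
    show "berger_section (ball 0 (min r1 r2)) cayley"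
      by unfold_locales (simp_all add: smooth_cayley cayley_SO5 r1(2))
    have "x = y" if b: "berger_coset (cayley x) = berger_coset (cayley y)" and "norm x < r2" "norm y < r2" for x y
    proof -
      define q where "q = transpose (cayley y) ** cayley x"
      have q: "q \<in> SO3_irr" using b unfolding q_def berger_coset_eq_iff[OF cayley_SO5 cayley_SO5] .
      have "cayley x = cayley y ** q" by (simp only: q_def SO5_cancel(2)[OF cayley_SO5])
      then have "coset_invariant (cayley x) = coset_invariant (cayley y)" by (simp only: coset_invariant_mult[OF q])
      then show ?thesis using inj_onD[OF r2(2)] that(2,3) by simp
    qed
    then show "inj_on (\<lambda>x. berger_coset (cayley x)) (ball 0 (min r1 r2))"
      by (intro inj_onI) simp
  qed
qed

section \<open>Integration over the Berger space\<close>

lemma continuous_on_matrix_mult: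
  fixes f :: "'a::topological_space \<Rightarrow> real^'n^'m" and g :: "'a \<Rightarrow> real^'k^'n"
  shows "continuous_on S f \<Longrightarrow> continuous_on S g \<Longrightarrow> continuous_on S (\<lambda>x. f x ** g x)"
  by (rule bounded_bilinear.continuous_on[OF bounded_bilinear_matrix_matrix_mult])

lemma compact_rotations: "compact {A :: real^'n^'n. rotation_matrix A}"
proof -
  have eq: "{A :: real^'n^'n. rotation_matrix A} = {A. transpose A ** A = mat 1} \<inter> {A. det A = 1}"
    by (auto simp: rotation_matrix_def orthogonal_matrix)
  have "continuous_on UNIV (\<lambda>A :: real^'n^'n. transpose A ** A)"
    by (intro continuous_on_matrix_mult linear_continuous_on[OF bounded_linear_transpose] continuous_on_id)
  then have 1: "closed {A :: real^'n^'n. transpose A ** A = mat 1}"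
    by (intro closed_Collect_eq continuous_on_const)
  have "(\<lambda>A :: real^'n^'n. A $ i $ j) differentiable (at B)" for i j B
    using bounded_linear_imp_has_derivative[OF bounded_linear_compose[OF bounded_linear_vec_nth bounded_linear_vec_nth]]
    unfolding differentiable_def by blast
  from differentiable_imp_continuous_within[OF det_differentiable[OF this]]
  have "continuous_on UNIV (\<lambda>A :: real^'n^'n. det A)"
    by (intro continuous_at_imp_continuous_on ballI)
  then have 2: "closed {A :: real^'n^'n. det A = 1}"
    by (intro closed_Collect_eq continuous_on_const)
  have "norm A \<le> sqrt (trace (mat 1 :: real^'n^'n))" if "rotation_matrix A" for A :: "real^'n^'n"
    using rotation_mult_transpose[OF that] by (simp add: norm_eq_sqrt_inner inner_matrix)
  then have "bounded {A :: real^'n^'n. rotation_matrix A}" unfolding bounded_iff by blast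
  moreover have "closed {A :: real^'n^'n. rotation_matrix A}" unfolding eq by (rule closed_Int[OF 1 2])
  ultimately show ?thesis by (simp add: compact_eq_bounded_closed)
qed

text \<open>Exhibits the isotropy group as a continuous image of SO(3), hence as a compact
  set.\<close>

lemma SO3_irr_eq_image: "SO3_irr = rho ` {A. rotation_matrix A}"
proof
  show "rho ` {A. rotation_matrix A} \<subseteq> SO3_irr" using rho_SO3_irr by blast
  show "SO3_irr \<subseteq> rho ` {A. rotation_matrix A}"
  proof
    fix Q
    assume "Q \<in> SO3_irr"
    then obtain A :: "real^3^3" where A: "rotation_matrix A"
      "\<And>x. sym_traceless (Q *v x) = A ** sym_traceless x ** transpose A"
      unfolding SO3_irr_def by blast
    have "Q *v x = rho A *v x" for x
      unfolding sym_traceless_inject[symmetric] A(2) sym_traceless_rho[OF A(1)] ..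
    then have "Q = rho A" unfolding matrix_eq by blast
    with A(1) show "Q \<in> rho ` {A. rotation_matrix A}" by blast
  qed
qed

lemma compact_SO3_irr: "compact SO3_irr"
  unfolding SO3_irr_eq_image
proof (rule compact_continuous_image[OF _ compact_rotations])
  show "continuous_on {A. rotation_matrix A} rho"
    unfolding rho_def[abs_def]
    by (rule bounded_bilinear.continuous_on[OF bounded_bilinear_rho continuous_on_id continuous_on_id])
qed

lemma SO5_mat_1: "mat 1 \<in> SO5"
  by (simp add: SO5_def rotation_matrix_mat_1)

lemma compact_SO5: "compact SO5"
  unfolding SO5_def by (rule compact_rotations)

locale cayley_domain =
  fixes r :: real
  assumes r_pos: "r > 0" and slice: "berger_section (ball 0 r) cayley"
    and slice_inj: "inj_on (\<lambda>x. berger_coset (cayley x)) (ball 0 r)"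
begin

abbreviation slice_map :: "real^5^5 \<Rightarrow> real^7 \<Rightarrow> (real^5^5) set" where
  "slice_map P x \<equiv> berger_coset (P ** cayley x)"

lemma slice_chart: "P \<in> SO5 \<Longrightarrow> (ball 0 r, slice_map P) \<in> berger_atlas"
  using berger_atlas_translate[OF berger_atlasI[OF slice refl slice_inj]] by (simp add: berger_coset_translate)

lemma manifold_points_berger: "manifold_points berger_atlas = berger_coset ` SO5"
proof
  show "manifold_points berger_atlas \<subseteq> berger_coset ` SO5"
    unfolding manifold_points_def berger_atlas_def by auto
  have "berger_coset R \<in> manifold_points berger_atlas" if "R \<in> SO5" for R
    unfolding manifold_points_def
    by (rule UN_I[OF slice_chart[OF that]]) (use r_pos in \<open>auto intro!: image_eqI[of _ _ 0] simp: cayley_0\<close>)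
  then show "berger_coset ` SO5 \<subseteq> manifold_points berger_atlas" by blast
qed

text \<open>A compact part of the slice: the volume density is integrable on it, and overlaps of its
  translates are closed.\<close>

abbreviation core :: "(real^7) set" where
  "core \<equiv> cball 0 (r / 2)"

lemma core_subset: "core \<subseteq> ball 0 r"
  using r_pos by auto

lemma slice_onto:
  obtains d where "d > 0" "\<And>M. transpose M ** M = mat 1 \<Longrightarrow> norm (M - mat 1) < d \<Longrightarrow>
    \<exists>x\<in>core. \<exists>h\<in>SO3_irr. M = cayley x ** h"
proof -
  interpret s: berger_section "ball 0 r" cayley by (rule slice)
  have "(0 :: real^7) \<in> ball 0 r" "r / 2 > 0" using r_pos by simp_all
  from s.local_param_onto[OF this] obtain d where d: "d > 0"
    "\<And>M. transpose M ** M = mat 1 \<Longrightarrow> norm (M - mat 1) < d \<Longrightarrow>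
      \<exists>w. fst w \<in> ball 0 r \<and> s.local_param 0 w = M \<and> norm (w - (0, 0)) < r / 2"
    by blast
  have "\<exists>x\<in>core. \<exists>h\<in>SO3_irr. M = cayley x ** h" if M: "transpose M ** M = mat 1" "norm (M - mat 1) < d" for M
  proof -
    obtain w where w: "s.local_param 0 w = M" "norm (w - (0, 0)) < r / 2" using d(2)[OF M] by blast
    have "norm (fst w) \<le> norm w" by (metis norm_fst_le prod.collapse)
    then have "fst w \<in> core" using w(2) by (simp flip: zero_prod_def)
    moreover have "M = cayley (fst w) ** H_param (snd w)"
      using w(1) by (simp add: s.local_param_def cayley_0 transpose_mat)
    ultimately show ?thesis using H_param_SO3_irr by blast
  qed
  with d(1) show ?thesis by (rule that)
qed

lemma berger_coset_mult:
  assumes "P \<in> SO5" "h \<in> SO3_irr" "P ** h \<in> SO5"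
  shows "berger_coset (P ** h) = berger_coset P"
  unfolding berger_coset_eq_iff[OF assms(3,1)] SO5_cancel(1)[OF assms(1)] by (rule assms(2))

text \<open>Neighbourhoods of the points of SO(5) cover this compact group, and near P each R has
  the form P C h with C on the slice and h in the isotropy group, by
  \<open>slice_onto\<close>.\<close>

lemma finite_cover:
  obtains N :: nat and P :: "nat \<Rightarrow> real^5^5" where "\<And>k. k < N \<Longrightarrow> P k \<in> SO5"
    "\<And>R. R \<in> SO5 \<Longrightarrow> \<exists>k<N. berger_coset R \<in> slice_map (P k) ` core"
proof -
  obtain d where d: "d > 0" "\<And>M. transpose M ** M = mat 1 \<Longrightarrow> norm (M - mat 1) < d \<Longrightarrow>
    \<exists>x\<in>core. \<exists>h\<in>SO3_irr. M = cayley x ** h"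
    using slice_onto by blast
  define O' where "O' = (\<lambda>P :: real^5^5. {R :: real^5^5. norm (transpose P ** R - mat 1) < d})"
  have op: "open (O' P)" for P
    unfolding O'_def
    by (intro open_Collect_less continuous_on_norm continuous_on_diff continuous_on_matrix_mult continuous_on_const continuous_on_id)
  have "R \<in> O' R" if "R \<in> SO5" for R
    using SO5_cancel(1)[OF that, of "mat 1"] d(1) by (simp add: O'_def)
  then have cover: "SO5 \<subseteq> (\<Union>P\<in>SO5. O' P)" by blast
  obtain C where C: "C \<subseteq> SO5" "finite C" "SO5 \<subseteq> (\<Union>P\<in>C. O' P)"
    by (rule compactE_image[OF compact_SO5 op cover])
  obtain xs where xs: "set xs = C" using finite_list[OF C(2)] by blast
  show ?thesis
  proof (rule that[of "length xs" "(!) xs"])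
    show "xs ! k \<in> SO5" if "k < length xs" for k using C(1) xs that nth_mem by blast
    fix R
    assume R: "R \<in> SO5"
    then obtain P where P: "P \<in> C" "R \<in> O' P" using C(3) by blast
    from P(1) have "P \<in> set xs" by (simp only: xs)
    then obtain k where k: "k < length xs" "xs ! k = P" unfolding in_set_conv_nth by blast
    have P5: "P \<in> SO5" using P(1) C(1) by blast
    have "transpose P ** R \<in> SO5" by (intro SO5_mult SO5_transpose P5 R)
    then have orth: "transpose (transpose P ** R) ** (transpose P ** R) = mat 1"
      by (simp only: SO5_def mem_Collect_eq rotation_mult_transpose)
    have "norm (transpose P ** R - mat 1) < d" using P(2) by (simp only: O'_def mem_Collect_eq)
    from d(2)[OF orth this] obtain x h where xh: "x \<in> core" "h \<in> SO3_irr" "transpose P ** R = cayley x ** h"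
      by (elim bexE)
    have "P ** (transpose P ** R) = P ** cayley x ** h" unfolding xh(3) by (simp only: matrix_mul_assoc)
    then have Req: "R = P ** cayley x ** h" by (simp only: SO5_cancel(2)[OF P5])
    have "P ** cayley x ** h \<in> SO5" using R by (simp only: Req[symmetric])
    then have "berger_coset R = slice_map P x"
      unfolding Req by (rule berger_coset_mult[OF SO5_mult[OF P5 cayley_SO5] xh(2)])
    then have "berger_coset R \<in> slice_map (xs ! k) ` core"
      unfolding k(2) by (rule image_eqI[OF _ xh(1)])
    with k(1) show "\<exists>k<length xs. berger_coset R \<in> slice_map (xs ! k) ` core" by (intro exI conjI)
  qed
qed

lemma continuous_cayley: "continuous_on S (\<lambda>x. P ** cayley x)"
  by (intro continuous_on_matrix_mult continuous_on_const smooth_on_continuous[OF smooth_cayley])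

text \<open>The overlap is the preimage of all products Q C h with C over the core and h in the
  isotropy group; these form a compact set.\<close>

lemma closed_overlap:
  assumes P: "P \<in> SO5" and Q: "Q \<in> SO5"
  shows "closed {x \<in> core. slice_map P x \<in> slice_map Q ` core}"
proof -
  define T where "T = (\<lambda>p. Q ** cayley (fst p) ** snd p) ` (core \<times> SO3_irr)"
  have "continuous_on (core \<times> SO3_irr) (\<lambda>p. Q ** cayley (fst p) ** snd p)"
    by (intro continuous_on_matrix_mult continuous_on_snd continuous_on_id
        continuous_on_compose2[OF continuous_cayley[of UNIV Q] continuous_on_fst[OF continuous_on_id]]) auto
  then have "compact T"
    unfolding T_def by (rule compact_continuous_image[OF _ compact_Times[OF compact_cball compact_SO3_irr]])
  then have "closed (core \<inter> (\<lambda>x. P ** cayley x) -` T)"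
    by (intro continuous_closed_preimage continuous_cayley closed_cball compact_imp_closed)
  moreover have "slice_map P x \<in> slice_map Q ` core \<longleftrightarrow> P ** cayley x \<in> T" for x
  proof -
    have Px: "P ** cayley x \<in> SO5" by (rule SO5_mult[OF P cayley_SO5])
    have Qy: "Q ** cayley y \<in> SO5" for y by (rule SO5_mult[OF Q cayley_SO5])
    have "slice_map P x = slice_map Q y \<longleftrightarrow> (\<exists>h\<in>SO3_irr. P ** cayley x = Q ** cayley y ** h)" for y
    proof
      assume "slice_map P x = slice_map Q y"
      then have "transpose (Q ** cayley y) ** (P ** cayley x) \<in> SO3_irr"
        unfolding berger_coset_eq_iff[OF Px Qy] .
      moreover have "P ** cayley x = Q ** cayley y ** (transpose (Q ** cayley y) ** (P ** cayley x))"
        by (simp only: SO5_cancel(2)[OF Qy])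
      ultimately show "\<exists>h\<in>SO3_irr. P ** cayley x = Q ** cayley y ** h" by (rule bexI[rotated])
    next
      assume "\<exists>h\<in>SO3_irr. P ** cayley x = Q ** cayley y ** h"
      then obtain h where h: "h \<in> SO3_irr" "P ** cayley x = Q ** cayley y ** h" ..
      have "Q ** cayley y ** h \<in> SO5" using Px by (simp only: h(2))
      then show "slice_map P x = slice_map Q y"
        unfolding h(2) by (rule berger_coset_mult[OF Qy h(1)])
    qed
    then show ?thesis by (simp only: T_def image_iff split_paired_Bex_Sigma fst_conv snd_conv)
  qed
  then have "{x \<in> core. slice_map P x \<in> slice_map Q ` core} = core \<inter> (\<lambda>x. P ** cayley x) -` T"
    by (simp only: set_eq_iff mem_Collect_eq Int_iff vimage_eq simp_thms)
  ultimately show ?thesis by (simp only:)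
qed

text \<open>Each piece is the core minus the earlier translates; closed overlaps make it Borel. The
  first piece is the whole core, on which the density has a positive minimum, so the total volume is
  positive.\<close>

lemma manifold_integral_negative:
  assumes f: "\<And>P x. P \<in> SO5 \<Longrightarrow> x \<in> ball 0 r \<Longrightarrow> f (ball 0 r, slice_map P) x = - \<kappa>" and \<kappa>: "\<kappa> > 0"
    and cont: "\<And>P. P \<in> SO5 \<Longrightarrow> continuous_on (ball 0 r) (\<lambda>x. det (metric_matrix (g (ball 0 r, slice_map P)) x))"
    and pos: "\<And>P x. P \<in> SO5 \<Longrightarrow> x \<in> ball 0 r \<Longrightarrow> det (metric_matrix (g (ball 0 r, slice_map P)) x) > 0"
  shows "\<exists>I<0. has_manifold_integral berger_atlas g f I"
proof -
  obtain N :: nat and P :: "nat \<Rightarrow> real^5^5" where P: "\<And>k. k < N \<Longrightarrow> P k \<in> SO5"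
    and cov: "\<And>R. R \<in> SO5 \<Longrightarrow> \<exists>k<N. berger_coset R \<in> slice_map (P k) ` core"
    using finite_cover by blast
  have N: "0 < N" using cov[OF SO5_mat_1] by auto
  define B where "B = (\<lambda>k. {x \<in> core. \<forall>j<k. slice_map (P k) x \<notin> slice_map (P j) ` core})"
  define C where "C = (\<lambda>k. (ball (0 :: real^7) r, slice_map (P k)))"
  define D where "D = (\<lambda>k x. sqrt (det (metric_matrix (g (C k)) x)))"
  have Bc: "B k \<subseteq> core" for k by (auto simp: B_def)
  have Bb: "B k \<subseteq> ball 0 r" for k using Bc core_subset by blast
  have Dc: "continuous_on core (D k)" if "k < N" for k
    unfolding D_def C_def by (intro continuous_on_real_sqrt continuous_on_subset[OF cont[OF P[OF that]] core_subset])
  have Dp: "D k x > 0" if "k < N" "x \<in> ball 0 r" for k x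
    using pos[OF P[OF that(1)] that(2)] by (simp add: D_def C_def)
  have Bm: "B k \<in> sets borel" if "k < N" for k
  proof -
    have "B k = core - (\<Union>j<k. {x \<in> core. slice_map (P k) x \<in> slice_map (P j) ` core})"
      by (auto simp: B_def)
    also have "\<dots> \<in> sets borel"
      by (intro sets.Diff sets.finite_UN borel_closed closed_overlap closed_cball P that finite_lessThan)
        (use that in auto)
    finally show ?thesis .
  qed
  have Di: "set_integrable lborel core (D k)" if "k < N" for k
    unfolding set_integrable_def by (rule borel_integrable_compact[OF compact_cball Dc[OF that]])
  have BDi: "set_integrable lborel (B k) (D k)" if "k < N" for k
    by (rule set_integrable_subset[OF Di[OF that]]) (use Bm[OF that] Bc in simp_all)
  have fD: "f (C k) x * D k x = - \<kappa> * D k x" if "k < N" "x \<in> B k" for k x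
    using f[OF P[OF that(1)] subsetD[OF Bb that(2)]] by (simp add: C_def)
  have int: "set_integrable lborel (B k) (\<lambda>x. f (C k) x * D k x)" if "k < N" for k
  proof -
    have "set_integrable lborel (B k) (\<lambda>x. - \<kappa> * D k x)"
      by (rule set_integrable_mult_right) (rule BDi[OF that])
    then show ?thesis by (subst set_integrable_cong[OF refl refl fD[OF that]])
  qed
  define a where "a = (\<lambda>k. set_lebesgue_integral lborel (B k) (D k))"
  have val: "set_lebesgue_integral lborel (B k) (\<lambda>x. f (C k) x * D k x) = - \<kappa> * a k" if "k < N" for k
  proof -
    have "set_lebesgue_integral lborel (B k) (\<lambda>x. f (C k) x * D k x) = set_lebesgue_integral lborel (B k) (\<lambda>x. - \<kappa> * D k x)"
      by (rule set_lebesgue_integral_cong) (use Bm[OF that] fD[OF that] in auto)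
    then show ?thesis by (simp only: set_integral_mult_right a_def)
  qed
  have a: "a k \<ge> 0" if "k < N" for k
    unfolding a_def set_lebesgue_integral_def
    by (rule Bochner_Integration.integral_nonneg)
      (use Dp[OF that] Bb[of k] in \<open>auto simp: indicator_def intro!: less_imp_le\<close>)
  have B0: "B 0 = core" by (auto simp: B_def)
  have a0: "a 0 > 0"
  proof -
    have "core \<noteq> {}" using r_pos by simp
    then obtain x0 where x0: "x0 \<in> core" "\<And>x. x \<in> core \<Longrightarrow> D 0 x0 \<le> D 0 x"
      using continuous_attains_inf[OF compact_cball _ Dc[OF N]] by blast
    have cm: "core \<in> sets lborel" "emeasure lborel core \<noteq> \<infinity>"
      using emeasure_bounded_finite[OF bounded_cball, of "0 :: real^7" "r / 2"] by simp_all
    have c: "set_integrable lborel core (\<lambda>x. D 0 x0)"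
      unfolding set_integrable_def by (rule borel_integrable_compact[OF compact_cball continuous_on_const])
    have "0 < measure lborel core * D 0 x0"
      using content_cball_pos[of "r / 2" "0 :: real^7"] r_pos Dp[OF N, of x0] x0(1) core_subset by auto
    also have "\<dots> = set_lebesgue_integral lborel core (\<lambda>x. D 0 x0)"
      by (simp only: set_integral_const[OF cm] real_scaleR_def)
    also have "\<dots> \<le> a 0"
      unfolding a_def B0 by (rule set_integral_mono[OF c Di[OF N] x0(2)])
    finally show ?thesis .
  qed
  have "0 < (\<Sum>k<N. a k)"
    by (rule sum_pos2[of _ 0]) (use N a a0 in auto)
  then have neg: "(\<Sum>k<N. - \<kappa> * a k) < 0" using \<kappa> by (simp add: sum_negf flip: sum_distrib_left)
  have dis: "slice_map (P k) ` B k \<inter> slice_map (P j) ` B j = {}" if "j < k" for j k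
    using that Bc[of j] by (auto simp: B_def)
  have "disjoint_family_on (\<lambda>k. snd (C k) ` B k) {..<N}"
    unfolding disjoint_family_on_def C_def snd_conv
    by (metis dis Int_commute linorder_neqE_nat)
  moreover have "(\<Union>k<N. snd (C k) ` B k) = manifold_points berger_atlas"
  proof
    show "(\<Union>k<N. snd (C k) ` B k) \<subseteq> manifold_points berger_atlas"
      unfolding manifold_points_berger C_def using SO5_mult[OF P cayley_SO5] by auto
    show "manifold_points berger_atlas \<subseteq> (\<Union>k<N. snd (C k) ` B k)"
    proof
      fix p
      assume "p \<in> manifold_points berger_atlas"
      then obtain R where R: "R \<in> SO5" "p = berger_coset R" unfolding manifold_points_berger by blast
      have "\<exists>k. k < N \<and> p \<in> slice_map (P k) ` core" using cov[OF R(1)] R(2) by blast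
      then obtain k where k: "k < N" "p \<in> slice_map (P k) ` core"
        "\<And>j. j < k \<Longrightarrow> \<not> (j < N \<and> p \<in> slice_map (P j) ` core)"
        using exists_least_iff[of "\<lambda>k. k < N \<and> p \<in> slice_map (P k) ` core"] by blast
      then have "p \<in> slice_map (P k) ` B k" by (fastforce simp: B_def)
      then show "p \<in> (\<Union>k<N. snd (C k) ` B k)" using k(1) by (auto simp: C_def)
    qed
  qed
  moreover have "\<forall>k<N. C k \<in> berger_atlas \<and> B k \<in> sets borel \<and> B k \<subseteq> fst (C k)"
    using slice_chart[OF P] Bm Bb by (simp add: C_def)
  moreover have "\<forall>k<N. set_integrable lborel (B k) (\<lambda>x. f (C k) x * sqrt (det (metric_matrix (g (C k)) x)))"
    using int by (simp add: D_def)
  moreover have "(\<Sum>k<N. - \<kappa> * a k) = (\<Sum>k<N. set_lebesgue_integral lborel (B k)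
      (\<lambda>x. f (C k) x * sqrt (det (metric_matrix (g (C k)) x))))"
    by (rule sum.cong) (use val in \<open>simp_all add: D_def\<close>)
  ultimately have "has_manifold_integral berger_atlas g f (\<Sum>k<N. - \<kappa> * a k)"
    unfolding has_manifold_integral_def by blast
  with neg show ?thesis by blast
qed

end

section \<open>The Killing tensors\<close>

text \<open>A chart records cosets only, so one lift per chart is chosen. Compatibility of the
  choices is \<open>ktensor_transform\<close>.\<close>

definition chart_section :: "((real^5^5) set, 7) chart \<Rightarrow> real^7 \<Rightarrow> real^5^5" where
  "chart_section c = (SOME \<sigma>. berger_section (fst c) \<sigma> \<and> (\<forall>x\<in>fst c. snd c x = berger_coset (\<sigma> x)))"

lemma chart_section:
  assumes "c \<in> berger_atlas"
  shows "berger_section (fst c) (chart_section c)" "x \<in> fst c \<Longrightarrow> snd c x = berger_coset (chart_section c x)"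
proof -
  have "\<exists>\<sigma>. berger_section (fst c) \<sigma> \<and> (\<forall>x\<in>fst c. snd c x = berger_coset (\<sigma> x))"
    using assms berger_atlas_section[of "fst c" "snd c"] by (metis prod.collapse)
  from someI_ex[OF this] show "berger_section (fst c) (chart_section c)"
    "x \<in> fst c \<Longrightarrow> snd c x = berger_coset (chart_section c x)"
    unfolding chart_section_def by blast+
qed

text \<open>The equivariant map \<open>\<real>\<^sup>5 \<rightarrow> Sym\<^sup>2 m\<close> turns a fixed vector \<open>v\<close> into a tensor field on the quotient, by
  Frobenius reciprocity; it does not depend on the choice of the section.\<close>

definition ktensor :: "real^5 \<Rightarrow> ((real^5^5) set, 7) tensor2" where
  "ktensor v = (\<lambda>c x i j. if c \<in> berger_atlas \<and> x \<in> fst c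
     then berger_section.th (chart_section c) i x \<bullet>
       (iota (transpose (chart_section c x) *v v) *v berger_section.th (chart_section c) j x)
     else 0)"

lemma ktensor_eq:
  "c \<in> berger_atlas \<Longrightarrow> x \<in> fst c \<Longrightarrow> ktensor v c x i j = berger_section.th (chart_section c) i x \<bullet>
     (iota (transpose (chart_section c x) *v v) *v berger_section.th (chart_section c) j x)"
  by (simp add: ktensor_def)

lemma iota_form_symmetric: "u \<bullet> (iota w *v u') = u' \<bullet> (iota w *v u)"
proof -
  have "transpose (iota w) = iota w" by (simp add: transpose_def vec_eq_iff iota_symmetric[of w])
  then have "u \<bullet> (iota w *v u') = u \<bullet> (transpose (iota w) *v u')" by simp
  also have "\<dots> = u' \<bullet> (iota w *v u)" by (simp only: transpose_matrix_vector dot_vector_matrix_mult)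
  finally show ?thesis .
qed

lemma ktensor_symmetric: "symmetric_tensor2 (ktensor v)"
  unfolding symmetric_tensor2_def ktensor_def by (auto intro: iota_form_symmetric)

lemma linear_ktensor_form: "linear (\<lambda>v. u \<bullet> (iota (A *v v) *v u'))"
proof -
  have "linear (\<lambda>v. iota (A *v v))"
    using linear_compose[OF matrix_vector_mul_linear linear_iota] by (simp add: o_def)
  then show ?thesis
    by (simp add: linear_iff matrix_vector_mult_add_rdistrib inner_add_right flip: scaleR_matrix_vector_assoc)
qed

lemma ktensor_add: "ktensor (v + w) = ktensor v + ktensor w"
  unfolding ktensor_def linear_add[OF linear_ktensor_form] by (auto simp: fun_eq_iff)

lemma ktensor_scale: "ktensor (a *\<^sub>R v) = tensor_scale a (ktensor v)"
  unfolding ktensor_def tensor_scale_def linear_cmul[OF linear_ktensor_form] by (auto simp: fun_eq_iff)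

lemma ktensor_0: "ktensor 0 = 0"
  using ktensor_scale[of 0 0] by (simp add: tensor_scale_def fun_eq_iff)

lemma ktensor_sum: "ktensor (\<Sum>i\<in>I. f i) = (\<Sum>i\<in>I. ktensor (f i))"
  by (induction I rule: infinite_finite_induct) (simp_all add: ktensor_0 ktensor_add)

lemma berger_atlas_nonempty: obtains c x where "c \<in> berger_atlas" "x \<in> fst c"
proof -
  obtain r where r: "r > 0" "berger_section (ball 0 r) cayley" "inj_on (\<lambda>x. berger_coset (cayley x)) (ball 0 r)"
    using cayley_slice by blast
  show ?thesis
    by (rule that[OF berger_atlasI[OF r(2) refl r(3)], of 0]) (simp add: r(1))
qed

text \<open>One chart point is enough: the coframe spans m there, so \<open>iota\<close> vanishes at
  the rotated vector, and both \<open>iota\<close> and the rotation are injective.\<close>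

lemma ktensor_eq_0:
  assumes "ktensor v = 0"
  shows "v = 0"
proof -
  obtain c x where c: "c \<in> berger_atlas" "x \<in> fst c" using berger_atlas_nonempty by blast
  interpret s: berger_section "fst c" "chart_section c" by (rule chart_section(1)[OF c(1)])
  define A where "A = iota (transpose (chart_section c x) *v v)"
  have z: "s.th i x \<bullet> (A *v s.th j x) = 0" for i j
    using ktensor_eq[OF c, of v i j] by (simp only: assms A_def zero_fun_apply)
  have span: "\<exists>w. u = (\<Sum>i\<in>UNIV. w $ i *\<^sub>R s.th i x)" for u
  proof -
    obtain w where "mcoord (s.tangent x w) = u" by (rule s.mcoord_tangent_surj[OF c(2)])
    then show ?thesis unfolding s.mcoord_tangent[OF c(2)] by blast
  qed
  have "u \<bullet> (A *v w) = 0" for u w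
  proof -
    obtain p where p: "u = (\<Sum>i\<in>UNIV. p $ i *\<^sub>R s.th i x)" using span by blast
    obtain q where q: "w = (\<Sum>i\<in>UNIV. q $ i *\<^sub>R s.th i x)" using span by blast
    show ?thesis
      unfolding p q linear_sum[OF matrix_vector_mul_linear] linear_cmul[OF matrix_vector_mul_linear]
        inner_sum_left inner_sum_right by (simp add: z)
  qed
  from this[of "A *v w" w for w] have "A *v w = 0 *v w" for w
    unfolding inner_eq_zero_iff matrix_vector_mult_0 .
  then have "A = 0" unfolding matrix_eq by blast
  then have "iota (transpose (chart_section c x) *v v) = 0" by (simp only: A_def)
  then have "transpose (chart_section c x) *v v = 0" by (rule iota_eq_0)
  then have "chart_section c x *v (transpose (chart_section c x) *v v) = 0" by simp
  then show ?thesis unfolding matrix_vector_mul_assoc s.section_orthogonal(2)[OF c(2)] by simp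
qed

text \<open>Two lifts of a coset differ by an isotropy element q. It acts on the coframe by
  conjugation and on the rotated vector by multiplication; \<open>iota_equivariant\<close> balances
  the two.\<close>

lemma ktensor_transform:
  assumes c: "c \<in> berger_atlas" "x \<in> fst c" and c': "c' \<in> berger_atlas" "x' \<in> fst c'" and eq: "snd c x = snd c' x'"
  shows "ktensor v c x i j = (\<Sum>a\<in>UNIV. \<Sum>b\<in>UNIV.
    ktensor v c' x' a b * transition_jac c c' x a i * transition_jac c c' x b j)"
proof -
  interpret s: berger_section "fst c" "chart_section c" by (rule chart_section(1)[OF c(1)])
  interpret t: berger_section "fst c'" "chart_section c'" by (rule chart_section(1)[OF c'(1)])
  let ?\<sigma> = "chart_section c" and ?\<sigma>' = "chart_section c'"
  define q where "q = transpose (?\<sigma>' x') ** ?\<sigma> x"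
  have q: "q \<in> SO3_irr"
    using eq unfolding chart_section(2)[OF c] chart_section(2)[OF c'] q_def
      berger_coset_eq_iff[OF s.section_SO5[OF c(2)] t.section_SO5[OF c'(2)]] .
  have \<sigma>x: "?\<sigma> x = ?\<sigma>' x' ** q"
    by (simp only: q_def SO5_cancel(2)[OF t.section_SO5[OF c'(2)]])
  have inj: "inj_on (snd c') (fst c')" using c'(1) by (auto simp: berger_atlas_def)
  let ?J = "transition_jac c c' x"
  have J: "(\<Sum>a\<in>UNIV. ?J a i *\<^sub>R t.th a x') = mcoord (q ** s.om i x ** transpose q)" for i
    using transition_jac_frame[OF s.berger_section_axioms t.berger_section_axioms c(2) c'(2) q \<sigma>x inj
        chart_section(2)[OF c(1)] chart_section(2)[OF c'(1)], of i] by simp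
  have qv: "q *v (transpose (?\<sigma> x) *v v) = transpose (?\<sigma>' x') *v v"
    unfolding q_def matrix_vector_mul_assoc using SO5_cancel(3)[OF s.section_SO5[OF c(2)]] by simp
  let ?A = "iota (transpose (?\<sigma>' x') *v v)"
  have "(\<Sum>a\<in>UNIV. \<Sum>b\<in>UNIV. ktensor v c' x' a b * ?J a i * ?J b j)
      = (\<Sum>a\<in>UNIV. \<Sum>b\<in>UNIV. ?J a i * (?J b j * (t.th a x' \<bullet> (?A *v t.th b x'))))"
    by (simp add: ktensor_eq[OF c'] mult_ac)
  also have "\<dots> = (\<Sum>a\<in>UNIV. ?J a i *\<^sub>R t.th a x') \<bullet> (?A *v (\<Sum>b\<in>UNIV. ?J b j *\<^sub>R t.th b x'))"
    by (simp only: bounded_bilinear.sum_right[OF bounded_bilinear_matrix_vector_mult] matrix_vector_mult_scaleR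
        inner_sum_left inner_sum_right sum_distrib_left inner_scaleR_left inner_scaleR_right)
      (subst sum.swap, simp only: mult.left_commute)
  also have "\<dots> = s.th i x \<bullet> (iota (transpose (?\<sigma> x) *v v) *v s.th j x)"
    unfolding J qv[symmetric] iota_equivariant[OF s.om_skew[OF c(2)] s.om_skew[OF c(2)] q] s.th_def ..
  finally show ?thesis by (simp only: ktensor_eq[OF c])
qed

lemma det_congruence_pos:
  fixes T :: "real^7^7"
  assumes "invertible T" "k > 0"
  shows "det (transpose T ** (k *\<^sub>R G0) ** T) > 0"
proof -
  have "det (k *\<^sub>R G0) = (\<Prod>i\<in>UNIV. (k *\<^sub>R G0) $ i $ i)"
    by (rule det_diagonal) (simp add: G0_def)
  also have "\<dots> > 0"
    by (rule prod_pos) (simp add: G0_def assms(2) nrm_pos[OF i7_less10])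
  finally have "det (k *\<^sub>R G0) > 0" .
  moreover have "det T * det T > 0" using assms(1) by (auto simp: invertible_det_nz zero_less_mult_iff linorder_neq_iff)
  moreover have "det (transpose T ** (k *\<^sub>R G0) ** T) = det (k *\<^sub>R G0) * (det T * det T)"
    by (simp add: det_mul mult_ac)
  ultimately show ?thesis by (simp only: mult_pos_pos)
qed

context berger_g2
begin

lemma chart_metric:
  obtains k where "k > 0" "\<And>c. c \<in> berger_atlas \<Longrightarrow> berger_metric (fst c) (chart_section c) (g c) k"
proof -
  obtain k where k: "k > 0"
    "\<And>U \<psi> \<sigma> x i j. (U, \<psi>) \<in> berger_atlas \<Longrightarrow> berger_section U \<sigma> \<Longrightarrow> (\<And>y. y \<in> U \<Longrightarrow> \<psi> y = berger_coset (\<sigma> y))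
      \<Longrightarrow> x \<in> U \<Longrightarrow> g (U, \<psi>) x i j = k * (berger_section.th \<sigma> i x \<bullet> (G0 *v berger_section.th \<sigma> j x))"
    by (rule metric_scale) (rule that; blast)
  show ?thesis
  proof (rule that[OF k(1)])
    fix c :: "((real^5^5) set, 7) chart"
    assume c: "c \<in> berger_atlas"
    then have c1: "(fst c, snd c) \<in> berger_atlas" by simp
    have "g c x i j = k * (berger_section.th (chart_section c) i x \<bullet> (G0 *v berger_section.th (chart_section c) j x))"
      if "x \<in> fst c" for x i j
      using k(2)[OF c1 chart_section(1)[OF c] chart_section(2)[OF c] that, of i j] by simp
    then show "berger_metric (fst c) (chart_section c) (g c) k"
      using chart_section(1)[OF c] k(1) by (simp add: berger_metric_def berger_metric_axioms_def)
  qed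
qed

lemma ktensor_field: "tensor2_field berger_atlas (ktensor v)"
proof -
  obtain k where k: "k > 0" "\<And>c. c \<in> berger_atlas \<Longrightarrow> berger_metric (fst c) (chart_section c) (g c) k"
    using chart_metric by blast
  have "smooth_on (\<lambda>x. ktensor v c x i j) (fst c)" if "c \<in> berger_atlas" for c i j
    by (rule berger_metric.tensor_smooth[OF k(2)[OF that] ktensor_eq[OF that]])
  then have "\<forall>c\<in>berger_atlas. \<forall>i j. smooth_on (\<lambda>x. ktensor v c x i j) (fst c)" by blast
  moreover have "\<forall>c x i j. c \<notin> berger_atlas \<or> x \<notin> fst c \<longrightarrow> ktensor v c x i j = 0"
    by (auto simp: ktensor_def)
  ultimately show ?thesis
    unfolding tensor2_field_def by (intro conjI ballI allI impI ktensor_transform) blast+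
qed

lemma ktensor_tt: "tt_tensor berger_atlas g (ktensor v)"
proof -
  obtain k where k: "k > 0" "\<And>c. c \<in> berger_atlas \<Longrightarrow> berger_metric (fst c) (chart_section c) (g c) k"
    using chart_metric by blast
  show ?thesis
    unfolding tt_tensor_def
    using ktensor_field ktensor_symmetric berger_metric.trace2_eq[OF k(2) ktensor_eq]
      berger_metric.divergence2_eq[OF k(2) ktensor_eq] by blast
qed

lemma ktensor_killing: "killing_tensor berger_atlas g (ktensor v)"
proof -
  obtain k where k: "k > 0" "\<And>c. c \<in> berger_atlas \<Longrightarrow> berger_metric (fst c) (chart_section c) (g c) k"
    using chart_metric by blast
  show ?thesis
    unfolding killing_tensor_def
    using ktensor_field ktensor_symmetric berger_metric.killing_eq[OF k(2) ktensor_eq] by blast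
qed

lemma unstable: "linearly_unstable berger_atlas g"
proof -
  obtain k where k: "k > 0" "\<And>c. c \<in> berger_atlas \<Longrightarrow> berger_metric (fst c) (chart_section c) (g c) k"
    using chart_metric by blast
  obtain r where r: "r > 0" "berger_section (ball 0 r) cayley" "inj_on (\<lambda>x. berger_coset (cayley x)) (ball 0 r)"
    using cayley_slice by blast
  interpret d: cayley_domain r by (rule cayley_domain.intro[OF r])
  \<comment> \<open>A unit vector, so that the integrand is exactly the constant of
    \<open>stability_integrand_eq\<close>.\<close>
  let ?v = "axis 1 1 :: real^5"
  let ?f = "\<lambda>c. inner2 (g c)
     (\<lambda>x i j. rough_laplacian (g c) (ktensor ?v c) x i j - 2 * curvature_action (g c) (ktensor ?v c) x i j) (ktensor ?v c)"
  have "?v \<noteq> 0" by (simp add: axis_eq_0_iff)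
  then have "ktensor ?v \<noteq> 0" using ktensor_eq_0 by blast
  moreover have "einstein berger_atlas g (27 / (10 * k))"
    unfolding einstein_def using berger_metric.ricci_eq[OF k(2)] by blast
  moreover have "\<exists>I<0. has_manifold_integral berger_atlas g ?f I"
  proof (rule d.manifold_integral_negative[where \<kappa> = "8 / (5 * k) * (112 / (25 * k\<^sup>2))"])
    show "0 < 8 / (5 * k) * (112 / (25 * k\<^sup>2))" using k(1) by simp
    fix P :: "real^5^5"
    assume P: "P \<in> SO5"
    let ?c = "(ball (0 :: real^7) r, d.slice_map P)"
    interpret m: berger_metric "ball 0 r" "chart_section ?c" "g ?c" k
      using k(2)[OF d.slice_chart[OF P]] by simp
    have h: "ktensor ?v ?c x i j = m.th i x \<bullet> (iota (transpose (chart_section ?c x) *v ?v) *v m.th j x)"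
      if "x \<in> ball 0 r" for x i j
      by (rule ktensor_eq[OF d.slice_chart[OF P]]) (use that in simp)
    have "?v \<bullet> ?v = 1" by (simp add: inner_axis)
    then show "?f ?c x = - (8 / (5 * k) * (112 / (25 * k\<^sup>2)))" if "x \<in> ball 0 r" for x
      using m.stability_integrand_eq[OF h that] by simp
    show "0 < det (metric_matrix (g ?c) x)" if "x \<in> ball 0 r" for x
      unfolding m.metric_matrix_eq[OF that] by (rule det_congruence_pos[OF m.Th_invertible[OF that] k(1)])
    have "(\<lambda>y. metric_matrix (g ?c) y $ i $ j) differentiable (at x)" if "x \<in> ball 0 r" for x i j
      using smooth_on_differentiable[OF m.smooth_metric that] by (simp add: metric_matrix_def)
    from differentiable_imp_continuous_within[OF det_differentiable[OF this]]
    show "continuous_on (ball 0 r) (\<lambda>x. det (metric_matrix (g ?c) x))"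
      by (intro continuous_at_imp_continuous_on ballI)
  qed
  ultimately show ?thesis
    unfolding linearly_unstable_def using ktensor_tt by blast
qed

end

section \<open>The five-dimensional space of tensors\<close>

lemma subspace_range_ktensor: "tens.subspace (range ktensor)"
  unfolding tens.subspace_def
proof (intro conjI ballI allI)
  show "0 \<in> range ktensor" using rangeI[of ktensor 0] unfolding ktensor_0 .
next
  fix h h' :: "((real^5^5) set, 7) tensor2"
  assume "h \<in> range ktensor" "h' \<in> range ktensor"
  then show "h + h' \<in> range ktensor"
  proof (elim rangeE)
    fix v w
    assume "h = ktensor v" "h' = ktensor w"
    then show ?thesis using rangeI[of ktensor "v + w"] by (simp only: ktensor_add)
  qed
next
  fix a :: real and h :: "((real^5^5) set, 7) tensor2"
  assume "h \<in> range ktensor"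
  then show "tensor_scale a h \<in> range ktensor"
  proof (elim rangeE)
    fix v
    assume "h = ktensor v"
    then show ?thesis using rangeI[of ktensor "a *\<^sub>R v"] by (simp only: ktensor_scale)
  qed
qed

text \<open>\<open>ktensor\<close> is linear and injective, so the images of the standard basis of
  R^5 form a basis of its range.\<close>

lemma dim_range_ktensor: "tens.dim (range ktensor) = 5"
proof -
  let ?b = "\<lambda>i :: 5. ktensor (axis i 1)"
  have comb: "(\<Sum>i\<in>UNIV. tensor_scale (u i) (?b i)) = ktensor (\<chi> i. u i)" for u :: "5 \<Rightarrow> real"
  proof -
    have "(\<chi> i. u i) = (\<Sum>i\<in>UNIV. u i *\<^sub>R axis i 1)"
      using basis_expansion[of "\<chi> i. u i"] by (simp add: scalar_mult_eq_scaleR)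
    then show ?thesis by (simp only: ktensor_sum ktensor_scale)
  qed
  have inj: "inj ?b"
  proof (rule injI)
    fix i j
    assume "?b i = ?b j"
    then have "ktensor (axis i 1 + (- 1) *\<^sub>R axis j 1) = 0"
      unfolding ktensor_add ktensor_scale by (simp add: tensor_scale_def fun_eq_iff)
    from ktensor_eq_0[OF this] have "axis i 1 = (axis j 1 :: real^5)" by simp
    then show "i = j" by (simp add: axis_eq_axis)
  qed
  show ?thesis
  proof (rule tens.dim_unique)
    show "range ?b \<subseteq> range ktensor" by blast
    show "range ktensor \<subseteq> tens.span (range ?b)"
    proof
      fix h
      assume "h \<in> range ktensor"
      then obtain v where "h = ktensor v" by blast
      then have h: "h = (\<Sum>i\<in>UNIV. tensor_scale (v $ i) (?b i))" using comb[of "($) v"] by simp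
      show "h \<in> tens.span (range ?b)"
        unfolding h by (intro tens.span_sum tens.span_scale tens.span_base rangeI)
    qed
    show "tens.independent (range ?b)"
    proof
      assume "tens.dependent (range ?b)"
      then obtain u where u: "\<exists>h\<in>range ?b. u h \<noteq> 0" "(\<Sum>h\<in>range ?b. tensor_scale (u h) h) = 0"
        unfolding tens.dependent_finite[OF finite_imageI[OF finite]] by blast
      have "ktensor (\<chi> i. u (?b i)) = 0"
        using u(2) unfolding sum.reindex[OF inj] o_def comb .
      then have "(\<chi> i. u (?b i)) = 0" by (rule ktensor_eq_0)
      then have "u (?b i) = 0" for i by (simp add: vec_eq_iff)
      then show False using u(1) by blast
    qed
    show "card (range ?b) = 5" using card_image[OF inj] by simp
  qed
qed

theorem theorem5p6:
  fixes \<phi> :: "((real^5^5) set, 7) tensor3"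
    and g :: "((real^5^5) set, 7) tensor2"
  assumes "g2_structure berger_atlas \<phi>"
    and "berger_homogeneous \<phi>"
    and "nearly_parallel berger_atlas \<phi>"
    and "g2_metric berger_atlas \<phi> g"
  shows "linearly_unstable berger_atlas g \<and>
    (\<exists>V. tens.subspace V \<and> tens.dim V = 5 \<and>
       (\<forall>h\<in>V. tt_tensor berger_atlas g h \<and> killing_tensor berger_atlas g h))"
proof -
  interpret berger_g2 \<phi> g by unfold_locales (rule assms)+
  have "\<forall>h\<in>range ktensor. tt_tensor berger_atlas g h \<and> killing_tensor berger_atlas g h"
    using ktensor_tt ktensor_killing by blast
  with unstable subspace_range_ktensor dim_range_ktensor show ?thesis by blast
qed

end
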